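(* Let $p$ be a prime, $n \ge 1$, $q = p^n$, and let $\mathbb{F}_q$ be represented as $\mathbb{F}_p[X]/\langle f\rangle$ for a monic irreducible $f \in \mathbb{F}_p[X]$ of degree $n$. Let $t$ be a prime factor of $q-1$, and let $s$ be the multiplicative order of $p$ in $\mathbb{Z}/t\mathbb{Z}$. There is a probabilistic (Las Vegas) algorithm which, given $a \in \mathbb{F}_q^*$, decides whether $a$ is a $t$-th power in $\mathbb{F}_q^*$, and if so computes one of its $t$-th roots, using: (i) an expected $O(s\,\mathsf{M}(n)\log(p) + \mathsf{C}(n)\log(n))$ operations ($+,-,\times,\div$) in $\mathbb{F}_p$; and (ii) one $t$-th root extraction in $\mathbb{F}_{p^s}$, i.e. one call to a black-box procedure that, given a $t$-th power in the field $\mathbb{F}_{p^s}$ (represented as $\mathbb{F}_p[Z]/\langle g\rangle$ for an irreducible $g \in \mathbb{F}_p[Z]$ of degree dividing $s$), returns one of its $t$-th roots.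
   Context: Complexity is measured in the algebraic model: the cost is the number of field operations $+,-,\times,\div$ in $\mathbb{F}_p$. Elements of $\mathbb{F}_q = \mathbb{F}_p[X]/\langle f\rangle$ are represented in the monomial basis, i.e. as polynomials in $\mathbb{F}_p[X]$ of degree less than $n$. $\mathsf{M}(n)$ denotes an upper bound on the cost of multiplying two polynomials of degree $n$ over any field $\mathbb{K}$, and $\mathsf{C}(n)$ denotes an upper bound on the cost of modular composition, i.e. computing $F(G) \bmod H$ for polynomials $F,G,H$ of degree $n$ over any field $\mathbb{K}$, measured in operations in $\mathbb{K}$. Both $\mathsf{M}$ and $\mathsf{C}$ are assumed super-linear (i.e. $\mathsf{M}(n)/n$ and $\mathsf{C}(n)/n$ are non-decreasing), and $\mathsf{M}(n) = O(\mathsf{C}(n))$. A Las Vegas algorithm always returns a correct answer; its running time is a random variable and the bound is on its expectation. *)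

theory Defs
  imports
    "HOL-Probability.SPMF"
    "HOL-Library.Landau_Symbols"
    "HOL-Number_Theory.Number_Theory"
    "HOL-Algebra.Algebra"
begin

section \<open>The algebraic model of computation\<close>

text \<open>
  An algorithm is a finite program, written without reference to a particular field.  It manipulates
  natural-number variables, which carry the control flow and sizes, and arrays of field elements.
  Field elements can only be combined by the four field operations, copied, initialised with 0 and
  1, tested for being zero, drawn uniformly at random, and passed to the black box; hence no integer
  representative of a field element is ever available to a program.  The cost counter \<open>ops\<close> counts
  exactly the operations \<open>+, -, \<times>, \<div>\<close> in the field.
\<close>

datatype nexp =
    NConst nat
  | NVar nat
  | NAdd nexp nexp
  | NSub nexp nexp
  | NMul nexp nexp
  | NDiv nexp nexp
  | NMod nexp nexp

text \<open>A cell is an array name together with an index expression.\<close>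

type_synonym cell = "nat \<times> nexp"

datatype bexp =
    NLess nexp nexp
  | IsZero cell
  | BNot bexp
  | BAnd bexp bexp

datatype field_op = FAdd | FSub | FMul | FDiv

datatype com =
    Skip
  | NAssign nat nexp
  | SetZero cell
  | SetOne cell
  | Copy cell cell
  | Arith field_op cell cell cell
  | Random cell
  | Seq com com
  | IfThen bexp com com
  | While bexp com
  | Call "nexp list" "nat list" com nat nat
  | BlackBox nexp nat nat nat

record 'k store =
  nvar :: "nat \<Rightarrow> nat"
  farr :: "nat \<Rightarrow> nat \<Rightarrow> 'k"
  ops :: nat
  calls :: nat

primrec nval :: "(nat \<Rightarrow> nat) \<Rightarrow> nexp \<Rightarrow> nat" where
  "nval v (NConst k) = k"
| "nval v (NVar x) = v x"
| "nval v (NAdd a b) = nval v a + nval v b"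
| "nval v (NSub a b) = nval v a - nval v b"
| "nval v (NMul a b) = nval v a * nval v b"
| "nval v (NDiv a b) = nval v a div nval v b"
| "nval v (NMod a b) = nval v a mod nval v b"

definition get_cell :: "'k store \<Rightarrow> cell \<Rightarrow> 'k" where
  "get_cell s c = farr s (fst c) (nval (nvar s) (snd c))"

definition set_cell :: "'k store \<Rightarrow> cell \<Rightarrow> 'k \<Rightarrow> 'k store" where
  "set_cell s c x =
     s\<lparr>farr := (farr s)(fst c := (farr s (fst c))(nval (nvar s) (snd c) := x))\<rparr>"

primrec bval :: "'k ring \<Rightarrow> bexp \<Rightarrow> 'k store \<Rightarrow> bool" where
  "bval K (NLess a b) s = (nval (nvar s) a < nval (nvar s) b)"
| "bval K (IsZero c) s = (get_cell s c = \<zero>\<^bsub>K\<^esub>)"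
| "bval K (BNot b) s = (\<not> bval K b s)"
| "bval K (BAnd a b) s = (bval K a s \<and> bval K b s)"

text \<open>Division by zero makes the run fail (\<open>None\<close>).\<close>

fun arith :: "'k ring \<Rightarrow> field_op \<Rightarrow> 'k \<Rightarrow> 'k \<Rightarrow> 'k option" where
  "arith K FAdd x y = Some (x \<oplus>\<^bsub>K\<^esub> y)"
| "arith K FSub x y = Some (x \<ominus>\<^bsub>K\<^esub> y)"
| "arith K FMul x y = Some (x \<otimes>\<^bsub>K\<^esub> y)"
| "arith K FDiv x y = (if y = \<zero>\<^bsub>K\<^esub> then None else Some (x \<otimes>\<^bsub>K\<^esub> inv\<^bsub>K\<^esub> y))"

text \<open>
  Polynomials are the normalised coefficient lists of \<^theory>\<open>HOL-Algebra.Polynomials\<close> (leading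
  coefficient first).  In memory, cell \<open>i\<close> of an array holds the coefficient of \<open>X\<^sup>i\<close>;
  \<open>read_poly K d A\<close> is the polynomial of degree less than \<open>d\<close> held by \<open>A\<close>.
\<close>

definition read_poly :: "'k ring \<Rightarrow> nat \<Rightarrow> (nat \<Rightarrow> 'k) \<Rightarrow> 'k list" where
  "read_poly K d A = ring.normalize K (map A (rev [0..<d]))"

text \<open>The store with the given numbers in variables 0, 1, ... and the given arrays in 0, 1, ...\<close>

definition frame ::
  "'k ring \<Rightarrow> nat list \<Rightarrow> (nat \<Rightarrow> 'k) list \<Rightarrow> nat \<Rightarrow> nat \<Rightarrow> 'k store" where
  "frame K ns As k l =
     \<lparr>nvar = (\<lambda>i. if i < length ns then ns ! i else 0),
      farr = (\<lambda>j. if j < length As then As ! j else (\<lambda>_. \<zero>\<^bsub>K\<^esub>)),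
      ops = k, calls = l\<rparr>"

definition initial :: "'k ring \<Rightarrow> nat list \<Rightarrow> 'k list list \<Rightarrow> 'k store" where
  "initial K ns Ps = frame K ns (map (ring.coeff K) Ps) 0 0"

partial_function (spmf) while_spmf ::
  "('s \<Rightarrow> bool) \<Rightarrow> ('s \<Rightarrow> 's spmf) \<Rightarrow> 's \<Rightarrow> 's spmf" where
  "while_spmf b c s = (if b s then bind_spmf (c s) (while_spmf b c) else return_spmf s)"

text \<open>
  The final store is a random variable; mass missing from the subprobability distribution is the
  probability that the run fails or does not terminate.

  \<open>Call es As c x A\<close> runs \<open>c\<close> as a procedure in a fresh frame, passing numbers and arrays by value;
  variable 0 and array 0 of the frame are copied back to \<open>x\<close> and \<open>A\<close>.
  \<open>BlackBox d G Y R\<close> passes the polynomials of degree at most \<open>d\<close> in \<open>G\<close> and of degree less than \<open>d\<close>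
  in \<open>Y\<close> to the black box \<open>orc\<close> and stores the polynomial it returns in \<open>R\<close>.
\<close>

primrec run ::
  "'k ring \<Rightarrow> ('k list \<Rightarrow> 'k list \<Rightarrow> 'k list) \<Rightarrow> com \<Rightarrow> 'k store \<Rightarrow> 'k store spmf" where
  "run K orc Skip = return_spmf"
| "run K orc (NAssign x e) = (\<lambda>s. return_spmf (s\<lparr>nvar := (nvar s)(x := nval (nvar s) e)\<rparr>))"
| "run K orc (SetZero c) = (\<lambda>s. return_spmf (set_cell s c \<zero>\<^bsub>K\<^esub>))"
| "run K orc (SetOne c) = (\<lambda>s. return_spmf (set_cell s c \<one>\<^bsub>K\<^esub>))"
| "run K orc (Copy c d) = (\<lambda>s. return_spmf (set_cell s c (get_cell s d)))"
| "run K orc (Arith f c d e) = (\<lambda>s.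
     case arith K f (get_cell s d) (get_cell s e) of
       None \<Rightarrow> return_pmf None
     | Some x \<Rightarrow> return_spmf ((set_cell s c x)\<lparr>ops := Suc (ops s)\<rparr>))"
| "run K orc (Random c) = (\<lambda>s. map_spmf (set_cell s c) (spmf_of_set (carrier K)))"
| "run K orc (Seq c d) = (\<lambda>s. bind_spmf (run K orc c s) (run K orc d))"
| "run K orc (IfThen b c d) = (\<lambda>s. if bval K b s then run K orc c s else run K orc d s)"
| "run K orc (While b c) = while_spmf (bval K b) (run K orc c)"
| "run K orc (Call es As c x A) = (\<lambda>s.
     map_spmf
       (\<lambda>s'. s\<lparr>nvar := (nvar s)(x := nvar s' 0), farr := (farr s)(A := farr s' 0),
               ops := ops s', calls := calls s'\<rparr>)
       (run K orc c (frame K (map (nval (nvar s)) es) (map (farr s) As) (ops s) (calls s))))"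
| "run K orc (BlackBox d G Y R) = (\<lambda>s. return_spmf
     (s\<lparr>farr := (farr s)(R := ring.coeff K
                  (orc (read_poly K (Suc (nval (nvar s) d)) (farr s G))
                       (read_poly K (nval (nvar s) d) (farr s Y)))),
        calls := Suc (calls s)\<rparr>))"

primrec deterministic :: "com \<Rightarrow> bool" where
  "deterministic Skip = True"
| "deterministic (NAssign x e) = True"
| "deterministic (SetZero c) = True"
| "deterministic (SetOne c) = True"
| "deterministic (Copy c d) = True"
| "deterministic (Arith f c d e) = True"
| "deterministic (Random c) = False"
| "deterministic (Seq c d) = (deterministic c \<and> deterministic d)"
| "deterministic (IfThen b c d) = (deterministic c \<and> deterministic d)"
| "deterministic (While b c) = deterministic c"
| "deterministic (Call es As c x A) = deterministic c"
| "deterministic (BlackBox d G Y R) = False"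

text \<open>
  A Las Vegas run: it terminates almost surely, every outcome satisfies \<open>Q\<close>, and the expected
  number of field operations is at most \<open>B\<close>.
\<close>

definition las_vegas :: "'k store spmf \<Rightarrow> ('k store \<Rightarrow> bool) \<Rightarrow> real \<Rightarrow> bool" where
  "las_vegas D Q B \<longleftrightarrow>
     lossless_spmf D \<and> (\<forall>s \<in> set_spmf D. Q s) \<and>
     (\<integral>\<^sup>+ s. ennreal (real (ops s)) \<partial>measure_spmf D) \<le> ennreal B"


section \<open>Costs of polynomial multiplication and modular composition\<close>

definition modular_composition :: "'k ring \<Rightarrow> 'k list \<Rightarrow> 'k list \<Rightarrow> 'k list \<Rightarrow> 'k list" where
  "modular_composition K F G H =
     ring.pmod K (ring.eval (poly_ring K) (map (ring.poly_of_const K) F) G) H"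

text \<open>
  HOL cannot quantify over types inside a formula, so ``any field'' ranges over all fields whose
  carrier is a set of integers; up to isomorphism these are all countable fields, and they include
  the prime fields \<open>residue_ring p\<close> themselves.
\<close>

definition mult_bound :: "(nat \<Rightarrow> real) \<Rightarrow> bool" where
  "mult_bound M \<longleftrightarrow> (\<exists>c. deterministic c \<and>
     (\<forall>(K :: int ring) orc n F G.
        field K \<and> n \<ge> 1 \<and>
        F \<in> carrier (poly_ring K) \<and> Polynomials.degree F \<le> n \<and>
        G \<in> carrier (poly_ring K) \<and> Polynomials.degree G \<le> n \<longrightarrow>
        (\<exists>s. run K orc c (initial K [n] [F, G]) = return_spmf s \<and>
             read_poly K (2 * n + 1) (farr s 0) = F \<otimes>\<^bsub>poly_ring K\<^esub> G \<and>
             real (ops s) \<le> M n)))"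

definition composition_bound :: "(nat \<Rightarrow> real) \<Rightarrow> bool" where
  "composition_bound C \<longleftrightarrow> (\<exists>c. deterministic c \<and>
     (\<forall>(K :: int ring) orc n F G H.
        field K \<and> n \<ge> 1 \<and>
        F \<in> carrier (poly_ring K) \<and> Polynomials.degree F \<le> n \<and>
        G \<in> carrier (poly_ring K) \<and> Polynomials.degree G \<le> n \<and>
        H \<in> carrier (poly_ring K) \<and> Polynomials.degree H = n \<longrightarrow>
        (\<exists>s. run K orc c (initial K [n] [F, G, H]) = return_spmf s \<and>
             read_poly K n (farr s 0) = modular_composition K F G H \<and>
             real (ops s) \<le> C n)))"

definition superlinear :: "(nat \<Rightarrow> real) \<Rightarrow> bool" where
  "superlinear T \<longleftrightarrow> (\<forall>m n. 1 \<le> m \<and> m \<le> n \<longrightarrow> T m / real m \<le> T n / real n)"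


section \<open>Finite fields and root extraction\<close>

abbreviation prime_field :: "nat \<Rightarrow> int ring" where
  "prime_field p \<equiv> residue_ring (int p)"

text \<open>\<open>ext p f\<close> is \<open>\<F>\<^sub>p[X]/\<langle>f\<rangle>\<close> and \<open>cls p f a\<close> the class of \<open>a\<close> in it.\<close>

abbreviation ext :: "nat \<Rightarrow> int list \<Rightarrow> int list set ring" where
  "ext p f \<equiv> Rupt\<^bsub>prime_field p\<^esub> (carrier (prime_field p)) f"

definition cls :: "nat \<Rightarrow> int list \<Rightarrow> int list \<Rightarrow> int list set" where
  "cls p f a = PIdl\<^bsub>poly_ring (prime_field p)\<^esub> f +>\<^bsub>poly_ring (prime_field p)\<^esub> a"

text \<open>
  Correctness of a black box extracting \<open>t\<close>-th roots in the subfields of \<open>\<F>\<^bsub>p\<^sup>s\<^esub>\<close>.  On arguments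
  that violate the precondition its answer is arbitrary.
\<close>

definition root_box ::
  "nat \<Rightarrow> nat \<Rightarrow> nat \<Rightarrow> (int list \<Rightarrow> int list \<Rightarrow> int list) \<Rightarrow> bool" where
  "root_box p s t orc \<longleftrightarrow> (\<forall>g y.
     g \<in> carrier (poly_ring (prime_field p)) \<and>
     pirreducible\<^bsub>prime_field p\<^esub> (carrier (prime_field p)) g \<and>
     Polynomials.degree g dvd s \<and>
     y \<in> carrier (poly_ring (prime_field p)) \<and> Polynomials.degree y < Polynomials.degree g \<and>
     (\<exists>z \<in> carrier (ext p g). z [^]\<^bsub>ext p g\<^esub> t = cls p g y) \<longrightarrow>
     orc g y \<in> carrier (poly_ring (prime_field p)) \<and>
     Polynomials.degree (orc g y) < Polynomials.degree g \<and>
     cls p g (orc g y) [^]\<^bsub>ext p g\<^esub> t = cls p g y)"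

definition is_power :: "nat \<Rightarrow> int list \<Rightarrow> nat \<Rightarrow> int list \<Rightarrow> bool" where
  "is_power p f t a \<longleftrightarrow>
     (\<exists>b \<in> carrier (ext p f) - {\<zero>\<^bsub>ext p f\<^esub>}. b [^]\<^bsub>ext p f\<^esub> t = cls p f a)"

text \<open>
  Variable 0 holds the decision (1 for yes, 0 for no), and array 0 the coefficients of a root when
  there is one.
\<close>

definition correct_answer :: "nat \<Rightarrow> nat \<Rightarrow> int list \<Rightarrow> nat \<Rightarrow> int list \<Rightarrow> int store \<Rightarrow> bool" where
  "correct_answer p n f t a s \<longleftrightarrow>
     nvar s 0 = (if is_power p f t a then 1 else 0) \<and>
     (is_power p f t a \<longrightarrow>
        (\<forall>i<n. farr s 0 i \<in> carrier (prime_field p)) \<and>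
        cls p f (read_poly (prime_field p) n (farr s 0)) [^]\<^bsub>ext p f\<^esub> t = cls p f a)"

end

theory Submission
  imports Defs
begin

text \<open>
  Write \<open>L = \<F>\<^sub>p[X]/\<langle>f\<rangle>\<close>, \<open>Q = p\<^sup>s\<close>, \<open>m = n/s\<close> and \<open>b = a\<^bsup>(Q-1)/t\<^esup>\<close>.  The element \<open>a\<close> is a \<open>t\<close>-th power iff
  \<open>N\<^sub>m = \<Prod>\<^bsub>i<m\<^esub> b\<^bsup>Q^i\<^esup> = a\<^bsup>(q-1)/t\<^esup>\<close> is 1.  If \<open>a = \<alpha>\<^sup>t\<close>, then the sum \<open>w = \<Sum>\<^bsub>j<m\<^esub> N\<^sub>j c\<^bsup>Q^j\<^esup>\<close>
  satisfies \<open>\<alpha> w = Tr(\<alpha> c)\<close> for the trace to \<open>\<F>\<^sub>Q\<close>, although \<open>\<alpha>\<close> is unknown.  For a random \<open>c\<close> this is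
  nonzero with probability at least 1/2, and then \<open>y = a w\<^sup>t\<close> is the \<open>t\<close>-th power of an element of
  \<open>\<F>\<^sub>Q\<close>.  With the minimal polynomial \<open>g\<close> of \<open>y\<close>, the black box extracts a root \<open>r(Z)\<close> of \<open>Z\<close> modulo
  \<open>g\<close>, and \<open>r(y)/w\<close> is a \<open>t\<close>-th root of \<open>a\<close>.

  Both \<open>N\<^sub>m\<close> and \<open>w\<close> are computed by doubling with \<open>O(log m)\<close> modular compositions, since
  \<open>h\<^bsup>Q^k\<^esup>\<close> is \<open>h\<close> composed with \<open>X\<^bsup>Q^k\<^esup>\<close> modulo \<open>f\<close>.  The polynomial \<open>g\<close> is recovered by the Euclidean
  algorithm from the constant coefficients of \<open>2s\<close> powers of \<open>y\<close>, and \<open>1/w\<close> is obtained from the norm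
  of \<open>w\<close> to \<open>\<F>\<^sub>p\<close>.  Reduction modulo \<open>f\<close> is Barrett's method, whose precomputation is a single
  modular composition.
\<close>

text \<open>Only multiplication and modular composition come with a cost bound, so every other
  operation has to be reduced to them. In particular w is inverted through its norm, which reuses
  the doubling procedure, and not by a fast Euclidean algorithm. The sum w works because b =
  alpha^(Q-1) makes N_j = alpha^(Q^j - 1), so multiplication by alpha turns each summand into a
  conjugate of alpha c. The element y may generate a proper subfield of F_Q, while its evident root
  alpha w is only known to lie in F_Q. A root in F_p(y) still exists: with d the degree of F_p(y),
  either t divides p^d - 1, which forces d = s, or t is prime to the order of the multiplicative
  group and every element is a t-th power. The Euclidean algorithm used for g is the quadratic one;
  its cost O(s^2) fits since s^2 <= s n and n is at most a constant times M(n), which rests on M(1)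
  > 0. At n = 1 the term C(n) log(n) vanishes, and C(1) has to be paid by s M(n) log(p).\<close>

section \<open>Probabilistic loops\<close>

text \<open>Makes bounds on expectations accessible to fixpoint induction over loops. The chain may
  be uncountable, so supremum and integral are exchanged over the count space of the support of the
  limit, which is countable.\<close>

lemma admissible_nn_integral_le:
  "spmf.admissible (\<lambda>f. \<forall>s. I s \<longrightarrow> (\<integral>\<^sup>+ x. g x \<partial>measure_spmf (f s)) \<le> h s)"
proof (rule ccpo.admissibleI)
  fix Y :: "('a \<Rightarrow> 'b spmf) set"
  assume ch: "Complete_Partial_Order.chain (fun_ord (ord_spmf (=))) Y" and ne: "Y \<noteq> {}"
    and le: "\<forall>f\<in>Y. \<forall>s. I s \<longrightarrow> (\<integral>\<^sup>+ x. g x \<partial>measure_spmf (f s)) \<le> h s"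
  have "(\<integral>\<^sup>+ x. g x \<partial>measure_spmf (lub_spmf Z)) \<le> b"
    if chZ: "Complete_Partial_Order.chain (ord_spmf (=)) Z" and neZ: "Z \<noteq> {}"
      and leZ: "\<And>q. q \<in> Z \<Longrightarrow> (\<integral>\<^sup>+ x. g x \<partial>measure_spmf q) \<le> b" for Z :: "'b spmf set" and b
  proof -
    let ?C = "count_space (set_spmf (lub_spmf Z))"
    have ch': "Complete_Partial_Order.chain (\<le>) ((\<lambda>p x. ennreal (spmf p x) * g x) ` Z)"
      using chZ by (rule chain_imageI) (auto simp: le_fun_def intro!: mult_right_mono dest: ord_spmf_eq_leD)
    have "(\<integral>\<^sup>+ x. g x \<partial>measure_spmf (lub_spmf Z)) = (\<integral>\<^sup>+ x. ennreal (spmf (lub_spmf Z) x) * g x \<partial>?C)"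
      by (simp add: nn_integral_measure_spmf')
    also have "\<dots> = (\<integral>\<^sup>+ x. (SUP p\<in>Z. ennreal (spmf p x) * g x) \<partial>?C)"
      by (simp add: ennreal_spmf_lub_spmf[OF chZ neZ] SUP_mult_right_ennreal neZ)
    also have "\<dots> = (SUP p\<in>Z. \<integral>\<^sup>+ x. ennreal (spmf p x) * g x \<partial>?C)"
      using neZ ch' by (rule nn_integral_monotone_convergence_SUP_countable) simp
    also have "\<dots> \<le> (SUP p\<in>Z. \<integral>\<^sup>+ x. g x \<partial>measure_spmf p)"
      by (intro SUP_mono) (auto simp: nn_integral_measure_spmf nn_integral_count_space_indicator
          intro!: bexI nn_integral_mono split: split_indicator)
    also have "\<dots> \<le> b" using leZ by (intro SUP_least) auto
    finally show ?thesis .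
  qed
  note * = this
  show "\<forall>s. I s \<longrightarrow> (\<integral>\<^sup>+ x. g x \<partial>measure_spmf (fun_lub lub_spmf Y s)) \<le> h s"
  proof (intro allI impI)
    fix s assume "I s"
    show "(\<integral>\<^sup>+ x. g x \<partial>measure_spmf (fun_lub lub_spmf Y s)) \<le> h s"
      unfolding fun_lub_def
      by (rule *[OF chain_fun[OF ch]]) (use ne le \<open>I s\<close> in auto)
  qed
qed

lemma nn_integral_bind_spmf:
  "(\<integral>\<^sup>+ y. g y \<partial>measure_spmf (bind_spmf p f)) = (\<integral>\<^sup>+ x. (\<integral>\<^sup>+ y. g y \<partial>measure_spmf (f x)) \<partial>measure_spmf p)"
  by (simp add: measure_spmf_bind o_def nn_integral_bind[where B = "count_space UNIV"])

text \<open>Runs that never stop contribute no outcome, so fixpoint induction gives this partial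
  correctness rule without any termination argument.\<close>

lemma set_while_spmf:
  assumes inv: "\<And>s s'. I s \<Longrightarrow> b s \<Longrightarrow> s' \<in> set_spmf (c s) \<Longrightarrow> I s'" and "I s"
    and "s' \<in> set_spmf (while_spmf b c s)"
  shows "I s' \<and> \<not> b s'"
proof -
  have "\<forall>s. I s \<longrightarrow> set_spmf (while_spmf b c s) \<subseteq> {s'. I s' \<and> \<not> b s'}"
  proof (induction rule: while_spmf.fixp_induct)
    case 1 show ?case by simp
  next
    case 2 show ?case by simp
  next
    case (3 w)
    show ?case
    proof (intro allI impI)
      fix s assume "I s"
      then show "set_spmf (if b s then c s \<bind> w b c else return_spmf s) \<subseteq> {s'. I s' \<and> \<not> b s'}"
        using 3 inv[of s] by (auto simp: set_bind_spmf) blast+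
    qed
  qed
  with assms show ?thesis by blast
qed

text \<open>Fixpoint induction bounds a loop only from above. Equality therefore takes two
  inductions, each unrolling one side, joined by antisymmetry.\<close>

lemma map_while_spmf:
  assumes b: "\<And>s. b (h s) = b s" and c: "\<And>s. c (h s) = map_spmf h (c s)"
  shows "while_spmf b c (h s) = map_spmf h (while_spmf b c s)"
proof (rule spmf.leq_antisym)
  have "\<forall>s. ord_spmf (=) (while_spmf b c (h s)) (map_spmf h (while_spmf b c s))"
  proof (induction rule: while_spmf.fixp_induct[of "\<lambda>w. \<forall>s. ord_spmf (=) (w b c (h s)) (map_spmf h (while_spmf b c s))"])
    case 1 show ?case by simp
  next
    case 2 show ?case by simp
  next
    case (3 w)
    show ?case
    proof
      fix s
      show "ord_spmf (=) (if b (h s) then c (h s) \<bind> w b c else return_spmf (h s)) (map_spmf h (while_spmf b c s))"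
        unfolding while_spmf.simps[of b c s] using 3
        by (auto simp: b c map_spmf_bind_spmf bind_map_spmf o_def intro!: bind_spmf_mono' ord_spmf_reflI)
    qed
  qed
  then show "ord_spmf (=) (while_spmf b c (h s)) (map_spmf h (while_spmf b c s))" by blast
next
  have "\<forall>s. ord_spmf (=) (map_spmf h (while_spmf b c s)) (while_spmf b c (h s))"
  proof (induction rule: while_spmf.fixp_induct[of "\<lambda>w. \<forall>s. ord_spmf (=) (map_spmf h (w b c s)) (while_spmf b c (h s))"])
    case 1 show ?case by simp
  next
    case 2 show ?case by simp
  next
    case (3 w)
    show ?case
    proof
      fix s
      show "ord_spmf (=) (map_spmf h (if b s then c s \<bind> w b c else return_spmf s)) (while_spmf b c (h s))"
        unfolding while_spmf.simps[of b c "h s"] using 3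
        by (auto simp: b c map_spmf_bind_spmf bind_map_spmf o_def intro!: bind_spmf_mono' ord_spmf_reflI)
    qed
  qed
  then show "ord_spmf (=) (map_spmf h (while_spmf b c s)) (while_spmf b c (h s))" by blast
qed


text \<open>Bootstrapping: a termination probability of at least e in all states of the invariant
  improves itself to 1/2 + e/2, because a round leaves the loop with probability at least 1/2. From
  e = 0 this gives 1 - 2^-k for every k.\<close>

lemma lossless_while_spmf:
  assumes inv: "\<And>s s'. I s \<Longrightarrow> b s \<Longrightarrow> s' \<in> set_spmf (c s) \<Longrightarrow> I s'"
    and ll: "\<And>s. I s \<Longrightarrow> b s \<Longrightarrow> lossless_spmf (c s)"
    and half: "\<And>s. I s \<Longrightarrow> b s \<Longrightarrow> measure (measure_spmf (c s)) {s'. b s'} \<le> 1 / 2"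
    and "I s"
  shows "lossless_spmf (while_spmf b c s)"
proof -
  define W where "W s = weight_spmf (while_spmf b c s)" for s
  have step: "W s \<ge> 1 / 2 + e / 2" if I: "I s" and e: "\<And>s. I s \<Longrightarrow> e \<le> W s" "0 \<le> e" "e \<le> 1" for s e
  proof (cases "b s")
    case False
    then show ?thesis using e by (simp add: W_def while_spmf.simps)
  next
    case True
    let ?M = "measure_spmf (c s)"
    have "prob_space ?M" using ll[OF I True]
      by (simp add: lossless_spmf_def prob_spaceI measure_spmf.emeasure_eq_measure weight_spmf_def)
    then interpret M: prob_space ?M .
    have bnd: "1 - (1 - e) * indicator {s'. b s'} s' \<le> W s'" if "s' \<in> set_spmf (c s)" for s'
      using e(1)[OF inv[OF I True that]] by (auto simp: W_def while_spmf.simps split: split_indicator)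
    have "1 / 2 + e / 2 \<le> 1 - (1 - e) * measure ?M {s'. b s'}"
      using half[OF I True] e mult_left_mono[of "measure ?M {s'. b s'}" "1/2" "1 - e"] by (simp add: algebra_simps)
    also have "\<dots> = (\<integral>s'. 1 - (1 - e) * indicator {s'. b s'} s' \<partial>?M)"
      by (subst Bochner_Integration.integral_diff) (auto simp: M.prob_space measure_spmf.emeasure_eq_measure)
    also have "\<dots> \<le> (\<integral>s'. W s' \<partial>?M)"
    proof (rule integral_mono_AE)
      show "integrable ?M W"
        by (rule measure_spmf.integrable_const_bound[of _ 1]) (auto simp: W_def weight_spmf_le_1)
      show "AE s' in ?M. 1 - (1 - e) * indicator {s'. b s'} s' \<le> W s'"
        using bnd by (simp add: AE_measure_spmf_iff)
      show "integrable ?M (\<lambda>s'. 1 - (1 - e) * indicator {s'. b s'} s')"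
        by (auto simp: measure_spmf.emeasure_eq_measure)
    qed
    also have "\<dots> = W s"
      using True unfolding W_def while_spmf.simps[of b c s] by (simp add: weight_bind_spmf o_def)
    finally show ?thesis .
  qed
  have "1 - (1 / 2) ^ k \<le> W s" if "I s" for s k
    using that
  proof (induction k arbitrary: s)
    case 0 then show ?case by (simp add: W_def weight_spmf_nonneg)
  next
    case (Suc k)
    then show ?case using step[of s "1 - (1/2)^k"] by (simp add: power_le_one field_simps)
  qed
  then have "(\<lambda>k. 1 - (1 / 2 :: real) ^ k) \<longlonglongrightarrow> 1 - 0 \<Longrightarrow> 1 - 0 \<le> W s"
    using \<open>I s\<close> LIMSEQ_le_const2[of "\<lambda>k. 1 - (1 / 2 :: real) ^ k" 1 "W s"] by auto
  moreover have "(\<lambda>k. 1 - (1 / 2 :: real) ^ k) \<longlonglongrightarrow> 1 - 0"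
    by (intro tendsto_intros LIMSEQ_power_zero) auto
  ultimately show ?thesis
    using weight_spmf_le_1[of "while_spmf b c s"] by (simp add: lossless_spmf_def W_def)
qed

lemma expected_cost_while_spmf:
  fixes cost :: "'s \<Rightarrow> nat"
  assumes inv: "\<And>s s'. I s \<Longrightarrow> b s \<Longrightarrow> s' \<in> set_spmf (c s) \<Longrightarrow> I s' \<and> cost s' \<le> cost s + B"
    and half: "\<And>s. I s \<Longrightarrow> b s \<Longrightarrow> measure (measure_spmf (c s)) {s'. b s'} \<le> 1 / 2"
    and "I s"
  shows "(\<integral>\<^sup>+ s'. ennreal (real (cost s')) \<partial>measure_spmf (while_spmf b c s)) \<le> ennreal (real (cost s + 2 * B))"
proof -
  \<comment> \<open>Potential: a charge of 2 B as long as the guard holds. A round costs B and keeps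
    the charge with probability at most 1/2, so B + (2 B)/2 is exactly covered.\<close>
  let ?h = "\<lambda>s. ennreal (real (cost s)) + ennreal (2 * real B) * indicator {s. b s} s"
  have "\<forall>s. I s \<longrightarrow> (\<integral>\<^sup>+ s'. ennreal (real (cost s')) \<partial>measure_spmf (while_spmf b c s)) \<le> ?h s"
  proof (induction rule: while_spmf.fixp_induct)
    case 1
    have "spmf.admissible (\<lambda>w. \<forall>x. (fst (fst x) = b \<and> snd (fst x) = c \<and> I (snd x)) \<longrightarrow>
        (\<integral>\<^sup>+ s'. ennreal (real (cost s')) \<partial>measure_spmf (w x)) \<le> ?h (snd x))"
      by (rule admissible_nn_integral_le)
    then show ?case by (simp add: curry_def split_paired_All)
  next
    case 2 show ?case by simp
  next
    case (3 w)
    show ?case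
    proof (intro allI impI)
      fix s assume I: "I s"
      show "(\<integral>\<^sup>+ s'. ennreal (real (cost s')) \<partial>measure_spmf (if b s then c s \<bind> w b c else return_spmf s)) \<le> ?h s"
      proof (cases "b s")
        case False
        then show ?thesis by (simp add: measure_spmf_return_spmf nn_integral_return)
      next
        case True
        let ?M = "measure_spmf (c s)"
        have "(\<integral>\<^sup>+ s'. ennreal (real (cost s')) \<partial>measure_spmf (c s \<bind> w b c)) =
           (\<integral>\<^sup>+ s1. (\<integral>\<^sup>+ s'. ennreal (real (cost s')) \<partial>measure_spmf (w b c s1)) \<partial>?M)"
          by (simp add: nn_integral_bind_spmf)
        also have "\<dots> \<le> (\<integral>\<^sup>+ s1. ennreal (real (cost s + B)) + ennreal (2 * real B) * indicator {s. b s} s1 \<partial>?M)"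
        proof (rule nn_integral_mono_AE, subst AE_measure_spmf_iff, rule ballI)
          fix s1 assume s1: "s1 \<in> set_spmf (c s)"
          have "(\<integral>\<^sup>+ s'. ennreal (real (cost s')) \<partial>measure_spmf (w b c s1)) \<le> ?h s1"
            using 3 inv[OF I True s1] by blast
          also have "\<dots> \<le> ennreal (real (cost s + B)) + ennreal (2 * real B) * indicator {s. b s} s1"
            using inv[OF I True s1] by (intro add_mono ennreal_leI) auto
          finally show "(\<integral>\<^sup>+ s'. ennreal (real (cost s')) \<partial>measure_spmf (w b c s1)) \<le>
             ennreal (real (cost s + B)) + ennreal (2 * real B) * indicator {s. b s} s1" .
        qed
        also have "\<dots> = ennreal (real (cost s + B)) * emeasure ?M UNIV + ennreal (2 * real B) * emeasure ?M {s. b s}"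
          by (subst nn_integral_add) (auto simp: nn_integral_cmult space_measure_spmf)
        also have "\<dots> \<le> ennreal (real (cost s + B)) * 1 + ennreal (2 * real B) * ennreal (1 / 2)"
          using half[OF I True] measure_spmf.subprob_emeasure_le_1[of "c s" UNIV]
          by (intro add_mono mult_left_mono) (auto simp: measure_spmf.emeasure_eq_measure intro!: ennreal_leI simp del: ennreal_half)
        also have "\<dots> = ennreal (real (cost s) + 2 * real B)"
        proof -
          have "ennreal (2 * real B) * ennreal (1 / 2) = ennreal (real B)"
            by (subst ennreal_mult[symmetric]) auto
          then show ?thesis
            by (simp only: mult_1_right) (simp add: ennreal_plus[symmetric] del: ennreal_plus)
        qed
        also have "\<dots> = ?h s" using True by (simp add: ennreal_plus)
        finally show ?thesis using True by simp
      qed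
    qed
  qed
  then have "(\<integral>\<^sup>+ s'. ennreal (real (cost s')) \<partial>measure_spmf (while_spmf b c s)) \<le> ?h s"
    using \<open>I s\<close> by blast
  also have "\<dots> \<le> ennreal (real (cost s)) + ennreal (2 * real B)"
    by (auto split: split_indicator)
  also have "\<dots> = ennreal (real (cost s + 2 * B))" by (simp add: ennreal_plus[symmetric] del: ennreal_plus)
  finally show ?thesis .
qed

section \<open>Weakest preconditions for deterministic runs\<close>

text \<open>Asking for a point mass makes this a total correctness notion: it includes termination
  and the absence of division by zero.\<close>

definition wp :: "'k ring \<Rightarrow> ('k list \<Rightarrow> 'k list \<Rightarrow> 'k list) \<Rightarrow> com \<Rightarrow> ('k store \<Rightarrow> bool) \<Rightarrow> 'k store \<Rightarrow> bool" where
  "wp K orc c Q s \<longleftrightarrow> (\<exists>s'. run K orc c s = return_spmf s' \<and> Q s')"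

lemma wp_atomic [simp]:
  "wp K orc Skip Q s = Q s"
  "wp K orc (NAssign x e) Q s = Q (s\<lparr>nvar := (nvar s)(x := nval (nvar s) e)\<rparr>)"
  "wp K orc (SetZero d) Q s = Q (set_cell s d \<zero>\<^bsub>K\<^esub>)"
  "wp K orc (SetOne d) Q s = Q (set_cell s d \<one>\<^bsub>K\<^esub>)"
  "wp K orc (Copy d d1) Q s = Q (set_cell s d (get_cell s d1))"
  "wp K orc (Arith FAdd d d1 d2) Q s = Q ((set_cell s d (get_cell s d1 \<oplus>\<^bsub>K\<^esub> get_cell s d2))\<lparr>ops := Suc (ops s)\<rparr>)"
  "wp K orc (Arith FSub d d1 d2) Q s = Q ((set_cell s d (get_cell s d1 \<ominus>\<^bsub>K\<^esub> get_cell s d2))\<lparr>ops := Suc (ops s)\<rparr>)"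
  "wp K orc (Arith FMul d d1 d2) Q s = Q ((set_cell s d (get_cell s d1 \<otimes>\<^bsub>K\<^esub> get_cell s d2))\<lparr>ops := Suc (ops s)\<rparr>)"
  "wp K orc (BlackBox k G Y R) Q s = Q (s\<lparr>farr := (farr s)(R := ring.coeff K
                  (orc (read_poly K (Suc (nval (nvar s) k)) (farr s G))
                       (read_poly K (nval (nvar s) k) (farr s Y)))),
        calls := Suc (calls s)\<rparr>)"
  by (simp_all add: wp_def)

lemma wp_FDiv: "get_cell s d2 \<noteq> \<zero>\<^bsub>K\<^esub> \<Longrightarrow>
  wp K orc (Arith FDiv d d1 d2) Q s = Q ((set_cell s d (get_cell s d1 \<otimes>\<^bsub>K\<^esub> inv\<^bsub>K\<^esub> get_cell s d2))\<lparr>ops := Suc (ops s)\<rparr>)"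
  by (simp add: wp_def)

lemma wp_IfThen [simp]: "wp K orc (IfThen b c d) Q s = (if bval K b s then wp K orc c Q s else wp K orc d Q s)"
  by (simp add: wp_def)

lemma wp_mono: "wp K orc c Q s \<Longrightarrow> (\<And>s'. Q s' \<Longrightarrow> Q' s') \<Longrightarrow> wp K orc c Q' s"
  by (auto simp: wp_def)

lemma wp_Seq: "wp K orc c (wp K orc d Q) s \<Longrightarrow> wp K orc (Seq c d) Q s"
  by (auto simp: wp_def)

lemma wp_Seq_atomic [simp]:
  "wp K orc (Seq Skip c) Q s = wp K orc c Q s"
  "wp K orc (Seq (NAssign x e) c) Q s = wp K orc c Q (s\<lparr>nvar := (nvar s)(x := nval (nvar s) e)\<rparr>)"
  "wp K orc (Seq (SetZero d) c) Q s = wp K orc c Q (set_cell s d \<zero>\<^bsub>K\<^esub>)"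
  "wp K orc (Seq (SetOne d) c) Q s = wp K orc c Q (set_cell s d \<one>\<^bsub>K\<^esub>)"
  "wp K orc (Seq (Copy d d1) c) Q s = wp K orc c Q (set_cell s d (get_cell s d1))"
  "wp K orc (Seq (Arith FAdd d d1 d2) c) Q s = wp K orc c Q ((set_cell s d (get_cell s d1 \<oplus>\<^bsub>K\<^esub> get_cell s d2))\<lparr>ops := Suc (ops s)\<rparr>)"
  "wp K orc (Seq (Arith FSub d d1 d2) c) Q s = wp K orc c Q ((set_cell s d (get_cell s d1 \<ominus>\<^bsub>K\<^esub> get_cell s d2))\<lparr>ops := Suc (ops s)\<rparr>)"
  "wp K orc (Seq (Arith FMul d d1 d2) c) Q s = wp K orc c Q ((set_cell s d (get_cell s d1 \<otimes>\<^bsub>K\<^esub> get_cell s d2))\<lparr>ops := Suc (ops s)\<rparr>)"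
  by (simp_all add: wp_def)

lemma wp_While:
  fixes m :: "'k store \<Rightarrow> nat"
  assumes "I s" and step: "\<And>s. I s \<Longrightarrow> bval K b s \<Longrightarrow> wp K orc c (\<lambda>s'. I s' \<and> m s' < m s) s"
    and exit: "\<And>s. I s \<Longrightarrow> \<not> bval K b s \<Longrightarrow> Q s"
  shows "wp K orc (While b c) Q s"
  using \<open>I s\<close>
proof (induction "m s" arbitrary: s rule: less_induct)
  case less
  show ?case
  proof (cases "bval K b s")
    case True
    obtain s' where s': "run K orc c s = return_spmf s'" "I s'" "m s' < m s"
      using step[OF less.prems True] by (auto simp: wp_def)
    show ?thesis
      using less.hyps[OF s'(3,2)] True s'(1) by (simp add: wp_def while_spmf.simps[of _ _ s])
  next
    case False
    then show ?thesis using exit[OF less.prems] by (simp add: wp_def while_spmf.simps[of _ _ s])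
  qed
qed

definition For :: "nat \<Rightarrow> nexp \<Rightarrow> com \<Rightarrow> com" where
  "For i e c = Seq (NAssign i (NConst 0))
     (While (NLess (NVar i) e) (Seq c (NAssign i (NAdd (NVar i) (NConst 1)))))"

lemma wp_For:
  assumes "I 0 (s\<lparr>nvar := (nvar s)(i := 0)\<rparr>)"
    and bound: "\<And>j s. I j s \<Longrightarrow> nval (nvar s) e = k"
    and step: "\<And>j s. j < k \<Longrightarrow> I j s \<Longrightarrow> nvar s i = j \<Longrightarrow>
      wp K orc c (\<lambda>s'. nvar s' i = j \<and> I (Suc j) (s'\<lparr>nvar := (nvar s')(i := Suc j)\<rparr>)) s"
    and exit: "\<And>s. I k s \<Longrightarrow> Q s"
  shows "wp K orc (For i e c) Q s"
  unfolding For_def wp_Seq_atomic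
proof (rule wp_While[where I = "\<lambda>s. nvar s i \<le> k \<and> I (nvar s i) s" and m = "\<lambda>s. k - nvar s i"])
  fix s assume I: "nvar s i \<le> k \<and> I (nvar s i) s" and b: "bval K (NLess (NVar i) e) s"
  then have "nvar s i < k" using bound by fastforce
  then show "wp K orc (Seq c (NAssign i (NAdd (NVar i) (NConst 1))))
     (\<lambda>s'. (nvar s' i \<le> k \<and> I (nvar s' i) s') \<and> k - nvar s' i < k - nvar s i) s"
    using I by (intro wp_Seq wp_mono[OF step]) auto
next
  fix s assume I: "nvar s i \<le> k \<and> I (nvar s i) s" and b: "\<not> bval K (NLess (NVar i) e) s"
  then have "nvar s i = k" using bound[of "nvar s i" s] by simp
  with I exit show "Q s" by blast
qed (use assms(1) in simp)

section \<open>Invariance of runs under shifting the counters\<close>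

abbreviation shift :: "nat \<Rightarrow> nat \<Rightarrow> 'k store \<Rightarrow> 'k store" where
  "shift u l s \<equiv> s\<lparr>ops := ops s + u, calls := calls s + l\<rparr>"

lemma set_cell_shift: "set_cell (shift u l s) d x = shift u l (set_cell s d x)"
  by (simp add: set_cell_def)

lemma bval_shift: "bval K b (shift u l s) = bval K b s"
  by (induction b) (auto simp: get_cell_def)

text \<open>No expression or guard reads \<open>ops\<close> or \<open>calls\<close>, so the counters
  are carried along passively. This transfers cost bounds measured from zero to procedures called in
  the middle of a computation.\<close>

lemma run_shift: "run K orc c (shift u l s) = map_spmf (shift u l) (run K orc c s)"
proof (induction c arbitrary: s)
  case (Arith f d d1 d2)
  then show ?case by (cases f) (auto simp: get_cell_def set_cell_def)
next
  case (Random d)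
  have "set_cell (shift u l s) d = (\<lambda>x. shift u l (set_cell s d x))" by (rule ext) (rule set_cell_shift)
  then show ?case by (simp add: o_def spmf.map_comp)
next
  case (Seq c d)
  then show ?case by (simp add: bind_map_spmf map_spmf_bind_spmf o_def)
next
  case (IfThen b c d)
  then show ?case by (simp add: bval_shift)
next
  case (While b c)
  show ?case unfolding run.simps by (rule map_while_spmf[where h = "shift u l"]) (rule bval_shift, rule While.IH)
next
  case (Call es As c x A)
  let ?f = "frame K (map (nval (nvar s)) es) (map (farr s) As) (ops s) (calls s)"
  have "run K orc c (shift u l ?f) = map_spmf (shift u l) (run K orc c ?f)" by (rule Call.IH)
  moreover have "frame K (map (nval (nvar (shift u l s))) es) (map (farr (shift u l s)) As) (ops (shift u l s)) (calls (shift u l s)) = shift u l ?f"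
    by (simp add: frame_def)
  ultimately show ?case by (simp only: run.simps) (simp add: spmf.map_comp o_def)
qed (auto simp: set_cell_def get_cell_def)

text \<open>\<open>deterministic\<close> excludes \<open>BlackBox\<close>, the only command that
  raises \<open>calls\<close> by itself; the given multiplication and composition programs thus
  never consult the oracle.\<close>

lemma deterministic_calls: "deterministic c \<Longrightarrow> s' \<in> set_spmf (run K orc c s) \<Longrightarrow> calls s' = calls s"
proof (induction c arbitrary: s s')
  case (Arith f d d1 d2)
  then show ?case by (cases f) (auto simp: set_cell_def split: if_splits)
next
  case (Seq c d)
  then show ?case by (fastforce simp: set_bind_spmf)
next
  case (While b c)
  then show ?case using set_while_spmf[of "\<lambda>s'. calls s' = calls s" "bval K b" "run K orc c" s s'] by auto
next
  case (Call es As c x A)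
  then show ?case by (fastforce simp: frame_def)
qed (auto simp: set_cell_def split: if_splits)

text \<open>Consequently a multiplication program must perform arithmetic, so \<open>M 1 > 0\<close>; with superlinearity
  this absorbs all terms linear in \<open>n\<close> of the cost.\<close>

lemma zero_ops_values:
  fixes S :: "'k set"
  defines "good \<equiv> \<lambda>s :: 'k store. \<forall>j i. farr s j i \<in> S"
  assumes S: "\<zero>\<^bsub>K\<^esub> \<in> S" "\<one>\<^bsub>K\<^esub> \<in> S"
  shows "deterministic c \<Longrightarrow> s' \<in> set_spmf (run K orc c s) \<Longrightarrow>
    ops s \<le> ops s' \<and> (ops s' = ops s \<and> good s \<longrightarrow> good s')"
proof (induction c arbitrary: s s')
  case (Arith f d d1 d2)
  then show ?case by (cases f) (auto simp: set_cell_def split: if_splits)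
next
  case (Seq c d)
  then obtain s1 where s1: "s1 \<in> set_spmf (run K orc c s)" "s' \<in> set_spmf (run K orc d s1)"
    by (auto simp: set_bind_spmf)
  show ?case using Seq.IH(1)[OF _ s1(1)] Seq.IH(2)[OF _ s1(2)] Seq.prems(1) by auto
next
  case (While b c)
  let ?I = "\<lambda>s'. ops s \<le> ops s' \<and> (ops s' = ops s \<and> good s \<longrightarrow> good s')"
  have "?I s' \<and> \<not> bval K b s'"
  proof (rule set_while_spmf[where I = ?I and b = "bval K b" and c = "run K orc c" and s = s])
    fix s1 s2 assume "?I s1" "s2 \<in> set_spmf (run K orc c s1)"
    then show "?I s2" using While.IH[of s2 s1] While.prems(1) by auto
  qed (use While.prems in auto)
  then show ?case by blast
next
  case (Call es As c x A)
  then obtain s1 where s1: "s1 \<in> set_spmf (run K orc c (frame K (map (nval (nvar s)) es) (map (farr s) As) (ops s) (calls s)))"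
    and s': "s' = s\<lparr>nvar := (nvar s)(x := nvar s1 0), farr := (farr s)(A := farr s1 0), ops := ops s1, calls := calls s1\<rparr>"
    by auto
  have "good s \<Longrightarrow> good (frame K (map (nval (nvar s)) es) (map (farr s) As) (ops s) (calls s))"
    using S by (simp add: good_def frame_def)
  moreover have "good s \<Longrightarrow> good s1 \<Longrightarrow> good s'" by (simp add: good_def s')
  moreover have "ops (frame K (map (nval (nvar s)) es) (map (farr s) As) (ops s) (calls s)) = ops s"
    by (simp add: frame_def)
  moreover have "ops s' = ops s1" by (simp add: s')
  ultimately show ?case using Call.IH[OF _ s1] Call.prems(1) by auto
qed (use S in \<open>auto simp: good_def set_cell_def get_cell_def split: if_splits\<close>)

lemma mult_bound_pos:
  assumes "mult_bound M" shows "M 1 > 0"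
proof (rule ccontr)
  assume M: "\<not> M 1 > 0"
  obtain c where c: "deterministic c" and run: "\<And>(K :: int ring) orc n F G.
        field K \<and> n \<ge> 1 \<and>
        F \<in> carrier (poly_ring K) \<and> Polynomials.degree F \<le> n \<and>
        G \<in> carrier (poly_ring K) \<and> Polynomials.degree G \<le> n \<longrightarrow>
        (\<exists>s. run K orc c (initial K [n] [F, G]) = return_spmf s \<and>
             read_poly K (2 * n + 1) (farr s 0) = F \<otimes>\<^bsub>poly_ring K\<^esub> G \<and>
             real (ops s) \<le> M n)"
    using assms unfolding mult_bound_def by auto
  \<comment> \<open>Modulo 7 the product 3 * 3 is 2, which lies outside {0, 1, 3}, the only values
    that can occur without arithmetic when both inputs are the constant 3.\<close>
  let ?K = "residue_ring 7"
  have "\<not> n dvd 7" if "n \<in> {2..<7}" for n :: nat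
    using that by (cases "n = 2 \<or> n = 3 \<or> n = 4 \<or> n = 5 \<or> n = 6") auto
  then have p7: "Factorial_Ring.prime (7::nat)" by (simp add: prime_nat_iff')
  interpret residues_prime 7 ?K by unfold_locales (use p7 in auto)
  interpret field ?K by (rule is_field)
  have k: "carrier ?K = {0..6}" "\<zero>\<^bsub>?K\<^esub> = 0" "\<one>\<^bsub>?K\<^esub> = 1" "\<And>x y. x \<otimes>\<^bsub>?K\<^esub> y = (x * y) mod 7" "\<And>x y. x \<oplus>\<^bsub>?K\<^esub> y = (x + y) mod 7"
    by (auto simp: residue_ring_def)
  have F: "[3] \<in> carrier (poly_ring ?K)" by (auto simp: univ_poly_def polynomial_def k)
  then obtain s where s: "run ?K (\<lambda>_ _. []) c (initial ?K [1] [[3], [3]]) = return_spmf s"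
      "read_poly ?K (2 * 1 + 1) (farr s 0) = [3] \<otimes>\<^bsub>poly_ring ?K\<^esub> [3]" "real (ops s) \<le> M 1"
    using run[of ?K 1 "[3]" "[3]" "\<lambda>_ _. []"] is_field by auto
  have "ops s = 0" using s(3) M by simp
  then have val: "farr s j i \<in> {0, 1, 3}" for j i
    using zero_ops_values[of ?K "{0,1,3}" c s "\<lambda>_ _. []" "initial ?K [1] [[3], [3]]"] c s(1)
    by (auto simp: k initial_def frame_def less_Suc_eq_0_disj)
  have "[3] \<otimes>\<^bsub>poly_ring ?K\<^esub> [3] = [2]"
    by (simp add: univ_poly_mult k)
  moreover have "read_poly ?K 3 (farr s 0) = normalize [farr s 0 2, farr s 0 1, farr s 0 0]"
    by (simp add: read_poly_def upt_rec numeral_eq_Suc)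
  ultimately have "farr s 0 0 = 2 \<or> farr s 0 1 = 2 \<or> farr s 0 2 = 2"
    using s(2) by (auto simp: k split: if_splits)
  then show False using val[of 0 0] val[of 0 1] val[of 0 2] by auto
qed

section \<open>Contracts for procedures\<close>

text \<open>The contract fixes the whole result array, also beyond its meaningful cells, so that
  contracts chain by rewriting. It holds for all initial counters, and the number returned in
  variable 0 is left open; callers direct it to a scratch variable or overwrite it.\<close>

definition computes :: "'k ring \<Rightarrow> ('k list \<Rightarrow> 'k list \<Rightarrow> 'k list) \<Rightarrow> com \<Rightarrow> nat list \<Rightarrow> (nat \<Rightarrow> 'k) list \<Rightarrow> (nat \<Rightarrow> 'k) \<Rightarrow> nat \<Rightarrow> bool" where
  "computes K orc c ns As A k \<longleftrightarrow> (\<forall>u l.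
     wp K orc c (\<lambda>s. farr s 0 = A \<and> ops s \<le> u + k \<and> calls s = l) (frame K ns As u l))"

lemma wp_Call:
  assumes "computes K orc c (map (nval (nvar s)) es) (map (farr s) As) B k"
    and "\<And>v j. j \<le> ops s + k \<Longrightarrow> Q (s\<lparr>nvar := (nvar s)(x := v), farr := (farr s)(A := B), ops := j\<rparr>)"
  shows "wp K orc (Call es As c x A) Q s"
proof -
  obtain s' where s': "run K orc c (frame K (map (nval (nvar s)) es) (map (farr s) As) (ops s) (calls s)) = return_spmf s'"
    "farr s' 0 = B" "ops s' \<le> ops s + k" "calls s' = calls s"
    using assms(1) unfolding computes_def wp_def by blast
  then have "run K orc (Call es As c x A) s = return_spmf (s\<lparr>nvar := (nvar s)(x := nvar s' 0), farr := (farr s)(A := B), ops := ops s'\<rparr>)"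
    by (simp)
  then show ?thesis using assms(2)[of "ops s'" "nvar s' 0"] s'(3) by (auto simp: wp_def)
qed

text \<open>A single run from zero counters determines the runs from all counters by
  \<open>run_shift\<close>.\<close>

lemma computes_frame:
  assumes "deterministic c" "run K orc c (frame K ns As 0 0) = return_spmf s" "ops s \<le> k"
  shows "computes K orc c ns As (farr s 0) k"
  unfolding computes_def wp_def
proof (intro allI)
  fix u l
  have "frame K ns As u l = shift u l (frame K ns As 0 0)" by (simp add: frame_def)
  then have "run K orc c (frame K ns As u l) = map_spmf (shift u l) (run K orc c (frame K ns As 0 0))"
    using run_shift[where u = u and l = l and s = "frame K ns As 0 0"] by (simp only:)
  then have "run K orc c (frame K ns As u l) = return_spmf (shift u l s)"
    by (simp add: assms(2))
  moreover have "calls s = 0"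
    using deterministic_calls[OF assms(1), of s K orc "frame K ns As 0 0"] assms(2) by (simp add: frame_def)
  ultimately show "\<exists>s'. run K orc c (frame K ns As u l) = return_spmf s' \<and> farr s' 0 = farr s 0 \<and> ops s' \<le> u + k \<and> calls s' = l"
    using assms(3) by auto
qed

section \<open>Polynomials as arrays\<close>

locale base_field = field K for K :: "'k ring" (structure)
begin

abbreviation PR where "PR \<equiv> poly_ring K"
abbreviation xp :: "nat \<Rightarrow> 'k list" where "xp k \<equiv> X\<^bsub>K\<^esub> [^]\<^bsub>PR\<^esub> k"

lemma PR_domain: "domain PR"
  by (rule univ_poly_is_domain[OF carrier_is_subring])

lemma PR_set: "F \<in> carrier PR \<Longrightarrow> set F \<subseteq> carrier K"
  by (meson polynomial_incl univ_poly_carrier)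

lemma PR_coeff_closed [simp]: "F \<in> carrier PR \<Longrightarrow> coeff F i \<in> carrier K"
  by (simp add: PR_set)

lemma PR_zero: "\<zero>\<^bsub>PR\<^esub> = []" by (simp add: univ_poly_zero)

lemma poly_eqI:
  assumes "F \<in> carrier PR" "G \<in> carrier PR" "\<And>i. coeff F i = coeff G i" shows "F = G"
  using assms coeff_iff_polynomial_cond[of "carrier K" F G] by (auto simp: univ_poly_carrier)

lemma PR_length_le_iff:
  assumes "F \<in> carrier PR" shows "length F \<le> k \<longleftrightarrow> (\<forall>i\<ge>k. coeff F i = \<zero>)"
proof
  assume "length F \<le> k" then show "\<forall>i\<ge>k. coeff F i = \<zero>" by (simp add: coeff_length)
next
  assume z: "\<forall>i\<ge>k. coeff F i = \<zero>"
  show "length F \<le> k"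
  proof (rule ccontr)
    assume "\<not> length F \<le> k"
    then have "F \<noteq> []" "degree F \<ge> k" by auto
    moreover have "lead_coeff F \<noteq> \<zero>" using assms \<open>F \<noteq> []\<close> by (auto simp: univ_poly_def polynomial_def)
    ultimately show False using z lead_coeff_simp by metis
  qed
qed

lemma coeff_normalize_map_upt: "coeff (normalize (map A (rev [0..<k]))) i = (if i < k then A i else \<zero>)"
proof -
  have "coeff (map A (rev [0..<k])) i = (if i < k then A i else \<zero>)"
  proof (cases "i < k")
    case True
    then show ?thesis using coeff_nth[of i "map A (rev [0..<k])"] by (simp add: rev_nth)
  next
    case False
    then show ?thesis using coeff_length[of "map A (rev [0..<k])" i] by simp
  qed
  then show ?thesis by (simp only: normalize_coeff[symmetric])
qed

lemma read_poly_closed: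
  assumes "\<And>i. i < k \<Longrightarrow> A i \<in> carrier K"
  shows "read_poly K k A \<in> carrier PR"
  unfolding read_poly_def
  using normalize_gives_polynomial[of "map A (rev [0..<k])" "carrier K"] assms by (fastforce simp: univ_poly_carrier)

lemma coeff_read_poly: "coeff (read_poly K k A) i = (if i < k then A i else \<zero>)"
  unfolding read_poly_def by (rule coeff_normalize_map_upt)

lemma length_read_poly: "length (read_poly K k A) \<le> k"
  unfolding read_poly_def using normalize_length_le[of "map A (rev [0..<k])"] by simp

lemma read_poly_coeff:
  assumes "F \<in> carrier PR" "length F \<le> k" shows "read_poly K k (coeff F) = F"
  by (rule poly_eqI) (use assms in \<open>auto simp: read_poly_closed coeff_read_poly coeff_length\<close>)

lemma coeff_add:
  "F \<in> carrier PR \<Longrightarrow> G \<in> carrier PR \<Longrightarrow> coeff (F \<oplus>\<^bsub>PR\<^esub> G) i = coeff F i \<oplus> coeff G i"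
  unfolding univ_poly_add using poly_add_coeff[of F G] PR_set by (auto simp del: poly_add.simps)

lemma coeff_uminus: "F \<in> carrier PR \<Longrightarrow> coeff (\<ominus>\<^bsub>PR\<^esub> F) i = \<ominus> coeff F i"
proof -
  have "coeff (map (\<lambda>a. \<ominus> a) F) i = \<ominus> coeff F i" if "set F \<subseteq> carrier K" for F
    using that by (induction F) auto
  then show "F \<in> carrier PR \<Longrightarrow> ?thesis" using univ_poly_a_inv_def'[OF carrier_is_subring, of F] PR_set by simp
qed

lemma coeff_minus:
  assumes "F \<in> carrier PR" "G \<in> carrier PR" shows "coeff (F \<ominus>\<^bsub>PR\<^esub> G) i = coeff F i \<ominus> coeff G i"
proof -
  interpret P: domain PR by (rule PR_domain)
  show ?thesis using assms by (simp add: a_minus_def coeff_add coeff_uminus)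
qed

lemma coeff_mult:
  "F \<in> carrier PR \<Longrightarrow> G \<in> carrier PR \<Longrightarrow> coeff (F \<otimes>\<^bsub>PR\<^esub> G) i = (\<Oplus>k\<in>{..i}. coeff F k \<otimes> coeff G (i - k))"
  unfolding univ_poly_mult using poly_mult_coeff[of F G] PR_set by (auto simp del: poly_mult.simps)

lemma coeff_xp: "coeff (xp k) i = (if i = k then \<one> else \<zero>)"
  using unitary_monom_eq_var_pow[OF carrier_is_subring, of k] monom_coeff[of \<one> k] by simp

lemma xp_closed [simp]: "xp k \<in> carrier PR"
  by (rule var_pow_closed[OF carrier_is_subring])

lemma X_closed [simp]: "X\<^bsub>K\<^esub> \<in> carrier PR"
  by (rule var_closed[OF carrier_is_subring])

lemma length_xp: "length (xp k) = Suc k"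
  using unitary_monom_eq_var_pow[OF carrier_is_subring, of k] by (metis monom_def length_Cons length_replicate)

lemma coeff_xp_mult:
  assumes "F \<in> carrier PR"
  shows "coeff (xp k \<otimes>\<^bsub>PR\<^esub> F) i = (if i < k then \<zero> else coeff F (i - k))"
proof -
  have "coeff (xp k \<otimes>\<^bsub>PR\<^esub> F) i = (\<Oplus>j\<in>{..i}. if k = j then coeff F (i - j) else \<zero>)"
    using assms by (simp add: coeff_mult coeff_xp) (rule add.finprod_cong', auto)
  also have "\<dots> = (if i < k then \<zero> else coeff F (i - k))"
    using assms add.finprod_singleton[of k "{..i}" "\<lambda>j. coeff F (i - j)"]
    by (cases "k \<le> i") (auto intro!: add.finprod_one_eqI)
  finally show ?thesis .
qed

lemma poly_of_const_closed [simp]: "q \<in> carrier K \<Longrightarrow> poly_of_const q \<in> carrier PR"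
  unfolding poly_of_const_def using normalize_gives_polynomial[of "[q]" "carrier K"] by (simp add: univ_poly_carrier del: normalize.simps)

lemma coeff_poly_of_const: "coeff (poly_of_const q) i = (if i = 0 then q else \<zero>)"
  unfolding poly_of_const_def by auto

lemma coeff_const_mult:
  assumes "F \<in> carrier PR" "q \<in> carrier K"
  shows "coeff (poly_of_const q \<otimes>\<^bsub>PR\<^esub> F) i = q \<otimes> coeff F i"
proof -
  have "coeff (poly_of_const q \<otimes>\<^bsub>PR\<^esub> F) i = (\<Oplus>j\<in>{..i}. if 0 = j then q \<otimes> coeff F (i - j) else \<zero>)"
    using assms by (simp add: coeff_mult coeff_poly_of_const) (rule add.finprod_cong', auto)
  also have "\<dots> = q \<otimes> coeff F i"
    using assms add.finprod_singleton[of 0 "{..i}" "\<lambda>j. q \<otimes> coeff F (i - j)"] by auto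
  finally show ?thesis .
qed

lemma length_mult_le:
  assumes "F \<in> carrier PR" "G \<in> carrier PR" "length F \<le> Suc k" "length G \<le> Suc l"
  shows "length (F \<otimes>\<^bsub>PR\<^esub> G) \<le> Suc (k + l)"
  using poly_mult_degree_eq[OF carrier_is_subring, of F G] assms
  by (auto simp: univ_poly_carrier univ_poly_mult split: if_splits)

lemma length_add_le:
  assumes "F \<in> carrier PR" "G \<in> carrier PR" "length F \<le> k" "length G \<le> k"
  shows "length (F \<oplus>\<^bsub>PR\<^esub> G) \<le> k"
  using poly_add_length_le[of F G] assms unfolding univ_poly_add by linarith

lemma length_minus_le:
  assumes "F \<in> carrier PR" "G \<in> carrier PR" "length F \<le> k" "length G \<le> k"
  shows "length (F \<ominus>\<^bsub>PR\<^esub> G) \<le> k"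
proof -
  interpret P: domain PR by (rule PR_domain)
  show ?thesis unfolding a_minus_def
    using assms univ_poly_a_inv_length[OF carrier_is_subring, of G] by (intro length_add_le) auto
qed

lemma length_xp_mult_le:
  assumes "F \<in> carrier PR" "length F \<le> l" shows "length (xp k \<otimes>\<^bsub>PR\<^esub> F) \<le> k + l"
proof -
  interpret P: domain PR by (rule PR_domain)
  show ?thesis using assms PR_length_le_iff[OF P.m_closed[OF xp_closed assms(1)], of k "k + l"]
    by (auto simp: coeff_xp_mult coeff_length)
qed

lemma length_xp_mult_cancel:
  assumes "F \<in> carrier PR" "length (xp k \<otimes>\<^bsub>PR\<^esub> F) \<le> k + l" shows "length F \<le> l"
proof -
  interpret P: domain PR by (rule PR_domain)
  have "\<forall>i\<ge>k+l. coeff (xp k \<otimes>\<^bsub>PR\<^esub> F) i = \<zero>" using PR_length_le_iff[OF P.m_closed[OF xp_closed assms(1)], of k "k + l"] assms(2) by blast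
  then have "coeff (xp k \<otimes>\<^bsub>PR\<^esub> F) (i + k) = \<zero>" if "i \<ge> l" for i using that by simp
  then have "coeff F i = \<zero>" if "i \<ge> l" for i using that assms(1) by (simp add: coeff_xp_mult)
  then show ?thesis using PR_length_le_iff[OF assms(1)] by blast
qed

text \<open>Barrett reduction: \<open>J\<close> approximates \<open>X\<^bsup>2n-1\<^esup> / f\<close> closely enough for all products of
  residues modulo \<open>f\<close>.\<close>

lemma barrett:
  assumes f: "f \<in> carrier PR" "length f = Suc n" and J: "J \<in> carrier PR"
    and R0: "length (xp (2 * n - 1) \<ominus>\<^bsub>PR\<^esub> J \<otimes>\<^bsub>PR\<^esub> f) \<le> n"
    and F1: "F1 \<in> carrier PR" "length F1 \<le> n - 1" and F0: "F0 \<in> carrier PR" "length F0 \<le> n"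
    and Q: "Q \<in> carrier PR" and Q0: "Q0 \<in> carrier PR" "length Q0 \<le> n - 1"
    and eq: "F1 \<otimes>\<^bsub>PR\<^esub> J = xp (n - 1) \<otimes>\<^bsub>PR\<^esub> Q \<oplus>\<^bsub>PR\<^esub> Q0" and n: "n \<ge> 1"
  shows "length ((xp n \<otimes>\<^bsub>PR\<^esub> F1 \<oplus>\<^bsub>PR\<^esub> F0) \<ominus>\<^bsub>PR\<^esub> Q \<otimes>\<^bsub>PR\<^esub> f) \<le> n"
proof -
  interpret P: domain PR by (rule PR_domain)
  define D where "D = xp (2 * n - 1) \<ominus>\<^bsub>PR\<^esub> J \<otimes>\<^bsub>PR\<^esub> f"
  have D: "D \<in> carrier PR" using f J by (simp add: D_def)
  have x2: "xp (2 * n - 1) = xp (n - 1) \<otimes>\<^bsub>PR\<^esub> xp n" using n by (simp add: P.nat_pow_mult mult_2)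
  have Q': "xp (n - 1) \<otimes>\<^bsub>PR\<^esub> Q = F1 \<otimes>\<^bsub>PR\<^esub> J \<ominus>\<^bsub>PR\<^esub> Q0"
    unfolding eq using Q Q0 by (simp add: P.minus_eq P.a_assoc P.r_neg)
  have P_cancel: "(d \<oplus>\<^bsub>PR\<^esub> c \<oplus>\<^bsub>PR\<^esub> e) \<ominus>\<^bsub>PR\<^esub> (c \<ominus>\<^bsub>PR\<^esub> g) = d \<oplus>\<^bsub>PR\<^esub> e \<oplus>\<^bsub>PR\<^esub> g"
    if "c \<in> carrier PR" "d \<in> carrier PR" "e \<in> carrier PR" "g \<in> carrier PR" for c d e g
    using that by algebra
  \<comment> \<open>After multiplication by X^(n-1) the remainder becomes F1 D + X^(n-1) F0 + Q0 f,
    where each summand has length at most 2n - 1; cancelling X^(n-1) leaves n.\<close>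
  have "xp (n - 1) \<otimes>\<^bsub>PR\<^esub> ((xp n \<otimes>\<^bsub>PR\<^esub> F1 \<oplus>\<^bsub>PR\<^esub> F0) \<ominus>\<^bsub>PR\<^esub> Q \<otimes>\<^bsub>PR\<^esub> f)
    = (xp (2 * n - 1) \<otimes>\<^bsub>PR\<^esub> F1 \<oplus>\<^bsub>PR\<^esub> xp (n - 1) \<otimes>\<^bsub>PR\<^esub> F0) \<ominus>\<^bsub>PR\<^esub> (xp (n - 1) \<otimes>\<^bsub>PR\<^esub> Q) \<otimes>\<^bsub>PR\<^esub> f"
    unfolding x2 using f F1 F0 Q
    by (simp add: P.minus_eq P.r_distr P.m_assoc P.r_minus)
  also have "\<dots> = (F1 \<otimes>\<^bsub>PR\<^esub> D \<oplus>\<^bsub>PR\<^esub> xp (n - 1) \<otimes>\<^bsub>PR\<^esub> F0) \<oplus>\<^bsub>PR\<^esub> Q0 \<otimes>\<^bsub>PR\<^esub> f"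
  proof -
    have "xp (2 * n - 1) = D \<oplus>\<^bsub>PR\<^esub> J \<otimes>\<^bsub>PR\<^esub> f" unfolding D_def using f J by (simp add: P.minus_eq P.a_assoc P.l_neg)
    moreover have "(F1 \<otimes>\<^bsub>PR\<^esub> J \<ominus>\<^bsub>PR\<^esub> Q0) \<otimes>\<^bsub>PR\<^esub> f = F1 \<otimes>\<^bsub>PR\<^esub> (J \<otimes>\<^bsub>PR\<^esub> f) \<ominus>\<^bsub>PR\<^esub> Q0 \<otimes>\<^bsub>PR\<^esub> f"
      using f J F1 Q0 by (simp add: P.minus_eq P.l_distr P.m_assoc P.l_minus)
    ultimately show ?thesis unfolding Q'
      using P_cancel[of "F1 \<otimes>\<^bsub>PR\<^esub> (J \<otimes>\<^bsub>PR\<^esub> f)" "F1 \<otimes>\<^bsub>PR\<^esub> D" "xp (n - 1) \<otimes>\<^bsub>PR\<^esub> F0" "Q0 \<otimes>\<^bsub>PR\<^esub> f"] f J F1 F0 Q0 D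
      by (simp add: P.r_distr P.l_distr P.m_comm[of _ F1])
  qed
  finally have eq2: "xp (n - 1) \<otimes>\<^bsub>PR\<^esub> ((xp n \<otimes>\<^bsub>PR\<^esub> F1 \<oplus>\<^bsub>PR\<^esub> F0) \<ominus>\<^bsub>PR\<^esub> Q \<otimes>\<^bsub>PR\<^esub> f)
    = (F1 \<otimes>\<^bsub>PR\<^esub> D \<oplus>\<^bsub>PR\<^esub> xp (n - 1) \<otimes>\<^bsub>PR\<^esub> F0) \<oplus>\<^bsub>PR\<^esub> Q0 \<otimes>\<^bsub>PR\<^esub> f" .
  have "length (F1 \<otimes>\<^bsub>PR\<^esub> D) \<le> (n - 1) + n"
    using length_mult_le[OF F1(1) D, of "n - 1" "n - 1"] F1 R0 n unfolding D_def[symmetric] by linarith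
  moreover have "length (xp (n - 1) \<otimes>\<^bsub>PR\<^esub> F0) \<le> (n - 1) + n" using length_xp_mult_le F0 by blast
  moreover have "length (Q0 \<otimes>\<^bsub>PR\<^esub> f) \<le> (n - 1) + n"
  \<comment> \<open>For n = 1 the truncated difference n - 2 would spoil the length estimate;
    \<open>Q0\<close> is then the zero polynomial.\<close>
  proof (cases "n = 1")
    case True
    then show ?thesis using Q0 f P.l_null[of f] by (simp add: PR_zero)
  next
    case False
    then show ?thesis using length_mult_le[OF Q0(1) f(1), of "n - 2" n] Q0(2) f(2) n by linarith
  qed
  ultimately have "length (xp (n - 1) \<otimes>\<^bsub>PR\<^esub> ((xp n \<otimes>\<^bsub>PR\<^esub> F1 \<oplus>\<^bsub>PR\<^esub> F0) \<ominus>\<^bsub>PR\<^esub> Q \<otimes>\<^bsub>PR\<^esub> f)) \<le> (n - 1) + n"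
    unfolding eq2 using F1(1) D F0(1) Q0(1) f(1)
    by (intro length_add_le P.a_closed P.m_closed xp_closed)
  then show ?thesis using F1(1) F0(1) Q f(1)
    by (intro length_xp_mult_cancel[of _ "n - 1" n] P.minus_closed P.a_closed P.m_closed xp_closed)
qed

end

lemma nvar_frame [simp]: "nvar (frame K ns As u l) i = (if i < length ns then ns ! i else 0)"
  and farr_frame [simp]: "farr (frame K ns As u l) j = (if j < length As then As ! j else (\<lambda>_. \<zero>\<^bsub>K\<^esub>))"
  and ops_frame [simp]: "ops (frame K ns As u l) = u"
  and calls_frame [simp]: "calls (frame K ns As u l) = l"
  by (simp_all add: frame_def)

lemma wp_Call':
  assumes "computes K orc c ns Bs B k"
    and "map (nval (nvar s)) es = ns" "map (farr s) As = Bs"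
    and "\<And>v j. j \<le> ops s + k \<Longrightarrow> Q (s\<lparr>nvar := (nvar s)(x := v), farr := (farr s)(A := B), ops := j\<rparr>)"
  shows "wp K orc (Call es As c x A) Q s"
  using assms by (intro wp_Call[where B = B and k = k]) auto

lemma wp_Seq_Call:
  assumes "computes K orc c ns Bs B k"
    and "map (nval (nvar s)) es = ns" "map (farr s) As = Bs"
    and "\<And>v j. j \<le> ops s + k \<Longrightarrow> wp K orc d Q (s\<lparr>nvar := (nvar s)(x := v), farr := (farr s)(A := B), ops := j\<rparr>)"
  shows "wp K orc (Seq (Call es As c x A) d) Q s"
  by (rule wp_Seq, rule wp_Call'[OF assms(1-3)]) (rule assms(4))

text \<open>Array 0 of the frame is the result, so callers pass a zero array there. All cells from
  \<open>len\<close> on are then zero, which also turns a slice at offset 0 into a truncation that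
  clears garbage.\<close>

definition slice_prog :: com where
  "slice_prog = For 2 (NVar 1) (Copy (0, NVar 2) (1, NAdd (NVar 2) (NVar 0)))"

lemma computes_slice:
  "computes K orc slice_prog [off, len] [\<lambda>_. \<zero>\<^bsub>K\<^esub>, A] (\<lambda>i. if i < len then A (i + off) else \<zero>\<^bsub>K\<^esub>) 0"
  unfolding computes_def slice_prog_def
  by (intro allI wp_For[where k = len and I = "\<lambda>j s. nvar s 0 = off \<and> nvar s 1 = len \<and> farr s 1 = A \<and>
      farr s 0 = (\<lambda>i. if i < j then A (i + off) else \<zero>\<^bsub>K\<^esub>) \<and> ops s = u \<and> calls s = l" for u l])
    (auto simp: set_cell_def get_cell_def fun_eq_iff)

definition reverse_prog :: com where
  "reverse_prog = For 2 (NVar 1) (Copy (0, NVar 2) (1, NSub (NVar 0) (NVar 2)))"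

lemma computes_reverse:
  "computes K orc reverse_prog [off, len] [\<lambda>_. \<zero>\<^bsub>K\<^esub>, A] (\<lambda>i. if i < len then A (off - i) else \<zero>\<^bsub>K\<^esub>) 0"
  unfolding computes_def reverse_prog_def
  by (intro allI wp_For[where k = len and I = "\<lambda>j s. nvar s 0 = off \<and> nvar s 1 = len \<and> farr s 1 = A \<and>
      farr s 0 = (\<lambda>i. if i < j then A (off - i) else \<zero>\<^bsub>K\<^esub>) \<and> ops s = u \<and> calls s = l" for u l])
    (auto simp: set_cell_def get_cell_def fun_eq_iff)

text \<open>Computes A - q X^k B. With q = 1 it subtracts, with q = -1 it adds, with A = 0 it
  scales, and with general k it is one elimination step of polynomial division.\<close>

definition axpy_prog :: com where
  "axpy_prog = For 2 (NVar 1) (IfThen (NLess (NVar 2) (NVar 0)) (Copy (0, NVar 2) (1, NVar 2))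
     (Seq (Arith FMul (4, NConst 0) (3, NConst 0) (2, NSub (NVar 2) (NVar 0)))
          (Arith FSub (0, NVar 2) (1, NVar 2) (4, NConst 0))))"

lemma computes_axpy_array:
  "computes K orc axpy_prog [k, len] [\<lambda>_. \<zero>\<^bsub>K\<^esub>, A, B, q]
     (\<lambda>i. if i < len then (if i < k then A i else A i \<ominus>\<^bsub>K\<^esub> q 0 \<otimes>\<^bsub>K\<^esub> B (i - k)) else \<zero>\<^bsub>K\<^esub>) (2 * len)"
  unfolding computes_def
proof (intro allI)
  fix u l
  show "wp K orc axpy_prog (\<lambda>s. farr s 0 = (\<lambda>i. if i < len then (if i < k then A i else A i \<ominus>\<^bsub>K\<^esub> q 0 \<otimes>\<^bsub>K\<^esub> B (i - k)) else \<zero>\<^bsub>K\<^esub>) \<and>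
      ops s \<le> u + 2 * len \<and> calls s = l) (frame K [k, len] [\<lambda>_. \<zero>\<^bsub>K\<^esub>, A, B, q] u l)"
    unfolding axpy_prog_def
    by (rule wp_For[where k = len and I = "\<lambda>j s. nvar s 0 = k \<and> nvar s 1 = len \<and> farr s 1 = A \<and> farr s 2 = B \<and> farr s 3 = q \<and>
      farr s 0 = (\<lambda>i. if i < j then (if i < k then A i else A i \<ominus>\<^bsub>K\<^esub> q 0 \<otimes>\<^bsub>K\<^esub> B (i - k)) else \<zero>\<^bsub>K\<^esub>) \<and> ops s \<le> u + 2 * j \<and> calls s = l"])
      (auto simp: set_cell_def get_cell_def fun_eq_iff)
qed

context base_field begin

lemma computes_axpy:
  assumes "F \<in> carrier PR" "G \<in> carrier PR" "c \<in> carrier K" "q 0 = c"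
    and "length (F \<ominus>\<^bsub>PR\<^esub> poly_of_const c \<otimes>\<^bsub>PR\<^esub> (xp k \<otimes>\<^bsub>PR\<^esub> G)) \<le> len"
  shows "computes K orc axpy_prog [k, len] [\<lambda>_. \<zero>, coeff F, coeff G, q]
     (coeff (F \<ominus>\<^bsub>PR\<^esub> poly_of_const c \<otimes>\<^bsub>PR\<^esub> (xp k \<otimes>\<^bsub>PR\<^esub> G))) (2 * len)"
proof -
  interpret P: domain PR by (rule PR_domain)
  let ?D = "F \<ominus>\<^bsub>PR\<^esub> poly_of_const c \<otimes>\<^bsub>PR\<^esub> (xp k \<otimes>\<^bsub>PR\<^esub> G)"
  have "(\<lambda>i. if i < len then (if i < k then coeff F i else coeff F i \<ominus> q 0 \<otimes> coeff G (i - k)) else \<zero>) = coeff ?D"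
  proof
    fix i
    have "coeff ?D i = (if i < k then coeff F i else coeff F i \<ominus> q 0 \<otimes> coeff G (i - k))"
      using assms by (simp add: coeff_minus coeff_const_mult coeff_xp_mult) (simp add: a_minus_def)
    moreover have "i \<ge> len \<Longrightarrow> coeff ?D i = \<zero>" using assms(5) by (intro coeff_length) auto
    ultimately show "(if i < len then (if i < k then coeff F i else coeff F i \<ominus> q 0 \<otimes> coeff G (i - k)) else \<zero>) = coeff ?D i"
      by (cases "i < len") auto
  qed
  then show ?thesis using computes_axpy_array[of K orc k len "coeff F" "coeff G" q] by simp
qed

lemma poly_of_const_one: "poly_of_const \<one> = \<one>\<^bsub>PR\<^esub>"
  by (simp add: poly_of_const_def univ_poly_one)

lemma coeff_slice:
  assumes "F \<in> carrier PR"
  shows "\<exists>G\<in>carrier PR. coeff G = (\<lambda>i. if i < len then coeff F (i + off) else \<zero>) \<and> length G \<le> len"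
  by (rule bexI[of _ "read_poly K len (\<lambda>i. coeff F (i + off))"])
    (use assms in \<open>auto simp: coeff_read_poly read_poly_closed length_read_poly\<close>)

lemma coeff_reverse:
  assumes "F \<in> carrier PR"
  shows "\<exists>G\<in>carrier PR. coeff G = (\<lambda>i. if i < len then coeff F (off - i) else \<zero>) \<and> length G \<le> len"
  by (rule bexI[of _ "read_poly K len (\<lambda>i. coeff F (off - i))"])
    (use assms in \<open>auto simp: coeff_read_poly read_poly_closed length_read_poly\<close>)

end

text \<open>The given program promises only the product read from the lowest 2n + 1 cells. The slice
  clears all others, so that the result array is exactly the coefficient function of the
  product.\<close>

definition mul_prog :: "com \<Rightarrow> com" where
  "mul_prog cM = Seq (Call [NVar 0] [1, 2] cM 1 3)
     (Call [NConst 0, NAdd (NMul (NConst 2) (NVar 0)) (NConst 1)] [0, 3] slice_prog 1 0)"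

definition comp_prog :: "com \<Rightarrow> com" where
  "comp_prog cC = Seq (Call [NVar 0] [1, 2, 3] cC 1 4) (Call [NConst 0, NVar 0] [0, 4] slice_prog 1 0)"

locale poly_machine = base_field K for K :: "'k ring" (structure) +
  fixes orc :: "'k list \<Rightarrow> 'k list \<Rightarrow> 'k list" and cM cC :: com and n Mn Cn :: nat
  assumes n_pos: "n \<ge> 1"
    and cM: "\<And>F G. F \<in> carrier PR \<Longrightarrow> G \<in> carrier PR \<Longrightarrow> length F \<le> Suc n \<Longrightarrow> length G \<le> Suc n \<Longrightarrow>
      \<exists>A. computes K orc cM [n] [coeff F, coeff G] A Mn \<and> read_poly K (2 * n + 1) A = F \<otimes>\<^bsub>PR\<^esub> G"
    and cC: "\<And>F G H. F \<in> carrier PR \<Longrightarrow> G \<in> carrier PR \<Longrightarrow> H \<in> carrier PR \<Longrightarrow>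
      length F \<le> Suc n \<Longrightarrow> length G \<le> Suc n \<Longrightarrow> length H = Suc n \<Longrightarrow>
      \<exists>A. computes K orc cC [n] [coeff F, coeff G, coeff H] A Cn \<and> read_poly K n A = modular_composition K F G H"
begin

lemma computes_mul:
  assumes "F \<in> carrier PR" "G \<in> carrier PR" "length F \<le> Suc n" "length G \<le> Suc n"
  shows "computes K orc (mul_prog cM) [n] [\<lambda>_. \<zero>, coeff F, coeff G] (coeff (F \<otimes>\<^bsub>PR\<^esub> G)) Mn"
proof -
  obtain A where A: "computes K orc cM [n] [coeff F, coeff G] A Mn" "read_poly K (2 * n + 1) A = F \<otimes>\<^bsub>PR\<^esub> G"
    using cM[OF assms] by blast
  have eq: "(\<lambda>i. if i < 2 * n + 1 then A (i + 0) else \<zero>) = coeff (F \<otimes>\<^bsub>PR\<^esub> G)"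
    unfolding A(2)[symmetric] by (rule ext) (simp only: coeff_read_poly add_0_right)
  show ?thesis unfolding computes_def mul_prog_def
    by (intro allI, rule wp_Seq_Call[OF A(1)]; (rule wp_Call'[OF computes_slice[of K orc 0 "2 * n + 1" A, unfolded eq]])?) auto
qed

lemma computes_comp:
  assumes "F \<in> carrier PR" "G \<in> carrier PR" "H \<in> carrier PR" "length F \<le> Suc n" "length G \<le> Suc n" "length H = Suc n"
  shows "computes K orc (comp_prog cC) [n] [\<lambda>_. \<zero>, coeff F, coeff G, coeff H] (coeff (modular_composition K F G H)) Cn"
proof -
  obtain A where A: "computes K orc cC [n] [coeff F, coeff G, coeff H] A Cn" "read_poly K n A = modular_composition K F G H"
    using cC[OF assms] by blast
  have eq: "(\<lambda>i. if i < n then A (i + 0) else \<zero>) = coeff (modular_composition K F G H)"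
    unfolding A(2)[symmetric] by (rule ext) (simp only: coeff_read_poly add_0_right)
  show ?thesis unfolding computes_def comp_prog_def
    by (intro allI, rule wp_Seq_Call[OF A(1)]; (rule wp_Call'[OF computes_slice[of K orc 0 n A, unfolded eq]])?) auto
qed

end

section \<open>Reduction modulo a fixed polynomial\<close>

context base_field begin

lemma coeff_one: "coeff \<one>\<^bsub>PR\<^esub> = (\<lambda>_. \<zero>)(0 := \<one>)"
  by (auto simp: univ_poly_one)

lemma length_one: "length \<one>\<^bsub>PR\<^esub> = 1"
  by (simp add: univ_poly_one)

text \<open>The list \<open>replicate m \<one>\<close> is the polynomial 1 + X + ... + X^(m-1), so
  the second claim is the telescoping geometric sum.\<close>

lemma geometric_eval:
  assumes "u \<in> carrier PR"
  defines "G \<equiv> \<lambda>m. ring.eval PR (map poly_of_const (replicate m \<one>)) u"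
  shows "G m \<in> carrier PR" "(\<one>\<^bsub>PR\<^esub> \<ominus>\<^bsub>PR\<^esub> u) \<otimes>\<^bsub>PR\<^esub> G m = \<one>\<^bsub>PR\<^esub> \<ominus>\<^bsub>PR\<^esub> u [^]\<^bsub>PR\<^esub> m"
proof -
  interpret P: domain PR by (rule PR_domain)
  have "G m \<in> carrier PR \<and> (\<one>\<^bsub>PR\<^esub> \<ominus>\<^bsub>PR\<^esub> u) \<otimes>\<^bsub>PR\<^esub> G m = \<one>\<^bsub>PR\<^esub> \<ominus>\<^bsub>PR\<^esub> u [^]\<^bsub>PR\<^esub> m"
  proof (induction m)
    case 0
    show ?case using assms(1) by (simp add: G_def P.minus_eq P.r_neg)
  next
    case (Suc m)
    have G: "G (Suc m) = u [^]\<^bsub>PR\<^esub> m \<oplus>\<^bsub>PR\<^esub> G m"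
      using assms(1) by (simp add: G_def poly_of_const_one)
    have um: "u [^]\<^bsub>PR\<^esub> m \<in> carrier PR" using assms(1) by simp
    have "(\<one>\<^bsub>PR\<^esub> \<ominus>\<^bsub>PR\<^esub> u) \<otimes>\<^bsub>PR\<^esub> G (Suc m) =
        (\<one>\<^bsub>PR\<^esub> \<ominus>\<^bsub>PR\<^esub> u) \<otimes>\<^bsub>PR\<^esub> u [^]\<^bsub>PR\<^esub> m \<oplus>\<^bsub>PR\<^esub> (\<one>\<^bsub>PR\<^esub> \<ominus>\<^bsub>PR\<^esub> u [^]\<^bsub>PR\<^esub> m)"
      unfolding G using Suc assms(1) um by (simp add: P.r_distr)
    also have "\<dots> = \<one>\<^bsub>PR\<^esub> \<ominus>\<^bsub>PR\<^esub> u \<otimes>\<^bsub>PR\<^esub> u [^]\<^bsub>PR\<^esub> m"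
    proof -
      have "(\<one>\<^bsub>PR\<^esub> \<ominus>\<^bsub>PR\<^esub> u) \<otimes>\<^bsub>PR\<^esub> w \<oplus>\<^bsub>PR\<^esub> (\<one>\<^bsub>PR\<^esub> \<ominus>\<^bsub>PR\<^esub> w) = \<one>\<^bsub>PR\<^esub> \<ominus>\<^bsub>PR\<^esub> u \<otimes>\<^bsub>PR\<^esub> w" if "w \<in> carrier PR" for w
        using that assms(1) by algebra
      then show ?thesis using um by blast
    qed
    finally show ?case using Suc assms(1) um by (simp add: G P.m_comm)
  qed
  then show "G m \<in> carrier PR" "(\<one>\<^bsub>PR\<^esub> \<ominus>\<^bsub>PR\<^esub> u) \<otimes>\<^bsub>PR\<^esub> G m = \<one>\<^bsub>PR\<^esub> \<ominus>\<^bsub>PR\<^esub> u [^]\<^bsub>PR\<^esub> m" by auto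
qed

text \<open>Composing the geometric series with \<open>u\<close> modulo \<open>X\<^sup>n\<close> inverts the power series \<open>1 - u\<close>.\<close>

lemma series_inverse:
  assumes u: "u \<in> carrier PR" "coeff u 0 = \<zero>" and n: "n \<ge> 1" and i: "i < n"
  defines "\<psi> \<equiv> modular_composition K (replicate n \<one>) u (xp n)"
  shows "coeff ((\<one>\<^bsub>PR\<^esub> \<ominus>\<^bsub>PR\<^esub> u) \<otimes>\<^bsub>PR\<^esub> \<psi>) i = (if i = 0 then \<one> else \<zero>)"
proof -
  interpret P: domain PR by (rule PR_domain)
  let ?G = "ring.eval PR (map poly_of_const (replicate n \<one>)) u"
  have G: "?G \<in> carrier PR" using geometric_eval[OF u(1)] by blast
  have nz: "xp n \<noteq> []" using length_xp[of n] by auto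
  have psi: "\<psi> = pmod ?G (xp n)" by (simp add: \<psi>_def modular_composition_def)
  define D where "D = pdiv ?G (xp n)"
  have cl: "\<psi> \<in> carrier PR" "D \<in> carrier PR"
    unfolding psi D_def using long_division_closed[OF carrier_is_subfield G xp_closed] by auto
  have "?G = xp n \<otimes>\<^bsub>PR\<^esub> D \<oplus>\<^bsub>PR\<^esub> \<psi>" unfolding psi D_def
    by (rule pdiv_pmod[OF carrier_is_subfield G xp_closed])
  then have psi_eq: "\<psi> = ?G \<ominus>\<^bsub>PR\<^esub> xp n \<otimes>\<^bsub>PR\<^esub> D" using G cl
    by (metis P.add.inv_solve_right' P.minus_eq P.m_closed P.a_comm xp_closed)
  obtain v where v: "v \<in> carrier PR" "coeff v = (\<lambda>i. if i < length u then coeff u (i + 1) else \<zero>)"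
    using coeff_slice[OF u(1)] by blast
  have uv: "u = xp 1 \<otimes>\<^bsub>PR\<^esub> v"
  proof (rule poly_eqI)
    fix i show "coeff u i = coeff (xp 1 \<otimes>\<^bsub>PR\<^esub> v) i"
      using v u(2) coeff_length[of u i] by (subst coeff_xp_mult) (auto simp: Suc_diff_Suc not_less)
  qed (use u v in auto)
  \<comment> \<open>Since u has constant term zero it is X v, so the error term u^n of the geometric
    sum is a multiple of X^n and is invisible in degrees below n.\<close>
  have un: "u [^]\<^bsub>PR\<^esub> n = xp n \<otimes>\<^bsub>PR\<^esub> v [^]\<^bsub>PR\<^esub> n"
    unfolding uv using v by (simp add: P.nat_pow_distrib P.nat_pow_pow)
  have "(\<one>\<^bsub>PR\<^esub> \<ominus>\<^bsub>PR\<^esub> u) \<otimes>\<^bsub>PR\<^esub> \<psi> = (\<one>\<^bsub>PR\<^esub> \<ominus>\<^bsub>PR\<^esub> u) \<otimes>\<^bsub>PR\<^esub> ?G \<ominus>\<^bsub>PR\<^esub> xp n \<otimes>\<^bsub>PR\<^esub> ((\<one>\<^bsub>PR\<^esub> \<ominus>\<^bsub>PR\<^esub> u) \<otimes>\<^bsub>PR\<^esub> D)"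
    using psi_eq G cl u by (simp add: P.minus_eq P.r_distr P.r_minus P.m_lcomm)
  also have "\<dots> = \<one>\<^bsub>PR\<^esub> \<ominus>\<^bsub>PR\<^esub> xp n \<otimes>\<^bsub>PR\<^esub> v [^]\<^bsub>PR\<^esub> n \<ominus>\<^bsub>PR\<^esub> xp n \<otimes>\<^bsub>PR\<^esub> ((\<one>\<^bsub>PR\<^esub> \<ominus>\<^bsub>PR\<^esub> u) \<otimes>\<^bsub>PR\<^esub> D)"
    using geometric_eval(2)[OF u(1), of n] by (simp add: un)
  finally show ?thesis using i v cl u
    by (simp add: coeff_minus coeff_xp_mult coeff_one) (simp add: a_minus_def)
qed

text \<open>Reversal turns the coefficients of J f in degrees 2n - 1 down to n into those of phi psi
  in degrees 0 up to n - 1, and these are 1, 0, ..., 0. Division by f from the top thus becomes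
  power series inversion.\<close>

lemma reverse_quotient:
  assumes f: "f \<in> carrier PR" "length f = Suc n" and \<phi>: "\<phi> \<in> carrier PR" "\<And>i. coeff \<phi> i = (if i < Suc n then coeff f (n - i) else \<zero>)"
    and \<psi>: "\<psi> \<in> carrier PR" and inv: "\<And>i. i < n \<Longrightarrow> coeff (\<phi> \<otimes>\<^bsub>PR\<^esub> \<psi>) i = (if i = 0 then \<one> else \<zero>)"
    and J: "J \<in> carrier PR" "\<And>i. coeff J i = (if i < n then coeff \<psi> (n - 1 - i) else \<zero>)" and n: "n \<ge> 1"
  shows "length (xp (2 * n - 1) \<ominus>\<^bsub>PR\<^esub> J \<otimes>\<^bsub>PR\<^esub> f) \<le> n"
proof -
  interpret P: domain PR by (rule PR_domain)
  have J_len: "length J \<le> n" using PR_length_le_iff[OF J(1)] J(2) by auto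
  have "coeff (xp (2 * n - 1) \<ominus>\<^bsub>PR\<^esub> J \<otimes>\<^bsub>PR\<^esub> f) m = \<zero>" if m: "m \<ge> n" for m
  proof (cases "m \<le> 2 * n - 1")
    case False
    have "length (J \<otimes>\<^bsub>PR\<^esub> f) \<le> Suc (n - 1 + n)" by (rule length_mult_le) (use J J_len f n in auto)
    then have "coeff (J \<otimes>\<^bsub>PR\<^esub> f) m = \<zero>" using False n by (intro coeff_length) linarith
    then show ?thesis using False J f by (simp add: coeff_minus coeff_xp)
  next
    case True
    have "coeff (J \<otimes>\<^bsub>PR\<^esub> f) m = (\<Oplus>k\<in>{..m}. coeff J k \<otimes> coeff f (m - k))" using J f by (simp add: coeff_mult)
    \<comment> \<open>Outside this window one factor vanishes: below m - n the index exceeds the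
      degree of \<open>f\<close>, and from n on it exceeds that of \<open>J\<close>. The shift by m
      - n then moves the window to start at 0.\<close>
    also have "\<dots> = (\<Oplus>k\<in>{m - n..n - 1}. coeff J k \<otimes> coeff f (m - k))"
    proof (rule add.finprod_mono_neutral_cong_right)
      show "coeff J k \<otimes> coeff f (m - k) = \<zero>" if "k \<in> {..m} - {m - n..n - 1}" for k
      proof -
        have "k < m - n \<or> k \<ge> n" "k \<le> m" using n that by auto
        then have "coeff f (m - k) = \<zero> \<or> coeff J k = \<zero>" using J(2) f(2) coeff_length[of f "m - k"] by auto
        then show "coeff J k \<otimes> coeff f (m - k) = \<zero>" using J(1) f(1) by auto
      qed
    qed (use True m n J f \<psi> in auto)
    also have "\<dots> = (\<Oplus>k\<in>{..2 * n - 1 - m}. coeff \<phi> k \<otimes> coeff \<psi> (2 * n - 1 - m - k))"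
    proof -
      have bij: "inj_on (\<lambda>k. k + (m - n)) {..2 * n - 1 - m}" by (auto simp: inj_on_def)
      have img: "(\<lambda>k. k + (m - n)) ` {..2 * n - 1 - m} = {m - n..n - 1}"
      proof (intro equalityI subsetI)
        fix k assume "k \<in> {m - n..n - 1}"
        then have "k = (k - (m - n)) + (m - n)" "k - (m - n) \<in> {..2 * n - 1 - m}" using m True by auto
        then show "k \<in> (\<lambda>k. k + (m - n)) ` {..2 * n - 1 - m}" by (rule image_eqI)
      qed (use m True in auto)
      have "(\<Oplus>k\<in>{m - n..n - 1}. coeff J k \<otimes> coeff f (m - k)) = (\<Oplus>k\<in>{..2 * n - 1 - m}. coeff J (k + (m - n)) \<otimes> coeff f (m - (k + (m - n))))"
        unfolding img[symmetric] by (rule add.finprod_reindex[OF _ bij]) (use J(1) f(1) in auto)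
      also have "\<dots> = (\<Oplus>k\<in>{..2 * n - 1 - m}. coeff \<phi> k \<otimes> coeff \<psi> (2 * n - 1 - m - k))"
      proof (rule add.finprod_cong')
        fix k assume k: "k \<in> {..2 * n - 1 - m}"
        have "coeff J (k + (m - n)) = coeff \<psi> (2 * n - 1 - m - k)"
        proof -
          have "k + (m - n) < n" "n - 1 - (k + (m - n)) = 2 * n - 1 - m - k" using k m True n by auto
          then show ?thesis by (simp only: J(2) if_True)
        qed
        moreover have "coeff f (m - (k + (m - n))) = coeff \<phi> k"
        proof -
          have "k < Suc n" "m - (k + (m - n)) = n - k" using k m True n by auto
          then show ?thesis by (simp only: \<phi>(2) if_True)
        qed
        ultimately show "coeff J (k + (m - n)) \<otimes> coeff f (m - (k + (m - n))) = coeff \<phi> k \<otimes> coeff \<psi> (2 * n - 1 - m - k)"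
          using \<phi>(1) \<psi> by (simp add: m_comm)
      qed (use \<phi>(1) \<psi> in auto)
      finally show ?thesis .
    qed
    also have "\<dots> = coeff (\<phi> \<otimes>\<^bsub>PR\<^esub> \<psi>) (2 * n - 1 - m)" using \<phi> \<psi> by (simp add: coeff_mult)
    also have "\<dots> = (if m = 2 * n - 1 then \<one> else \<zero>)" using inv[of "2 * n - 1 - m"] m n True by auto
    finally show ?thesis using J f by (simp add: coeff_minus coeff_xp)
  qed
  then show ?thesis using PR_length_le_iff[of "xp (2 * n - 1) \<ominus>\<^bsub>PR\<^esub> J \<otimes>\<^bsub>PR\<^esub> f" n] J f by auto
qed

end

text \<open>Array 3 holds a single 1 in cell 0 and is passed twice to \<open>axpy_prog\<close>, as
  the polynomial 1 and as the scalar 1; the result is u = 1 - rev(f). Array 5 is the geometric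
  series and array 6 the modulus X^n.\<close>

definition barrett_prog :: "com \<Rightarrow> com" where
  "barrett_prog cC =
    Seq (Call [NVar 0, NAdd (NVar 0) (NConst 1)] [0, 1] reverse_prog 1 2)
   (Seq (SetOne (3, NConst 0))
   (Seq (Call [NConst 0, NAdd (NVar 0) (NConst 1)] [0, 3, 2, 3] axpy_prog 1 4)
   (Seq (For 2 (NVar 0) (SetOne (5, NVar 2)))
   (Seq (SetOne (6, NVar 0))
   (Seq (Call [NVar 0] [0, 5, 4, 6] (comp_prog cC) 1 7)
        (Call [NSub (NVar 0) (NConst 1), NVar 0] [0, 7] reverse_prog 1 0))))))"

text \<open>Three multiplications: the product itself, its upper part times the approximate inverse,
  and the resulting quotient times \<open>f\<close>. The final difference is formed in n cells only,
  since Barrett's estimate bounds its length by n.\<close>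

definition mulmod_prog :: "com \<Rightarrow> com" where
  "mulmod_prog cM =
    Seq (Call [NVar 0] [0, 1, 2] (mul_prog cM) 1 5)
   (Seq (Call [NVar 0, NSub (NVar 0) (NConst 1)] [0, 5] slice_prog 1 6)
   (Seq (Call [NVar 0] [0, 6, 4] (mul_prog cM) 1 7)
   (Seq (Call [NSub (NVar 0) (NConst 1), NSub (NVar 0) (NConst 1)] [0, 7] slice_prog 1 8)
   (Seq (Call [NVar 0] [0, 8, 3] (mul_prog cM) 1 9)
   (Seq (SetOne (10, NConst 0))
        (Call [NConst 0, NVar 0] [0, 5, 9, 10] axpy_prog 1 0))))))"

context poly_machine begin

lemma computes_barrett:
  assumes f: "f \<in> carrier PR" "length f = Suc n" "lead_coeff f = \<one>"
  shows "\<exists>J\<in>carrier PR. length J \<le> n \<and> length (xp (2 * n - 1) \<ominus>\<^bsub>PR\<^esub> J \<otimes>\<^bsub>PR\<^esub> f) \<le> n \<and>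
    computes K orc (barrett_prog cC) [n] [\<lambda>_. \<zero>, coeff f] (coeff J) (Cn + 2 * n + 2)"
proof -
  interpret P: domain PR by (rule PR_domain)
  obtain \<phi> where \<phi>: "\<phi> \<in> carrier PR" "coeff \<phi> = (\<lambda>i. if i < Suc n then coeff f (n - i) else \<zero>)" "length \<phi> \<le> Suc n"
    using coeff_reverse[OF f(1)] by blast
  define u where "u = \<one>\<^bsub>PR\<^esub> \<ominus>\<^bsub>PR\<^esub> \<phi>"
  have u: "u \<in> carrier PR" "length u \<le> Suc n"
    unfolding u_def using \<phi> length_minus_le[of "\<one>\<^bsub>PR\<^esub>" \<phi> "Suc n"] by (auto simp: length_one)
  have fn: "coeff f n = \<one>" using lead_coeff_simp[of f] f by (cases f) auto
  have u0: "coeff u 0 = \<zero>" using \<phi> fn by (simp add: u_def coeff_minus coeff_one)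
  have \<phi>u: "\<phi> = \<one>\<^bsub>PR\<^esub> \<ominus>\<^bsub>PR\<^esub> u" unfolding u_def using \<phi>(1) by algebra
  let ?ones = "replicate n \<one>"
  have ones: "?ones \<in> carrier PR" "coeff ?ones = (\<lambda>i. if i < n then \<one> else \<zero>)"
  proof -
    show "?ones \<in> carrier PR" using n_pos by (auto simp: univ_poly_def polynomial_def)
    show "coeff ?ones = (\<lambda>i. if i < n then \<one> else \<zero>)"
      by (rule ext) (use coeff_nth[of _ ?ones] coeff_length[of ?ones] in \<open>auto\<close>)
  qed
  define \<psi> where "\<psi> = modular_composition K ?ones u (xp n)"
  have \<psi>: "\<psi> \<in> carrier PR"
    unfolding \<psi>_def modular_composition_def using geometric_eval[OF u(1)]
    by (intro long_division_closed(2)[OF carrier_is_subfield]) auto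
  obtain J where J: "J \<in> carrier PR" "coeff J = (\<lambda>i. if i < n then coeff \<psi> (n - 1 - i) else \<zero>)" "length J \<le> n"
    using coeff_reverse[OF \<psi>] by blast
  have "length (xp (2 * n - 1) \<ominus>\<^bsub>PR\<^esub> J \<otimes>\<^bsub>PR\<^esub> f) \<le> n"
  proof (rule reverse_quotient[OF f(1,2) \<phi>(1) _ \<psi>])
    fix i assume "i < n"
    then show "coeff (\<phi> \<otimes>\<^bsub>PR\<^esub> \<psi>) i = (if i = 0 then \<one> else \<zero>)"
      unfolding \<phi>u \<psi>_def by (rule series_inverse[OF u(1) u0 n_pos])
  qed (use J \<phi> n_pos in auto)
  moreover have "computes K orc (barrett_prog cC) [n] [\<lambda>_. \<zero>, coeff f] (coeff J) (Cn + 2 * n + 2)"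
    unfolding computes_def
  proof (intro allI)
    fix v l
    have s1: "computes K orc reverse_prog [n, n + 1] [\<lambda>_. \<zero>, coeff f] (coeff \<phi>) 0"
      using computes_reverse[of K orc n "n + 1" "coeff f"] by (simp add: \<phi>(2))
    have ueq: "u = \<one>\<^bsub>PR\<^esub> \<ominus>\<^bsub>PR\<^esub> poly_of_const \<one> \<otimes>\<^bsub>PR\<^esub> (xp 0 \<otimes>\<^bsub>PR\<^esub> \<phi>)" using \<phi>(1) by (simp add: u_def poly_of_const_one)
    have s2: "computes K orc axpy_prog [0, n + 1] [\<lambda>_. \<zero>, (\<lambda>_. \<zero>)(0 := \<one>), coeff \<phi>, (\<lambda>_. \<zero>)(0 := \<one>)] (coeff u) (2 * (n + 1))"
      using computes_axpy[of "\<one>\<^bsub>PR\<^esub>" \<phi> \<one> "(\<lambda>_. \<zero>)(0 := \<one>)" 0 "n + 1" orc, folded ueq] u \<phi> by (simp add: coeff_one)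
    have s3: "computes K orc (comp_prog cC) [n] [\<lambda>_. \<zero>, \<lambda>i. if i < n then \<one> else \<zero>, coeff u, (\<lambda>_. \<zero>)(n := \<one>)] (coeff \<psi>) Cn"
    proof -
      have "coeff (xp n) = (\<lambda>_. \<zero>)(n := \<one>)" by (rule ext) (simp add: coeff_xp)
      then show ?thesis using computes_comp[OF ones(1) u(1) xp_closed[of n]] u(2) by (simp add: ones(2) length_xp \<psi>_def)
    qed
    have s4: "computes K orc reverse_prog [n - 1, n] [\<lambda>_. \<zero>, coeff \<psi>] (coeff J) 0"
      using computes_reverse[of K orc "n - 1" n "coeff \<psi>"] by (simp add: J(2))
    show "wp K orc (barrett_prog cC) (\<lambda>s. farr s 0 = coeff J \<and> ops s \<le> v + (Cn + 2 * n + 2) \<and> calls s = l)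
        (frame K [n] [\<lambda>_. \<zero>, coeff f] v l)"
      unfolding barrett_prog_def
      apply (rule wp_Seq_Call[OF s1]; simp add: set_cell_def)
      apply (rule wp_Seq_Call[OF s2]; simp add: fun_upd_def cong: if_cong)
      apply (rule wp_Seq)
      apply (rule wp_For[where k = n and I = "\<lambda>j s. nvar s 0 = n \<and> farr s 0 = (\<lambda>_. \<zero>) \<and> farr s 4 = coeff u \<and>
          farr s 6 = (\<lambda>_. \<zero>) \<and> farr s 5 = (\<lambda>i. if i < j then \<one> else \<zero>) \<and> ops s \<le> v + (2 * n + 2) \<and> calls s = l"])
         apply (simp)
        apply simp
       apply (simp add: set_cell_def fun_eq_iff less_Suc_eq)
      apply (simp add: set_cell_def)
      apply (rule wp_Seq_Call[OF s3]; simp)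
      apply (rule wp_Call'[OF s4]; simp)
      done
  qed
  ultimately show ?thesis using J by blast
qed

lemma computes_mulmod:
  assumes f: "f \<in> carrier PR" "length f = Suc n" and J: "J \<in> carrier PR" "length J \<le> n"
    and R0: "length (xp (2 * n - 1) \<ominus>\<^bsub>PR\<^esub> J \<otimes>\<^bsub>PR\<^esub> f) \<le> n"
    and FG: "F \<in> carrier PR" "G \<in> carrier PR" "length F \<le> n" "length G \<le> n"
  shows "computes K orc (mulmod_prog cM) [n] [\<lambda>_. \<zero>, coeff F, coeff G, coeff f, coeff J]
    (coeff (pmod (F \<otimes>\<^bsub>PR\<^esub> G) f)) (3 * Mn + 2 * n)"
proof -
  interpret P: domain PR by (rule PR_domain)
  define H where "H = F \<otimes>\<^bsub>PR\<^esub> G"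
  have H: "H \<in> carrier PR" "length H \<le> 2 * n - 1"
    using FG length_mult_le[OF FG(1,2), of "n - 1" "n - 1"] n_pos by (auto simp: H_def)
  obtain F1 where F1: "F1 \<in> carrier PR" "coeff F1 = (\<lambda>i. if i < n - 1 then coeff H (i + n) else \<zero>)" "length F1 \<le> n - 1"
    using coeff_slice[OF H(1)] by blast
  obtain F0 where F0: "F0 \<in> carrier PR" "coeff F0 = (\<lambda>i. if i < n then coeff H (i + 0) else \<zero>)" "length F0 \<le> n"
    using coeff_slice[OF H(1)] by blast
  define W where "W = F1 \<otimes>\<^bsub>PR\<^esub> J"
  have W: "W \<in> carrier PR" "length W \<le> 2 * n - 2"
  proof -
    show "W \<in> carrier PR" using F1 J by (simp add: W_def)
    show "length W \<le> 2 * n - 2"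
    proof (cases "n = 1")
      case True then show ?thesis using F1 J P.l_null[of J] by (simp add: W_def PR_zero)
    next
      case False
      then show ?thesis using length_mult_le[OF F1(1) J(1), of "n - 2" "n - 1"] F1(3) J(2) n_pos unfolding W_def by linarith
    qed
  qed
  obtain Q where Q: "Q \<in> carrier PR" "coeff Q = (\<lambda>i. if i < n - 1 then coeff W (i + (n - 1)) else \<zero>)" "length Q \<le> n - 1"
    using coeff_slice[OF W(1)] by blast
  obtain Q0 where Q0: "Q0 \<in> carrier PR" "coeff Q0 = (\<lambda>i. if i < n - 1 then coeff W (i + 0) else \<zero>)" "length Q0 \<le> n - 1"
    using coeff_slice[OF W(1)] by blast
  have Heq: "H = xp n \<otimes>\<^bsub>PR\<^esub> F1 \<oplus>\<^bsub>PR\<^esub> F0"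
  proof (rule poly_eqI)
    fix i show "coeff H i = coeff (xp n \<otimes>\<^bsub>PR\<^esub> F1 \<oplus>\<^bsub>PR\<^esub> F0) i"
      using H F1 F0 coeff_length[of H i] by (auto simp: coeff_add coeff_xp_mult)
  qed (use H F1 F0 in auto)
  have Weq: "W = xp (n - 1) \<otimes>\<^bsub>PR\<^esub> Q \<oplus>\<^bsub>PR\<^esub> Q0"
  proof (rule poly_eqI)
    fix i show "coeff W i = coeff (xp (n - 1) \<otimes>\<^bsub>PR\<^esub> Q \<oplus>\<^bsub>PR\<^esub> Q0) i"
      using W Q Q0 coeff_length[of W i] by (auto simp: coeff_add coeff_xp_mult)
  qed (use W Q Q0 in auto)
  define V where "V = Q \<otimes>\<^bsub>PR\<^esub> f"
  have V: "V \<in> carrier PR" using Q f by (simp add: V_def)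
  have len: "length (H \<ominus>\<^bsub>PR\<^esub> V) \<le> n"
    unfolding V_def Heq by (rule barrett[OF f J(1) R0 F1(1,3) F0(1,3) Q(1) Q0(1,3) Weq[unfolded W_def] n_pos])
  have pmod: "H \<ominus>\<^bsub>PR\<^esub> V = pmod H f"
  proof -
    have "H = f \<otimes>\<^bsub>PR\<^esub> Q \<oplus>\<^bsub>PR\<^esub> (H \<ominus>\<^bsub>PR\<^esub> V)"
      unfolding V_def using H(1) Q(1) f(1) by algebra
    moreover have "H \<ominus>\<^bsub>PR\<^esub> V = [] \<or> degree (H \<ominus>\<^bsub>PR\<^esub> V) < degree f"
      using len f(2) n_pos by auto
    ultimately have "long_divides H f (Q, H \<ominus>\<^bsub>PR\<^esub> V)"
      using H V Q by (auto simp: long_divides_def)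
    moreover have "f \<noteq> []" using f(2) by auto
    ultimately show ?thesis using long_divisionI[OF carrier_is_subfield H(1) f(1)] by blast
  qed
  show ?thesis unfolding computes_def H_def[symmetric] pmod[symmetric]
  proof (intro allI)
    fix v l
    have s1: "computes K orc (mul_prog cM) [n] [\<lambda>_. \<zero>, coeff F, coeff G] (coeff H) Mn"
      unfolding H_def by (rule computes_mul) (use FG in auto)
    have s2: "computes K orc slice_prog [n, n - 1] [\<lambda>_. \<zero>, coeff H] (coeff F1) 0"
      using computes_slice[of K orc n "n - 1" "coeff H"] by (simp add: F1(2))
    have s3: "computes K orc (mul_prog cM) [n] [\<lambda>_. \<zero>, coeff F1, coeff J] (coeff W) Mn"
      unfolding W_def by (rule computes_mul) (use F1 J in auto)
    have s4: "computes K orc slice_prog [n - 1, n - 1] [\<lambda>_. \<zero>, coeff W] (coeff Q) 0"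
      using computes_slice[of K orc "n - 1" "n - 1" "coeff W"] by (simp add: Q(2))
    have s5: "computes K orc (mul_prog cM) [n] [\<lambda>_. \<zero>, coeff Q, coeff f] (coeff V) Mn"
      unfolding V_def by (rule computes_mul) (use Q f in auto)
    have Deq: "H \<ominus>\<^bsub>PR\<^esub> poly_of_const \<one> \<otimes>\<^bsub>PR\<^esub> (xp 0 \<otimes>\<^bsub>PR\<^esub> V) = H \<ominus>\<^bsub>PR\<^esub> V" using V by (simp add: poly_of_const_one)
    have s6: "computes K orc axpy_prog [0, n] [\<lambda>_. \<zero>, coeff H, coeff V, (\<lambda>_. \<zero>)(0 := \<one>)] (coeff (H \<ominus>\<^bsub>PR\<^esub> V)) (2 * n)"
      using computes_axpy[of H V \<one> "(\<lambda>_. \<zero>)(0 := \<one>)" 0 n orc, unfolded Deq] H V len by simp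
    show "wp K orc (mulmod_prog cM) (\<lambda>s. farr s 0 = coeff (H \<ominus>\<^bsub>PR\<^esub> V) \<and> ops s \<le> v + (3 * Mn + 2 * n) \<and> calls s = l)
       (frame K [n] [\<lambda>_. \<zero>, coeff F, coeff G, coeff f, coeff J] v l)"
      unfolding mulmod_prog_def
      apply (rule wp_Seq_Call[OF s1]; simp)
      apply (rule wp_Seq_Call[OF s2]; simp)
      apply (rule wp_Seq_Call[OF s3]; simp)
      apply (rule wp_Seq_Call[OF s4]; simp)
      apply (rule wp_Seq_Call[OF s5]; simp add: set_cell_def)
      apply (rule wp_Call'[OF s6]; simp)
      done
  qed
qed

end

section \<open>Finite fields\<close>

lemma (in cring) binomial_finsum:
  assumes "x \<in> carrier R" "y \<in> carrier R"
  shows "(x \<oplus> y) [^] (n::nat) = (\<Oplus>k\<in>{..n}. add_pow R (n choose k) (x [^] k \<otimes> y [^] (n - k)))"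
proof (induction n)
  case 0
  then show ?case using assms by simp
next
  case (Suc n)
  define a where "a k = add_pow R (n choose k) (x [^] k \<otimes> y [^] (Suc n - k))" for k
  \<comment> \<open>The case k = 0 is set to zero so that, after an index shift, both sums run over
    \<open>{..Suc n}\<close> and Pascal's rule applies term by term.\<close>
  define b where "b k = add_pow R (if k = 0 then 0 else n choose (k - 1)) (x [^] k \<otimes> y [^] (Suc n - k))" for k
  have ab: "a k \<in> carrier R" "b k \<in> carrier R" for k using assms by (auto simp: a_def b_def)
  have "(x \<oplus> y) [^] Suc n = x \<otimes> (\<Oplus>k\<in>{..n}. add_pow R (n choose k) (x [^] k \<otimes> y [^] (n - k))) \<oplus> y \<otimes> (\<Oplus>k\<in>{..n}. add_pow R (n choose k) (x [^] k \<otimes> y [^] (n - k)))"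
    using Suc assms by (simp add: m_comm l_distr)
  also have "x \<otimes> (\<Oplus>k\<in>{..n}. add_pow R (n choose k) (x [^] k \<otimes> y [^] (n - k))) = (\<Oplus>k\<in>{..n}. b (Suc k))"
    using assms by (simp add: finsum_rdistr b_def) (rule add.finprod_cong', auto simp: add_pow_rdistr m_ac)
  also have "\<dots> = (\<Oplus>k\<in>{..Suc n}. b k)"
  proof -
    have b0: "b 0 = \<zero>" using assms by (simp add: b_def)
    have "(\<Oplus>k\<in>{..Suc n}. b k) = (\<Oplus>k\<in>{..n}. b (Suc k)) \<oplus> b 0" by (rule finsum_Suc2) (use ab in auto)
    also have "\<dots> = (\<Oplus>k\<in>{..n}. b (Suc k))" unfolding b0 by (rule r_zero, rule add.finprod_closed) (use ab in auto)
    finally show ?thesis by simp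
  qed
  also have "y \<otimes> (\<Oplus>k\<in>{..n}. add_pow R (n choose k) (x [^] k \<otimes> y [^] (n - k))) = (\<Oplus>k\<in>{..n}. a k)"
    using assms by (simp add: finsum_rdistr a_def) (rule add.finprod_cong', auto simp: add_pow_rdistr m_ac Suc_diff_le)
  also have "\<dots> = (\<Oplus>k\<in>{..Suc n}. a k)"
    using finsum_Suc[of a n] ab assms by (auto simp: a_def binomial_eq_0)
  also have "(\<Oplus>k\<in>{..Suc n}. b k) \<oplus> (\<Oplus>k\<in>{..Suc n}. a k) = (\<Oplus>k\<in>{..Suc n}. b k \<oplus> a k)"
    using ab by (subst finsum_addf) auto
  also have "\<dots> = (\<Oplus>k\<in>{..Suc n}. add_pow R (Suc n choose k) (x [^] k \<otimes> y [^] (Suc n - k)))"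
  proof (rule add.finprod_cong')
    fix k assume "k \<in> {..Suc n}"
    show "b k \<oplus> a k = add_pow R (Suc n choose k) (x [^] k \<otimes> y [^] (Suc n - k))"
      unfolding a_def b_def using assms by (cases k) (simp_all add: add.nat_pow_mult)
  qed (use assms in auto)
  finally show ?case .
qed

lemma (in cring) frobenius_add:
  assumes p: "Factorial_Ring.prime (p::nat)" and ch: "add_pow R (p) \<one> = \<zero>" and x: "x \<in> carrier R" and y: "y \<in> carrier R"
  shows "(x \<oplus> y) [^] p = x [^] p \<oplus> y [^] p"
proof -
  have p2: "p \<ge> 2" using p by (rule prime_ge_2_nat)
  have vanish: "add_pow R (m) z = \<zero>" if "p dvd m" "z \<in> carrier R" for m z
  proof -
    obtain j where j: "m = p * j" using \<open>p dvd m\<close> by blast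
    have "add_pow R (p) z = (add_pow R (p) \<one>) \<otimes> z" using that by (simp add: add_pow_ldistr)
    then have "add_pow R (p) z = \<zero>" using ch that by simp
    then show ?thesis using that add.nat_pow_pow[of z j p] by (simp add: j mult.commute)
  qed
  have "(x \<oplus> y) [^] p = (\<Oplus>k\<in>{..p}. add_pow R (p choose k) (x [^] k \<otimes> y [^] (p - k)))"
    by (rule binomial_finsum[OF x y])
  also have "\<dots> = (\<Oplus>k\<in>{0, p}. add_pow R (p choose k) (x [^] k \<otimes> y [^] (p - k)))"
  proof (rule add.finprod_mono_neutral_cong_right)
    fix k assume "k \<in> {..p} - {0, p}"
    then have "p dvd (p choose k)" using p by (intro dvd_choose_prime) auto
    then show "add_pow R (p choose k) (x [^] k \<otimes> y [^] (p - k)) = \<zero>" using vanish x y by simp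
  qed (use x y in auto)
  also have "\<dots> = x [^] p \<oplus> y [^] p" using x y p2 by (simp add: a_comm)
  finally show ?thesis .
qed

lemma (in cring) frobenius_pow_add:
  assumes p: "Factorial_Ring.prime (p::nat)" and ch: "add_pow R (p) \<one> = \<zero>" and x: "x \<in> carrier R" and y: "y \<in> carrier R"
  shows "(x \<oplus> y) [^] (p ^ k) = x [^] (p ^ k) \<oplus> y [^] (p ^ k)"
proof (induction k)
  case (Suc k)
  have "(x \<oplus> y) [^] (p ^ Suc k) = ((x \<oplus> y) [^] (p ^ k)) [^] p" using x y by (simp add: nat_pow_pow mult.commute)
  also have "\<dots> = (x [^] (p ^ k)) [^] p \<oplus> (y [^] (p ^ k)) [^] p" unfolding Suc using x y by (intro frobenius_add[OF p ch]) auto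
  finally show ?case using x y by (simp add: nat_pow_pow mult.commute)
qed (use x y in simp)

lemma (in cring) frobenius_hom:
  assumes p: "Factorial_Ring.prime (p::nat)" and ch: "add_pow R (p) \<one> = \<zero>"
  shows "ring_hom_ring R R (\<lambda>x. x [^] (p ^ k))"
  by (rule ring_hom_ringI[OF ring_axioms ring_axioms])
    (auto simp: nat_pow_distrib frobenius_pow_add[OF p ch])

lemma (in field) finite_field_generator:
  assumes fin: "finite (carrier R)"
  obtains g where "g \<in> carrier R" "g \<noteq> \<zero>" "\<And>x. x \<in> carrier R \<Longrightarrow> x \<noteq> \<zero> \<Longrightarrow> \<exists>i::nat. x = g [^] i"
    "\<And>i::nat. g [^] i = \<one> \<longleftrightarrow> card (carrier R) - 1 dvd i"
proof -
  interpret G: group "Multiplicative_Group.mult_of R" by (rule field_mult_group)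
  obtain g where g: "g \<in> carrier (Multiplicative_Group.mult_of R)" "carrier (Multiplicative_Group.mult_of R) = {g [^] i | i::nat. i \<in> UNIV}"
    using finite_field_mult_group_has_gen[OF fin] by blast
  have "G.ord g = order (Multiplicative_Group.mult_of R)"
  proof -
    have "G.ord g \<noteq> 0" using G.ord_ge_1[of g] finite_mult_of[OF fin] g(1) by simp
    then have "generate (Multiplicative_Group.mult_of R) {g} = carrier (Multiplicative_Group.mult_of R)"
      unfolding g(2) using G.generate_pow_nat[OF g(1)] by (simp add: Multiplicative_Group.nat_pow_mult_of)
    then show ?thesis using G.generate_pow_card[OF g(1)] by (simp add: order_def)
  qed
  moreover have "order (Multiplicative_Group.mult_of R) = card (carrier R) - 1"
    using fin by (simp add: order_def)
  ultimately have "g [^] i = \<one> \<longleftrightarrow> card (carrier R) - 1 dvd i" for i :: nat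
    using G.pow_eq_id[OF g(1), of i] by (simp add: Multiplicative_Group.nat_pow_mult_of)
  moreover have "\<exists>i::nat. x = g [^] i" if "x \<in> carrier R" "x \<noteq> \<zero>" for x
  proof -
    have "x \<in> carrier (Multiplicative_Group.mult_of R)" using that by simp
    then show ?thesis using g(2) by auto
  qed
  ultimately show ?thesis using that[of g] g(1) by auto
qed

lemma (in field) finite_field_pow_card:
  assumes fin: "finite (carrier R)" and x: "x \<in> carrier R"
  shows "x \<noteq> \<zero> \<Longrightarrow> x [^] (card (carrier R) - 1) = \<one>" and "x [^] card (carrier R) = x"
proof -
  obtain g where g: "g \<in> carrier R" "\<And>x. x \<in> carrier R \<Longrightarrow> x \<noteq> \<zero> \<Longrightarrow> \<exists>i::nat. x = g [^] i"
    "\<And>i::nat. g [^] i = \<one> \<longleftrightarrow> card (carrier R) - 1 dvd i" using finite_field_generator[OF fin] by metis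
  show *: "x [^] (card (carrier R) - 1) = \<one>" if nz: "x \<noteq> \<zero>"
  proof -
    obtain i :: nat where i: "x = g [^] i" using g(2)[OF x nz] by blast
    have "g [^] (i * (card (carrier R) - 1)) = \<one>" using g(3) by simp
    then show ?thesis unfolding i nat_pow_pow[OF g(1)] .
  qed
  have pos: "card (carrier R) > 0" using fin by (auto simp: card_gt_0_iff)
  show "x [^] card (carrier R) = x"
  proof (cases "x = \<zero>")
    case True
    then show ?thesis using pos by (simp add: nat_pow_zero)
  next
    case False
    have "x [^] Suc (card (carrier R) - 1) = x" unfolding nat_pow_Suc *[OF False] using x by simp
    then show ?thesis using pos by (simp only: Suc_diff_1)
  qed
qed

text \<open>Let g generate the group, of order N, and a = g^i. Then a^(N/t) = 1 says that N divides
  i N/t, that is, t divides i.\<close>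

lemma (in field) power_residue_iff:
  assumes fin: "finite (carrier R)" and t: "t dvd card (carrier R) - 1" "t > 0" and a: "a \<in> carrier R" "a \<noteq> \<zero>"
  shows "(\<exists>b\<in>carrier R - {\<zero>}. b [^] t = a) \<longleftrightarrow> a [^] ((card (carrier R) - 1) div t) = \<one>"
proof
  assume "\<exists>b\<in>carrier R - {\<zero>}. b [^] t = a"
  then obtain b where b: "b \<in> carrier R" "b \<noteq> \<zero>" "b [^] t = a" by auto
  then have "a [^] ((card (carrier R) - 1) div t) = b [^] (t * ((card (carrier R) - 1) div t))"
    by (metis nat_pow_pow)
  then show "a [^] ((card (carrier R) - 1) div t) = \<one>" using t b finite_field_pow_card[OF fin] by simp
next
  assume eq: "a [^] ((card (carrier R) - 1) div t) = \<one>"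
  obtain g where g: "g \<in> carrier R" "g \<noteq> \<zero>" "\<And>x. x \<in> carrier R \<Longrightarrow> x \<noteq> \<zero> \<Longrightarrow> \<exists>i::nat. x = g [^] i"
    "\<And>i::nat. g [^] i = \<one> \<longleftrightarrow> card (carrier R) - 1 dvd i" using finite_field_generator[OF fin] by metis
  obtain i :: nat where i: "a = g [^] i" using g(3)[OF a] by blast
  let ?N = "card (carrier R) - 1"
  have "?N dvd i * (?N div t)" using eq g(1,4) by (simp add: i nat_pow_pow)
  moreover have "?N = t * (?N div t)" using t by simp
  moreover have "?N > 0"
  proof -
    have "card {\<zero>, \<one>} \<le> card (carrier R)" using fin by (intro card_mono) auto
    then show ?thesis by simp
  qed
  ultimately have "t * (?N div t) dvd i * (?N div t)" "?N div t > 0" by (metis, metis gr0I mult_0_right)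
  then have "t dvd i" by simp
  then obtain j where "i = j * t" by (metis dvd_def mult.commute)
  then have "(g [^] j) [^] t = a" using g(1) by (simp add: i nat_pow_pow)
  then show "\<exists>b\<in>carrier R - {\<zero>}. b [^] t = a" using g(1,2) a t(2)
    by (intro bexI[of _ "g [^] j"]) (auto simp: nat_pow_zero i)
qed

text \<open>The exponent t is invertible modulo the group order; with inverse k the element a^k is a
  root.\<close>

lemma (in field) coprime_power:
  assumes fin: "finite (carrier R)" and t: "coprime t (card (carrier R) - 1)" "t > 0" and a: "a \<in> carrier R"
  shows "\<exists>b\<in>carrier R. b [^] t = a"
proof (cases "a = \<zero>")
  case True
  then show ?thesis using t by (intro bexI[of _ \<zero>]) (auto simp: nat_pow_zero)
next
  case False
  obtain k where k: "[t * k = 1] (mod (card (carrier R) - 1))"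
    using cong_solve_coprime_nat[OF t(1)] by auto
  have "a [^] (t * k) = a"
  proof -
    obtain g where g: "g \<in> carrier R" "\<And>x. x \<in> carrier R \<Longrightarrow> x \<noteq> \<zero> \<Longrightarrow> \<exists>i::nat. x = g [^] i"
      "\<And>i::nat. g [^] i = \<one> \<longleftrightarrow> card (carrier R) - 1 dvd i" using finite_field_generator[OF fin] by metis
    let ?N = "card (carrier R) - 1"
    have one: "a [^] (?N * j) = \<one>" for j
      using finite_field_pow_card(1)[OF fin a False] a by (simp flip: nat_pow_pow)
    obtain j1 j2 where "1 + j2 * ?N = t * k + j1 * ?N" using k unfolding cong_iff_lin_nat by blast
    then have "t * k + ?N * j1 = 1 + ?N * j2" by (simp only: mult.commute)
    then have "a [^] (t * k) \<otimes> a [^] (?N * j1) = a [^] (1::nat) \<otimes> a [^] (?N * j2)" using a by (simp add: nat_pow_mult m_comm)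
    then show ?thesis using one a by simp
  qed
  then show ?thesis using a by (intro bexI[of _ "a [^] k"]) (auto simp: nat_pow_pow mult.commute)
qed

text \<open>Applied to a generator, the hypothesis gives that p^d - 1 divides p^s - 1. Modulo p^d -
  1 the exponent s may be replaced by r = s mod d, and p^r - 1 is too small to be a positive
  multiple of p^d - 1.\<close>

lemma (in field) finite_field_subfield_degree:
  assumes fin: "finite (carrier R)" and card: "card (carrier R) = p ^ d" and p: "p \<ge> 2" and "d \<ge> 1"
    and fixed: "\<And>x. x \<in> carrier R \<Longrightarrow> x [^] (p ^ s) = x"
  shows "d dvd s"
proof -
  obtain g where g: "g \<in> carrier R" "g \<noteq> \<zero>"
    "\<And>i::nat. g [^] i = \<one> \<longleftrightarrow> card (carrier R) - 1 dvd i" using finite_field_generator[OF fin] by metis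
  have "g \<otimes> g [^] (p ^ s - 1) = g \<otimes> \<one>"
    using fixed[OF g(1)] g(1) p by (simp flip: nat_pow_Suc2)
  then have "g [^] (p ^ s - 1) = \<one>" using g(1,2) m_lcancel[of g "g [^] (p ^ s - 1)" \<one>] by blast
  then have dv: "p ^ d - 1 dvd p ^ s - 1" using g(3) card by simp
  show ?thesis
  proof (rule ccontr)
    assume nd: "\<not> d dvd s"
    define r where "r = s mod d"
    have r: "0 < r" "r < d" using nd \<open>d \<ge> 1\<close> by (auto simp: r_def dvd_eq_mod_eq_0)
    have s: "s = d * (s div d) + r" by (simp add: r_def)
    have one: "[p ^ d = 1] (mod (p ^ d - 1))"
    proof -
      have "p ^ d = (p ^ d - 1) + 1" using p by simp
      then show ?thesis by (metis cong_def mod_add_self1)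
    qed
    have "[p ^ s = 1 ^ (s div d) * p ^ r] (mod (p ^ d - 1))"
      by (subst s, unfold power_add power_mult) (intro cong_mult cong_pow one cong_refl)
    moreover have "[p ^ s = 1] (mod (p ^ d - 1))"
      using dv p cong_add[of "p ^ s - 1" 0 "p ^ d - 1" 1 1] by (simp add: cong_0_iff)
    ultimately have "[p ^ r = 1] (mod (p ^ d - 1))" by (simp add: cong_def)
    then have "p ^ d - 1 dvd p ^ r - 1" using p by (metis cong_to_1_nat)
    moreover have "p ^ r - 1 > 0" using r(1) p one_less_power[of p r] by simp
    moreover have "p ^ r < p ^ d" using r(2) p by simp
    ultimately show False using dvd_imp_le[of "p ^ d - 1" "p ^ r - 1"] by linarith
  qed
qed

lemma prime_field_facts:
  assumes p: "Factorial_Ring.prime p"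
  shows "field (prime_field p)" "finite (carrier (prime_field p))" "card (carrier (prime_field p)) = p"
    "add_pow (prime_field p) p \<one>\<^bsub>prime_field p\<^esub> = \<zero>\<^bsub>prime_field p\<^esub>"
proof -
  interpret residues_prime p "prime_field p" by unfold_locales (use p in auto)
  show "field (prime_field p)" by (rule is_field)
  show "finite (carrier (prime_field p))" by simp
  show "card (carrier (prime_field p)) = p" using p prime_gt_0_nat by (simp add: res_carrier_eq)
  have "add_pow (prime_field p) m \<one>\<^bsub>prime_field p\<^esub> = int m mod int p" for m
  proof (induction m)
    case 0
    then show ?case by (simp add: res_zero_eq)
  next
    case (Suc m)
    then show ?case by (simp add: res_add_eq res_one_eq mod_simps add.commute)
  qed
  then show "add_pow (prime_field p) p \<one>\<^bsub>prime_field p\<^esub> = \<zero>\<^bsub>prime_field p\<^esub>" by (simp add: res_zero_eq)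
qed

section \<open>The extension field and its coordinate arrays\<close>

text \<open>The leading coefficient of \<open>f\<close> is arbitrary: the locale is instantiated a
  second time with minimal polynomials, which the Euclidean algorithm yields only up to a
  unit.\<close>

locale prime_ext =
  fixes p :: nat and f :: "int list"
  assumes p: "Factorial_Ring.prime p" and f: "f \<in> carrier (poly_ring (prime_field p))"
    and irr: "pirreducible\<^bsub>prime_field p\<^esub> (carrier (prime_field p)) f"
begin

abbreviation K :: "int ring" where "K \<equiv> prime_field p"
abbreviation L :: "int list set ring" where "L \<equiv> ext p f"

sublocale K: base_field K
  unfolding base_field_def by (rule prime_field_facts[OF p])

sublocale P: domain K.PR by (rule K.PR_domain)

sublocale L: field L
  using K.rupture_is_field_iff_pirreducible[OF K.carrier_is_subfield f] irr by simp

definition dg :: nat where "dg = length f - 1"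

lemma dg_pos: "dg \<ge> 1" and length_f: "length f = Suc dg" and f_nz: "f \<noteq> []"
proof -
  show "dg \<ge> 1" using K.pirreducible_degree[OF K.carrier_is_subfield f irr] by (simp add: dg_def)
  then show "length f = Suc dg" "f \<noteq> []" by (auto simp: dg_def)
qed

sublocale cls: ring_hom_ring K.PR L "cls p f"
  using K.rupture_surj_hom(2)[OF K.carrier_is_subring f] unfolding cls_def[abs_def] .

lemma cls_pmod: "F \<in> carrier K.PR \<Longrightarrow> cls p f (K.pmod F f) = cls p f F"
  unfolding cls_def by (rule K.rupture_surj_composed_with_pmod[OF K.carrier_is_subfield f, symmetric])

lemma pmod_closed: "F \<in> carrier K.PR \<Longrightarrow> K.pmod F f \<in> carrier K.PR"
  and length_pmod: "F \<in> carrier K.PR \<Longrightarrow> length (K.pmod F f) \<le> dg"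
proof -
  show "F \<in> carrier K.PR \<Longrightarrow> K.pmod F f \<in> carrier K.PR"
    by (rule K.long_division_closed(2)[OF K.carrier_is_subfield _ f])
  show "length (K.pmod F f) \<le> dg" if "F \<in> carrier K.PR"
    using K.pmod_degree[OF K.carrier_is_subfield that f f_nz] length_f dg_pos by (cases "K.pmod F f") auto
qed

lemma pmod_small: "F \<in> carrier K.PR \<Longrightarrow> length F \<le> dg \<Longrightarrow> K.pmod F f = F"
  by (rule K.pmod_const(2)[OF K.carrier_is_subfield _ f]) (use length_f dg_pos in auto)

lemma cls_inj:
  assumes "F \<in> carrier K.PR" "length F \<le> dg" "G \<in> carrier K.PR" "length G \<le> dg" "cls p f F = cls p f G"
  shows "F = G"
proof -
  have "inj_on (cls p f) ((\<lambda>q. K.pmod q f) ` carrier K.PR)"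
    using K.rupture_surj_inj_on[OF K.carrier_is_subfield f] unfolding cls_def[abs_def] .
  moreover have "F \<in> (\<lambda>q. K.pmod q f) ` carrier K.PR" "G \<in> (\<lambda>q. K.pmod q f) ` carrier K.PR"
    using assms pmod_small[of F] pmod_small[of G] by (metis image_eqI)+
  ultimately show ?thesis using inj_onD[of "cls p f" "(\<lambda>q. K.pmod q f) ` carrier K.PR" F G] assms(5) by blast
qed

lemma cls_surj:
  assumes "z \<in> carrier L" obtains F where "F \<in> carrier K.PR" "length F \<le> dg" "cls p f F = z"
proof -
  have "z \<in> cls p f ` ((\<lambda>q. K.pmod q f) ` carrier K.PR)"
    using K.rupture_carrier_as_pmod_image[OF K.carrier_is_subfield f] assms unfolding cls_def[abs_def] by simp
  then show ?thesis using that pmod_closed length_pmod by auto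
qed

lemma cls_zero_iff: "F \<in> carrier K.PR \<Longrightarrow> cls p f F = \<zero>\<^bsub>L\<^esub> \<longleftrightarrow> K.pmod F f = []"
  using cls_inj[OF pmod_closed length_pmod, of F "[]"] cls_pmod[of F] cls.hom_zero length_pmod
  by (auto simp: K.PR_zero)

definition rep :: "int list set \<Rightarrow> int list" where
  "rep z = (THE F. F \<in> carrier K.PR \<and> length F \<le> dg \<and> cls p f F = z)"

text \<open>Coordinates in the monomial basis, continued by zero. Elements are equal iff their
  arrays are equal as functions, which is what the contracts \<open>computes\<close>
  compare.\<close>

definition arr :: "int list set \<Rightarrow> nat \<Rightarrow> int" where "arr z = K.coeff (rep z)"

lemma rep:
  assumes "z \<in> carrier L" shows rep_closed: "rep z \<in> carrier K.PR" and rep_length: "length (rep z) \<le> dg" and cls_rep: "cls p f (rep z) = z"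
proof -
  have "\<exists>!F. F \<in> carrier K.PR \<and> length F \<le> dg \<and> cls p f F = z"
    using cls_surj[OF assms] cls_inj by metis
  from theI'[OF this] show "rep z \<in> carrier K.PR" "length (rep z) \<le> dg" "cls p f (rep z) = z"
    unfolding rep_def by auto
qed

lemma rep_cls: "F \<in> carrier K.PR \<Longrightarrow> rep (cls p f F) = K.pmod F f"
  using cls_inj[OF rep_closed rep_length pmod_closed length_pmod] cls_rep cls_pmod by auto

lemma arr_cls: "F \<in> carrier K.PR \<Longrightarrow> arr (cls p f F) = K.coeff (K.pmod F f)"
  by (simp add: arr_def rep_cls)

lemma arr_closed [simp]: "z \<in> carrier L \<Longrightarrow> arr z i \<in> carrier K"
  by (simp add: arr_def rep_closed)

lemma arr_high: "z \<in> carrier L \<Longrightarrow> i \<ge> dg \<Longrightarrow> arr z i = \<zero>\<^bsub>K\<^esub>"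
  unfolding arr_def by (rule K.coeff_length, rule order_trans[OF rep_length])

lemma arr_add: "z \<in> carrier L \<Longrightarrow> w \<in> carrier L \<Longrightarrow> arr (z \<oplus>\<^bsub>L\<^esub> w) i = arr z i \<oplus>\<^bsub>K\<^esub> arr w i"
proof -
  assume zw: "z \<in> carrier L" "w \<in> carrier L"
  have "rep (z \<oplus>\<^bsub>L\<^esub> w) = rep z \<oplus>\<^bsub>K.PR\<^esub> rep w"
    by (rule cls_inj) (use zw in \<open>auto simp: rep intro!: K.length_add_le\<close>)
  then show ?thesis using zw by (simp add: arr_def K.coeff_add rep)
qed

definition emb :: "int \<Rightarrow> int list set" where "emb k = cls p f (K.poly_of_const k)"

lemma emb_closed [simp]: "k \<in> carrier K \<Longrightarrow> emb k \<in> carrier L"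
  by (simp add: emb_def)

lemma arr_scale: "k \<in> carrier K \<Longrightarrow> z \<in> carrier L \<Longrightarrow> arr (emb k \<otimes>\<^bsub>L\<^esub> z) i = k \<otimes>\<^bsub>K\<^esub> arr z i"
proof -
  assume k: "k \<in> carrier K" and z: "z \<in> carrier L"
  have "length (K.poly_of_const k \<otimes>\<^bsub>K.PR\<^esub> rep z) \<le> dg"
    using k z by (subst K.PR_length_le_iff) (auto simp: K.coeff_const_mult rep K.coeff_length dest: order_trans[OF rep_length])
  then have "rep (emb k \<otimes>\<^bsub>L\<^esub> z) = K.poly_of_const k \<otimes>\<^bsub>K.PR\<^esub> rep z"
    using k z by (intro cls_inj) (auto simp: rep emb_def)
  then show ?thesis using k z by (simp add: arr_def K.coeff_const_mult rep)
qed

lemma arr_inj: "z \<in> carrier L \<Longrightarrow> w \<in> carrier L \<Longrightarrow> (\<And>i. arr z i = arr w i) \<Longrightarrow> z = w"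
  unfolding arr_def using K.poly_eqI[OF rep_closed rep_closed] cls_rep by metis

lemma arr_zero: "arr \<zero>\<^bsub>L\<^esub> i = \<zero>\<^bsub>K\<^esub>"
  using cls_inj[OF rep_closed rep_length, of "\<zero>\<^bsub>L\<^esub>" "[]"] cls_rep[of "\<zero>\<^bsub>L\<^esub>"] cls.hom_zero
  by (simp add: arr_def K.PR_zero univ_poly_zero_closed)

lemma arr_one: "arr \<one>\<^bsub>L\<^esub> = (\<lambda>_. \<zero>\<^bsub>K\<^esub>)(0 := \<one>\<^bsub>K\<^esub>)"
proof -
  have "rep \<one>\<^bsub>L\<^esub> = \<one>\<^bsub>K.PR\<^esub>"
    by (rule cls_inj) (use rep[of "\<one>\<^bsub>L\<^esub>"] dg_pos in \<open>auto simp: K.length_one\<close>)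
  then show ?thesis by (simp add: arr_def K.coeff_one)
qed

lemma emb_hom: "ring_hom_ring K L emb"
proof -
  have "ring_hom_ring K K.PR K.poly_of_const"
    using K.canonical_embedding_ring_hom[OF K.carrier_is_subring] by simp
  then show ?thesis unfolding emb_def[abs_def]
    using ring_hom_trans[OF ring_hom_ring.homh cls.homh, of K K.poly_of_const]
    by (intro ring_hom_ringI2[OF K.ring_axioms L.ring_axioms]) (simp add: o_def)
qed

sublocale emb: ring_hom_ring K L emb by (rule emb_hom)

lemma char_L: "add_pow L p \<one>\<^bsub>L\<^esub> = \<zero>\<^bsub>L\<^esub>"
proof -
  have "emb (add_pow K m \<one>\<^bsub>K\<^esub>) = add_pow L m \<one>\<^bsub>L\<^esub>" for m :: nat
    by (induction m) auto
  then show ?thesis using prime_field_facts(4)[OF p] emb.hom_zero by metis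
qed

lemma emb_frob [simp]: "k \<in> carrier K \<Longrightarrow> emb k [^]\<^bsub>L\<^esub> (p ^ m) = emb k"
proof (induction m)
  case (Suc m)
  have "emb k [^]\<^bsub>L\<^esub> (p ^ Suc m) = (emb k [^]\<^bsub>L\<^esub> (p ^ m)) [^]\<^bsub>L\<^esub> p"
    using L.nat_pow_pow[OF emb_closed[OF Suc.prems], of "p ^ m" p] by (simp add: mult.commute)
  also have "\<dots> = emb (k [^]\<^bsub>K\<^esub> p)" using Suc unfolding Suc.IH[OF Suc.prems] by (simp add: emb.hom_nat_pow)
  also have "k [^]\<^bsub>K\<^esub> p = k"
    using K.finite_field_pow_card(2)[OF prime_field_facts(2)[OF p] Suc.prems] prime_field_facts(3)[OF p] by simp
  finally show ?case .
qed simp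

definition ev :: "int list set \<Rightarrow> int list \<Rightarrow> int list set" where "ev v F = L.eval (map emb F) v"

lemma set_map_emb: "F \<in> carrier K.PR \<Longrightarrow> set (map emb F) \<subseteq> carrier L"
  by (simp add: image_subset_iff) (meson K.PR_set emb_closed subsetD)

lemma ev_closed [simp]: "F \<in> carrier K.PR \<Longrightarrow> v \<in> carrier L \<Longrightarrow> ev v F \<in> carrier L"
  unfolding ev_def by (intro L.eval_in_carrier set_map_emb)

lemma ev_hom:
  assumes v: "v \<in> carrier L" shows "ring_hom_ring K.PR L (ev v)"
proof (rule ring_hom_ringI[OF P.ring_axioms L.ring_axioms])
  fix F G assume FG: "F \<in> carrier K.PR" "G \<in> carrier K.PR"
  have norm: "L.eval (L.normalize (map emb H)) v = L.eval (map emb H) v" if "set H \<subseteq> carrier K" for H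
    by (rule L.eval_normalize) (use that v in auto)
  have FG': "set F \<subseteq> carrier K" "set G \<subseteq> carrier K" using FG K.PR_set by auto
  show "ev v (F \<otimes>\<^bsub>K.PR\<^esub> G) = ev v F \<otimes>\<^bsub>L\<^esub> ev v G"
    unfolding ev_def univ_poly_mult
    using norm[OF K.poly_mult_in_carrier[OF FG']] emb.poly_mult_hom'[OF FG']
      L.eval_poly_mult[OF set_map_emb[OF FG(1)] set_map_emb[OF FG(2)] v] by simp
  show "ev v (F \<oplus>\<^bsub>K.PR\<^esub> G) = ev v F \<oplus>\<^bsub>L\<^esub> ev v G"
    unfolding ev_def univ_poly_add
    using norm[OF K.poly_add_in_carrier[OF FG']] emb.poly_add_hom'[OF FG']
      L.eval_poly_add[OF set_map_emb[OF FG(1)] set_map_emb[OF FG(2)] v] by simp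
next
  show "ev v \<one>\<^bsub>K.PR\<^esub> = \<one>\<^bsub>L\<^esub>" using v by (simp add: ev_def univ_poly_one)
qed (use v in auto)

lemma ev_X: "v \<in> carrier L \<Longrightarrow> ev v X\<^bsub>K\<^esub> = v"
  by (simp add: ev_def var_def)

lemma ev_const: "v \<in> carrier L \<Longrightarrow> k \<in> carrier K \<Longrightarrow> ev v (K.poly_of_const k) = emb k"
  by (simp add: ev_def K.poly_of_const_def)

definition gen :: "int list set" where "gen = cls p f X\<^bsub>K\<^esub>"

lemma gen_closed [simp]: "gen \<in> carrier L"
  by (simp add: gen_def)

lemma cls_eq_ev:
  assumes F: "F \<in> carrier K.PR" shows "cls p f F = ev gen F"
proof -
  have set: "set (map K.poly_of_const F) \<subseteq> carrier K.PR" using K.PR_set[OF F] by auto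
  have "cls p f F = cls p f (P.eval (map K.poly_of_const F) X\<^bsub>K\<^esub>)"
    using K.eval_rewrite[OF K.carrier_is_subring F] by simp
  also have "\<dots> = L.eval (map (cls p f) (map K.poly_of_const F)) gen"
    unfolding gen_def by (rule cls.eval_hom'[OF K.X_closed set])
  finally show ?thesis by (simp add: ev_def emb_def[abs_def] o_def)
qed

text \<open>The Frobenius is a ring homomorphism that fixes the coefficients of F, which lie in the
  prime field. At the generator this is what lets one modular composition replace a power with
  exponent p^m.\<close>

lemma ev_frob:
  assumes "F \<in> carrier K.PR" "v \<in> carrier L"
  shows "ev v F [^]\<^bsub>L\<^esub> (p ^ m) = ev (v [^]\<^bsub>L\<^esub> (p ^ m)) F"
proof -
  interpret h: ring_hom_ring L L "\<lambda>x. x [^]\<^bsub>L\<^esub> (p ^ m)" by (rule L.frobenius_hom[OF p char_L])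
  have "map (\<lambda>x. x [^]\<^bsub>L\<^esub> (p ^ m)) (map emb F) = map emb F"
    using K.PR_set[OF assms(1)] by auto
  then show ?thesis unfolding ev_def using h.eval_hom'[OF assms(2) set_map_emb[OF assms(1)]] by (simp only:)
qed

lemma cls_composition:
  assumes "F \<in> carrier K.PR" "G \<in> carrier K.PR"
  shows "cls p f (modular_composition K F G f) = ev (cls p f G) F"
    and "modular_composition K F G f \<in> carrier K.PR" "length (modular_composition K F G f) \<le> dg"
proof -
  have set: "set (map K.poly_of_const F) \<subseteq> carrier K.PR" using K.PR_set[OF assms(1)] by auto
  have cl: "P.eval (map K.poly_of_const F) G \<in> carrier K.PR" by (rule P.eval_in_carrier[OF set assms(2)])
  show "modular_composition K F G f \<in> carrier K.PR" "length (modular_composition K F G f) \<le> dg"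
    unfolding modular_composition_def using pmod_closed[OF cl] length_pmod[OF cl] by auto
  have "cls p f (modular_composition K F G f) = cls p f (P.eval (map K.poly_of_const F) G)"
    unfolding modular_composition_def by (rule cls_pmod[OF cl])
  also have "\<dots> = L.eval (map (cls p f) (map K.poly_of_const F)) (cls p f G)" by (rule cls.eval_hom'[OF assms(2) set])
  also have "\<dots> = ev (cls p f G) F" by (simp add: ev_def emb_def[abs_def] o_def)
  finally show "cls p f (modular_composition K F G f) = ev (cls p f G) F" .
qed

lemma comp_frob:
  assumes "h \<in> carrier L"
  shows "ev (gen [^]\<^bsub>L\<^esub> (p ^ m)) (rep h) = h [^]\<^bsub>L\<^esub> (p ^ m)"
  using ev_frob[OF rep_closed[OF assms] gen_closed, of m] cls_eq_ev[OF rep_closed[OF assms]] cls_rep[OF assms] by simp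

lemma finite_L: "finite (carrier L)" and card_L: "card (carrier L) = p ^ dg"
proof -
  let ?S = "{..<dg} \<rightarrow>\<^sub>E carrier K"
  let ?h = "\<lambda>z. restrict (arr z) {..<dg}"
  have "bij_betw ?h (carrier L) ?S"
  proof (rule bij_betw_imageI)
    show "inj_on ?h (carrier L)"
    proof (rule inj_onI)
      fix z w assume zw: "z \<in> carrier L" "w \<in> carrier L" "?h z = ?h w"
      then have "arr z i = arr w i" for i
        using arr_high[of z i] arr_high[of w i] by (cases "i < dg") (auto simp: restrict_def dest!: fun_cong[of _ _ i])
      then show "z = w" using arr_inj zw by blast
    qed
    show "?h ` carrier L = ?S"
    proof (intro equalityI subsetI)
      fix g assume g: "g \<in> ?S"
      let ?F = "read_poly K dg g"
      have F: "?F \<in> carrier K.PR" by (rule K.read_poly_closed) (use g in auto)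
      have "?h (cls p f ?F) = g"
        using F g by (auto simp: arr_cls pmod_small K.length_read_poly K.coeff_read_poly fun_eq_iff PiE_def extensional_def restrict_def)
      then show "g \<in> ?h ` carrier L" using F by (metis cls.hom_closed image_eqI)
    next
      fix g assume "g \<in> ?h ` carrier L"
      then show "g \<in> ?S" by (auto simp: PiE_def extensional_def)
    qed
  qed
  moreover have "finite ?S" using prime_field_facts(2)[OF p] by (intro finite_PiE) auto
  moreover have "card ?S = p ^ dg" using prime_field_facts(3)[OF p] by (simp add: card_PiE)
  ultimately show "finite (carrier L)" "card (carrier L) = p ^ dg"
    using bij_betw_finite[of ?h "carrier L" ?S] bij_betw_same_card[of ?h "carrier L" ?S] by simp_all
qed

lemma frob_dg: "z \<in> carrier L \<Longrightarrow> z [^]\<^bsub>L\<^esub> (p ^ dg) = z"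
  using L.finite_field_pow_card(2)[OF finite_L] card_L by simp

end

section \<open>Minimal polynomials\<close>

lemma (in domain) nat_pow_nonzero:
  "x \<in> carrier R \<Longrightarrow> x \<noteq> \<zero> \<Longrightarrow> x [^] (n::nat) \<noteq> \<zero>"
  by (induction n) (auto simp: integral_iff)

lemma (in field) card_roots_le:
  assumes F: "F \<in> carrier (poly_ring R)" "F \<noteq> []" and S: "finite S" "\<And>z. z \<in> S \<Longrightarrow> z \<in> carrier R \<and> eval F z = \<zero>"
  shows "card S \<le> degree F"
proof -
  have "S \<subseteq> set_mset (roots F)" using S F roots_mem_iff_is_root[OF F(1)] by (auto simp: is_root_def)
  then have "card S \<le> card (set_mset (roots F))" by (intro card_mono) auto
  also have "\<dots> \<le> size (roots F)" by (metis mset_set_set_mset_msubset size_mset_mono size_mset_set)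
  also have "\<dots> \<le> degree F" by (rule size_roots_le_degree[OF F(1)])
  finally show ?thesis .
qed

context base_field begin

text \<open>The extended Euclidean algorithm for \<open>X\<^bsup>2s\<^esup>\<close> and \<open>U\<close>, stopped half way, recovers the
  reduced denominator of the rational function whose expansion is \<open>U\<close>.\<close>

lemma rational_reconstruction:
  assumes g: "g \<in> carrier PR" "pirreducible (carrier K) g" "length g = Suc d" "1 \<le> d" "d \<le> s"
    and U: "U \<in> carrier PR" and H: "H \<in> carrier PR" "length H \<le> d" "H \<noteq> []"
    and w: "w \<in> carrier PR" and gU: "g \<otimes>\<^bsub>PR\<^esub> U = H \<oplus>\<^bsub>PR\<^esub> xp (2 * s) \<otimes>\<^bsub>PR\<^esub> w"
    and cl: "r \<in> carrier PR" "v \<in> carrier PR" "w1 \<in> carrier PR" "v' \<in> carrier PR" "w0 \<in> carrier PR"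
    and r: "r = v \<otimes>\<^bsub>PR\<^esub> U \<oplus>\<^bsub>PR\<^esub> xp (2 * s) \<otimes>\<^bsub>PR\<^esub> w1"
    and det: "v' \<otimes>\<^bsub>PR\<^esub> w1 \<ominus>\<^bsub>PR\<^esub> v \<otimes>\<^bsub>PR\<^esub> w0 \<in> Units PR"
    and len: "length r \<le> s" "length v \<le> Suc s"
  shows "\<exists>c\<in>Units PR. v = g \<otimes>\<^bsub>PR\<^esub> c"
proof -
  interpret P: domain PR by (rule PR_domain)
  let ?N = "xp (2 * s)"
  let ?D = "v \<otimes>\<^bsub>PR\<^esub> w \<oplus>\<^bsub>PR\<^esub> g \<otimes>\<^bsub>PR\<^esub> w1"
  have H': "H = g \<otimes>\<^bsub>PR\<^esub> U \<ominus>\<^bsub>PR\<^esub> ?N \<otimes>\<^bsub>PR\<^esub> w"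
    using gU H(1) w by (simp add: P.minus_eq P.a_assoc P.r_neg)
  \<comment> \<open>Eliminating U between the relations for g and for v leaves a multiple of X^(2s).
    Both products on the left have length at most s + d <= 2s, so the cofactor \<open>?D\<close>
    must vanish.\<close>
  have e1: "g \<otimes>\<^bsub>PR\<^esub> r \<ominus>\<^bsub>PR\<^esub> v \<otimes>\<^bsub>PR\<^esub> H = ?N \<otimes>\<^bsub>PR\<^esub> ?D"
  proof -
    have "g \<otimes>\<^bsub>PR\<^esub> (v \<otimes>\<^bsub>PR\<^esub> U \<oplus>\<^bsub>PR\<^esub> z \<otimes>\<^bsub>PR\<^esub> w1) \<ominus>\<^bsub>PR\<^esub> v \<otimes>\<^bsub>PR\<^esub> (g \<otimes>\<^bsub>PR\<^esub> U \<ominus>\<^bsub>PR\<^esub> z \<otimes>\<^bsub>PR\<^esub> w) = z \<otimes>\<^bsub>PR\<^esub> ?D"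
      if "z \<in> carrier PR" for z using that g(1) cl w U by algebra
    then show ?thesis using r H' by (metis xp_closed)
  qed
  have "length (g \<otimes>\<^bsub>PR\<^esub> r) \<le> Suc (d + (s - 1))" "length (v \<otimes>\<^bsub>PR\<^esub> H) \<le> Suc (s + (d - 1))"
    using length_mult_le[OF g(1) cl(1), of d "s - 1"] length_mult_le[OF cl(2) H(1), of s "d - 1"] g(3-5) H(2) len by linarith+
  then have "length (?N \<otimes>\<^bsub>PR\<^esub> ?D) \<le> 2 * s + 0" unfolding e1[symmetric] using g H cl by (intro length_minus_le) auto
  then have D0: "?D = []" using length_xp_mult_cancel[of ?D "2 * s" 0] g(1) cl w by auto
  have "g \<otimes>\<^bsub>PR\<^esub> r = v \<otimes>\<^bsub>PR\<^esub> H"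
    using e1 D0 P.r_null[OF xp_closed, of "2 * s"] g(1) cl H(1) P.r_right_minus_eq[of "g \<otimes>\<^bsub>PR\<^esub> r" "v \<otimes>\<^bsub>PR\<^esub> H"] by (simp add: PR_zero)
  then have "g pdivides (v \<otimes>\<^bsub>PR\<^esub> H)" unfolding pdivides_def factor_def using cl by (metis)
  moreover have "pprime (carrier K) g" using pprime_iff_pirreducible[OF carrier_is_subfield g(1)] g(2) by simp
  ultimately have "g pdivides v \<or> g pdivides H"
    using pprimeE(3)[OF carrier_is_subfield g(1)] cl(2) H(1) by blast
  moreover have "\<not> g pdivides H"
    using pdivides_imp_degree_le[OF carrier_is_subring g(1) H(1) H(3)] g(3,4) H(2,3) by auto
  ultimately obtain k where k: "k \<in> carrier PR" "v = g \<otimes>\<^bsub>PR\<^esub> k" by (auto simp: pdivides_def factor_def)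
  have "g \<otimes>\<^bsub>PR\<^esub> (k \<otimes>\<^bsub>PR\<^esub> w \<oplus>\<^bsub>PR\<^esub> w1) = \<zero>\<^bsub>PR\<^esub>"
    using D0 k g(1) cl w by (simp add: PR_zero P.r_distr P.m_assoc)
  moreover have "g \<noteq> \<zero>\<^bsub>PR\<^esub>" using g(3) by (auto simp: PR_zero)
  ultimately have "k \<otimes>\<^bsub>PR\<^esub> w \<oplus>\<^bsub>PR\<^esub> w1 = \<zero>\<^bsub>PR\<^esub>" using P.integral[of g] g(1) k(1) w cl by blast
  then have w1: "w1 = \<ominus>\<^bsub>PR\<^esub> (k \<otimes>\<^bsub>PR\<^esub> w)" using k w cl by (metis P.add.inv_equality P.a_comm P.m_closed)
  let ?u = "v' \<otimes>\<^bsub>PR\<^esub> w1 \<ominus>\<^bsub>PR\<^esub> v \<otimes>\<^bsub>PR\<^esub> w0"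
  \<comment> \<open>Both v and w1 are multiples of k, hence so is the determinant; as it is a unit,
    k is one too.\<close>
  have "?u = k \<otimes>\<^bsub>PR\<^esub> (\<ominus>\<^bsub>PR\<^esub> (v' \<otimes>\<^bsub>PR\<^esub> w) \<ominus>\<^bsub>PR\<^esub> g \<otimes>\<^bsub>PR\<^esub> w0)"
    unfolding w1 k(2) using k(1) cl w g(1) by algebra
  then have "k \<in> Units PR" using det k(1) cl w g(1) P.unit_factor[of k] by (metis P.a_inv_closed P.m_closed P.minus_closed)
  then show ?thesis using k by blast
qed

end

context prime_ext begin

text \<open>Characterised by divisibility and not by being monic: the notion is stable under unit
  factors, so the output of the Euclidean algorithm qualifies without normalisation.\<close>

definition minpoly :: "int list set \<Rightarrow> int list \<Rightarrow> bool" where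
  "minpoly y g \<longleftrightarrow> g \<in> carrier K.PR \<and> g \<noteq> [] \<and> (\<forall>F\<in>carrier K.PR. ev y F = \<zero>\<^bsub>L\<^esub> \<longleftrightarrow> g divides\<^bsub>K.PR\<^esub> F)"

lemma minpoly_irreducible:
  assumes y: "y \<in> carrier L" and g: "minpoly y g"
  shows "pirreducible\<^bsub>K\<^esub> (carrier K) g"
proof (rule K.pirreducibleI[OF K.carrier_is_subring])
  interpret e: ring_hom_ring K.PR L "ev y" by (rule ev_hom[OF y])
  have gc: "g \<in> carrier K.PR" "g \<noteq> []" using g by (auto simp: minpoly_def)
  then show "g \<in> carrier K.PR" "g \<noteq> []" by auto
  have ev_iff: "ev y F = \<zero>\<^bsub>L\<^esub> \<longleftrightarrow> g divides\<^bsub>K.PR\<^esub> F" if "F \<in> carrier K.PR" for F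
    using g that by (auto simp: minpoly_def)
  have ev_g: "ev y g = \<zero>\<^bsub>L\<^esub>" using ev_iff[OF gc(1)] P.divides_refl[OF gc(1)] by blast
  show "g \<notin> Units K.PR"
  proof
    assume "g \<in> Units K.PR"
    then obtain h where "h \<in> carrier K.PR" "g \<otimes>\<^bsub>K.PR\<^esub> h = \<one>\<^bsub>K.PR\<^esub>" using P.Units_r_inv_ex by blast
    then have "g divides\<^bsub>K.PR\<^esub> \<one>\<^bsub>K.PR\<^esub>" by (auto simp: factor_def intro!: bexI[of _ h])
    then have "ev y \<one>\<^bsub>K.PR\<^esub> = \<zero>\<^bsub>L\<^esub>" using ev_iff by blast
    then show False using e.hom_one L.one_not_zero by simp
  qed
  fix q r assume qr: "q \<in> carrier K.PR" "r \<in> carrier K.PR" "g = q \<otimes>\<^bsub>K.PR\<^esub> r"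
  have unit: "b \<in> Units K.PR" if ab: "a \<in> carrier K.PR" "b \<in> carrier K.PR" "g = a \<otimes>\<^bsub>K.PR\<^esub> b" "ev y a = \<zero>\<^bsub>L\<^esub>" for a b
  proof -
    obtain h where h: "h \<in> carrier K.PR" "a = g \<otimes>\<^bsub>K.PR\<^esub> h" using ev_iff[OF ab(1)] ab(4) by (auto simp: factor_def)
    then have "g \<otimes>\<^bsub>K.PR\<^esub> (h \<otimes>\<^bsub>K.PR\<^esub> b) = g \<otimes>\<^bsub>K.PR\<^esub> \<one>\<^bsub>K.PR\<^esub>"
      using ab(2,3) gc(1) by (simp flip: P.m_assoc)
    then have "h \<otimes>\<^bsub>K.PR\<^esub> b = \<one>\<^bsub>K.PR\<^esub>" using P.m_lcancel[of g "h \<otimes>\<^bsub>K.PR\<^esub> b" "\<one>\<^bsub>K.PR\<^esub>"] gc h ab(2) by (simp add: K.PR_zero)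
    then show ?thesis using h(1) ab(2) P.m_comm[OF h(1) ab(2)] by (auto simp: Units_def)
  qed
  have "ev y q = \<zero>\<^bsub>L\<^esub> \<or> ev y r = \<zero>\<^bsub>L\<^esub>"
    using ev_g qr y L.integral_iff by (metis e.hom_mult ev_closed)
  then show "q \<in> Units K.PR \<or> r \<in> Units K.PR"
    using unit[of q r] unit[of r q] qr P.m_comm by metis
qed

lemma minpoly_exists:
  assumes y: "y \<in> carrier L" shows "\<exists>g. minpoly y g"
proof -
  interpret e: ring_hom_ring K.PR L "ev y" by (rule ev_hom[OF y])
  let ?I = "a_kernel K.PR L (ev y)"
  have I: "?I = {F \<in> carrier K.PR. ev y F = \<zero>\<^bsub>L\<^esub>}" by (rule a_kernel_def')
  \<comment> \<open>The polynomial X^(p^dg) - X vanishes on all of L, so the kernel of evaluation at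
    y is a nonzero principal ideal.\<close>
  let ?F = "K.xp (p ^ dg) \<ominus>\<^bsub>K.PR\<^esub> X\<^bsub>K\<^esub>"
  have Fc: "?F \<in> carrier K.PR" by simp
  have "ev y ?F = ev y (K.xp (p ^ dg)) \<oplus>\<^bsub>L\<^esub> (\<ominus>\<^bsub>L\<^esub> ev y X\<^bsub>K\<^esub>)"
    unfolding P.minus_eq by simp
  also have "ev y (K.xp (p ^ dg)) = y" using e.hom_nat_pow[OF K.X_closed] ev_X[OF y] frob_dg[OF y] by simp
  finally have F0: "ev y ?F = \<zero>\<^bsub>L\<^esub>" using ev_X[OF y] y by (simp add: L.r_neg)
  have "p ^ dg > 1" using one_less_power[OF prime_gt_1_nat[OF p], of dg] dg_pos by simp
  moreover have "K.coeff (K.xp q \<ominus>\<^bsub>K.PR\<^esub> X\<^bsub>K\<^esub>) q = \<one>\<^bsub>K\<^esub>" if "q > 1" for q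
    using that K.coeff_xp[of 1] by (simp add: K.coeff_minus K.coeff_xp) (simp add: K.minus_eq)
  ultimately have "K.coeff ?F (p ^ dg) = \<one>\<^bsub>K\<^esub>" by blast
  then have Fn: "?F \<noteq> []" using K.one_not_zero by auto
  have "?I \<noteq> {[]}" using F0 Fn Fc I by auto
  then obtain g where g: "g \<in> carrier K.PR" "?I = PIdl\<^bsub>K.PR\<^esub> g"
    using K.exists_unique_gen[OF K.carrier_is_subfield e.kernel_is_ideal] by metis
  have mem: "F \<in> PIdl\<^bsub>K.PR\<^esub> g \<longleftrightarrow> g divides\<^bsub>K.PR\<^esub> F" for F
    using g(1) P.m_comm by (auto simp: cgenideal_def factor_def)
  have "g \<noteq> []" using mem[of ?F] F0 Fn Fc I g P.l_null by (auto simp: factor_def K.PR_zero)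
  then show ?thesis using g(1) mem I g(2) by (intro exI[of _ g]) (auto simp: minpoly_def)
qed

lemma minpoly_unit_mult:
  assumes g: "minpoly y g" and c: "c \<in> Units K.PR"
  shows "minpoly y (g \<otimes>\<^bsub>K.PR\<^esub> c)"
proof -
  have gc: "g \<in> carrier K.PR" "g \<noteq> []" "c \<in> carrier K.PR" using g c by (auto simp: minpoly_def)
  obtain h where h: "h \<in> carrier K.PR" "c \<otimes>\<^bsub>K.PR\<^esub> h = \<one>\<^bsub>K.PR\<^esub>" using P.Units_r_inv_ex[OF c] by blast
  have "g \<otimes>\<^bsub>K.PR\<^esub> c divides\<^bsub>K.PR\<^esub> F \<longleftrightarrow> g divides\<^bsub>K.PR\<^esub> F" for F
  proof
    assume "g \<otimes>\<^bsub>K.PR\<^esub> c divides\<^bsub>K.PR\<^esub> F"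
    then show "g divides\<^bsub>K.PR\<^esub> F" using gc by (auto simp: factor_def P.m_assoc)
  next
    assume "g divides\<^bsub>K.PR\<^esub> F"
    then obtain q where q: "q \<in> carrier K.PR" "F = g \<otimes>\<^bsub>K.PR\<^esub> q" by (auto simp: factor_def)
    have "F = (g \<otimes>\<^bsub>K.PR\<^esub> c) \<otimes>\<^bsub>K.PR\<^esub> (h \<otimes>\<^bsub>K.PR\<^esub> q)"
      using q gc h by (metis P.m_assoc P.m_closed P.l_one)
    then show "g \<otimes>\<^bsub>K.PR\<^esub> c divides\<^bsub>K.PR\<^esub> F" using h q by (auto simp: factor_def)
  qed
  moreover have "g \<otimes>\<^bsub>K.PR\<^esub> c \<noteq> []"
  proof -
    have "c \<noteq> \<zero>\<^bsub>K.PR\<^esub>" using h P.one_not_zero P.l_null by metis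
    then show ?thesis using gc P.integral_iff by (simp flip: K.PR_zero)
  qed
  ultimately show ?thesis using g gc by (auto simp: minpoly_def)
qed

lemma minpoly_field:
  assumes y: "y \<in> carrier L" and g: "minpoly y g"
  shows "prime_ext p g"
  using g minpoly_irreducible[OF y g] p by (intro prime_ext.intro) (auto simp: minpoly_def)

text \<open>Identifies F_p[Z]/g with the subfield of L generated by y without constructing an
  isomorphism: equations between polynomial expressions can be moved in either direction.\<close>

lemma minpoly_cls_iff:
  assumes y: "y \<in> carrier L" and g: "minpoly y g" and F: "F \<in> carrier K.PR" "G \<in> carrier K.PR"
  shows "cls p g F = cls p g G \<longleftrightarrow> ev y F = ev y G"
proof -
  interpret G: prime_ext p g by (rule minpoly_field[OF y g])
  interpret e: ring_hom_ring K.PR L "ev y" by (rule ev_hom[OF y])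
  have D: "F \<ominus>\<^bsub>K.PR\<^esub> G \<in> carrier K.PR" using F by simp
  have gc: "g \<in> carrier K.PR" using g by (simp add: minpoly_def)
  have "cls p g F = cls p g G \<longleftrightarrow> cls p g (F \<ominus>\<^bsub>K.PR\<^esub> G) = \<zero>\<^bsub>ext p g\<^esub>"
    using F by (simp add: P.minus_eq G.L.minus_eq[symmetric])
  also have "\<dots> \<longleftrightarrow> K.pmod (F \<ominus>\<^bsub>K.PR\<^esub> G) g = []" by (rule G.cls_zero_iff[OF D])
  also have "\<dots> \<longleftrightarrow> g divides\<^bsub>K.PR\<^esub> (F \<ominus>\<^bsub>K.PR\<^esub> G)"
    using K.pmod_zero_iff_pdivides[OF K.carrier_is_subfield D gc] by (simp add: pdivides_def)
  also have "\<dots> \<longleftrightarrow> ev y (F \<ominus>\<^bsub>K.PR\<^esub> G) = \<zero>\<^bsub>L\<^esub>" using g D by (auto simp: minpoly_def)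
  also have "\<dots> \<longleftrightarrow> ev y F = ev y G"
    using F y by (simp add: P.minus_eq L.minus_eq[symmetric])
  finally show ?thesis .
qed

text \<open>The p^s-power map fixes the class of Z, hence every element of F_p[Z]/g, and
  \<open>finite_field_subfield_degree\<close> applies. This is the degree condition in the
  precondition of the black box.\<close>

lemma minpoly_subfield:
  assumes y: "y \<in> carrier L" and g: "minpoly y g" and fixed: "y [^]\<^bsub>L\<^esub> (p ^ s) = y"
  shows "Polynomials.degree g dvd s"
proof -
  interpret G: prime_ext p g by (rule minpoly_field[OF y g])
  interpret e: ring_hom_ring K.PR L "ev y" by (rule ev_hom[OF y])
  have "cls p g (K.xp (p ^ s)) = cls p g X\<^bsub>K\<^esub>"
    using minpoly_cls_iff[OF y g, of "K.xp (p ^ s)" "X\<^bsub>K\<^esub>"] fixed y by (simp add: e.hom_nat_pow ev_X)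
  then have gen: "G.gen [^]\<^bsub>ext p g\<^esub> (p ^ s) = G.gen" by (simp add: G.gen_def G.cls.hom_nat_pow)
  have "G.dg dvd s"
  proof (rule G.L.finite_field_subfield_degree[OF G.finite_L G.card_L prime_ge_2_nat[OF p] G.dg_pos])
    fix x assume x: "x \<in> carrier (ext p g)"
    show "x [^]\<^bsub>ext p g\<^esub> (p ^ s) = x"
      using G.comp_frob[OF x, of s] gen G.comp_frob[OF x, of 0] x by simp
  qed
  then show ?thesis by (simp add: G.dg_def)
qed

text \<open>The root T lies in F_Q but perhaps not in the field generated by y, whose degree is d.
  If t divides p^d - 1, then the order s of p divides d, so d = s, and the power residue criterion
  carries over from T. Otherwise t is prime to the group order and every element has a t-th
  root.\<close>

lemma minpoly_power:
  assumes y: "y \<in> carrier L" and g: "minpoly y g" and t: "Factorial_Ring.prime t" "t dvd p ^ s - 1" "s = ord t p"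
    and T: "T \<in> carrier L" "T \<noteq> \<zero>\<^bsub>L\<^esub>" "T [^]\<^bsub>L\<^esub> t = y" "T [^]\<^bsub>L\<^esub> (p ^ s) = T"
  shows "\<exists>z\<in>carrier (ext p g). z [^]\<^bsub>ext p g\<^esub> t = cls p g X\<^bsub>K\<^esub>"
proof -
  interpret G: prime_ext p g by (rule minpoly_field[OF y g])
  interpret e: ring_hom_ring K.PR L "ev y" by (rule ev_hom[OF y])
  have "y [^]\<^bsub>L\<^esub> (p ^ s) = (T [^]\<^bsub>L\<^esub> (p ^ s)) [^]\<^bsub>L\<^esub> t" unfolding T(3)[symmetric] using T(1) by (simp add: L.nat_pow_pow mult.commute)
  then have "y [^]\<^bsub>L\<^esub> (p ^ s) = y" using T by simp
  then have d: "G.dg dvd s" using minpoly_subfield[OF y g] by (simp add: G.dg_def)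
  have tp: "t > 0" using t(1) prime_gt_0_nat by blast
  have pp: "p ^ k > 0" for k using prime_gt_0_nat[OF p] by simp
  show ?thesis
  proof (cases "t dvd p ^ G.dg - 1")
    case True
    then obtain q where "p ^ G.dg - 1 = t * q" by blast
    then have "p ^ G.dg = 1 + t * q" using pp[of G.dg] by linarith
    then have "[p ^ G.dg = 1] (mod t)" by (metis cong_def mod_mult_self2)
    then have "s dvd G.dg" unfolding t(3) using ord_divides by blast
    then have s: "s = G.dg" using d dvd_antisym by blast
    have "T \<otimes>\<^bsub>L\<^esub> T [^]\<^bsub>L\<^esub> (p ^ s - 1) = T \<otimes>\<^bsub>L\<^esub> \<one>\<^bsub>L\<^esub>"
      using T(1,4) pp[of s] by (simp flip: L.nat_pow_Suc2)
    then have "T [^]\<^bsub>L\<^esub> (p ^ s - 1) = \<one>\<^bsub>L\<^esub>" using L.m_lcancel[of T "T [^]\<^bsub>L\<^esub> (p ^ s - 1)" "\<one>\<^bsub>L\<^esub>"] T(1,2) by blast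
    moreover have "t * ((p ^ s - 1) div t) = p ^ s - 1" using t(2) by simp
    ultimately have "y [^]\<^bsub>L\<^esub> ((p ^ s - 1) div t) = \<one>\<^bsub>L\<^esub>"
      unfolding T(3)[symmetric] L.nat_pow_pow[OF T(1)] by simp
    then have "cls p g (K.xp ((p ^ s - 1) div t)) = cls p g \<one>\<^bsub>K.PR\<^esub>"
      using minpoly_cls_iff[OF y g, of "K.xp ((p ^ s - 1) div t)" "\<one>\<^bsub>K.PR\<^esub>"] y by (simp add: e.hom_nat_pow ev_X)
    then have "G.gen [^]\<^bsub>ext p g\<^esub> ((card (carrier (ext p g)) - 1) div t) = \<one>\<^bsub>ext p g\<^esub>"
      unfolding G.card_L s[symmetric] by (simp add: G.gen_def G.cls.hom_nat_pow)
    moreover have "G.gen \<noteq> \<zero>\<^bsub>ext p g\<^esub>"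
    proof
      assume "G.gen = \<zero>\<^bsub>ext p g\<^esub>"
      then have "cls p g X\<^bsub>K\<^esub> = cls p g \<zero>\<^bsub>K.PR\<^esub>" by (simp add: G.gen_def)
      then have "y = \<zero>\<^bsub>L\<^esub>" using minpoly_cls_iff[OF y g, of "X\<^bsub>K\<^esub>" "\<zero>\<^bsub>K.PR\<^esub>"] y by (simp add: ev_X)
      then show False using T L.nat_pow_nonzero[of T t] by simp
    qed
    ultimately show ?thesis
      using G.L.power_residue_iff[OF G.finite_L _ tp G.gen_closed] True by (auto simp: G.card_L G.gen_def)
  next
    case False
    then have "coprime t (card (carrier (ext p g)) - 1)" unfolding G.card_L using t(1) prime_imp_coprime_nat by blast
    then show ?thesis using G.L.coprime_power[OF G.finite_L _ tp G.gen_closed] by (auto simp: G.gen_def)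
  qed
qed

end

section \<open>Twisted norms and traces\<close>

text \<open>The exponent (Q^k - 1)/(Q - 1), written without division.\<close>

primrec geo :: "nat \<Rightarrow> nat \<Rightarrow> nat" where
  "geo Q 0 = 0"
| "geo Q (Suc k) = geo Q k + Q ^ k"

lemma geo_mult: "Q \<ge> 1 \<Longrightarrow> (Q - 1) * geo Q k + 1 = Q ^ k"
proof (induction k)
  case (Suc k)
  have "(Q - 1) * geo Q (Suc k) + 1 = ((Q - 1) * geo Q k + 1) + (Q - 1) * Q ^ k" by (simp add: algebra_simps)
  also have "\<dots> = Q ^ k + (Q - 1) * Q ^ k" using Suc by simp
  also have "\<dots> = Q ^ Suc k" using Suc.prems by (simp add: algebra_simps)
  finally show ?case .
qed simp

context prime_ext begin

text \<open>The truncation length k is a parameter here and in \<open>twisted_trace\<close>, because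
  doubling combines partial products and sums of lengths k and l; the case k = m gives the decision
  value and w.\<close>

primrec twisted_norm :: "nat \<Rightarrow> int list set \<Rightarrow> nat \<Rightarrow> int list set" where
  "twisted_norm Q b 0 = \<one>\<^bsub>L\<^esub>"
| "twisted_norm Q b (Suc k) = twisted_norm Q b k \<otimes>\<^bsub>L\<^esub> b [^]\<^bsub>L\<^esub> (Q ^ k)"

primrec twisted_trace :: "nat \<Rightarrow> int list set \<Rightarrow> int list set \<Rightarrow> nat \<Rightarrow> int list set" where
  "twisted_trace Q b c 0 = \<zero>\<^bsub>L\<^esub>"
| "twisted_trace Q b c (Suc k) = twisted_trace Q b c k \<oplus>\<^bsub>L\<^esub> twisted_norm Q b k \<otimes>\<^bsub>L\<^esub> c [^]\<^bsub>L\<^esub> (Q ^ k)"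

primrec trace :: "nat \<Rightarrow> int list set \<Rightarrow> nat \<Rightarrow> int list set" where
  "trace Q z 0 = \<zero>\<^bsub>L\<^esub>"
| "trace Q z (Suc k) = trace Q z k \<oplus>\<^bsub>L\<^esub> z [^]\<^bsub>L\<^esub> (Q ^ k)"

lemma twisted_norm_closed [simp]: "b \<in> carrier L \<Longrightarrow> twisted_norm Q b k \<in> carrier L"
  by (induction k) auto

lemma twisted_trace_closed [simp]: "b \<in> carrier L \<Longrightarrow> c \<in> carrier L \<Longrightarrow> twisted_trace Q b c k \<in> carrier L"
  by (induction k) auto

lemma trace_closed [simp]: "z \<in> carrier L \<Longrightarrow> trace Q z k \<in> carrier L"
  by (induction k) auto

lemma frob_add:
  "x \<in> carrier L \<Longrightarrow> y \<in> carrier L \<Longrightarrow> (x \<oplus>\<^bsub>L\<^esub> y) [^]\<^bsub>L\<^esub> ((p ^ s) ^ k) = x [^]\<^bsub>L\<^esub> ((p ^ s) ^ k) \<oplus>\<^bsub>L\<^esub> y [^]\<^bsub>L\<^esub> ((p ^ s) ^ k)"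
  unfolding power_mult[symmetric] by (rule L.frobenius_pow_add[OF p char_L])

lemma zero_frob: "\<zero>\<^bsub>L\<^esub> [^]\<^bsub>L\<^esub> ((p ^ s) ^ k) = \<zero>\<^bsub>L\<^esub>"
  using prime_gt_0_nat[OF p] by (intro L.nat_pow_zero) simp

lemma twisted_norm_add:
  assumes b: "b \<in> carrier L"
  shows "twisted_norm Q b (k + l) = twisted_norm Q b k \<otimes>\<^bsub>L\<^esub> (twisted_norm Q b l) [^]\<^bsub>L\<^esub> (Q ^ k)"
proof (induction l)
  case (Suc l)
  have "twisted_norm Q b (k + Suc l) = twisted_norm Q b k \<otimes>\<^bsub>L\<^esub> (twisted_norm Q b l) [^]\<^bsub>L\<^esub> (Q ^ k) \<otimes>\<^bsub>L\<^esub> b [^]\<^bsub>L\<^esub> (Q ^ l * Q ^ k)"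
    using Suc by (simp add: power_add mult.commute)
  then show ?case using b by (simp add: L.nat_pow_distrib L.nat_pow_pow L.m_assoc)
qed (use b in simp)

text \<open>The terms from k on are N_k times the Q^k-th powers of the first l terms. Moving that
  power outside the sum is additivity of the Frobenius, which is why the base is p^s here, whereas
  the multiplicative \<open>twisted_norm_add\<close> holds for every Q.\<close>

lemma twisted_trace_add:
  assumes b: "b \<in> carrier L" and c: "c \<in> carrier L"
  shows "twisted_trace (p ^ s) b c (k + l) = twisted_trace (p ^ s) b c k \<oplus>\<^bsub>L\<^esub> twisted_norm (p ^ s) b k \<otimes>\<^bsub>L\<^esub> (twisted_trace (p ^ s) b c l) [^]\<^bsub>L\<^esub> ((p ^ s) ^ k)"
proof (induction l)
  case (Suc l)
  let ?Q = "p ^ s" let ?S = "twisted_trace ?Q b c" let ?N = "twisted_norm ?Q b"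
  have "?S (k + Suc l) = (?S k \<oplus>\<^bsub>L\<^esub> ?N k \<otimes>\<^bsub>L\<^esub> ?S l [^]\<^bsub>L\<^esub> (?Q ^ k)) \<oplus>\<^bsub>L\<^esub> ?N (k + l) \<otimes>\<^bsub>L\<^esub> c [^]\<^bsub>L\<^esub> (?Q ^ l * ?Q ^ k)"
    using Suc by (simp add: power_add mult.commute)
  also have "?N (k + l) \<otimes>\<^bsub>L\<^esub> c [^]\<^bsub>L\<^esub> (?Q ^ l * ?Q ^ k) = ?N k \<otimes>\<^bsub>L\<^esub> (?N l \<otimes>\<^bsub>L\<^esub> c [^]\<^bsub>L\<^esub> (?Q ^ l)) [^]\<^bsub>L\<^esub> (?Q ^ k)"
    unfolding twisted_norm_add[OF b] using b c by (simp add: L.nat_pow_distrib L.nat_pow_pow L.m_assoc)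
  finally have "?S (k + Suc l) = ?S k \<oplus>\<^bsub>L\<^esub> ?N k \<otimes>\<^bsub>L\<^esub> (?S l [^]\<^bsub>L\<^esub> (?Q ^ k) \<oplus>\<^bsub>L\<^esub> (?N l \<otimes>\<^bsub>L\<^esub> c [^]\<^bsub>L\<^esub> (?Q ^ l)) [^]\<^bsub>L\<^esub> (?Q ^ k))"
    using b c by (simp add: L.r_distr L.a_assoc)
  then show ?case using b c frob_add[of "?S l" "?N l \<otimes>\<^bsub>L\<^esub> c [^]\<^bsub>L\<^esub> (?Q ^ l)" s k] by simp
qed (use b c in \<open>simp add: zero_frob\<close>)

lemma twisted_norm_eq: "b \<in> carrier L \<Longrightarrow> twisted_norm Q b k = b [^]\<^bsub>L\<^esub> geo Q k"
  by (induction k) (auto simp: L.nat_pow_mult)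

text \<open>Since t e = Q - 1, the exponent e (Q^m - 1)/(Q - 1) equals (p^dg - 1)/t, the exponent of
  the power residue criterion.\<close>

lemma twisted_norm_test:
  assumes a: "a \<in> carrier L" and t: "t * e = Q - 1" "t > 0" and Q: "Q \<ge> 1" "Q ^ m = p ^ dg"
  shows "twisted_norm Q (a [^]\<^bsub>L\<^esub> e) m = a [^]\<^bsub>L\<^esub> ((p ^ dg - 1) div t)"
proof -
  have "t * (e * geo Q m) + 1 = p ^ dg" using geo_mult[OF Q(1), of m] t Q(2) by (metis mult.assoc)
  then have "(p ^ dg - 1) div t = e * geo Q m" using t(2) by (metis add_diff_cancel_right' nonzero_mult_div_cancel_left not_gr0)
  then show ?thesis using a by (simp add: twisted_norm_eq L.nat_pow_pow)
qed

text \<open>Here b = alpha^(Q-1), so N_k alpha = alpha^(Q^k) by \<open>geo_mult\<close>, and alpha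
  times the k-th summand is (alpha c)^(Q^k).\<close>

lemma twisted_trace_eq_trace:
  assumes al: "\<alpha> \<in> carrier L" and c: "c \<in> carrier L" and t: "t * e = Q - 1" and Q: "Q \<ge> 1"
  shows "twisted_trace Q ((\<alpha> [^]\<^bsub>L\<^esub> t) [^]\<^bsub>L\<^esub> e) c k \<otimes>\<^bsub>L\<^esub> \<alpha> = trace Q (\<alpha> \<otimes>\<^bsub>L\<^esub> c) k"
proof (induction k)
  case (Suc k)
  let ?b = "(\<alpha> [^]\<^bsub>L\<^esub> t) [^]\<^bsub>L\<^esub> e"
  have "?b = \<alpha> [^]\<^bsub>L\<^esub> (Q - 1)" using al t by (simp add: L.nat_pow_pow)
  then have "twisted_norm Q ?b k \<otimes>\<^bsub>L\<^esub> \<alpha> = \<alpha> [^]\<^bsub>L\<^esub> ((Q - 1) * geo Q k) \<otimes>\<^bsub>L\<^esub> \<alpha>" using al by (simp add: twisted_norm_eq L.nat_pow_pow)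
  also have "\<dots> = \<alpha> [^]\<^bsub>L\<^esub> (Q ^ k)" unfolding geo_mult[OF Q, symmetric] by simp
  finally have N: "twisted_norm Q ?b k \<otimes>\<^bsub>L\<^esub> \<alpha> = \<alpha> [^]\<^bsub>L\<^esub> (Q ^ k)" .
  have "twisted_norm Q ?b k \<otimes>\<^bsub>L\<^esub> c [^]\<^bsub>L\<^esub> (Q ^ k) \<otimes>\<^bsub>L\<^esub> \<alpha> = (\<alpha> \<otimes>\<^bsub>L\<^esub> c) [^]\<^bsub>L\<^esub> (Q ^ k)"
    using al c N[symmetric] by (simp add: L.nat_pow_distrib L.m_assoc L.m_comm[of \<alpha>]) (simp add: L.m_ac)
  then show ?case using Suc al c by (simp add: L.l_distr)
qed (use al c in simp)

lemma trace_fixed: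
  assumes z: "z \<in> carrier L" and m: "(p ^ s) ^ m = p ^ dg"
  shows "trace (p ^ s) z m [^]\<^bsub>L\<^esub> (p ^ s) = trace (p ^ s) z m"
proof -
  let ?Q = "p ^ s"
  \<comment> \<open>Raising to the power Q shifts the sum by one term. The form with z on the left
    avoids subtraction; for k = m the added term is again z and cancels.\<close>
  have "trace ?Q z k [^]\<^bsub>L\<^esub> ?Q \<oplus>\<^bsub>L\<^esub> z = trace ?Q z k \<oplus>\<^bsub>L\<^esub> z [^]\<^bsub>L\<^esub> (?Q ^ k)" for k
  proof (induction k)
    case 0
    then show ?case using z zero_frob[of s 1] by simp
  next
    case (Suc k)
    have "trace ?Q z (Suc k) [^]\<^bsub>L\<^esub> ?Q = trace ?Q z k [^]\<^bsub>L\<^esub> ?Q \<oplus>\<^bsub>L\<^esub> z [^]\<^bsub>L\<^esub> (?Q ^ Suc k)"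
      using frob_add[of "trace ?Q z k" "z [^]\<^bsub>L\<^esub> (?Q ^ k)" s 1] z by (simp add: L.nat_pow_pow mult.commute)
    then have "trace ?Q z (Suc k) [^]\<^bsub>L\<^esub> ?Q \<oplus>\<^bsub>L\<^esub> z = (trace ?Q z k [^]\<^bsub>L\<^esub> ?Q \<oplus>\<^bsub>L\<^esub> z) \<oplus>\<^bsub>L\<^esub> z [^]\<^bsub>L\<^esub> (?Q ^ Suc k)"
      using z by (simp add: L.a_ac)
    then show ?case unfolding Suc by simp
  qed
  from this[of m] show ?thesis using z frob_dg[OF z] by (simp add: m)
qed

lemma trace_add:
  "x \<in> carrier L \<Longrightarrow> y \<in> carrier L \<Longrightarrow> trace (p ^ s) (x \<oplus>\<^bsub>L\<^esub> y) k = trace (p ^ s) x k \<oplus>\<^bsub>L\<^esub> trace (p ^ s) y k"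
proof (induction k)
  case (Suc k)
  have "trace (p ^ s) (x \<oplus>\<^bsub>L\<^esub> y) (Suc k) = (trace (p ^ s) x k \<oplus>\<^bsub>L\<^esub> trace (p ^ s) y k) \<oplus>\<^bsub>L\<^esub> (x [^]\<^bsub>L\<^esub> ((p ^ s) ^ k) \<oplus>\<^bsub>L\<^esub> y [^]\<^bsub>L\<^esub> ((p ^ s) ^ k))"
    using Suc frob_add[of x y s k] by simp
  then show ?case using Suc.prems by (simp add: L.a_ac)
qed simp

lemma trace_scale:
  "k \<in> carrier K \<Longrightarrow> z \<in> carrier L \<Longrightarrow> trace (p ^ s) (emb k \<otimes>\<^bsub>L\<^esub> z) m = emb k \<otimes>\<^bsub>L\<^esub> trace (p ^ s) z m"
proof (induction m)
  case (Suc m)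
  have "(emb k \<otimes>\<^bsub>L\<^esub> z) [^]\<^bsub>L\<^esub> ((p ^ s) ^ m) = emb k \<otimes>\<^bsub>L\<^esub> z [^]\<^bsub>L\<^esub> ((p ^ s) ^ m)"
    using Suc.prems emb_frob[of k "s * m"] by (simp add: L.nat_pow_distrib power_mult)
  then show ?case using Suc by (simp add: L.r_distr)
qed simp

section \<open>Counting roots over the extension field\<close>

sublocale LB: base_field L by unfold_locales

text \<open>The trace is given by a nonzero polynomial of length at most Q^m, so it has fewer zeros
  than L has elements.\<close>

lemma trace_nonzero:
  assumes m: "m \<ge> 1" "(p ^ s) ^ m = p ^ dg" and s: "s \<ge> 1"
  shows "\<exists>z\<in>carrier L. trace (p ^ s) z m \<noteq> \<zero>\<^bsub>L\<^esub>"
proof (rule ccontr)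
  assume "\<not> ?thesis"
  then have zero: "trace (p ^ s) z m = \<zero>\<^bsub>L\<^esub>" if "z \<in> carrier L" for z using that by blast
  interpret PL: domain LB.PR by (rule LB.PR_domain)
  let ?Q = "p ^ s"
  have Q2: "?Q \<ge> 2" using power_increasing[of 1 s p] prime_ge_2_nat[OF p] s by simp
  define Tp where "Tp = rec_nat \<zero>\<^bsub>LB.PR\<^esub> (\<lambda>k F. F \<oplus>\<^bsub>LB.PR\<^esub> LB.xp (?Q ^ k))"
  have Tp: "Tp 0 = \<zero>\<^bsub>LB.PR\<^esub>" "Tp (Suc k) = Tp k \<oplus>\<^bsub>LB.PR\<^esub> LB.xp (?Q ^ k)" for k by (auto simp: Tp_def)
  have cl: "Tp k \<in> carrier LB.PR" for k by (induction k) (auto simp: Tp)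
  have high: "\<forall>i\<ge>?Q ^ k. L.coeff (Tp k) i = \<zero>\<^bsub>L\<^esub>" for k
  proof (induction k)
    case (Suc k)
    have "?Q ^ k < ?Q ^ Suc k" using Q2 by (intro power_strict_increasing) auto
    show ?case
    proof (intro allI impI)
      fix i assume "?Q ^ Suc k \<le> i"
      with \<open>?Q ^ k < ?Q ^ Suc k\<close> have "?Q ^ k < i" by linarith
      then have "L.coeff (Tp k) i = \<zero>\<^bsub>L\<^esub>" "i \<noteq> ?Q ^ k" using Suc by (blast intro: less_imp_le, blast)
      then show "L.coeff (Tp (Suc k)) i = \<zero>\<^bsub>L\<^esub>" using cl by (simp only: Tp LB.coeff_add LB.xp_closed LB.coeff_xp if_False L.r_zero L.zero_closed)
    qed
  qed (simp add: Tp LB.PR_zero)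
  obtain m' where m': "m = Suc m'" using m(1) by (cases m) auto
  \<comment> \<open>The last exponent Q^(m-1) exceeds all earlier ones since Q >= 2, so its
    coefficient 1 cannot cancel.\<close>
  have "L.coeff (Tp m) (?Q ^ m') = \<one>\<^bsub>L\<^esub>"
    using high[of m'] cl[of m'] by (simp add: m' Tp LB.coeff_add LB.coeff_xp)
  then have ne: "Tp m \<noteq> []" using L.one_not_zero by auto
  have len: "length (Tp m) \<le> ?Q ^ m" using high LB.PR_length_le_iff[OF cl] by blast
  have ev: "L.eval (Tp k) z = trace ?Q z k" if z: "z \<in> carrier L" for k z
  proof -
    interpret e: ring_hom_ring LB.PR L "\<lambda>F. L.eval F z" by (rule L.eval_ring_hom[OF L.carrier_is_subring z])
    show ?thesis by (induction k) (use z cl in \<open>auto simp: Tp e.hom_nat_pow L.eval_var\<close>)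
  qed
  have "card (carrier L) \<le> length (Tp m) - 1"
    by (rule L.card_roots_le[OF cl ne finite_L]) (use ev zero in auto)
  then show False using len ne m(2) card_L by (cases "Tp m") auto
qed

text \<open>The embedded prime field already supplies p roots of X^p - X; a further fixed point
  would be root number p + 1.\<close>

lemma frob_fixed_emb:
  assumes z: "z \<in> carrier L" "z [^]\<^bsub>L\<^esub> p = z"
  shows "\<exists>k\<in>carrier K. z = emb k"
proof (rule ccontr)
  assume nz: "\<not> ?thesis"
  interpret PL: domain LB.PR by (rule LB.PR_domain)
  let ?F = "LB.xp p \<ominus>\<^bsub>LB.PR\<^esub> X\<^bsub>L\<^esub>"
  have F: "?F \<in> carrier LB.PR" by simp
  have p1: "p > 1" by (rule prime_gt_1_nat[OF p])
  have "L.coeff ?F p = \<one>\<^bsub>L\<^esub>" using p1 LB.coeff_xp[of 1] by (simp add: LB.coeff_minus LB.coeff_xp) (simp add: L.minus_eq)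
  then have ne: "?F \<noteq> []" using L.one_not_zero by auto
  have len: "length ?F \<le> Suc p" by (rule LB.length_minus_le) (use LB.length_xp[of 1] LB.length_xp[of p] p1 in auto)
  have ev: "L.eval ?F w = w [^]\<^bsub>L\<^esub> p \<ominus>\<^bsub>L\<^esub> w" if w: "w \<in> carrier L" for w
  proof -
    interpret e: ring_hom_ring LB.PR L "\<lambda>F. L.eval F w" by (rule L.eval_ring_hom[OF L.carrier_is_subring w])
    show ?thesis unfolding PL.minus_eq L.minus_eq using w e.hom_nat_pow[OF LB.X_closed, of p] by (simp add: L.eval_var)
  qed
  have inj: "inj_on emb (carrier K)"
  proof (rule inj_onI)
    fix k l assume kl: "k \<in> carrier K" "l \<in> carrier K" "emb k = emb l"
    have "arr (emb k) 0 = k" if "k \<in> carrier K" for k using arr_scale[OF that L.one_closed, of 0] that by (simp add: arr_one)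
    then show "k = l" using kl by metis
  qed
  have "card (insert z (emb ` carrier K)) \<le> length ?F - 1"
  proof (rule L.card_roots_le[OF F ne])
    show "finite (insert z (emb ` carrier K))" using prime_field_facts(2)[OF p] by simp
    fix w assume "w \<in> insert z (emb ` carrier K)"
    then consider "w = z" | k where "k \<in> carrier K" "w = emb k" by blast
    then have "w \<in> carrier L \<and> w [^]\<^bsub>L\<^esub> p = w"
    proof cases
      case 1
      then show ?thesis using z by simp
    next
      case (2 k)
      then show ?thesis using emb_frob[of k 1] by simp
    qed
    then show "w \<in> carrier L \<and> L.eval ?F w = \<zero>\<^bsub>L\<^esub>" using ev by simp
  qed
  moreover have "z \<notin> emb ` carrier K" using nz by blast
  then have "card (insert z (emb ` carrier K)) = Suc p"
    using prime_field_facts(2,3)[OF p] card_image[OF inj] card_insert_disjoint[of "emb ` carrier K" z] by simp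
  ultimately show False using len by linarith
qed

text \<open>The constant coordinate is an F_p-linear form. The extra factor z is needed with z a
  power of y, so that the vanishing of g(y) yields the recurrence at every starting
  position.\<close>

lemma arr_ev:
  assumes "set g \<subseteq> carrier K" "y \<in> carrier L" "z \<in> carrier L"
  shows "arr (z \<otimes>\<^bsub>L\<^esub> ev y g) 0 = (\<Oplus>\<^bsub>K\<^esub>k\<in>{..<length g}. K.coeff g k \<otimes>\<^bsub>K\<^esub> arr (z \<otimes>\<^bsub>L\<^esub> y [^]\<^bsub>L\<^esub> k) 0)"
  using assms(1)
proof (induction g)
  case Nil
  then show ?case using assms by (simp add: ev_def arr_zero)
next
  case (Cons a g)
  have a: "a \<in> carrier K" and g: "set g \<subseteq> carrier K" using Cons.prems by auto
  have evg: "ev y g \<in> carrier L" unfolding ev_def by (rule L.eval_in_carrier) (use g assms in auto)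
  have "ev y (a # g) = emb a \<otimes>\<^bsub>L\<^esub> y [^]\<^bsub>L\<^esub> length g \<oplus>\<^bsub>L\<^esub> ev y g" by (simp add: ev_def)
  then have "z \<otimes>\<^bsub>L\<^esub> ev y (a # g) = emb a \<otimes>\<^bsub>L\<^esub> (z \<otimes>\<^bsub>L\<^esub> y [^]\<^bsub>L\<^esub> length g) \<oplus>\<^bsub>L\<^esub> z \<otimes>\<^bsub>L\<^esub> ev y g"
    using assms a evg by (simp add: L.r_distr L.m_lcomm)
  then have "arr (z \<otimes>\<^bsub>L\<^esub> ev y (a # g)) 0 = a \<otimes>\<^bsub>K\<^esub> arr (z \<otimes>\<^bsub>L\<^esub> y [^]\<^bsub>L\<^esub> length g) 0 \<oplus>\<^bsub>K\<^esub> arr (z \<otimes>\<^bsub>L\<^esub> ev y g) 0"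
    using assms a evg by (simp add: arr_add arr_scale)
  also have "arr (z \<otimes>\<^bsub>L\<^esub> ev y g) 0 = (\<Oplus>\<^bsub>K\<^esub>k\<in>{..<length g}. K.coeff (a # g) k \<otimes>\<^bsub>K\<^esub> arr (z \<otimes>\<^bsub>L\<^esub> y [^]\<^bsub>L\<^esub> k) 0)"
    unfolding Cons.IH[OF g] by (rule K.add.finprod_cong') (use g assms in auto)
  finally show ?case
    using assms a g Cons.prems by (simp add: lessThan_Suc K.add.finprod_insert Pi_def)
qed

text \<open>Every linear form applied to the powers of \<open>y\<close> gives a linearly recurrent sequence; for an
  irreducible minimal polynomial its generating function is a reduced fraction unless the sequence
  vanishes.\<close>

lemma generating_function:
  assumes y: "y \<in> carrier L" "y \<noteq> \<zero>\<^bsub>L\<^esub>" and g: "minpoly y g" "length g = Suc d" "d \<le> N" "1 \<le> N"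
  defines "U \<equiv> read_poly K N (\<lambda>i. arr (y [^]\<^bsub>L\<^esub> (N - 1 - i)) 0)"
  shows "\<exists>H\<in>carrier K.PR. \<exists>w\<in>carrier K.PR. length H \<le> d \<and> H \<noteq> [] \<and> g \<otimes>\<^bsub>K.PR\<^esub> U = H \<oplus>\<^bsub>K.PR\<^esub> K.xp N \<otimes>\<^bsub>K.PR\<^esub> w"
proof -
  interpret e: ring_hom_ring K.PR L "ev y" by (rule ev_hom[OF y(1)])
  have gc: "g \<in> carrier K.PR" "g \<noteq> []" using g by (auto simp: minpoly_def)
  have ev_g: "ev y g = \<zero>\<^bsub>L\<^esub>" using g(1) gc P.divides_refl[OF gc(1)] by (auto simp: minpoly_def)
  have U: "U \<in> carrier K.PR" "length U \<le> N" unfolding U_def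
    using y by (auto intro!: K.read_poly_closed K.length_read_poly)
  \<comment> \<open>The powers of y are stored in descending order, so that multiplication by g
    itself, and not by its reversal, produces the cancellation.\<close>
  have Uc: "K.coeff U i = (if i < N then arr (y [^]\<^bsub>L\<^esub> (N - 1 - i)) 0 else \<zero>\<^bsub>K\<^esub>)" for i
    by (simp add: U_def K.coeff_read_poly)
  let ?V = "g \<otimes>\<^bsub>K.PR\<^esub> U"
  have V: "?V \<in> carrier K.PR" using gc U by simp
  obtain H where H: "H \<in> carrier K.PR" "K.coeff H = (\<lambda>i. if i < N then K.coeff ?V (i + 0) else \<zero>\<^bsub>K\<^esub>)"
    using K.coeff_slice[OF V] by blast
  obtain w where w: "w \<in> carrier K.PR" "K.coeff w = (\<lambda>i. if i < length ?V then K.coeff ?V (i + N) else \<zero>\<^bsub>K\<^esub>)"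
    using K.coeff_slice[OF V] by blast
  have eq: "?V = H \<oplus>\<^bsub>K.PR\<^esub> K.xp N \<otimes>\<^bsub>K.PR\<^esub> w"
  proof (rule K.poly_eqI)
    fix i show "K.coeff ?V i = K.coeff (H \<oplus>\<^bsub>K.PR\<^esub> K.xp N \<otimes>\<^bsub>K.PR\<^esub> w) i"
      using H w V K.coeff_length[of ?V i] by (auto simp: K.coeff_add K.coeff_xp_mult)
  qed (use H w V in auto)
  \<comment> \<open>For these m the whole of g fits into the convolution, which becomes the linear
    form applied to y^(N-1-m) g(y) = 0.\<close>
  have "K.coeff ?V m = \<zero>\<^bsub>K\<^esub>" if m: "d \<le> m" "m < N" for m
  proof -
    have "K.coeff ?V m = (\<Oplus>\<^bsub>K\<^esub>k\<in>{..m}. K.coeff g k \<otimes>\<^bsub>K\<^esub> K.coeff U (m - k))" using gc U by (simp add: K.coeff_mult)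
    also have "\<dots> = (\<Oplus>\<^bsub>K\<^esub>k\<in>{..<length g}. K.coeff g k \<otimes>\<^bsub>K\<^esub> arr (y [^]\<^bsub>L\<^esub> (N - 1 - m) \<otimes>\<^bsub>L\<^esub> y [^]\<^bsub>L\<^esub> k) 0)"
    proof (rule K.add.finprod_mono_neutral_cong_right)
      fix k assume "k \<in> {..m} - {..<length g}"
      then show "K.coeff g k \<otimes>\<^bsub>K\<^esub> K.coeff U (m - k) = \<zero>\<^bsub>K\<^esub>" using K.coeff_length[of g k] U by simp
    next
      fix k assume k: "k \<in> {..<length g}"
      then have "k \<le> m" using m g(2) by simp
      then have "N - 1 - (m - k) = N - 1 - m + k" "m - k < N" using m by auto
      then show "K.coeff g k \<otimes>\<^bsub>K\<^esub> K.coeff U (m - k) = K.coeff g k \<otimes>\<^bsub>K\<^esub> arr (y [^]\<^bsub>L\<^esub> (N - 1 - m) \<otimes>\<^bsub>L\<^esub> y [^]\<^bsub>L\<^esub> k) 0"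
        using y by (simp add: Uc L.nat_pow_mult)
    qed (use m g gc U in auto)
    also have "\<dots> = arr (y [^]\<^bsub>L\<^esub> (N - 1 - m) \<otimes>\<^bsub>L\<^esub> ev y g) 0"
      by (rule arr_ev[symmetric]) (use y K.PR_set[OF gc(1)] in auto)
    also have "\<dots> = \<zero>\<^bsub>K\<^esub>" using y by (simp add: ev_g arr_zero)
    finally show ?thesis .
  qed
  then have len: "length H \<le> d" using H by (subst K.PR_length_le_iff) auto
  \<comment> \<open>If H were zero, then X^N w = g U would vanish at y; as y is nonzero, g divides w
    and X^N divides U, so U = 0 by length. But the top coefficient of U comes from y^0 and equals
    1.\<close>
  have "H \<noteq> []"
  proof
    assume H0: "H = []"
    then have eq': "?V = K.xp N \<otimes>\<^bsub>K.PR\<^esub> w" using eq w by (simp flip: K.PR_zero)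
    have "ev y ?V = \<zero>\<^bsub>L\<^esub>" using gc U y ev_g by simp
    then have "y [^]\<^bsub>L\<^esub> N \<otimes>\<^bsub>L\<^esub> ev y w = \<zero>\<^bsub>L\<^esub>" unfolding eq' using w y by (simp add: e.hom_nat_pow ev_X)
    then have "ev y w = \<zero>\<^bsub>L\<^esub>" using L.nat_pow_nonzero[OF y] L.integral_iff[of "y [^]\<^bsub>L\<^esub> N" "ev y w"] w y by simp
    then obtain q where q: "q \<in> carrier K.PR" "w = g \<otimes>\<^bsub>K.PR\<^esub> q" using g(1) w by (auto simp: minpoly_def factor_def)
    have "g \<otimes>\<^bsub>K.PR\<^esub> U = g \<otimes>\<^bsub>K.PR\<^esub> (K.xp N \<otimes>\<^bsub>K.PR\<^esub> q)" using eq' q gc by (simp add: P.m_lcomm)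
    then have Uq: "U = K.xp N \<otimes>\<^bsub>K.PR\<^esub> q" using P.m_lcancel[of g U "K.xp N \<otimes>\<^bsub>K.PR\<^esub> q"] gc U q by (simp add: K.PR_zero)
    then have "length q \<le> 0" using K.length_xp_mult_cancel[OF q(1), of N 0] U by simp
    then have "U = []" using Uq P.r_null[OF K.xp_closed, of N] by (simp add: K.PR_zero)
    then have "K.coeff U (N - 1) = \<zero>\<^bsub>K\<^esub>" by simp
    then show False using g(4) Uc[of "N - 1"] by (simp add: arr_one)
  qed
  then show ?thesis using H w len eq by blast
qed

end

section \<open>Arithmetic in the extension field\<close>

text \<open>The number of binary digits, which is the number of rounds of a halving loop.\<close>

fun bits :: "nat \<Rightarrow> nat" where
  "bits e = (if e = 0 then 0 else Suc (bits (e div 2)))"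

declare bits.simps [simp del]

definition pow_prog :: "com \<Rightarrow> com" where
  "pow_prog cM = Seq (SetOne (0, NConst 0))
    (While (NLess (NConst 0) (NVar 1))
      (Seq (IfThen (NLess (NConst 0) (NMod (NVar 1) (NConst 2))) (Call [NVar 0] [4, 0, 1, 2, 3] (mulmod_prog cM) 2 0) Skip)
      (Seq (Call [NVar 0] [4, 1, 1, 2, 3] (mulmod_prog cM) 2 1)
           (NAssign 1 (NDiv (NVar 1) (NConst 2))))))"

text \<open>A triple (X^(Q^k), N_k, S_k) is extended by one of length l: each component of the
  second is composed with X^(Q^k). The new norm and trace wait in arrays 11 and 12 until the end, so
  the update remains correct when both triples occupy the same arrays.\<close>

definition combine_prog :: "com \<Rightarrow> com \<Rightarrow> nat \<Rightarrow> nat \<Rightarrow> nat \<Rightarrow> nat \<Rightarrow> nat \<Rightarrow> nat \<Rightarrow> com" where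
  "combine_prog cM cC rx rN rS bx bN bS =
    Seq (Call [NVar 0] [9, bS, rx, 4] (comp_prog cC) 3 10)
   (Seq (Call [NVar 0] [9, rN, 10, 4, 5] (mulmod_prog cM) 3 10)
   (Seq (Call [NConst 0, NVar 0] [9, rS, 10, 13] axpy_prog 3 12)
   (Seq (Call [NVar 0] [9, bN, rx, 4] (comp_prog cC) 3 10)
   (Seq (Call [NVar 0] [9, rN, 10, 4, 5] (mulmod_prog cM) 3 11)
   (Seq (Call [NVar 0] [9, bx, rx, 4] (comp_prog cC) 3 rx)
   (Seq (Call [NConst 0, NVar 0] [9, 11] slice_prog 3 rN)
        (Call [NConst 0, NVar 0] [9, 12] slice_prog 3 rS)))))))"

text \<open>Arrays 6, 7, 8 hold \<open>X\<^bsup>Q^k\<^esup>, N\<^sub>k, S\<^sub>k\<close> for the part \<open>k\<close> of the exponent processed so far, and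
  arrays 1, 2, 3 the same triple for the current power of two.\<close>

definition double_prog :: "com \<Rightarrow> com \<Rightarrow> com" where
  "double_prog cM cC =
    Seq (SetOne (7, NConst 0))
   (Seq (SetOne (13, NConst 0))
   (Seq (Arith FSub (13, NConst 0) (9, NConst 0) (13, NConst 0))
   (Seq (While (NLess (NConst 0) (NVar 1))
      (Seq (IfThen (NLess (NConst 0) (NMod (NVar 1) (NConst 2))) (combine_prog cM cC 6 7 8 1 2 3) Skip)
      (Seq (combine_prog cM cC 1 2 3 1 2 3)
           (NAssign 1 (NDiv (NVar 1) (NConst 2))))))
   (IfThen (NLess (NConst 0) (NVar 2)) (Call [NConst 0, NVar 0] [9, 7] slice_prog 3 0)
      (Call [NConst 0, NVar 0] [9, 8] slice_prog 3 0)))))"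

locale field_machine = prime_ext p f for p f +
  fixes orc :: "int list \<Rightarrow> int list \<Rightarrow> int list" and cM cC :: com and Mn Cn :: nat and J :: "int list"
  assumes machine: "poly_machine (prime_field p) orc cM cC (prime_ext.dg f) Mn Cn"
    and J: "J \<in> carrier (poly_ring (prime_field p))" "length J \<le> prime_ext.dg f"
      "length (X\<^bsub>prime_field p\<^esub> [^]\<^bsub>poly_ring (prime_field p)\<^esub> (2 * prime_ext.dg f - 1) \<ominus>\<^bsub>poly_ring (prime_field p)\<^esub>
         J \<otimes>\<^bsub>poly_ring (prime_field p)\<^esub> f) \<le> prime_ext.dg f"
begin

sublocale PM: poly_machine K orc cM cC dg Mn Cn by (rule machine)

abbreviation zarr :: "nat \<Rightarrow> int" where "zarr \<equiv> \<lambda>_. \<zero>\<^bsub>K\<^esub>"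
abbreviation fa :: "nat \<Rightarrow> int" where "fa \<equiv> K.coeff f"
abbreviation ja :: "nat \<Rightarrow> int" where "ja \<equiv> K.coeff J"

text \<open>The cost of one multiplication in L.\<close>

definition mm :: nat where "mm = 3 * Mn + 2 * dg"

lemma computes_mulmod_L:
  assumes "x \<in> carrier L" "y \<in> carrier L"
  shows "computes K orc (mulmod_prog cM) [dg] [zarr, arr x, arr y, fa, ja] (arr (x \<otimes>\<^bsub>L\<^esub> y)) mm"
proof -
  have "rep (x \<otimes>\<^bsub>L\<^esub> y) = K.pmod (rep x \<otimes>\<^bsub>K.PR\<^esub> rep y) f"
    using rep_cls[of "rep x \<otimes>\<^bsub>K.PR\<^esub> rep y"] assms by (simp add: rep)
  then show ?thesis
    using PM.computes_mulmod[OF f length_f J rep_closed[OF assms(1)] rep_closed[OF assms(2)] rep_length[OF assms(1)] rep_length[OF assms(2)]]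
    by (simp add: arr_def mm_def)
qed

lemma computes_comp_L:
  assumes F: "F \<in> carrier K.PR" "length F \<le> Suc dg" and v: "v \<in> carrier L"
  shows "computes K orc (comp_prog cC) [dg] [zarr, K.coeff F, arr v, fa] (arr (ev v F)) Cn"
proof -
  let ?C = "modular_composition K F (rep v) f"
  have "ev v F = cls p f ?C" using cls_composition(1)[OF F(1) rep_closed[OF v]] cls_rep[OF v] by simp
  then have "arr (ev v F) = K.coeff ?C"
    using arr_cls pmod_small cls_composition(2,3)[OF F(1) rep_closed[OF v]] by simp
  moreover have "length (rep v) \<le> Suc dg" using rep_length[OF v] by simp
  ultimately show ?thesis
    using PM.computes_comp[OF F(1) rep_closed[OF v] f F(2) _ length_f] by (simp add: arr_def)
qed

lemma computes_frob:
  assumes h: "h \<in> carrier L"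
  shows "computes K orc (comp_prog cC) [dg] [zarr, arr h, arr (gen [^]\<^bsub>L\<^esub> (p ^ m)), fa] (arr (h [^]\<^bsub>L\<^esub> (p ^ m))) Cn"
  using computes_comp_L[OF rep_closed[OF h], of "gen [^]\<^bsub>L\<^esub> (p ^ m)"] rep_length[OF h] comp_frob[OF h, of m]
  by (simp add: arr_def)

lemma set_one_arr: "zarr(0 := \<one>\<^bsub>K\<^esub>) = arr \<one>\<^bsub>L\<^esub>"
  by (simp add: arr_one)

lemma arr_zero_fun: "arr \<zero>\<^bsub>L\<^esub> = zarr"
  by (rule ext) (rule arr_zero)

lemma computes_pow:
  assumes x: "x \<in> carrier L"
  shows "computes K orc (pow_prog cM) [dg, e] [zarr, arr x, fa, ja] (arr (x [^]\<^bsub>L\<^esub> e)) (2 * mm * bits e)"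
  unfolding computes_def
proof (intro allI)
  fix u l
  \<comment> \<open>The invariant carries the unspent budget, two multiplications for each binary
    digit still to be read, together with r b^k = x^e for the remaining exponent k.\<close>
  let ?I = "\<lambda>s. nvar s 0 = dg \<and> farr s 2 = fa \<and> farr s 3 = ja \<and> farr s 4 = zarr \<and> calls s = l \<and>
     ops s + 2 * mm * bits (nvar s 1) \<le> u + 2 * mm * bits e \<and>
     (\<exists>r b. r \<in> carrier L \<and> b \<in> carrier L \<and> farr s 0 = arr r \<and> farr s 1 = arr b \<and> r \<otimes>\<^bsub>L\<^esub> b [^]\<^bsub>L\<^esub> nvar s 1 = x [^]\<^bsub>L\<^esub> e)"
  show "wp K orc (pow_prog cM) (\<lambda>s. farr s 0 = arr (x [^]\<^bsub>L\<^esub> e) \<and> ops s \<le> u + 2 * mm * bits e \<and> calls s = l)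
     (frame K [dg, e] [zarr, arr x, fa, ja] u l)"
    unfolding pow_prog_def wp_Seq_atomic
  proof (rule wp_While[where I = ?I and m = "\<lambda>s. nvar s 1"])
    show "?I (set_cell (frame K [dg, e] [zarr, arr x, fa, ja] u l) (0, NConst 0) \<one>\<^bsub>K\<^esub>)"
      using x by (simp add: set_cell_def set_one_arr) (rule exI[of _ "\<one>\<^bsub>L\<^esub>"], simp, rule exI[of _ x], simp)
  next
    fix s assume I: "?I s" and b: "bval K (NLess (NConst 0) (NVar 1)) s"
    then obtain r b where rb: "r \<in> carrier L" "b \<in> carrier L" "farr s 0 = arr r" "farr s 1 = arr b" "r \<otimes>\<^bsub>L\<^esub> b [^]\<^bsub>L\<^esub> nvar s 1 = x [^]\<^bsub>L\<^esub> e" by blast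
    have A: "nvar s 0 = dg" "farr s 2 = fa" "farr s 3 = ja" "farr s 4 = zarr" "calls s = l" using I by blast+
    have pos: "nvar s 1 > 0" using b by simp
    have bits: "bits (nvar s 1) = Suc (bits (nvar s 1 div 2))" using pos by (subst bits.simps) simp
    let ?r = "if nvar s 1 mod 2 > 0 then r \<otimes>\<^bsub>L\<^esub> b else r"
    have eq: "?r \<otimes>\<^bsub>L\<^esub> (b \<otimes>\<^bsub>L\<^esub> b) [^]\<^bsub>L\<^esub> (nvar s 1 div 2) = x [^]\<^bsub>L\<^esub> e"
    proof -
      define h where "h = nvar s 1 div 2"
      have e1: "(b \<otimes>\<^bsub>L\<^esub> b) [^]\<^bsub>L\<^esub> h = b [^]\<^bsub>L\<^esub> (h + h)"
        using rb(2) by (simp add: L.nat_pow_distrib L.nat_pow_mult)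
      show ?thesis
      proof (cases "nvar s 1 mod 2 > 0")
        case True
        then have nv: "nvar s 1 = Suc (h + h)" unfolding h_def by presburger
        have calc: "r \<otimes>\<^bsub>L\<^esub> b \<otimes>\<^bsub>L\<^esub> b [^]\<^bsub>L\<^esub> (h + h) = r \<otimes>\<^bsub>L\<^esub> b [^]\<^bsub>L\<^esub> Suc (h + h)"
          using rb(1,2) by (simp add: L.m_assoc L.m_comm[of b])
        have "r \<otimes>\<^bsub>L\<^esub> b \<otimes>\<^bsub>L\<^esub> (b \<otimes>\<^bsub>L\<^esub> b) [^]\<^bsub>L\<^esub> h = x [^]\<^bsub>L\<^esub> e"
          unfolding e1 by (rule trans[OF calc rb(5)[unfolded nv]])
        then show ?thesis using True unfolding h_def[symmetric] by simp
      next
        case False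
        then have nv: "nvar s 1 = h + h" unfolding h_def by presburger
        have "r \<otimes>\<^bsub>L\<^esub> (b \<otimes>\<^bsub>L\<^esub> b) [^]\<^bsub>L\<^esub> h = x [^]\<^bsub>L\<^esub> e" unfolding e1 by (rule rb(5)[unfolded nv])
        then show ?thesis using False unfolding h_def[symmetric] by simp
      qed
    qed
    have cl: "?r \<in> carrier L" "b \<otimes>\<^bsub>L\<^esub> b \<in> carrier L" using rb by auto
    have fin: "?I s2 \<and> nvar s2 1 < nvar s 1"
      if "nvar s2 0 = dg" "farr s2 2 = fa" "farr s2 3 = ja" "farr s2 4 = zarr" "calls s2 = l" "nvar s2 1 = nvar s 1 div 2"
        "farr s2 0 = arr ?r" "farr s2 1 = arr (b \<otimes>\<^bsub>L\<^esub> b)" "ops s2 \<le> ops s + 2 * mm" for s2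
    proof -
      have "\<exists>r b. r \<in> carrier L \<and> b \<in> carrier L \<and> farr s2 0 = arr r \<and> farr s2 1 = arr b \<and> r \<otimes>\<^bsub>L\<^esub> b [^]\<^bsub>L\<^esub> nvar s2 1 = x [^]\<^bsub>L\<^esub> e"
        by (rule exI[of _ ?r], rule exI[of _ "b \<otimes>\<^bsub>L\<^esub> b"]) (use cl eq that in simp)
      then show ?thesis using that I bits pos by simp
    qed
    have step2: "wp K orc (Seq (Call [NVar 0] [4, 1, 1, 2, 3] (mulmod_prog cM) 2 1) (NAssign 1 (NDiv (NVar 1) (NConst 2))))
        (\<lambda>s'. ?I s' \<and> nvar s' 1 < nvar s 1) s1"
      if s1: "nvar s1 0 = dg" "farr s1 2 = fa" "farr s1 3 = ja" "farr s1 4 = zarr" "calls s1 = l" "nvar s1 1 = nvar s 1" "farr s1 0 = arr ?r" "farr s1 1 = arr b"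
       "ops s1 \<le> ops s + mm" for s1
      by (rule wp_Seq_Call[OF computes_mulmod_L[OF rb(2) rb(2)]], use s1 in simp, use s1 in simp,
          subst wp_atomic, rule fin) (use s1 in simp_all)
    show "wp K orc (Seq (IfThen (NLess (NConst 0) (NMod (NVar 1) (NConst 2))) (Call [NVar 0] [4, 0, 1, 2, 3] (mulmod_prog cM) 2 0) Skip)
      (Seq (Call [NVar 0] [4, 1, 1, 2, 3] (mulmod_prog cM) 2 1) (NAssign 1 (NDiv (NVar 1) (NConst 2)))))
      (\<lambda>s'. ?I s' \<and> nvar s' 1 < nvar s 1) s"
    proof (rule wp_Seq, cases "nvar s 1 mod 2 > 0")
      case True
      have "wp K orc (Call [NVar 0] [4, 0, 1, 2, 3] (mulmod_prog cM) 2 0) (wp K orc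
        (Seq (Call [NVar 0] [4, 1, 1, 2, 3] (mulmod_prog cM) 2 1) (NAssign 1 (NDiv (NVar 1) (NConst 2)))) (\<lambda>s'. ?I s' \<and> nvar s' 1 < nvar s 1)) s"

        apply (rule wp_Call'[OF computes_mulmod_L[OF rb(1,2)]])
          apply (simp add: A)
         apply (use A rb in simp)
        apply (rule step2)
                apply (use True A rb in simp_all)
        done
      then show "wp K orc (IfThen (NLess (NConst 0) (NMod (NVar 1) (NConst 2))) (Call [NVar 0] [4, 0, 1, 2, 3] (mulmod_prog cM) 2 0) Skip)
        (wp K orc (Seq (Call [NVar 0] [4, 1, 1, 2, 3] (mulmod_prog cM) 2 1) (NAssign 1 (NDiv (NVar 1) (NConst 2)))) (\<lambda>s'. ?I s' \<and> nvar s' 1 < nvar s 1)) s"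
        using True by simp
    next
      case False
      have "wp K orc (Seq (Call [NVar 0] [4, 1, 1, 2, 3] (mulmod_prog cM) 2 1) (NAssign 1 (NDiv (NVar 1) (NConst 2)))) (\<lambda>s'. ?I s' \<and> nvar s' 1 < nvar s 1) s"
        by (rule step2) (use False A rb in simp_all)
      then show "wp K orc (IfThen (NLess (NConst 0) (NMod (NVar 1) (NConst 2))) (Call [NVar 0] [4, 0, 1, 2, 3] (mulmod_prog cM) 2 0) Skip)
        (wp K orc (Seq (Call [NVar 0] [4, 1, 1, 2, 3] (mulmod_prog cM) 2 1) (NAssign 1 (NDiv (NVar 1) (NConst 2)))) (\<lambda>s'. ?I s' \<and> nvar s' 1 < nvar s 1)) s"
        using False by simp
    qed
  next
    fix s assume I: "?I s" and b: "\<not> bval K (NLess (NConst 0) (NVar 1)) s"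
    then show "farr s 0 = arr (x [^]\<^bsub>L\<^esub> e) \<and> ops s \<le> u + 2 * mm * bits e \<and> calls s = l" by auto
  qed
qed

text \<open>The cost of one \<open>combine_prog\<close>: three compositions, two products and one
  addition; the final copies are free.\<close>

definition cc :: nat where "cc = 3 * Cn + 2 * mm + 2 * dg"

text \<open>\<open>axpy_prog\<close> subtracts, so the scalar -1 makes it add.
  \<open>double_prog\<close> prepares that scalar once, in array 13.\<close>

lemma computes_add:
  assumes "x \<in> carrier L" "y \<in> carrier L" "q 0 = \<ominus>\<^bsub>K\<^esub> \<one>\<^bsub>K\<^esub>"
  shows "computes K orc axpy_prog [0, dg] [zarr, arr x, arr y, q] (arr (x \<oplus>\<^bsub>L\<^esub> y)) (2 * dg)"
proof -
  have "(\<lambda>i. if i < dg then (if i < 0 then arr x i else arr x i \<ominus>\<^bsub>K\<^esub> q 0 \<otimes>\<^bsub>K\<^esub> arr y (i - 0)) else \<zero>\<^bsub>K\<^esub>) = arr (x \<oplus>\<^bsub>L\<^esub> y)"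
    using assms by (intro ext) (simp add: arr_add arr_high K.minus_eq K.l_minus)
  then show ?thesis using computes_axpy_array[of K orc 0 dg "arr x" "arr y" q] by simp
qed

lemma computes_copy:
  assumes "x \<in> carrier L" shows "computes K orc slice_prog [0, dg] [zarr, arr x] (arr x) 0"
proof -
  have "(\<lambda>i. if i < dg then arr x (i + 0) else \<zero>\<^bsub>K\<^esub>) = arr x"
    using assms by (intro ext) (simp add: arr_high)
  then show ?thesis using computes_slice[of K orc 0 dg "arr x"] by simp
qed

text \<open>Distinctness is demanded within the first triple and against the work arrays, but the
  second triple may coincide with the first; this is how the current power of two is
  doubled.\<close>

lemma wp_combine:
  assumes idx: "distinct [rx, rN, rS]" "{rx, rN, rS, bx, bN, bS} \<inter> {4, 5, 9, 10, 11, 12, 13} = {}"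
    and s: "nvar s 0 = dg" "farr s 9 = zarr" "farr s 4 = fa" "farr s 5 = ja" "farr s 13 0 = \<ominus>\<^bsub>K\<^esub> \<one>\<^bsub>K\<^esub>"
    and cl: "N1 \<in> carrier L" "S1 \<in> carrier L" "X2 \<in> carrier L" "N2 \<in> carrier L" "S2 \<in> carrier L"
    and R: "farr s rx = arr (gen [^]\<^bsub>L\<^esub> (p ^ j))" "farr s rN = arr N1" "farr s rS = arr S1"
    and B: "farr s bx = arr X2" "farr s bN = arr N2" "farr s bS = arr S2"
    and post: "\<And>s'. \<lbrakk>\<And>i. i \<noteq> 3 \<Longrightarrow> nvar s' i = nvar s i; farr s' rx = arr (X2 [^]\<^bsub>L\<^esub> (p ^ j));
        farr s' rN = arr (N1 \<otimes>\<^bsub>L\<^esub> N2 [^]\<^bsub>L\<^esub> (p ^ j)); farr s' rS = arr (S1 \<oplus>\<^bsub>L\<^esub> N1 \<otimes>\<^bsub>L\<^esub> S2 [^]\<^bsub>L\<^esub> (p ^ j));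
        \<And>i. i \<notin> {10, 11, 12, rx, rN, rS} \<Longrightarrow> farr s' i = farr s i; ops s' \<le> ops s + cc; calls s' = calls s\<rbrakk> \<Longrightarrow> Q s'"
  shows "wp K orc (combine_prog cM cC rx rN rS bx bN bS) Q s"
proof -
  have i1: "rx \<noteq> rN" "rx \<noteq> rS" "rN \<noteq> rS" "rN \<noteq> rx" "rS \<noteq> rx" "rS \<noteq> rN" using idx(1) by auto
  have "\<forall>r\<in>{rx, rN, rS, bx, bN, bS}. \<forall>k\<in>{4, 5, 9, 10, 11, 12, 13}. r \<noteq> k" using idx(2) by blast
  note ne = i1 this[simplified]
  have c: "S2 [^]\<^bsub>L\<^esub> (p ^ j) \<in> carrier L" "N2 [^]\<^bsub>L\<^esub> (p ^ j) \<in> carrier L" "N1 \<otimes>\<^bsub>L\<^esub> S2 [^]\<^bsub>L\<^esub> (p ^ j) \<in> carrier L"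
    "N1 \<otimes>\<^bsub>L\<^esub> N2 [^]\<^bsub>L\<^esub> (p ^ j) \<in> carrier L" "S1 \<oplus>\<^bsub>L\<^esub> N1 \<otimes>\<^bsub>L\<^esub> S2 [^]\<^bsub>L\<^esub> (p ^ j) \<in> carrier L" using cl by auto
  show ?thesis unfolding combine_prog_def
    apply (rule wp_Seq_Call[OF computes_frob[OF cl(5), of j]]; (simp add: s R B ne)?)
    apply (rule wp_Seq_Call[OF computes_mulmod_L[OF cl(1) c(1)]]; (simp add: s R B ne)?)
    apply (rule wp_Seq_Call[OF computes_add[where q = "farr s 13", OF cl(2) c(3) s(5)]]; (simp add: s R B ne)?)
    apply (rule wp_Seq_Call[OF computes_frob[OF cl(4), of j]]; (simp add: s R B ne)?)
    apply (rule wp_Seq_Call[OF computes_mulmod_L[OF cl(1) c(2)]]; (simp add: s R B ne)?)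
    apply (rule wp_Seq_Call[OF computes_frob[OF cl(3), of j]]; (simp add: s R B ne)?)
    apply (rule wp_Seq_Call[OF computes_copy[OF c(4)]]; (simp add: s R B ne)?)
    apply (rule wp_Call'[OF computes_copy[OF c(5)]]; (simp add: s R B ne)?)
    apply (rule post)
          apply (simp_all add: ne cc_def)
    done
qed

lemma computes_double:
  assumes b: "b \<in> carrier L" and c: "c \<in> carrier L"
  shows "computes K orc (double_prog cM cC) [dg, m, flag]
    [zarr, arr (gen [^]\<^bsub>L\<^esub> (p ^ sd)), arr b, arr c, fa, ja, arr gen]
    (arr (if flag > 0 then twisted_norm (p ^ sd) b m else twisted_trace (p ^ sd) b c m)) (2 * cc * bits m + 1)"
  unfolding computes_def
proof (intro allI)
  fix u l
  let ?N = "twisted_norm (p ^ sd) b" and ?S = "twisted_trace (p ^ sd) b c" and ?x = "\<lambda>k. gen [^]\<^bsub>L\<^esub> (p ^ (sd * k))"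
  have addx: "?x l [^]\<^bsub>L\<^esub> (p ^ (sd * k)) = ?x (k + l)" for k l by (simp add: L.nat_pow_pow power_add[symmetric] algebra_simps)
  have addN: "?N k \<otimes>\<^bsub>L\<^esub> ?N l [^]\<^bsub>L\<^esub> (p ^ (sd * k)) = ?N (k + l)" for k l using twisted_norm_add[OF b, of "p ^ sd" k l] by (simp add: power_mult)
  have addS: "?S k \<oplus>\<^bsub>L\<^esub> ?N k \<otimes>\<^bsub>L\<^esub> ?S l [^]\<^bsub>L\<^esub> (p ^ (sd * k)) = ?S (k + l)" for k l using twisted_trace_add[OF b c, of sd k l] by (simp add: power_mult)
  have cl: "?x k \<in> carrier L" "?N k \<in> carrier L" "?S k \<in> carrier L" for k using b c by auto
  let ?A = "\<lambda>s. nvar s 0 = dg \<and> nvar s 2 = flag \<and> farr s 4 = fa \<and> farr s 5 = ja \<and> farr s 9 = zarr \<and> farr s 13 0 = \<ominus>\<^bsub>K\<^esub> \<one>\<^bsub>K\<^esub> \<and> calls s = l"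
  let ?B = "\<lambda>k j s. farr s 6 = arr (?x k) \<and> farr s 7 = arr (?N k) \<and> farr s 8 = arr (?S k) \<and>
      farr s 1 = arr (?x j) \<and> farr s 2 = arr (?N j) \<and> farr s 3 = arr (?S j)"
  \<comment> \<open>The accumulated length k plus j times the unread part of m is always m. Each
    round spends at most two combinations, and the extra 1 in the budget pays for computing
    -1.\<close>
  let ?I = "\<lambda>s. ?A s \<and> ops s + 2 * cc * bits (nvar s 1) \<le> u + 1 + 2 * cc * bits m \<and>
     (\<exists>k j. k + j * nvar s 1 = m \<and> ?B k j s)"
  let ?R = "\<lambda>s. farr s 0 = arr (if flag > 0 then ?N m else ?S m) \<and> ops s \<le> u + (2 * cc * bits m + 1) \<and> calls s = l"
  let ?body = "Seq (IfThen (NLess (NConst 0) (NMod (NVar 1) (NConst 2))) (combine_prog cM cC 6 7 8 1 2 3) Skip)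
      (Seq (combine_prog cM cC 1 2 3 1 2 3) (NAssign 1 (NDiv (NVar 1) (NConst 2))))"
  have loop: "wp K orc (While (NLess (NConst 0) (NVar 1)) ?body) (\<lambda>s. ?A s \<and> ops s \<le> u + (2 * cc * bits m + 1) \<and> farr s 7 = arr (?N m) \<and> farr s 8 = arr (?S m)) s"
    if "?I s" for s
  proof (rule wp_While[where I = ?I and m = "\<lambda>s. nvar s 1"])
    show "?I s" by (rule that)
  next
    fix s assume I: "?I s" and bv: "bval K (NLess (NConst 0) (NVar 1)) s"
    then obtain k j where kj: "k + j * nvar s 1 = m" "?B k j s" by blast
    have A: "?A s" using I by blast
    have pos: "nvar s 1 > 0" using bv by simp
    have bits: "bits (nvar s 1) = Suc (bits (nvar s 1 div 2))" using pos by (subst bits.simps) simp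
    let ?k = "if nvar s 1 mod 2 > 0 then k + j else k"
    have keq: "?k + (j + j) * (nvar s 1 div 2) = m"
    proof -
      define h where "h = nvar s 1 div 2"
      show ?thesis
      proof (cases "nvar s 1 mod 2 > 0")
        case True
        then have nv: "nvar s 1 = Suc (2 * h)" unfolding h_def by presburger
        show ?thesis using True kj(1) unfolding h_def[symmetric] nv by (simp add: algebra_simps)
      next
        case False
        then have nv: "nvar s 1 = 2 * h" unfolding h_def by presburger
        show ?thesis using False kj(1) unfolding h_def[symmetric] nv by (simp add: algebra_simps)
      qed
    qed
    have fin: "?I s2 \<and> nvar s2 1 < nvar s 1"
      if "?A s2" "nvar s2 1 = nvar s 1 div 2" "?B ?k (j + j) s2" "ops s2 \<le> ops s + 2 * cc" for s2
    proof -
      have "\<exists>k j. k + j * nvar s2 1 = m \<and> ?B k j s2"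
        by (rule exI[of _ ?k], rule exI[of _ "j + j"]) (use keq that in simp)
      then show ?thesis using that I bits pos by simp
    qed
    have step2: "wp K orc (Seq (combine_prog cM cC 1 2 3 1 2 3) (NAssign 1 (NDiv (NVar 1) (NConst 2)))) (\<lambda>s'. ?I s' \<and> nvar s' 1 < nvar s 1) s1"
      if s1: "?A s1" "nvar s1 1 = nvar s 1" "?B ?k j s1" "ops s1 \<le> ops s + cc" for s1
      apply (rule wp_Seq)
      apply (rule wp_combine[where j = "sd * j" and ?N1.0 = "?N j" and ?S1.0 = "?S j" and ?X2.0 = "?x j" and ?N2.0 = "?N j" and ?S2.0 = "?S j"])
                          apply (use s1 cl in \<open>simp_all only: addx addN addS\<close>)
        apply simp
       apply simp
      apply (subst wp_atomic, rule fin)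
         apply (use s1 in simp_all)
      done
    show "wp K orc ?body (\<lambda>s'. ?I s' \<and> nvar s' 1 < nvar s 1) s"
    proof (rule wp_Seq, cases "nvar s 1 mod 2 > 0")
      case True
      have "wp K orc (combine_prog cM cC 6 7 8 1 2 3) (wp K orc (Seq (combine_prog cM cC 1 2 3 1 2 3) (NAssign 1 (NDiv (NVar 1) (NConst 2)))) (\<lambda>s'. ?I s' \<and> nvar s' 1 < nvar s 1)) s"
        apply (rule wp_combine[where j = "sd * k" and ?N1.0 = "?N k" and ?S1.0 = "?S k" and ?X2.0 = "?x j" and ?N2.0 = "?N j" and ?S2.0 = "?S j"])
                          apply (use A kj cl in \<open>simp_all only: addx addN addS\<close>)
          apply simp
         apply simp
        apply (rule step2)
           apply (use A kj True in simp_all)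
        done
      then show "wp K orc (IfThen (NLess (NConst 0) (NMod (NVar 1) (NConst 2))) (combine_prog cM cC 6 7 8 1 2 3) Skip)
        (wp K orc (Seq (combine_prog cM cC 1 2 3 1 2 3) (NAssign 1 (NDiv (NVar 1) (NConst 2)))) (\<lambda>s'. ?I s' \<and> nvar s' 1 < nvar s 1)) s"
        using True by simp
    next
      case False
      have "wp K orc (Seq (combine_prog cM cC 1 2 3 1 2 3) (NAssign 1 (NDiv (NVar 1) (NConst 2)))) (\<lambda>s'. ?I s' \<and> nvar s' 1 < nvar s 1) s"
        by (rule step2) (use A kj False in simp_all)
      then show "wp K orc (IfThen (NLess (NConst 0) (NMod (NVar 1) (NConst 2))) (combine_prog cM cC 6 7 8 1 2 3) Skip)
        (wp K orc (Seq (combine_prog cM cC 1 2 3 1 2 3) (NAssign 1 (NDiv (NVar 1) (NConst 2)))) (\<lambda>s'. ?I s' \<and> nvar s' 1 < nvar s 1)) s"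
        using False by simp
    qed
  next
    fix s assume I: "?I s" and bv: "\<not> bval K (NLess (NConst 0) (NVar 1)) s"
    then obtain k j where kj: "k + j * nvar s 1 = m" "?B k j s" by blast
    then have "k = m" using bv by simp
    then show "?A s \<and> ops s \<le> u + (2 * cc * bits m + 1) \<and> farr s 7 = arr (?N m) \<and> farr s 8 = arr (?S m)"
      using kj I by simp
  qed
  have exit: "wp K orc (IfThen (NLess (NConst 0) (NVar 2)) (Call [NConst 0, NVar 0] [9, 7] slice_prog 3 0)
      (Call [NConst 0, NVar 0] [9, 8] slice_prog 3 0)) ?R s"
    if s: "?A s \<and> ops s \<le> u + (2 * cc * bits m + 1) \<and> farr s 7 = arr (?N m) \<and> farr s 8 = arr (?S m)" for s
  proof (cases "flag > 0")
    case True
    have "wp K orc (Call [NConst 0, NVar 0] [9, 7] slice_prog 3 0) ?R s"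
      by (rule wp_Call'[OF computes_copy[OF cl(2)[of m]]]) (use s True in simp_all)
    then show ?thesis using s True by simp
  next
    case False
    have "wp K orc (Call [NConst 0, NVar 0] [9, 8] slice_prog 3 0) ?R s"
      by (rule wp_Call'[OF computes_copy[OF cl(3)[of m]]]) (use s False in simp_all)
    then show ?thesis using s False by simp
  qed
  show "wp K orc (double_prog cM cC) ?R (frame K [dg, m, flag] [zarr, arr (gen [^]\<^bsub>L\<^esub> (p ^ sd)), arr b, arr c, fa, ja, arr gen] u l)"
    unfolding double_prog_def wp_Seq_atomic
    apply (rule wp_Seq)
    apply (rule wp_mono[OF loop])
     apply (simp add: set_cell_def get_cell_def set_one_arr K.minus_eq)
     apply (rule conjI, simp add: arr_one)
     apply (rule exI[of _ 0], rule exI[of _ 1])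
     apply (use b c in \<open>simp add: arr_zero_fun\<close>)
    apply (erule exit)
    done
qed

end

section \<open>Computing minimal polynomials\<close>

text \<open>Only the constant coordinate of each power is kept. The cells are filled from the top,
  the order that \<open>generating_function\<close> expects.\<close>

definition powers_prog :: "com \<Rightarrow> com" where
  "powers_prog cM = Seq (SetOne (4, NConst 0)) (For 2 (NVar 1)
     (Seq (Copy (0, NSub (NSub (NVar 1) (NConst 1)) (NVar 2)) (4, NConst 0))
          (Call [NVar 0] [5, 4, 1, 2, 3] (mulmod_prog cM) 3 4)))"

context field_machine begin

lemma computes_powers:
  assumes y: "y \<in> carrier L"
  shows "computes K orc (powers_prog cM) [dg, N] [zarr, arr y, fa, ja]
    (\<lambda>i. if i < N then arr (y [^]\<^bsub>L\<^esub> (N - 1 - i)) 0 else \<zero>\<^bsub>K\<^esub>) (mm * N)"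
  unfolding computes_def
proof (intro allI)
  fix u l
  let ?A = "\<lambda>j i. if i < N \<and> N - 1 - i < j then arr (y [^]\<^bsub>L\<^esub> (N - 1 - i)) 0 else \<zero>\<^bsub>K\<^esub>"
  let ?I = "\<lambda>j s. nvar s 0 = dg \<and> nvar s 1 = N \<and> farr s 0 = ?A j \<and> farr s 1 = arr y \<and> farr s 2 = fa \<and> farr s 3 = ja \<and>
      farr s 4 = arr (y [^]\<^bsub>L\<^esub> j) \<and> farr s 5 = zarr \<and> ops s \<le> u + mm * j \<and> calls s = l"
  show "wp K orc (powers_prog cM) (\<lambda>s. farr s 0 = (\<lambda>i. if i < N then arr (y [^]\<^bsub>L\<^esub> (N - 1 - i)) 0 else \<zero>\<^bsub>K\<^esub>) \<and> ops s \<le> u + mm * N \<and> calls s = l)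
     (frame K [dg, N] [zarr, arr y, fa, ja] u l)"
    unfolding powers_prog_def wp_Seq_atomic
  proof (rule wp_For[where k = N and I = ?I])
    show "?I 0 (set_cell (frame K [dg, N] [zarr, arr y, fa, ja] u l) (4, NConst 0) \<one>\<^bsub>K\<^esub>
        \<lparr>nvar := (nvar (set_cell (frame K [dg, N] [zarr, arr y, fa, ja] u l) (4, NConst 0) \<one>\<^bsub>K\<^esub>))(2 := 0)\<rparr>)"
      by (simp add: set_cell_def set_one_arr)
  next
    fix j s assume "?I j s" then show "nval (nvar s) (NVar 1) = N" by simp
  next
    fix j and s :: "int store" assume j: "j < N" and I: "?I j s" and i: "nvar s 2 = j"
    have upd: "(?A j)(N - Suc j := arr (y [^]\<^bsub>L\<^esub> j) 0) = ?A (Suc j)"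
      using j by (auto simp: fun_eq_iff)
    have cl: "y [^]\<^bsub>L\<^esub> j \<in> carrier L" using y by simp
    show "wp K orc (Seq (Copy (0, NSub (NSub (NVar 1) (NConst 1)) (NVar 2)) (4, NConst 0)) (Call [NVar 0] [5, 4, 1, 2, 3] (mulmod_prog cM) 3 4))
      (\<lambda>s'. nvar s' 2 = j \<and> ?I (Suc j) (s'\<lparr>nvar := (nvar s')(2 := Suc j)\<rparr>)) s"
      unfolding wp_Seq_atomic
    proof (rule wp_Call'[OF computes_mulmod_L[OF cl y]])
      fix v k assume k: "k \<le> ops (set_cell s (0, NSub (NSub (NVar 1) (NConst 1)) (NVar 2)) (get_cell s (4, NConst 0))) + mm"
      let ?s = "set_cell s (0, NSub (NSub (NVar 1) (NConst 1)) (NVar 2)) (get_cell s (4, NConst 0))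
        \<lparr>nvar := (nvar (set_cell s (0, NSub (NSub (NVar 1) (NConst 1)) (NVar 2)) (get_cell s (4, NConst 0))))(3 := v),
         farr := (farr (set_cell s (0, NSub (NSub (NVar 1) (NConst 1)) (NVar 2)) (get_cell s (4, NConst 0))))(4 := arr (y [^]\<^bsub>L\<^esub> j \<otimes>\<^bsub>L\<^esub> y)), ops := k\<rparr>"
      have f0: "farr ?s 0 = ?A (Suc j)" using I i upd by (simp add: set_cell_def get_cell_def)
      have "nvar ?s 2 = j \<and> nvar ?s 0 = dg \<and> nvar ?s 1 = N \<and> farr ?s 1 = arr y \<and> farr ?s 2 = fa \<and> farr ?s 3 = ja \<and>
        farr ?s 4 = arr (y [^]\<^bsub>L\<^esub> Suc j) \<and> farr ?s 5 = zarr \<and> ops ?s \<le> u + mm * Suc j \<and> calls ?s = l"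
        using I i k by (simp add: set_cell_def get_cell_def)
      with f0 show "nvar ?s 2 = j \<and> ?I (Suc j) (?s\<lparr>nvar := (nvar ?s)(2 := Suc j)\<rparr>)" by (simp only: store.simps fun_upd_apply) simp
    qed (use I in \<open>simp_all add: set_cell_def get_cell_def\<close>)
  next
    fix s assume "?I N s"
    then show "farr s 0 = (\<lambda>i. if i < N then arr (y [^]\<^bsub>L\<^esub> (N - 1 - i)) 0 else \<zero>\<^bsub>K\<^esub>) \<and> ops s \<le> u + mm * N \<and> calls s = l"
      by (auto simp: fun_eq_iff)
  qed
qed

end

section \<open>The extended Euclidean algorithm, stopped half way\<close>

text \<open>Cancels a single leading term and repeats the operation on the cofactor. The width 2s +
  1 suffices for remainders and cofactors alike, so each step has the same cost bound.\<close>

definition reduce_prog :: "nat \<Rightarrow> nat \<Rightarrow> nat \<Rightarrow> nat \<Rightarrow> nat \<Rightarrow> nat \<Rightarrow> com" where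
  "reduce_prog rA vA rB vB lA lB =
    Seq (Arith FDiv (6, NConst 0) (rA, NSub (NVar lA) (NConst 1)) (rB, NSub (NVar lB) (NConst 1)))
   (Seq (Call [NSub (NVar lA) (NVar lB), NAdd (NMul (NConst 2) (NVar 0)) (NConst 1)] [5, rA, rB, 6] axpy_prog 3 rA)
   (Seq (Call [NSub (NVar lA) (NVar lB), NAdd (NMul (NConst 2) (NVar 0)) (NConst 1)] [5, vA, vB, 6] axpy_prog 3 vA)
        (NAssign lA (NSub (NVar lA) (NConst 1)))))"

text \<open>One row is X^(2s) with cofactor 0 in arrays 2 and 3, its length bounded by variable 1;
  the other is U with cofactor 1 in arrays 1 and 4, bounded by variable 2. These are bounds and not
  exact lengths, so zero top cells are dropped one at a time.\<close>

definition euclid_prog :: com where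
  "euclid_prog =
    Seq (SetOne (2, NMul (NConst 2) (NVar 0)))
   (Seq (SetOne (4, NConst 0))
   (Seq (NAssign 1 (NAdd (NMul (NConst 2) (NVar 0)) (NConst 1)))
   (Seq (NAssign 2 (NMul (NConst 2) (NVar 0)))
   (Seq (While (BAnd (NLess (NVar 0) (NVar 1)) (NLess (NVar 0) (NVar 2)))
      (IfThen (IsZero (2, NSub (NVar 1) (NConst 1))) (NAssign 1 (NSub (NVar 1) (NConst 1)))
      (IfThen (IsZero (1, NSub (NVar 2) (NConst 1))) (NAssign 2 (NSub (NVar 2) (NConst 1)))
      (IfThen (NLess (NVar 1) (NVar 2)) (reduce_prog 1 4 2 3 2 1) (reduce_prog 2 3 1 4 1 2)))))
   (IfThen (NLess (NVar 0) (NVar 2))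
      (Call [NConst 0, NAdd (NMul (NConst 2) (NVar 0)) (NConst 1)] [5, 3] slice_prog 3 0)
      (Call [NConst 0, NAdd (NMul (NConst 2) (NVar 0)) (NConst 1)] [5, 4] slice_prog 3 0))))))"

context base_field begin

text \<open>The cofactor w of X^(2s) is a ghost: the program never computes it, but it is needed to
  express the relation and the determinant.\<close>

definition euclid_row :: "nat \<Rightarrow> 'k list \<Rightarrow> 'k list \<Rightarrow> 'k list \<Rightarrow> 'k list \<Rightarrow> nat \<Rightarrow> bool" where
  "euclid_row N U r v w k \<longleftrightarrow> r \<in> carrier PR \<and> v \<in> carrier PR \<and> w \<in> carrier PR \<and>
     r = v \<otimes>\<^bsub>PR\<^esub> U \<oplus>\<^bsub>PR\<^esub> xp N \<otimes>\<^bsub>PR\<^esub> w \<and> length r \<le> k"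

text \<open>The bounds are complementary: the cofactor of one row is limited by the remainder length
  of the other. When one row reaches length s the other is still longer than s, so the cofactor of
  the short row has length at most s + 1, as \<open>rational_reconstruction\<close>
  requires.\<close>

definition euclid_inv :: "nat \<Rightarrow> 'k list \<Rightarrow> 'k list \<Rightarrow> 'k list \<Rightarrow> 'k list \<Rightarrow> nat \<Rightarrow> 'k list \<Rightarrow> 'k list \<Rightarrow> 'k list \<Rightarrow> nat \<Rightarrow> bool" where
  "euclid_inv s U rA vA wA a rB vB wB b \<longleftrightarrow>
     euclid_row (2 * s) U rA vA wA a \<and> euclid_row (2 * s) U rB vB wB b \<and>
     vA \<otimes>\<^bsub>PR\<^esub> wB \<ominus>\<^bsub>PR\<^esub> vB \<otimes>\<^bsub>PR\<^esub> wA \<in> Units PR \<and>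
     length vB + a \<le> 2 * s + 2 \<and> length vA + b \<le> 2 * s + 2 \<and>
     s \<le> a \<and> s \<le> b \<and> (s < a \<or> s < b) \<and> a \<le> 2 * s + 1 \<and> b \<le> 2 * s + 1"

lemma PR_uminus_Units: "x \<in> Units PR \<Longrightarrow> \<ominus>\<^bsub>PR\<^esub> x \<in> Units PR"
proof -
  interpret P: domain PR by (rule PR_domain)
  assume x: "x \<in> Units PR"
  then obtain y where "y \<in> carrier PR" "x \<otimes>\<^bsub>PR\<^esub> y = \<one>\<^bsub>PR\<^esub>" using P.Units_r_inv_ex by blast
  then show ?thesis using P.Units_closed[OF x] P.m_comm
    by (auto simp: Units_def P.l_minus P.r_minus intro!: bexI[of _ "\<ominus>\<^bsub>PR\<^esub> y"])
qed

lemma euclid_inv_swap: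
  assumes "euclid_inv s U rA vA wA a rB vB wB b" shows "euclid_inv s U rB vB wB b rA vA wA a"
proof -
  interpret P: domain PR by (rule PR_domain)
  have cl: "vA \<in> carrier PR" "wA \<in> carrier PR" "vB \<in> carrier PR" "wB \<in> carrier PR"
    using assms by (auto simp: euclid_inv_def euclid_row_def)
  have "vB \<otimes>\<^bsub>PR\<^esub> wA \<ominus>\<^bsub>PR\<^esub> vA \<otimes>\<^bsub>PR\<^esub> wB = \<ominus>\<^bsub>PR\<^esub> (vA \<otimes>\<^bsub>PR\<^esub> wB \<ominus>\<^bsub>PR\<^esub> vB \<otimes>\<^bsub>PR\<^esub> wA)" using cl by algebra
  then show ?thesis using assms PR_uminus_Units by (auto simp: euclid_inv_def)
qed

lemma length_shrink:
  assumes "r \<in> carrier PR" "length r \<le> a" "coeff r (a - 1) = \<zero>" "a \<ge> 1" shows "length r \<le> a - 1"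
proof -
  have "coeff r i = \<zero>" if "i \<ge> a - 1" for i
    using that assms coeff_length[of r i] by (cases "i = a - 1") auto
  then show ?thesis using PR_length_le_iff[OF assms(1)] by blast
qed

lemma euclid_inv_shrink:
  assumes inv: "euclid_inv s U rA vA wA a rB vB wB b" and "coeff rA (a - 1) = \<zero>" "s < a" "s < b"
  shows "euclid_inv s U rA vA wA (a - 1) rB vB wB b"
proof -
  have "length rA \<le> a - 1" by (rule length_shrink) (use assms in \<open>auto simp: euclid_inv_def euclid_row_def\<close>)
  then show ?thesis using assms by (auto simp: euclid_inv_def euclid_row_def)
qed

lemma euclid_inv_reduce:
  assumes inv: "euclid_inv s U rA vA wA a rB vB wB b" and U: "U \<in> carrier PR" and lt: "s < a" "s < b" "b \<le> a"
    and nz: "coeff rB (b - 1) \<noteq> \<zero>"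
  defines "q \<equiv> coeff rA (a - 1) \<otimes> inv (coeff rB (b - 1))"
  defines "red \<equiv> \<lambda>A B. A \<ominus>\<^bsub>PR\<^esub> poly_of_const q \<otimes>\<^bsub>PR\<^esub> (xp (a - b) \<otimes>\<^bsub>PR\<^esub> B)"
  shows "euclid_inv s U (red rA rB) (red vA vB) (red wA wB) (a - 1) rB vB wB b"
    and "length (red rA rB) \<le> 2 * s + 1" "length (red vA vB) \<le> 2 * s + 1" "q \<in> carrier K"
proof -
  interpret P: domain PR by (rule PR_domain)
  have cl: "rA \<in> carrier PR" "vA \<in> carrier PR" "wA \<in> carrier PR" "rB \<in> carrier PR" "vB \<in> carrier PR" "wB \<in> carrier PR"
    and eqs: "rA = vA \<otimes>\<^bsub>PR\<^esub> U \<oplus>\<^bsub>PR\<^esub> xp (2 * s) \<otimes>\<^bsub>PR\<^esub> wA" "rB = vB \<otimes>\<^bsub>PR\<^esub> U \<oplus>\<^bsub>PR\<^esub> xp (2 * s) \<otimes>\<^bsub>PR\<^esub> wB"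
    and len: "length rA \<le> a" "length rB \<le> b" "length vB + a \<le> 2 * s + 2" "length vA + b \<le> 2 * s + 2" "a \<le> 2 * s + 1" "b \<le> 2 * s + 1"
    and det: "vA \<otimes>\<^bsub>PR\<^esub> wB \<ominus>\<^bsub>PR\<^esub> vB \<otimes>\<^bsub>PR\<^esub> wA \<in> Units PR"
    using inv by (auto simp: euclid_inv_def euclid_row_def)
  have iB: "inv (coeff rB (b - 1)) \<in> carrier K" "inv (coeff rB (b - 1)) \<otimes> coeff rB (b - 1) = \<one>"
    using nz cl(4) field_Units by (auto intro!: Units_l_inv)
  show q: "q \<in> carrier K" using iB cl by (simp add: q_def)
  let ?z = "poly_of_const q \<otimes>\<^bsub>PR\<^esub> xp (a - b)"
  have z: "?z \<in> carrier PR" using q by simp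
  have red: "red A B = A \<ominus>\<^bsub>PR\<^esub> ?z \<otimes>\<^bsub>PR\<^esub> B" if "A \<in> carrier PR" "B \<in> carrier PR" for A B
    using that q by (simp add: red_def P.m_assoc)
  have red_cl: "red A B \<in> carrier PR" if "A \<in> carrier PR" "B \<in> carrier PR" for A B using that z by (simp add: red)
  have red_coeff: "coeff (red A B) i = (if i < a - b then coeff A i else coeff A i \<ominus> q \<otimes> coeff B (i - (a - b)))"
    if "A \<in> carrier PR" "B \<in> carrier PR" for A B i
    using that q by (simp add: red_def coeff_minus coeff_const_mult coeff_xp_mult) (simp add: minus_eq)
  have top: "coeff (red rA rB) (a - 1) = \<zero>"
  proof -
    have "a - 1 - (a - b) = b - 1" "\<not> a - 1 < a - b" using lt by auto
    then have "coeff (red rA rB) (a - 1) = coeff rA (a - 1) \<ominus> q \<otimes> coeff rB (b - 1)" using red_coeff[OF cl(1,4), of "a - 1"] by simp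
    also have "q \<otimes> coeff rB (b - 1) = coeff rA (a - 1)" using cl iB by (simp add: q_def m_assoc)
    finally show ?thesis using cl by simp
  qed
  have "length (red rA rB) \<le> a"
    by (subst PR_length_le_iff[OF red_cl[OF cl(1,4)]]) (use red_coeff[OF cl(1,4)] len lt q cl in \<open>auto simp: coeff_length minus_eq\<close>)
  then have lr: "length (red rA rB) \<le> a - 1" using top lt by (intro length_shrink[OF red_cl[OF cl(1,4)]]) auto
  then show "length (red rA rB) \<le> 2 * s + 1" using len by simp
  \<comment> \<open>Shifting \<open>vB\<close> by a - b turns its bound 2s + 2 - a into 2s + 2 - b,
    which is already the bound for \<open>vA\<close>.\<close>
  have "length (red vA vB) \<le> 2 * s + 2 - b"
    by (subst PR_length_le_iff[OF red_cl[OF cl(2,5)]]) (use red_coeff[OF cl(2,5)] len lt q cl in \<open>auto simp: coeff_length minus_eq\<close>)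
  then have lv: "length (red vA vB) + b \<le> 2 * s + 2" using len by simp
  then show "length (red vA vB) \<le> 2 * s + 1" using lt by simp
  have eq: "red rA rB = red vA vB \<otimes>\<^bsub>PR\<^esub> U \<oplus>\<^bsub>PR\<^esub> xp (2 * s) \<otimes>\<^bsub>PR\<^esub> red wA wB"
  proof -
    have "(vA \<otimes>\<^bsub>PR\<^esub> U \<oplus>\<^bsub>PR\<^esub> y \<otimes>\<^bsub>PR\<^esub> wA) \<ominus>\<^bsub>PR\<^esub> z \<otimes>\<^bsub>PR\<^esub> (vB \<otimes>\<^bsub>PR\<^esub> U \<oplus>\<^bsub>PR\<^esub> y \<otimes>\<^bsub>PR\<^esub> wB) =
       (vA \<ominus>\<^bsub>PR\<^esub> z \<otimes>\<^bsub>PR\<^esub> vB) \<otimes>\<^bsub>PR\<^esub> U \<oplus>\<^bsub>PR\<^esub> y \<otimes>\<^bsub>PR\<^esub> (wA \<ominus>\<^bsub>PR\<^esub> z \<otimes>\<^bsub>PR\<^esub> wB)"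
      if "y \<in> carrier PR" "z \<in> carrier PR" for y z using that cl U by algebra
    note t = this[OF xp_closed[of "2 * s"] z]
    show ?thesis unfolding red[OF cl(1,4)] red[OF cl(2,5)] red[OF cl(3,6)]
      by (subst eqs(1), subst eqs(2)) (rule t)
  qed
  have "red vA vB \<otimes>\<^bsub>PR\<^esub> wB \<ominus>\<^bsub>PR\<^esub> vB \<otimes>\<^bsub>PR\<^esub> red wA wB = vA \<otimes>\<^bsub>PR\<^esub> wB \<ominus>\<^bsub>PR\<^esub> vB \<otimes>\<^bsub>PR\<^esub> wA"
  proof -
    have "(vA \<ominus>\<^bsub>PR\<^esub> z \<otimes>\<^bsub>PR\<^esub> vB) \<otimes>\<^bsub>PR\<^esub> wB \<ominus>\<^bsub>PR\<^esub> vB \<otimes>\<^bsub>PR\<^esub> (wA \<ominus>\<^bsub>PR\<^esub> z \<otimes>\<^bsub>PR\<^esub> wB) = vA \<otimes>\<^bsub>PR\<^esub> wB \<ominus>\<^bsub>PR\<^esub> vB \<otimes>\<^bsub>PR\<^esub> wA"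
      if "z \<in> carrier PR" for z using that cl by algebra
    from this[OF z] show ?thesis unfolding red[OF cl(2,5)] red[OF cl(3,6)] .
  qed
  then have det': "red vA vB \<otimes>\<^bsub>PR\<^esub> wB \<ominus>\<^bsub>PR\<^esub> vB \<otimes>\<^bsub>PR\<^esub> red wA wB \<in> Units PR" using det by simp
  have "euclid_row (2 * s) U (red rA rB) (red vA vB) (red wA wB) (a - 1)"
    unfolding euclid_row_def using eq lr red_cl cl by blast
  then show "euclid_inv s U (red rA rB) (red vA vB) (red wA wB) (a - 1) rB vB wB b"
    using inv det' lv lt by (auto simp: euclid_inv_def)
qed

text \<open>The two tuples in \<open>idx\<close> are the two directions of reduction; listing them
  concretely lets simplification decide which arrays coincide.\<close>

lemma wp_reduce:
  assumes idx: "(rA', vA', rB', vB', lA, lB) \<in> {(2, 3, 1, 4, 1, 2), (1, 4, 2, 3, 2, 1)}"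
    and inv: "euclid_inv s U rA vA wA (nvar st lA) rB vB wB (nvar st lB)" and U: "U \<in> carrier PR"
    and lt: "s < nvar st lA" "s < nvar st lB" "nvar st lB \<le> nvar st lA"
    and nz: "coeff rB (nvar st lB - 1) \<noteq> \<zero>"
    and st: "nvar st 0 = s" "farr st 5 = (\<lambda>_. \<zero>)" "farr st rA' = coeff rA" "farr st vA' = coeff vA" "farr st rB' = coeff rB" "farr st vB' = coeff vB"
    and post: "\<And>st' r v w. \<lbrakk>euclid_inv s U r v w (nvar st' lA) rB vB wB (nvar st' lB); farr st' rA' = coeff r; farr st' vA' = coeff v;
       farr st' rB' = coeff rB; farr st' vB' = coeff vB; nvar st' 0 = s; nvar st' lA = nvar st lA - 1; nvar st' lB = nvar st lB;
       farr st' 5 = (\<lambda>_. \<zero>); farr st' 0 = farr st 0; ops st' \<le> ops st + (8 * s + 5)\<rbrakk> \<Longrightarrow> Q st'"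
  shows "wp K orc (reduce_prog rA' vA' rB' vB' lA lB) Q st"
proof -
  let ?a = "nvar st lA" and ?b = "nvar st lB"
  define q where "q = coeff rA (?a - 1) \<otimes> inv (coeff rB (?b - 1))"
  let ?red = "\<lambda>A B. A \<ominus>\<^bsub>PR\<^esub> poly_of_const q \<otimes>\<^bsub>PR\<^esub> (xp (?a - ?b) \<otimes>\<^bsub>PR\<^esub> B)"
  note red = euclid_inv_reduce[OF inv U lt nz, folded q_def]
  have cl: "rA \<in> carrier PR" "vA \<in> carrier PR" "rB \<in> carrier PR" "vB \<in> carrier PR"
    using inv by (auto simp: euclid_inv_def euclid_row_def)
  let ?qa = "(farr st 6)(0 := q)"
  have s1: "computes K orc axpy_prog [?a - ?b, 2 * s + 1] [\<lambda>_. \<zero>, coeff rA, coeff rB, ?qa] (coeff (?red rA rB)) (2 * (2 * s + 1))"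
    by (rule computes_axpy[OF cl(1,3) red(4)]) (use red(2) in auto)
  have s2: "computes K orc axpy_prog [?a - ?b, 2 * s + 1] [\<lambda>_. \<zero>, coeff vA, coeff vB, ?qa] (coeff (?red vA vB)) (2 * (2 * s + 1))"
    by (rule computes_axpy[OF cl(2,4) red(4)]) (use red(3) in auto)
  have g: "get_cell st (rB', NSub (NVar lB) (NConst 1)) = coeff rB (?b - 1)" "get_cell st (rA', NSub (NVar lA) (NConst 1)) = coeff rA (?a - 1)"
    using st by (simp_all add: get_cell_def)
  show ?thesis unfolding reduce_prog_def
    apply (rule wp_Seq)
    apply (subst wp_FDiv)
     apply (subst g(1), rule nz)
    apply (unfold g q_def[symmetric])
    apply (rule wp_Seq_Call[OF s1])
      apply (use idx st in \<open>auto simp: set_cell_def\<close>)[1]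
     apply (use idx st in \<open>auto simp: set_cell_def\<close>)[1]
    apply (rule wp_Seq_Call[OF s2])
      apply (use idx st in \<open>auto simp: set_cell_def\<close>)[1]
     apply (use idx st in \<open>auto simp: set_cell_def\<close>)[1]
    apply (subst wp_atomic)
    apply (rule post[of "?red rA rB" "?red vA vB" "?red wA wB"])
              apply (use idx st red(1) in \<open>auto simp: set_cell_def\<close>)
    done
qed

text \<open>The resulting cofactor is only known to exist, hence a \<open>wp\<close> statement and
  not a \<open>computes\<close> contract. Counters start at zero, and \<open>computes_frame\<close>
  later lifts the run to arbitrary ones.\<close>

lemma wp_euclid:
  assumes U: "U \<in> carrier PR" "length U \<le> 2 * s" and s: "s \<ge> 1"
  shows "wp K orc euclid_prog (\<lambda>st. \<exists>r v w v' w'. farr st 0 = coeff v \<and> euclid_row (2 * s) U r v w s \<and> length v \<le> Suc s \<and>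
      v' \<in> carrier PR \<and> w' \<in> carrier PR \<and> v' \<otimes>\<^bsub>PR\<^esub> w \<ominus>\<^bsub>PR\<^esub> v \<otimes>\<^bsub>PR\<^esub> w' \<in> Units PR \<and> ops st \<le> (8 * s + 5) * (4 * s + 1))
    (frame K [s] [\<lambda>_. \<zero>, coeff U] 0 0)"
proof -
  interpret P: domain PR by (rule PR_domain)
  \<comment> \<open>The length bounds start with sum (2s + 1) + 2s = 4s + 1 and lose one per round.
    A round costs at most 8s + 5: one division and two \<open>axpy_prog\<close> calls of 2 (2s + 1)
    operations.\<close>
  let ?A = "\<lambda>st. nvar st 0 = s \<and> farr st 0 = (\<lambda>_. \<zero>) \<and> farr st 5 = (\<lambda>_. \<zero>) \<and> ops st + (8 * s + 5) * (nvar st 1 + nvar st 2) \<le> (8 * s + 5) * (4 * s + 1)"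
  let ?B = "\<lambda>r0 v0 w0 r1 v1 w1 st. farr st 2 = coeff r0 \<and> farr st 3 = coeff v0 \<and> farr st 1 = coeff r1 \<and> farr st 4 = coeff v1 \<and>
    euclid_inv s U r0 v0 w0 (nvar st 1) r1 v1 w1 (nvar st 2)"
  let ?I = "\<lambda>st. ?A st \<and> (\<exists>r0 v0 w0 r1 v1 w1. ?B r0 v0 w0 r1 v1 w1 st)"
  let ?b = "BAnd (NLess (NVar 0) (NVar 1)) (NLess (NVar 0) (NVar 2))"
  let ?body = "IfThen (IsZero (2, NSub (NVar 1) (NConst 1))) (NAssign 1 (NSub (NVar 1) (NConst 1)))
      (IfThen (IsZero (1, NSub (NVar 2) (NConst 1))) (NAssign 2 (NSub (NVar 2) (NConst 1)))
      (IfThen (NLess (NVar 1) (NVar 2)) (reduce_prog 1 4 2 3 2 1) (reduce_prog 2 3 1 4 1 2)))"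
  have loop: "wp K orc (While ?b ?body) (\<lambda>st. ?I st \<and> \<not> bval K ?b st) st" if "?I st" for st
  proof (rule wp_While[where I = ?I and m = "\<lambda>st. nvar st 1 + nvar st 2"])
    show "?I st" by (rule that)
  next
    fix st assume I: "?I st" and b: "bval K ?b st"
    then obtain r0 v0 w0 r1 v1 w1 where B: "?B r0 v0 w0 r1 v1 w1 st" by blast
    have A: "?A st" using I by blast
    have inv: "euclid_inv s U r0 v0 w0 (nvar st 1) r1 v1 w1 (nvar st 2)" using B by blast
    have lt: "s < nvar st 1" "s < nvar st 2" using b A by auto
    have dec: "(8 * s + 5) * (x + y) = (8 * s + 5) * (x - 1 + y) + (8 * s + 5)" "(8 * s + 5) * (x + y) = (8 * s + 5) * (x + (y - 1)) + (8 * s + 5)"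
      if "x \<ge> 1" "y \<ge> 1" for x y :: nat using that by (cases x; cases y; simp add: algebra_simps)+
    have "1 \<le> nvar st 1" "1 \<le> nvar st 2" using lt by auto
    note dec = dec[OF this]
    have fin: "?I st' \<and> nvar st' 1 + nvar st' 2 < nvar st 1 + nvar st 2"
      if "nvar st' 0 = s" "farr st' 0 = (\<lambda>_. \<zero>)" "farr st' 5 = (\<lambda>_. \<zero>)" "ops st' \<le> ops st + (8 * s + 5)" "?B r v w r' v' w' st'"
        "(nvar st' 1 = nvar st 1 - 1 \<and> nvar st' 2 = nvar st 2) \<or> (nvar st' 1 = nvar st 1 \<and> nvar st' 2 = nvar st 2 - 1)" for st' r v w r' v' w'
    proof -
      have "\<exists>r0 v0 w0 r1 v1 w1. ?B r0 v0 w0 r1 v1 w1 st'" using that(5) by blast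
      moreover have "ops st' + (8 * s + 5) * (nvar st' 1 + nvar st' 2) \<le> (8 * s + 5) * (4 * s + 1)"
        using that(6)
      proof (elim disjE conjE)
        assume e: "nvar st' 1 = nvar st 1 - 1" "nvar st' 2 = nvar st 2"
        show ?thesis unfolding e using that(4) A dec(1) by linarith
      next
        assume e: "nvar st' 1 = nvar st 1" "nvar st' 2 = nvar st 2 - 1"
        show ?thesis unfolding e using that(4) A dec(2) by linarith
      qed
      ultimately show ?thesis using that lt by auto
    qed
    show "wp K orc ?body (\<lambda>st'. ?I st' \<and> nvar st' 1 + nvar st' 2 < nvar st 1 + nvar st 2) st"
    proof -
      consider (z0) "coeff r0 (nvar st 1 - 1) = \<zero>" | (z1) "coeff r0 (nvar st 1 - 1) \<noteq> \<zero>" "coeff r1 (nvar st 2 - 1) = \<zero>"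
        | (lt) "coeff r0 (nvar st 1 - 1) \<noteq> \<zero>" "coeff r1 (nvar st 2 - 1) \<noteq> \<zero>" "nvar st 1 < nvar st 2"
        | (ge) "coeff r0 (nvar st 1 - 1) \<noteq> \<zero>" "coeff r1 (nvar st 2 - 1) \<noteq> \<zero>" "nvar st 2 \<le> nvar st 1" by linarith
      moreover have c: "bval K (IsZero (2, NSub (NVar 1) (NConst 1))) st = (coeff r0 (nvar st 1 - 1) = \<zero>)"
        "bval K (IsZero (1, NSub (NVar 2) (NConst 1))) st = (coeff r1 (nvar st 2 - 1) = \<zero>)"
        "bval K (NLess (NVar 1) (NVar 2)) st = (nvar st 1 < nvar st 2)"
        using B by (simp_all add: get_cell_def)
      ultimately show ?thesis
      proof cases
        case z0
        have "wp K orc (NAssign 1 (NSub (NVar 1) (NConst 1))) (\<lambda>st'. ?I st' \<and> nvar st' 1 + nvar st' 2 < nvar st 1 + nvar st 2) st"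
          by (subst wp_atomic, rule fin) (use A B euclid_inv_shrink[OF inv z0 lt] in simp_all)
        then show ?thesis by (simp only: wp_IfThen c z0 if_True simp_thms)
      next
        case z1
        have inv': "euclid_inv s U r0 v0 w0 (nvar st 1) r1 v1 w1 (nvar st 2 - 1)"
          by (rule euclid_inv_swap, rule euclid_inv_shrink[OF euclid_inv_swap[OF inv] z1(2) lt(2,1)])
        have "wp K orc (NAssign 2 (NSub (NVar 2) (NConst 1))) (\<lambda>st'. ?I st' \<and> nvar st' 1 + nvar st' 2 < nvar st 1 + nvar st 2) st"
          by (subst wp_atomic, rule fin) (use A B inv' in simp_all)
        then show ?thesis using z1(1) by (simp only: wp_IfThen c z1(2) if_True if_False simp_thms)
      next
        case lt
        have "wp K orc (reduce_prog 1 4 2 3 2 1) (\<lambda>st'. ?I st' \<and> nvar st' 1 + nvar st' 2 < nvar st 1 + nvar st 2) st"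
        proof (rule wp_reduce[OF _ euclid_inv_swap[OF inv] U(1)])
          fix st' :: "'k store" and r v w
          assume st': "euclid_inv s U r v w (nvar st' 2) r0 v0 w0 (nvar st' 1)" "farr st' 1 = coeff r" "farr st' 4 = coeff v"
            "farr st' 2 = coeff r0" "farr st' 3 = coeff v0" "nvar st' 0 = s" "nvar st' 2 = nvar st 2 - 1" "nvar st' 1 = nvar st 1"
            "farr st' 5 = (\<lambda>_. \<zero>)" "farr st' 0 = farr st 0" "ops st' \<le> ops st + (8 * s + 5)"
          show "?I st' \<and> nvar st' 1 + nvar st' 2 < nvar st 1 + nvar st 2"
            by (rule fin[of st' r0 v0 r v w0 w]) (use st' euclid_inv_swap[OF st'(1)] A in simp_all)
        qed (use A B b lt in simp_all)
        then show ?thesis using lt by (simp only: wp_IfThen c if_True if_False simp_thms)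
      next
        case ge
        have "wp K orc (reduce_prog 2 3 1 4 1 2) (\<lambda>st'. ?I st' \<and> nvar st' 1 + nvar st' 2 < nvar st 1 + nvar st 2) st"
        proof (rule wp_reduce[OF _ inv U(1)])
          fix st' :: "'k store" and r v w
          assume st': "euclid_inv s U r v w (nvar st' 1) r1 v1 w1 (nvar st' 2)" "farr st' 2 = coeff r" "farr st' 3 = coeff v"
            "farr st' 1 = coeff r1" "farr st' 4 = coeff v1" "nvar st' 0 = s" "nvar st' 1 = nvar st 1 - 1" "nvar st' 2 = nvar st 2"
            "farr st' 5 = (\<lambda>_. \<zero>)" "farr st' 0 = farr st 0" "ops st' \<le> ops st + (8 * s + 5)"
          show "?I st' \<and> nvar st' 1 + nvar st' 2 < nvar st 1 + nvar st 2"
            by (rule fin[of st' r v r1 v1 w w1]) (use st' A in simp_all)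
        qed (use A B b ge in simp_all)
        then show ?thesis using ge(1,2) leD[OF ge(3)] by (simp only: wp_IfThen c if_True if_False simp_thms)
      qed
    qed
  qed auto
  let ?R = "\<lambda>st. \<exists>r v w v' w'. farr st 0 = coeff v \<and> euclid_row (2 * s) U r v w s \<and> length v \<le> Suc s \<and>
      v' \<in> carrier PR \<and> w' \<in> carrier PR \<and> v' \<otimes>\<^bsub>PR\<^esub> w \<ominus>\<^bsub>PR\<^esub> v \<otimes>\<^bsub>PR\<^esub> w' \<in> Units PR \<and> ops st \<le> (8 * s + 5) * (4 * s + 1)"
  have exit: "wp K orc (IfThen (NLess (NVar 0) (NVar 2))
      (Call [NConst 0, NAdd (NMul (NConst 2) (NVar 0)) (NConst 1)] [5, 3] slice_prog 3 0)
      (Call [NConst 0, NAdd (NMul (NConst 2) (NVar 0)) (NConst 1)] [5, 4] slice_prog 3 0)) ?R st"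
    if st: "?I st \<and> \<not> bval K ?b st" for st
  proof -
    obtain r0 v0 w0 r1 v1 w1 where B: "?B r0 v0 w0 r1 v1 w1 st" using st by blast
    have A: "?A st" using st by blast
    have inv: "euclid_inv s U r0 v0 w0 (nvar st 1) r1 v1 w1 (nvar st 2)" using B by blast
    have copy: "computes K orc slice_prog [0, 2 * s + 1] [\<lambda>_. \<zero>, coeff v] (coeff v) 0" if "length v \<le> 2 * s + 1" for v
    proof -
      have "(\<lambda>i. if i < 2 * s + 1 then coeff v (i + 0) else \<zero>) = coeff v"
        using that coeff_length[of v] by (intro ext) (simp only: add_0_right, auto)
      then show ?thesis using computes_slice[of K orc 0 "2 * s + 1" "coeff v"] by simp
    qed
    show ?thesis
    proof (cases "s < nvar st 2")
      case True
      then have l0: "nvar st 1 = s" using st A inv by (auto simp: euclid_inv_def)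
      have lv: "length v0 \<le> Suc s" using inv True by (auto simp: euclid_inv_def)
      have row: "euclid_row (2 * s) U r0 v0 w0 s" using inv unfolding l0 euclid_inv_def by blast
      have det: "v1 \<otimes>\<^bsub>PR\<^esub> w0 \<ominus>\<^bsub>PR\<^esub> v0 \<otimes>\<^bsub>PR\<^esub> w1 \<in> Units PR" using euclid_inv_swap[OF inv] unfolding euclid_inv_def by blast
      have cl: "v1 \<in> carrier PR" "w1 \<in> carrier PR" using inv unfolding euclid_inv_def euclid_row_def by blast+
      have "wp K orc (Call [NConst 0, NAdd (NMul (NConst 2) (NVar 0)) (NConst 1)] [5, 3] slice_prog 3 0) ?R st"
      proof (rule wp_Call'[OF copy])
        show "length v0 \<le> 2 * s + 1" using lv by simp
        fix v j assume j: "j \<le> ops st + 0"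
        show "?R (st\<lparr>nvar := (nvar st)(3 := v), farr := (farr st)(0 := coeff v0), ops := j\<rparr>)"
          by (rule exI[where x = r0], rule exI[where x = v0], rule exI[where x = w0], rule exI[where x = v1], rule exI[where x = w1])
            (use j row det cl lv A in simp)
      qed (use A B in simp_all)
      then show ?thesis using True A by simp
    next
      case False
      then have l1: "nvar st 2 = s" "s < nvar st 1" using st A inv by (auto simp: euclid_inv_def)
      have lv: "length v1 \<le> Suc s" using inv l1 by (auto simp: euclid_inv_def)
      have row: "euclid_row (2 * s) U r1 v1 w1 s" using inv unfolding l1(1) euclid_inv_def by blast
      have det: "v0 \<otimes>\<^bsub>PR\<^esub> w1 \<ominus>\<^bsub>PR\<^esub> v1 \<otimes>\<^bsub>PR\<^esub> w0 \<in> Units PR" using inv unfolding euclid_inv_def by blast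
      have cl: "v0 \<in> carrier PR" "w0 \<in> carrier PR" using inv unfolding euclid_inv_def euclid_row_def by blast+
      have "wp K orc (Call [NConst 0, NAdd (NMul (NConst 2) (NVar 0)) (NConst 1)] [5, 4] slice_prog 3 0) ?R st"
      proof (rule wp_Call'[OF copy])
        show "length v1 \<le> 2 * s + 1" using lv by simp
        fix v j assume j: "j \<le> ops st + 0"
        show "?R (st\<lparr>nvar := (nvar st)(3 := v), farr := (farr st)(0 := coeff v1), ops := j\<rparr>)"
          by (rule exI[where x = r1], rule exI[where x = v1], rule exI[where x = w1], rule exI[where x = v0], rule exI[where x = w0])
            (use j row det cl lv A in simp)
      qed (use A B in simp_all)
      then show ?thesis using False A by simp
    qed
  qed
  have init: "euclid_inv s U (xp (2 * s)) \<zero>\<^bsub>PR\<^esub> \<one>\<^bsub>PR\<^esub> (2 * s + 1) U \<one>\<^bsub>PR\<^esub> \<zero>\<^bsub>PR\<^esub> (2 * s)"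
    using U s PR_uminus_Units[OF P.Units_one_closed] by (auto simp: euclid_inv_def euclid_row_def length_xp length_one P.minus_eq) (simp add: PR_zero)
  have xpf: "(\<lambda>_. \<zero>)(2 * s := \<one>) = coeff (xp (2 * s))" by (rule ext) (simp add: coeff_xp)
  show ?thesis unfolding euclid_prog_def wp_Seq_atomic
    apply (rule wp_Seq)
    apply (rule wp_mono[OF loop])
     apply (simp add: set_cell_def)
     apply (rule exI[of _ "xp (2 * s)"], rule conjI, rule xpf)
     apply (rule exI[of _ "\<zero>\<^bsub>PR\<^esub>"], rule conjI, simp add: PR_zero)
     apply (rule exI[of _ "\<one>\<^bsub>PR\<^esub>"], rule exI[of _ U], rule conjI, rule refl)
     apply (rule exI[of _ "\<one>\<^bsub>PR\<^esub>"], rule conjI, simp add: coeff_one)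
     apply (rule exI[of _ "\<zero>\<^bsub>PR\<^esub>"], use init in simp)
    apply (erule exit)
    done
qed

end

context field_machine begin

text \<open>\<open>generating_function\<close> presents the stored sequence as a fraction with
  denominator g, and \<open>rational_reconstruction\<close> shows that the computed cofactor agrees
  with g up to a unit.\<close>

lemma computes_minpoly:
  assumes y: "y \<in> carrier L" "y \<noteq> \<zero>\<^bsub>L\<^esub>" "y [^]\<^bsub>L\<^esub> (p ^ s) = y" and s: "s \<ge> 1"
  shows "\<exists>g. minpoly y g \<and> computes K orc euclid_prog [s] [zarr, \<lambda>i. if i < 2 * s then arr (y [^]\<^bsub>L\<^esub> (2 * s - 1 - i)) 0 else \<zero>\<^bsub>K\<^esub>]
     (K.coeff g) ((8 * s + 5) * (4 * s + 1))"
proof -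
  obtain g where g: "minpoly y g" using minpoly_exists[OF y(1)] by blast
  interpret G: prime_ext p g by (rule minpoly_field[OF y(1) g])
  have gc: "g \<in> carrier K.PR" using g by (simp add: minpoly_def)
  have d: "G.dg dvd s" using minpoly_subfield[OF y(1) g y(3)] by (simp add: G.dg_def)
  then have ds: "G.dg \<le> s" using s by (simp add: dvd_imp_le)
  define U where "U = read_poly K (2 * s) (\<lambda>i. arr (y [^]\<^bsub>L\<^esub> (2 * s - 1 - i)) 0)"
  have U: "U \<in> carrier K.PR" "length U \<le> 2 * s" unfolding U_def
    using y(1) by (auto intro!: K.read_poly_closed K.length_read_poly)
  have Uc: "(\<lambda>i. if i < 2 * s then arr (y [^]\<^bsub>L\<^esub> (2 * s - 1 - i)) 0 else \<zero>\<^bsub>K\<^esub>) = K.coeff U"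
    by (rule ext) (simp only: U_def K.coeff_read_poly)
  have "G.dg \<le> 2 * s" "1 \<le> 2 * s" using ds s by auto
  then obtain H w where H: "H \<in> carrier K.PR" "w \<in> carrier K.PR" "length H \<le> G.dg" "H \<noteq> []" "g \<otimes>\<^bsub>K.PR\<^esub> U = H \<oplus>\<^bsub>K.PR\<^esub> K.xp (2 * s) \<otimes>\<^bsub>K.PR\<^esub> w"
    using generating_function[OF y(1,2) g G.length_f] unfolding U_def by blast
  obtain st where st: "run K orc euclid_prog (frame K [s] [zarr, K.coeff U] 0 0) = return_spmf st"
    "\<exists>r v w v' w'. farr st 0 = K.coeff v \<and> K.euclid_row (2 * s) U r v w s \<and> length v \<le> Suc s \<and>
      v' \<in> carrier K.PR \<and> w' \<in> carrier K.PR \<and> v' \<otimes>\<^bsub>K.PR\<^esub> w \<ominus>\<^bsub>K.PR\<^esub> v \<otimes>\<^bsub>K.PR\<^esub> w' \<in> Units K.PR \<and> ops st \<le> (8 * s + 5) * (4 * s + 1)"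
    using K.wp_euclid[OF U s] unfolding wp_def by blast
  then obtain r v w1 v' w0 where v: "farr st 0 = K.coeff v" "K.euclid_row (2 * s) U r v w1 s" "length v \<le> Suc s"
      "v' \<in> carrier K.PR" "w0 \<in> carrier K.PR" "v' \<otimes>\<^bsub>K.PR\<^esub> w1 \<ominus>\<^bsub>K.PR\<^esub> v \<otimes>\<^bsub>K.PR\<^esub> w0 \<in> Units K.PR" "ops st \<le> (8 * s + 5) * (4 * s + 1)"
    by blast
  have row: "r \<in> carrier K.PR" "v \<in> carrier K.PR" "w1 \<in> carrier K.PR" "r = v \<otimes>\<^bsub>K.PR\<^esub> U \<oplus>\<^bsub>K.PR\<^esub> K.xp (2 * s) \<otimes>\<^bsub>K.PR\<^esub> w1" "length r \<le> s"
    using v(2) by (auto simp: K.euclid_row_def)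
  obtain c where c: "c \<in> Units K.PR" "v = g \<otimes>\<^bsub>K.PR\<^esub> c"
    using K.rational_reconstruction[OF gc minpoly_irreducible[OF y(1) g] G.length_f G.dg_pos ds U(1) H(1,3,4,2,5) row(1-3) v(4,5) row(4) v(6) row(5) v(3)] by blast
  have "deterministic euclid_prog"
    by (simp add: euclid_prog_def reduce_prog_def For_def axpy_prog_def slice_prog_def)
  then have "computes K orc euclid_prog [s] [zarr, K.coeff U] (farr st 0) ((8 * s + 5) * (4 * s + 1))"
    using computes_frame[OF _ st(1) v(7)] by blast
  then show ?thesis using minpoly_unit_mult[OF g c(1)] c(2) v(1) Uc by (intro exI[of _ v]) simp
qed

end

section \<open>Random elements\<close>

definition draw_prog :: com where
  "draw_prog = For 10 (NVar 1) (Random (10, NVar 10))"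

abbreviation draw_loop :: com where
  "draw_loop \<equiv> While (NLess (NVar 10) (NVar 1)) (Seq (Random (10, NVar 10)) (NAssign 10 (NAdd (NVar 10) (NConst 1))))"

text \<open>Describes only the support of the drawing loop; the values of the new cells stay open
  within the carrier, and probabilities are treated in \<open>draw_half\<close>.\<close>

definition drawn :: "'k ring \<Rightarrow> nat \<Rightarrow> nat \<Rightarrow> 'k store \<Rightarrow> 'k store \<Rightarrow> bool" where
  "drawn K n i st st' \<longleftrightarrow> (\<exists>c. st' = st\<lparr>nvar := (nvar st)(10 := n), farr := (farr st)(10 := c)\<rparr> \<and>
     (\<forall>k. (k < i \<or> k \<ge> n) \<longrightarrow> c k = farr st 10 k) \<and> (\<forall>k. i \<le> k \<and> k < n \<longrightarrow> c k \<in> carrier K))"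

text \<open>The distribution of the finished array is never written down. The second claim splits
  off one uniform draw, which allows probabilities to be bounded coordinate by coordinate.\<close>

lemma run_draw_loop:
  fixes K :: "'k ring"
  assumes fin: "finite (carrier K)" and ne: "carrier K \<noteq> {}"
  shows "nvar st 1 = n \<Longrightarrow> nvar st 10 = i \<Longrightarrow> i \<le> n \<Longrightarrow>
     lossless_spmf (run K orc draw_loop st) \<and> (\<forall>st'\<in>set_spmf (run K orc draw_loop st). drawn K n i st st')"
    and "nvar st 1 = n \<Longrightarrow> nvar st 10 = i \<Longrightarrow> i < n \<Longrightarrow>
     run K orc draw_loop st = bind_spmf (spmf_of_set (carrier K)) (\<lambda>v. run K orc draw_loop
        (st\<lparr>nvar := (nvar st)(10 := Suc i), farr := (farr st)(10 := (farr st 10)(i := v))\<rparr>))"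
proof -
  have unroll: "run K orc draw_loop st = bind_spmf (spmf_of_set (carrier K)) (\<lambda>v. run K orc draw_loop
        (st\<lparr>nvar := (nvar st)(10 := Suc i), farr := (farr st)(10 := (farr st 10)(i := v))\<rparr>))"
    if "nvar st 1 = n" "nvar st 10 = i" "i < n" for st :: "'k store" and i
  proof -
    let ?b = "bval K (NLess (NVar 10) (NVar 1))" and ?c = "run K orc (Seq (Random (10, NVar 10)) (NAssign 10 (NAdd (NVar 10) (NConst 1))))"
    have "?c st = map_spmf (\<lambda>v. st\<lparr>nvar := (nvar st)(10 := Suc i), farr := (farr st)(10 := (farr st 10)(i := v))\<rparr>) (spmf_of_set (carrier K))"
    proof -
      have swap: "st\<lparr>farr := A, nvar := N\<rparr> = st\<lparr>nvar := N, farr := A\<rparr>" for A N by (cases st) simp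
      show ?thesis using that by (simp add: bind_map_spmf o_def set_cell_def map_spmf_conv_bind_spmf swap)
    qed
    moreover have "run K orc draw_loop st = bind_spmf (?c st) (while_spmf ?b ?c)"
      unfolding run.simps(10) by (subst while_spmf.simps) (use that in simp)
    ultimately show ?thesis unfolding run.simps(10) by (simp only: bind_map_spmf o_def)
  qed
  show "run K orc draw_loop st = bind_spmf (spmf_of_set (carrier K)) (\<lambda>v. run K orc draw_loop
        (st\<lparr>nvar := (nvar st)(10 := Suc i), farr := (farr st)(10 := (farr st 10)(i := v))\<rparr>))"
    if "nvar st 1 = n" "nvar st 10 = i" "i < n" by (rule unroll[OF that])
  show "lossless_spmf (run K orc draw_loop st) \<and> (\<forall>st'\<in>set_spmf (run K orc draw_loop st). drawn K n i st st')"
    if "nvar st 1 = n" "nvar st 10 = i" "i \<le> n"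
    using that
  proof (induction "n - i" arbitrary: st i)
    case 0
    then have "i = n" by simp
    have "run K orc draw_loop st = return_spmf st" unfolding run.simps(10) by (subst while_spmf.simps) (use 0 in simp)
    moreover have "drawn K n i st st"
    proof -
      have "(nvar st)(10 := n) = nvar st" using 0 \<open>i = n\<close> by (simp add: fun_upd_idem)
      then show ?thesis unfolding drawn_def using \<open>i = n\<close> by (intro exI[of _ "farr st 10"]) auto
    qed
    ultimately show ?case by (simp del: run.simps)
  next
    case (Suc k)
    then have lt: "i < n" by simp
    let ?f = "\<lambda>v. st\<lparr>nvar := (nvar st)(10 := Suc i), farr := (farr st)(10 := (farr st 10)(i := v))\<rparr>"
    have IH: "lossless_spmf (run K orc draw_loop (?f v)) \<and> (\<forall>st'\<in>set_spmf (run K orc draw_loop (?f v)). drawn K n (Suc i) (?f v) st')" for v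
      by (rule Suc.hyps(1)) (use Suc lt in auto)
    have step: "drawn K n i st st'" if vd: "v \<in> carrier K" "drawn K n (Suc i) (?f v) st'" for v st'
    proof -
      obtain c where c: "st' = (?f v)\<lparr>nvar := (nvar (?f v))(10 := n), farr := (farr (?f v))(10 := c)\<rparr>"
        "\<forall>k. (k < Suc i \<or> k \<ge> n) \<longrightarrow> c k = farr (?f v) 10 k" "\<forall>k. Suc i \<le> k \<and> k < n \<longrightarrow> c k \<in> carrier K"
        using vd(2) unfolding drawn_def by blast
      have "c i = v" using c(2) by simp
      show ?thesis unfolding drawn_def
      proof (rule exI[of _ c], intro conjI allI impI)
        show "st' = st\<lparr>nvar := (nvar st)(10 := n), farr := (farr st)(10 := c)\<rparr>" using c(1) by simp
        show "c k = farr st 10 k" if "k < i \<or> k \<ge> n" for k using c(2) that lt by auto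
        show "c k \<in> carrier K" if "i \<le> k \<and> k < n" for k using c(3) that \<open>c i = v\<close> \<open>v \<in> carrier K\<close> by (cases "k = i") auto
      qed
    qed
    show ?case unfolding unroll[OF Suc.prems(1,2) lt]
      using IH step fin ne by (auto simp del: run.simps simp: set_bind_spmf set_spmf_of_set)
  qed
qed

text \<open>Draws before coordinate j0 are averaged over, the draw of j0 meets at most one bad value
  among at least two, and later draws cannot change the verdict.\<close>

lemma draw_half:
  fixes K :: "'k ring"
  assumes fin: "finite (carrier K)" and card: "card (carrier K) \<ge> 2" and j0: "j0 < n"
    and dep: "\<And>c c'. (\<And>k. k \<le> j0 \<Longrightarrow> c k = c' k) \<Longrightarrow> (\<And>k. k < n \<Longrightarrow> c k \<in> carrier K) \<Longrightarrow> (\<And>k. k < n \<Longrightarrow> c' k \<in> carrier K) \<Longrightarrow> good c = good c'"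
    and one: "\<And>c v v'. (\<And>k. k < n \<Longrightarrow> c k \<in> carrier K) \<Longrightarrow> v \<in> carrier K \<Longrightarrow> v' \<in> carrier K \<Longrightarrow> \<not> good (c(j0 := v)) \<Longrightarrow> \<not> good (c(j0 := v')) \<Longrightarrow> v = v'"
  shows "nvar st 1 = n \<Longrightarrow> nvar st 10 = i \<Longrightarrow> i \<le> j0 \<Longrightarrow> (\<And>k. k < n \<Longrightarrow> farr st 10 k \<in> carrier K) \<Longrightarrow>
    (\<integral>\<^sup>+ st'. indicator {st'. \<not> good (farr st' 10)} st' \<partial>measure_spmf (run K orc draw_loop st)) \<le> ennreal (1 / 2)"
proof (induction "j0 - i" arbitrary: st i)
  case 0
  have ne: "carrier K \<noteq> {}" using card by auto
  have i: "i = j0" using 0 by simp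
  let ?f = "\<lambda>v. st\<lparr>nvar := (nvar st)(10 := Suc i), farr := (farr st)(10 := (farr st 10)(i := v))\<rparr>"
  let ?B = "{st' :: 'k store. \<not> good (farr st' 10)}"
  let ?V = "{v \<in> carrier K. \<not> good ((farr st 10)(j0 := v))}"
  have c: "nvar st 1 = n" "nvar st 10 = i" "i < n" using 0 j0 i by auto
  have le: "(\<integral>\<^sup>+ st'. indicator ?B st' \<partial>measure_spmf (run K orc draw_loop (?f v))) \<le> indicator ?V v" if v: "v \<in> carrier K" for v
  proof -
    have fv: "nvar (?f v) 1 = n" "nvar (?f v) 10 = Suc i" "Suc i \<le> n" using c by auto
    have "indicator ?B st' \<le> (indicator ?V v :: ennreal)" if st': "st' \<in> set_spmf (run K orc draw_loop (?f v))" for st'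
    proof -
      have "drawn K n (Suc i) (?f v) st'" using run_draw_loop(1)[OF fin ne fv] st' by blast
      then obtain c where c: "farr st' 10 = c" "\<forall>k. (k < Suc i \<or> k \<ge> n) \<longrightarrow> c k = farr (?f v) 10 k" "\<forall>k. Suc i \<le> k \<and> k < n \<longrightarrow> c k \<in> carrier K"
        unfolding drawn_def by fastforce
      have "good c = good ((farr st 10)(j0 := v))"
      proof (rule dep)
        show "c k = ((farr st 10)(j0 := v)) k" if "k \<le> j0" for k using c(2) that i by auto
        show "c k \<in> carrier K" if "k < n" for k
          using c(2,3) that i v 0(5)[of k] by (cases "k < Suc i") (auto split: if_splits)
        show "((farr st 10)(j0 := v)) k \<in> carrier K" if "k < n" for k using that v 0(5) by auto
      qed
      then show ?thesis using c(1) v by (auto split: split_indicator)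
    qed
    then have "(\<integral>\<^sup>+ st'. indicator ?B st' \<partial>measure_spmf (run K orc draw_loop (?f v))) \<le> (\<integral>\<^sup>+ st'. indicator ?V v \<partial>measure_spmf (run K orc draw_loop (?f v)))"
      by (intro nn_integral_mono_AE) (simp only: AE_measure_spmf_iff, blast)
    also have "\<dots> \<le> indicator ?V v * 1"
      by (simp only: nn_integral_const) (intro mult_left_mono measure_spmf.subprob_emeasure_le_1, simp)
    finally show ?thesis by simp
  qed
  \<comment> \<open>By \<open>one\<close> any two bad values are equal, so a chosen one exhausts the
    set.\<close>
  have "?V \<subseteq> {SOME v. v \<in> ?V}"
  proof
    fix v assume v: "v \<in> ?V"
    then have "(SOME v. v \<in> ?V) \<in> ?V" by (rule someI)
    then show "v \<in> {SOME v. v \<in> ?V}" using v one[of "farr st 10" v "SOME v. v \<in> ?V"] 0(5) by blast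
  qed
  then have V: "card ?V \<le> 1" using card_mono[of "{SOME v. v \<in> ?V}" ?V] by simp
  have "(\<integral>\<^sup>+ st'. indicator ?B st' \<partial>measure_spmf (run K orc draw_loop st)) =
      (\<Sum>v\<in>carrier K. (\<integral>\<^sup>+ st'. indicator ?B st' \<partial>measure_spmf (run K orc draw_loop (?f v)))) / of_nat (card (carrier K))"
    unfolding run_draw_loop(2)[OF fin ne c] nn_integral_bind_spmf nn_integral_spmf_of_set by simp
  also have "\<dots> \<le> (\<Sum>v\<in>carrier K. indicator ?V v) / of_nat (card (carrier K))"
    by (intro divide_right_mono_ennreal sum_mono le)
  also have "(\<Sum>v\<in>carrier K. indicator ?V v) = (of_nat (card ?V) :: ennreal)"
    using fin by (simp add: indicator_def sum.If_cases Int_def)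
  also have "of_nat (card ?V) / of_nat (card (carrier K)) \<le> (1 / 2 :: ennreal)"
  proof -
    have "of_nat (card ?V) / of_nat (card (carrier K)) = ennreal (real (card ?V) / real (card (carrier K)))"
      using card by (simp add: divide_ennreal ennreal_of_nat_eq_real_of_nat)
    also have "\<dots> \<le> ennreal (1 / 2)"
      using V card by (intro ennreal_leI) (simp add: field_simps)
    finally show ?thesis by (simp add: divide_ennreal_def)
  qed
  finally show ?case by (simp add: divide_ennreal_def)
next
  case (Suc k)
  have ne: "carrier K \<noteq> {}" using card by auto
  let ?f = "\<lambda>v. st\<lparr>nvar := (nvar st)(10 := Suc i), farr := (farr st)(10 := (farr st 10)(i := v))\<rparr>"
  let ?B = "{st' :: 'k store. \<not> good (farr st' 10)}"
  have c: "nvar st 1 = n" "nvar st 10 = i" "i < n" using Suc j0 by auto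
  have IH: "(\<integral>\<^sup>+ st'. indicator ?B st' \<partial>measure_spmf (run K orc draw_loop (?f v))) \<le> ennreal (1 / 2)" if "v \<in> carrier K" for v
  proof (rule Suc.hyps(1)[of "Suc i"])
    show "k = j0 - Suc i" "Suc i \<le> j0" using Suc.hyps(2) by auto
    show "nvar (?f v) 1 = n" using Suc.prems(1) by simp
    show "farr (?f v) 10 k \<in> carrier K" if "k < n" for k using Suc.prems(4)[OF that] \<open>v \<in> carrier K\<close> by simp
  qed simp
  have "(\<integral>\<^sup>+ st'. indicator ?B st' \<partial>measure_spmf (run K orc draw_loop st)) =
      (\<integral>\<^sup>+ v. (\<integral>\<^sup>+ st'. indicator ?B st' \<partial>measure_spmf (run K orc draw_loop (?f v))) \<partial>measure_spmf (spmf_of_set (carrier K)))"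
    unfolding run_draw_loop(2)[OF fin ne c] nn_integral_bind_spmf ..
  also have "\<dots> \<le> (\<integral>\<^sup>+ v. ennreal (1 / 2) \<partial>measure_spmf (spmf_of_set (carrier K)))"
    using IH fin by (intro nn_integral_mono_AE) (simp only: AE_measure_spmf_iff set_spmf_of_set if_True, blast)
  also have "\<dots> \<le> ennreal (1 / 2) * 1"
    by (simp only: nn_integral_const) (intro mult_left_mono measure_spmf.subprob_emeasure_le_1, simp)
  finally show ?case by simp
qed

context prime_ext begin

definition elt :: "(nat \<Rightarrow> int) \<Rightarrow> int list set" where "elt c = cls p f (read_poly K dg c)"

lemma elt_closed: "(\<And>k. k < dg \<Longrightarrow> c k \<in> carrier K) \<Longrightarrow> elt c \<in> carrier L"
  unfolding elt_def by (intro cls.hom_closed K.read_poly_closed) auto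

lemma arr_elt: "(\<And>k. k < dg \<Longrightarrow> c k \<in> carrier K) \<Longrightarrow> arr (elt c) = (\<lambda>i. if i < dg then c i else \<zero>\<^bsub>K\<^esub>)"
  unfolding elt_def by (subst arr_cls) (auto simp: K.read_poly_closed pmod_small K.length_read_poly K.coeff_read_poly)

lemma elt_upd:
  assumes c: "\<And>k. k < dg \<Longrightarrow> c k \<in> carrier K" and j: "j < dg" and v: "v \<in> carrier K"
  shows "elt (c(j := v)) = elt (c(j := \<zero>\<^bsub>K\<^esub>)) \<oplus>\<^bsub>L\<^esub> emb v \<otimes>\<^bsub>L\<^esub> gen [^]\<^bsub>L\<^esub> j"
proof -
  have 1: "read_poly K dg (c(j := v)) \<in> carrier K.PR" "read_poly K dg (c(j := \<zero>\<^bsub>K\<^esub>)) \<in> carrier K.PR"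
    using c v by (auto intro!: K.read_poly_closed)
  have "read_poly K dg (c(j := v)) = read_poly K dg (c(j := \<zero>\<^bsub>K\<^esub>)) \<oplus>\<^bsub>K.PR\<^esub> K.poly_of_const v \<otimes>\<^bsub>K.PR\<^esub> K.xp j"
    by (rule K.poly_eqI) (use 1 v c j in \<open>auto simp: K.coeff_add K.coeff_const_mult K.coeff_read_poly K.coeff_xp\<close>)
  then show ?thesis unfolding elt_def using 1 v by (simp add: emb_def gen_def cls.hom_nat_pow)
qed

text \<open>The trace form is nonzero on some power of the generator; the last such power is the only
  coordinate that has to be avoided by a random choice.\<close>

lemma trace_form:
  assumes \<alpha>: "\<alpha> \<in> carrier L" "\<alpha> \<noteq> \<zero>\<^bsub>L\<^esub>" and m: "m \<ge> 1" "(p ^ s) ^ m = p ^ dg" "s \<ge> 1"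
  defines "good \<equiv> \<lambda>c. trace (p ^ s) (\<alpha> \<otimes>\<^bsub>L\<^esub> elt c) m \<noteq> \<zero>\<^bsub>L\<^esub>"
  obtains j0 where "j0 < dg"
    "\<And>c c'. (\<And>k. k \<le> j0 \<Longrightarrow> c k = c' k) \<Longrightarrow> (\<And>k. k < dg \<Longrightarrow> c k \<in> carrier K) \<Longrightarrow> (\<And>k. k < dg \<Longrightarrow> c' k \<in> carrier K) \<Longrightarrow> good c = good c'"
    "\<And>c v v'. (\<And>k. k < dg \<Longrightarrow> c k \<in> carrier K) \<Longrightarrow> v \<in> carrier K \<Longrightarrow> v' \<in> carrier K \<Longrightarrow> \<not> good (c(j0 := v)) \<Longrightarrow> \<not> good (c(j0 := v')) \<Longrightarrow> v = v'"
proof -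
  define lam where "lam z = trace (p ^ s) (\<alpha> \<otimes>\<^bsub>L\<^esub> z) m" for z
  have lcl: "lam z \<in> carrier L" if "z \<in> carrier L" for z using that \<alpha> by (simp add: lam_def)
  have ladd: "lam (z \<oplus>\<^bsub>L\<^esub> emb v \<otimes>\<^bsub>L\<^esub> w) = lam z \<oplus>\<^bsub>L\<^esub> emb v \<otimes>\<^bsub>L\<^esub> lam w" if "z \<in> carrier L" "w \<in> carrier L" "v \<in> carrier K" for z w v
  proof -
    have "\<alpha> \<otimes>\<^bsub>L\<^esub> (z \<oplus>\<^bsub>L\<^esub> emb v \<otimes>\<^bsub>L\<^esub> w) = \<alpha> \<otimes>\<^bsub>L\<^esub> z \<oplus>\<^bsub>L\<^esub> emb v \<otimes>\<^bsub>L\<^esub> (\<alpha> \<otimes>\<^bsub>L\<^esub> w)"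
      using that \<alpha> by (simp add: L.r_distr L.m_lcomm)
    then show ?thesis using that \<alpha> by (simp add: lam_def trace_add trace_scale)
  qed
  \<comment> \<open>Coordinates from k on are switched off. Passing from k to k + 1 adds the k-th
    coordinate times \<open>lam\<close> of the k-th power of the generator, so coordinates where
    that value is zero have no influence.\<close>
  define trunc where "trunc k c = (\<lambda>i. if i < k then c i else \<zero>\<^bsub>K\<^esub>)" for k :: nat and c :: "nat \<Rightarrow> int"
  have tcl: "trunc k c i \<in> carrier K" if "\<And>k. k < dg \<Longrightarrow> c k \<in> carrier K" "i < dg" for k c i using that by (simp add: trunc_def)
  have lstep: "lam (elt (trunc (Suc k) c)) = lam (elt (trunc k c)) \<oplus>\<^bsub>L\<^esub> emb (c k) \<otimes>\<^bsub>L\<^esub> lam (gen [^]\<^bsub>L\<^esub> k)"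
    if c: "\<And>k. k < dg \<Longrightarrow> c k \<in> carrier K" and k: "k < dg" for c k
  proof -
    have "trunc (Suc k) c = (trunc k c)(k := c k)" "(trunc k c)(k := \<zero>\<^bsub>K\<^esub>) = trunc k c" by (auto simp: trunc_def fun_eq_iff less_Suc_eq)
    then have "elt (trunc (Suc k) c) = elt (trunc k c) \<oplus>\<^bsub>L\<^esub> emb (c k) \<otimes>\<^bsub>L\<^esub> gen [^]\<^bsub>L\<^esub> k"
      using elt_upd[of "trunc k c" k "c k"] tcl[of c, OF c] c k by simp
    then show ?thesis using ladd[of "elt (trunc k c)" "gen [^]\<^bsub>L\<^esub> k" "c k"] elt_closed[of "trunc k c"] tcl[of c, OF c] c k by simp
  qed
  have lall: "lam (elt (trunc dg c)) = lam (elt c)" for c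
  proof -
    have "read_poly K dg (trunc dg c) = read_poly K dg c" unfolding read_poly_def by (rule arg_cong[where f = K.normalize]) (auto simp: trunc_def)
    then show ?thesis by (simp add: elt_def)
  qed
  have tail: "lam (elt (trunc k c)) = lam (elt (trunc j c))"
    if c: "\<And>k. k < dg \<Longrightarrow> c k \<in> carrier K" and z: "\<And>i. j \<le> i \<Longrightarrow> i < dg \<Longrightarrow> lam (gen [^]\<^bsub>L\<^esub> i) = \<zero>\<^bsub>L\<^esub>" and k: "j \<le> k" "k \<le> dg" for c j k
    using k
  proof (induction k rule: dec_induct)
    case (step k)
    then show ?case using lstep[of c k, OF c] z[of k] c[of k] lcl[of "elt (trunc k c)"] elt_closed[of "trunc k c"] lcl[of "elt (trunc j c)"] elt_closed[of "trunc j c"] tcl[of c, OF c] by simp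
  qed simp
  let ?J = "{j. j < dg \<and> lam (gen [^]\<^bsub>L\<^esub> j) \<noteq> \<zero>\<^bsub>L\<^esub>}"
  have "?J \<noteq> {}"
  proof
    assume "?J = {}"
    then have z: "lam (gen [^]\<^bsub>L\<^esub> i) = \<zero>\<^bsub>L\<^esub>" if "i < dg" for i using that by blast
    obtain x where x: "x \<in> carrier L" "trace (p ^ s) x m \<noteq> \<zero>\<^bsub>L\<^esub>" using trace_nonzero[OF m(1,2,3)] by blast
    \<comment> \<open>If \<open>lam\<close> vanished on all basis elements it would vanish on L;
      this z0 satisfies alpha z0 = x, where x has nonzero trace.\<close>
    define z0 where "z0 = inv\<^bsub>L\<^esub> \<alpha> \<otimes>\<^bsub>L\<^esub> x"
    have "\<alpha> \<in> Units L" using \<alpha> L.field_Units by simp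
    then have z0: "z0 \<in> carrier L" "\<alpha> \<otimes>\<^bsub>L\<^esub> z0 = x" using x \<alpha> by (auto simp: z0_def L.m_assoc[symmetric])
    have "lam (elt (trunc dg (arr z0))) = lam (elt (trunc 0 (arr z0)))" by (rule tail) (use z0 z in auto)
    moreover have "elt (trunc dg (arr z0)) = z0"
      by (rule arr_inj) (use z0 tcl[of "arr z0"] in \<open>auto intro!: elt_closed simp: arr_elt trunc_def arr_high\<close>)
    moreover have "elt (trunc 0 (arr z0)) = \<zero>\<^bsub>L\<^esub>"
      by (rule arr_inj) (auto intro!: elt_closed simp: arr_elt trunc_def arr_zero)
    moreover have "lam \<zero>\<^bsub>L\<^esub> = \<zero>\<^bsub>L\<^esub>"
    proof -
      have "trace (p ^ s) (emb \<zero>\<^bsub>K\<^esub> \<otimes>\<^bsub>L\<^esub> x) m = emb \<zero>\<^bsub>K\<^esub> \<otimes>\<^bsub>L\<^esub> trace (p ^ s) x m" by (rule trace_scale) (use x in auto)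
      then show ?thesis using \<alpha> x by (simp add: lam_def)
    qed
    ultimately show False using x z0 by (simp add: lam_def)
  qed
  define j0 where "j0 = Max ?J"
  have j0: "j0 < dg" "lam (gen [^]\<^bsub>L\<^esub> j0) \<noteq> \<zero>\<^bsub>L\<^esub>"
    using Max_in[of ?J] \<open>?J \<noteq> {}\<close> by (auto simp: j0_def)
  have above: "lam (gen [^]\<^bsub>L\<^esub> i) = \<zero>\<^bsub>L\<^esub>" if "Suc j0 \<le> i" "i < dg" for i
  proof (rule ccontr)
    assume "lam (gen [^]\<^bsub>L\<^esub> i) \<noteq> \<zero>\<^bsub>L\<^esub>"
    then have "i \<le> j0" unfolding j0_def using that by (intro Max_ge) auto
    then show False using that by simp
  qed
  have red: "lam (elt c) = lam (elt (trunc (Suc j0) c))" if c: "\<And>k. k < dg \<Longrightarrow> c k \<in> carrier K" for c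
    using tail[of c "Suc j0" dg, OF c above] j0 lall[of c] by simp
  show ?thesis
  proof (rule that[OF j0(1)])
    fix c c' :: "nat \<Rightarrow> int"
    assume "\<And>k. k \<le> j0 \<Longrightarrow> c k = c' k" and c: "\<And>k. k < dg \<Longrightarrow> c k \<in> carrier K" "\<And>k. k < dg \<Longrightarrow> c' k \<in> carrier K"
    then have "trunc (Suc j0) c = trunc (Suc j0) c'" by (auto simp: trunc_def fun_eq_iff)
    then show "good c = good c'" using red[of c, OF c(1)] red[of c', OF c(2)] by (simp add: good_def lam_def)
  next
    fix c :: "nat \<Rightarrow> int" and v v'
    assume c: "\<And>k. k < dg \<Longrightarrow> c k \<in> carrier K" and v: "v \<in> carrier K" "v' \<in> carrier K" and bad: "\<not> good (c(j0 := v))" "\<not> good (c(j0 := v'))"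
    have val: "lam (elt (trunc j0 c)) \<oplus>\<^bsub>L\<^esub> emb v \<otimes>\<^bsub>L\<^esub> lam (gen [^]\<^bsub>L\<^esub> j0) = \<zero>\<^bsub>L\<^esub>" if v: "v \<in> carrier K" "\<not> good (c(j0 := v))" for v
    proof -
      have cv: "\<And>k. k < dg \<Longrightarrow> (c(j0 := v)) k \<in> carrier K" using c v by auto
      have "trunc j0 (c(j0 := v)) = trunc j0 c" by (auto simp: trunc_def fun_eq_iff)
      then have "lam (elt (c(j0 := v))) = lam (elt (trunc j0 c)) \<oplus>\<^bsub>L\<^esub> emb v \<otimes>\<^bsub>L\<^esub> lam (gen [^]\<^bsub>L\<^esub> j0)"
        using red[of "c(j0 := v)", OF cv] lstep[of "c(j0 := v)" j0, OF cv j0(1)] by simp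
      then show ?thesis using v(2) by (simp add: good_def lam_def)
    qed
    have cl: "lam (elt (trunc j0 c)) \<in> carrier L" "lam (gen [^]\<^bsub>L\<^esub> j0) \<in> carrier L"
      using lcl[of "elt (trunc j0 c)"] elt_closed[of "trunc j0 c"] tcl[of c, OF c] lcl[of "gen [^]\<^bsub>L\<^esub> j0"] by simp_all
    \<comment> \<open>Both bad values solve the same affine equation, whose slope, the value of
      \<open>lam\<close> at the j0-th power of the generator, is nonzero.\<close>
    have "emb v \<otimes>\<^bsub>L\<^esub> lam (gen [^]\<^bsub>L\<^esub> j0) = emb v' \<otimes>\<^bsub>L\<^esub> lam (gen [^]\<^bsub>L\<^esub> j0)"
      using val[OF v(1) bad(1)] val[OF v(2) bad(2)] cl v L.add.l_cancel[of "lam (elt (trunc j0 c))"] by (metis L.m_closed emb_closed)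
    then have "emb v = emb v'" using L.m_rcancel[OF j0(2) cl(2)] v by simp
    moreover have "arr (emb k) 0 = k" if "k \<in> carrier K" for k using arr_scale[OF that L.one_closed, of 0] that by (simp add: arr_one)
    ultimately show "v = v'" using v by metis
  qed
qed

end

section \<open>The root extraction algorithm\<close>

definition nonzero_prog :: "nat \<Rightarrow> nat \<Rightarrow> com" where
  "nonzero_prog A x = Seq (NAssign x (NConst 0))
     (For 10 (NVar 1) (IfThen (IsZero (A, NVar 10)) Skip (NAssign x (NConst 1))))"

text \<open>Pure number arithmetic, which is free in this model: s is found as the first k for which
  t divides p^k - 1, with p^k kept alongside.\<close>

definition order_prog :: com where
  "order_prog = Seq (NAssign 3 (NConst 1)) (Seq (NAssign 4 (NVar 0))
     (While (NLess (NConst 0) (NMod (NSub (NVar 4) (NConst 1)) (NVar 2)))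
       (Seq (NAssign 3 (NAdd (NVar 3) (NConst 1))) (NAssign 4 (NMul (NVar 4) (NVar 0))))))"

definition degree_prog :: com where
  "degree_prog = Seq (NAssign 11 (NConst 0))
     (For 10 (NAdd (NVar 3) (NConst 1)) (IfThen (IsZero (15, NVar 10)) Skip (NAssign 11 (NVar 10))))"

text \<open>
  Variables 0 to 6 hold \<open>p, n, t, s, p\<^sup>s, (p\<^sup>s-1)/t, n/s\<close>; variable 7 is zero iff \<open>a\<close> is a \<open>t\<close>-th power
  and variable 8 is zero iff the last attempt failed; variable 9 receives unused results.  Arrays 0 and
  1 hold \<open>f\<close> and \<open>a\<close>, array 2 stays zero, array 3 is the Barrett inverse, arrays 4, 6, 7 hold the
  generator, its \<open>Q\<close>-th power and \<open>b\<close>, arrays 10 and 11 hold \<open>c\<close> and \<open>w\<close>; array 16 must still be zero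
  when the argument of the black box is written to it.
\<close>

definition setup_prog :: "com \<Rightarrow> com \<Rightarrow> com" where
  "setup_prog cM cC =
    Seq order_prog
   (Seq (NAssign 5 (NDiv (NSub (NVar 4) (NConst 1)) (NVar 2)))
   (Seq (NAssign 6 (NDiv (NVar 1) (NVar 3)))
   (Seq (Call [NVar 1] [2, 0] (barrett_prog cC) 9 3)
   (Seq (SetOne (5, NConst 1))
   (Seq (Call [NVar 1] [2, 5, 5, 0] (comp_prog cC) 9 4)
   (Seq (Call [NVar 1, NVar 4] [2, 4, 0, 3] (pow_prog cM) 9 6)
   (Seq (Call [NVar 1, NVar 5] [2, 1, 0, 3] (pow_prog cM) 9 7)
   (Seq (Call [NVar 1, NVar 6, NConst 1] [2, 6, 7, 2, 0, 3, 4] (double_prog cM cC) 9 8)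
   (Seq (SetOne (9, NConst 0))
   (Seq (Arith FSub (8, NConst 0) (8, NConst 0) (9, NConst 0))
        (nonzero_prog 8 7)))))))))))"

definition attempt_prog :: "com \<Rightarrow> com \<Rightarrow> com" where
  "attempt_prog cM cC = Seq (Call [NVar 1, NVar 6, NConst 0] [2, 6, 7, 10, 0, 3, 4] (double_prog cM cC) 9 11) (nonzero_prog 11 8)"

text \<open>The argument for the black box is Z reduced modulo g: for degree 1 it is the constant y,
  otherwise Z itself. For the inverse, array 21 is the product of the nontrivial p-power conjugates
  of w, so array 22 holds the norm in cell 0. The reciprocal is negated because
  \<open>axpy_prog\<close> subtracts.\<close>

definition root_prog :: "com \<Rightarrow> com \<Rightarrow> com" where
  "root_prog cM cC =
    Seq (Call [NVar 1, NVar 2] [2, 11, 0, 3] (pow_prog cM) 9 12)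
   (Seq (Call [NVar 1] [2, 1, 12, 0, 3] (mulmod_prog cM) 9 13)
   (Seq (Call [NVar 1, NMul (NConst 2) (NVar 3)] [2, 13, 0, 3] (powers_prog cM) 9 14)
   (Seq (Call [NVar 3] [2, 14] euclid_prog 9 15)
   (Seq degree_prog
   (Seq (IfThen (NLess (NVar 11) (NConst 2)) (Copy (16, NConst 0) (13, NConst 0)) (SetOne (16, NConst 1)))
   (Seq (BlackBox (NVar 11) 15 16 17)
   (Seq (Call [NVar 1] [2, 17, 13, 0] (comp_prog cC) 9 18)
   (Seq (Call [NVar 1, NVar 0] [2, 4, 0, 3] (pow_prog cM) 9 19)
   (Seq (Call [NVar 1, NVar 0] [2, 11, 0, 3] (pow_prog cM) 9 20)
   (Seq (Call [NVar 1, NSub (NVar 1) (NConst 1), NConst 1] [2, 19, 20, 2, 0, 3, 4] (double_prog cM cC) 9 21)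
   (Seq (Call [NVar 1] [2, 11, 21, 0, 3] (mulmod_prog cM) 9 22)
   (Seq (SetOne (24, NConst 0))
   (Seq (Arith FDiv (23, NConst 0) (24, NConst 0) (22, NConst 0))
   (Seq (Arith FSub (23, NConst 0) (2, NConst 0) (23, NConst 0))
   (Seq (Call [NConst 0, NVar 1] [2, 2, 21, 23] axpy_prog 9 25)
   (Seq (Call [NVar 1] [2, 18, 25, 0, 3] (mulmod_prog cM) 9 0)
        (NAssign 0 (NConst 1))))))))))))))))))"

definition main_prog :: "com \<Rightarrow> com \<Rightarrow> com" where
  "main_prog cM cC = Seq (setup_prog cM cC)
     (IfThen (NLess (NConst 0) (NVar 7)) (NAssign 0 (NConst 0))
       (Seq (NAssign 8 (NConst 0))
       (Seq (While (NLess (NVar 8) (NConst 1)) (Seq draw_prog (attempt_prog cM cC)))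
            (root_prog cM cC))))"

lemma wp_nonzero:
  assumes x: "x \<noteq> 1" "x \<noteq> 10"
    and "Q (st\<lparr>nvar := (nvar st)(x := if \<exists>i<nvar st 1. farr st A i \<noteq> \<zero>\<^bsub>K\<^esub> then 1 else 0, 10 := nvar st 1)\<rparr>)"
  shows "wp K orc (nonzero_prog A x) Q st"
  unfolding nonzero_prog_def wp_Seq_atomic
proof (rule wp_For[where k = "nvar st 1" and I = "\<lambda>j s. s = st\<lparr>nvar := (nvar st)(x := if \<exists>i<j. farr st A i \<noteq> \<zero>\<^bsub>K\<^esub> then 1 else 0, 10 := j)\<rparr>"])
  fix j s assume s: "s = st\<lparr>nvar := (nvar st)(x := if \<exists>i<j. farr st A i \<noteq> \<zero>\<^bsub>K\<^esub> then 1 else 0, 10 := j)\<rparr>"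
  show "nval (nvar s) (NVar 1) = nvar st 1" using x by (simp add: s)
  have ex: "(\<exists>i<Suc j. farr st A i \<noteq> \<zero>\<^bsub>K\<^esub>) = ((\<exists>i<j. farr st A i \<noteq> \<zero>\<^bsub>K\<^esub>) \<or> farr st A j \<noteq> \<zero>\<^bsub>K\<^esub>)"
    by (auto simp: less_Suc_eq)
  show "wp K orc (IfThen (IsZero (A, NVar 10)) Skip (NAssign x (NConst 1)))
     (\<lambda>s'. nvar s' 10 = j \<and> s'\<lparr>nvar := (nvar s')(10 := Suc j)\<rparr> = st\<lparr>nvar := (nvar st)(x := if \<exists>i<Suc j. farr st A i \<noteq> \<zero>\<^bsub>K\<^esub> then 1 else 0, 10 := Suc j)\<rparr>) s"
    using x unfolding ex by (cases "farr st A j = \<zero>\<^bsub>K\<^esub>") (auto simp: s get_cell_def fun_upd_twist)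
qed (use assms in \<open>auto simp: fun_upd_twist\<close>)

lemma dvd_pow_minus_one_iff:
  fixes p t k :: nat
  assumes "p > 0" shows "t dvd p ^ k - 1 \<longleftrightarrow> ord t p dvd k"
proof -
  have "t dvd p ^ k - 1 \<longleftrightarrow> [p ^ k = 1] (mod t)"
  proof
    assume "t dvd p ^ k - 1"
    then obtain q where "p ^ k - 1 = t * q" by blast
    moreover have "p ^ k > 0" using assms by simp
    ultimately have "p ^ k = 1 + t * q" by linarith
    then show "[p ^ k = 1] (mod t)" by (metis cong_def mod_mult_self2)
  next
    assume "[p ^ k = 1] (mod t)" then show "t dvd p ^ k - 1" by (rule cong_to_1_nat)
  qed
  then show ?thesis using ord_divides by blast
qed

lemma wp_order:
  assumes pr: "Factorial_Ring.prime t" and cop: "coprime p t" and st: "nvar st 0 = p" "nvar st 2 = t" "p > 0"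
    and Q: "Q (st\<lparr>nvar := (nvar st)(3 := ord t p, 4 := p ^ ord t p)\<rparr>)"
  shows "wp K orc order_prog Q st"
proof -
  let ?s = "ord t p"
  have "coprime t p" using cop by (rule coprime_commute[THEN iffD1])
  then have s: "?s \<ge> 1" using ord_eq_0[of t p] by linarith
  have dv: "(p ^ k - 1) mod t = 0 \<longleftrightarrow> ?s dvd k" for k
    using dvd_pow_minus_one_iff[OF st(3)] by (simp only: mod_eq_0_iff_dvd)
  show ?thesis unfolding order_prog_def wp_Seq_atomic
  proof (rule wp_While[where I = "\<lambda>s'. \<exists>k. 1 \<le> k \<and> k \<le> ?s \<and> s' = st\<lparr>nvar := (nvar st)(3 := k, 4 := p ^ k)\<rparr>" and m = "\<lambda>s'. ?s - nvar s' 3"])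
    show "\<exists>k. 1 \<le> k \<and> k \<le> ?s \<and> st\<lparr>nvar := (nvar st)(3 := nval (nvar st) (NConst 1)),
         nvar := (nvar (st\<lparr>nvar := (nvar st)(3 := nval (nvar st) (NConst 1))\<rparr>))(4 := nval (nvar (st\<lparr>nvar := (nvar st)(3 := nval (nvar st) (NConst 1))\<rparr>)) (NVar 0))\<rparr> = st\<lparr>nvar := (nvar st)(3 := k, 4 := p ^ k)\<rparr>"
      using s st by (intro exI[of _ 1]) simp
  next
    fix s' assume "\<exists>k. 1 \<le> k \<and> k \<le> ?s \<and> s' = st\<lparr>nvar := (nvar st)(3 := k, 4 := p ^ k)\<rparr>"
      and b: "bval K (NLess (NConst 0) (NMod (NSub (NVar 4) (NConst 1)) (NVar 2))) s'"
    then obtain k where k: "1 \<le> k" "k \<le> ?s" "s' = st\<lparr>nvar := (nvar st)(3 := k, 4 := p ^ k)\<rparr>" by blast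
    have "(p ^ k - 1) mod t \<noteq> 0" using b st by (simp add: k(3))
    then have "k \<noteq> ?s" using dv[of k] by auto
    then have lt: "k < ?s" using k(2) by simp
    have eq: "s'\<lparr>nvar := (nvar s')(3 := nvar s' 3 + 1), nvar := (nvar (s'\<lparr>nvar := (nvar s')(3 := nvar s' 3 + 1)\<rparr>))(4 := nvar s' 4 * p)\<rparr> = st\<lparr>nvar := (nvar st)(3 := Suc k, 4 := p ^ Suc k)\<rparr>"
      by (simp add: k(3) fun_upd_twist mult.commute)
    show "wp K orc (Seq (NAssign 3 (NAdd (NVar 3) (NConst 1))) (NAssign 4 (NMul (NVar 4) (NVar 0))))
      (\<lambda>s'a. (\<exists>k. 1 \<le> k \<and> k \<le> ?s \<and> s'a = st\<lparr>nvar := (nvar st)(3 := k, 4 := p ^ k)\<rparr>) \<and> ?s - nvar s'a 3 < ?s - nvar s' 3) s'"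
      using eq lt st by (simp add: k(3) fun_upd_twist mult.commute) (intro conjI exI[of _ "Suc k"], simp_all add: fun_upd_twist mult.commute)
  next
    fix s' assume "\<exists>k. 1 \<le> k \<and> k \<le> ?s \<and> s' = st\<lparr>nvar := (nvar st)(3 := k, 4 := p ^ k)\<rparr>"
      and b: "\<not> bval K (NLess (NConst 0) (NMod (NSub (NVar 4) (NConst 1)) (NVar 2))) s'"
    then obtain k where k: "1 \<le> k" "k \<le> ?s" "s' = st\<lparr>nvar := (nvar st)(3 := k, 4 := p ^ k)\<rparr>" by blast
    have "(p ^ k - 1) mod t = 0" using b st by (simp add: k(3))
    then have "k = ?s" using dv[of k] k(1,2) by (auto dest: dvd_imp_le)
    then show "Q s'" using Q k(3) by simp
  qed
qed

lemma wp_degree: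
  assumes g: "\<And>i. i > d \<Longrightarrow> farr st 15 i = \<zero>\<^bsub>K\<^esub>" "farr st 15 d \<noteq> \<zero>\<^bsub>K\<^esub>" and d: "d \<le> nvar st 3"
    and Q: "Q (st\<lparr>nvar := (nvar st)(11 := d, 10 := nvar st 3 + 1)\<rparr>)"
  shows "wp K orc degree_prog Q st"
  unfolding degree_prog_def wp_Seq_atomic
proof (rule wp_For[where k = "nvar st 3 + 1" and I = "\<lambda>j s. \<exists>v. (j > d \<longrightarrow> v = d) \<and> s = st\<lparr>nvar := (nvar st)(11 := v, 10 := j)\<rparr>"])
  fix j s assume "\<exists>v. (j > d \<longrightarrow> v = d) \<and> s = st\<lparr>nvar := (nvar st)(11 := v, 10 := j)\<rparr>"
  then obtain v where v: "j > d \<longrightarrow> v = d" "s = st\<lparr>nvar := (nvar st)(11 := v, 10 := j)\<rparr>" by blast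
  show "nval (nvar s) (NAdd (NVar 3) (NConst 1)) = nvar st 3 + 1" by (simp add: v)
  have "wp K orc (IfThen (IsZero (15, NVar 10)) Skip (NAssign 11 (NVar 10)))
     (\<lambda>s'. nvar s' 10 = j \<and> s'\<lparr>nvar := (nvar s')(10 := Suc j)\<rparr> = st\<lparr>nvar := (nvar st)(11 := if farr st 15 j = \<zero>\<^bsub>K\<^esub> then v else j, 10 := Suc j)\<rparr>) s"
    by (cases "farr st 15 j = \<zero>\<^bsub>K\<^esub>") (auto simp: v(2) get_cell_def fun_upd_twist)
  then show "wp K orc (IfThen (IsZero (15, NVar 10)) Skip (NAssign 11 (NVar 10)))
     (\<lambda>s'. nvar s' 10 = j \<and> (\<exists>v. (Suc j > d \<longrightarrow> v = d) \<and> s'\<lparr>nvar := (nvar s')(10 := Suc j)\<rparr> = st\<lparr>nvar := (nvar st)(11 := v, 10 := Suc j)\<rparr>)) s"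
  proof (rule wp_mono)
    fix s' assume s': "nvar s' 10 = j \<and> s'\<lparr>nvar := (nvar s')(10 := Suc j)\<rparr> = st\<lparr>nvar := (nvar st)(11 := if farr st 15 j = \<zero>\<^bsub>K\<^esub> then v else j, 10 := Suc j)\<rparr>"
    have "Suc j > d \<longrightarrow> (if farr st 15 j = \<zero>\<^bsub>K\<^esub> then v else j) = d" using v(1) g by (cases "j = d") auto
    then show "nvar s' 10 = j \<and> (\<exists>v. (Suc j > d \<longrightarrow> v = d) \<and> s'\<lparr>nvar := (nvar s')(10 := Suc j)\<rparr> = st\<lparr>nvar := (nvar st)(11 := v, 10 := Suc j)\<rparr>)"
      using s' by blast
  qed
next
  fix s assume "\<exists>v. (nvar st 3 + 1 > d \<longrightarrow> v = d) \<and> s = st\<lparr>nvar := (nvar st)(11 := v, 10 := nvar st 3 + 1)\<rparr>"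
  then show "Q s" using Q d by auto
qed (auto simp: fun_upd_twist)

section \<open>Correctness of the phases on a fixed input\<close>

text \<open>The Barrett inverse \<open>J\<close> is obtained existentially before the locale is
  entered, so the contract of the program that produces it is part of the assumptions.\<close>

locale root_problem = field_machine p f orc cM cC Mn Cn J for p f orc cM cC Mn Cn J +
  fixes t s :: nat and a :: "int list set"
  assumes t: "Factorial_Ring.prime t" "t dvd p ^ prime_ext.dg f - 1" and s: "s = ord t p"
    and a: "a \<in> carrier (ext p f)" "a \<noteq> \<zero>\<^bsub>ext p f\<^esub>"
    and box: "root_box p s t orc"
    and barrett: "computes (prime_field p) orc (barrett_prog cC) [prime_ext.dg f]
      [\<lambda>_. \<zero>\<^bsub>prime_field p\<^esub>, ring.coeff (prime_field p) f] (ring.coeff (prime_field p) J) (Cn + 2 * prime_ext.dg f + 2)"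
begin

definition e :: nat where "e = (p ^ s - 1) div t"
definition m :: nat where "m = dg div s"

lemma p_pos: "p > 0" using prime_gt_0_nat[OF p] .
lemma t_pos: "t > 0" using prime_gt_0_nat[OF t(1)] .
lemma pk_ge_1: "p ^ k \<ge> 1" using p_pos by (simp add: Suc_leI)

lemma t_dvd_iff: "t dvd p ^ k - 1 \<longleftrightarrow> s dvd k"
  unfolding s by (rule dvd_pow_minus_one_iff[OF p_pos])

lemma s_dvd: "s dvd dg" using t_dvd_iff[of dg] t(2) by simp

lemma s_pos: "s \<ge> 1" using s_dvd dg_pos by (cases s) auto

lemma m_pos: "m \<ge> 1" and Qm: "(p ^ s) ^ m = p ^ dg"
  using s_dvd s_pos dg_pos by (auto simp: m_def power_mult[symmetric] Suc_le_eq div_greater_zero_iff dvd_imp_le)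

lemma te: "t * e = p ^ s - 1" using t_dvd_iff[of s] by (simp add: e_def)

lemma cop: "coprime p t"
proof -
  have "coprime t p" using s_pos s ord_eq_0[of t p] by linarith
  then show ?thesis by (rule coprime_commute[THEN iffD1])
qed

definition is_pow :: bool where "is_pow \<longleftrightarrow> (\<exists>b\<in>carrier L - {\<zero>\<^bsub>L\<^esub>}. b [^]\<^bsub>L\<^esub> t = a)"

lemma is_pow_iff: "is_pow \<longleftrightarrow> twisted_norm (p ^ s) (a [^]\<^bsub>L\<^esub> e) m = \<one>\<^bsub>L\<^esub>"
  unfolding is_pow_def twisted_norm_test[OF a(1) te t_pos pk_ge_1 Qm]
  using L.power_residue_iff[OF finite_L _ t_pos a] t(2) by (simp add: card_L)

definition base :: "int store \<Rightarrow> bool" where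
  "base st \<longleftrightarrow> nvar st 0 = p \<and> nvar st 1 = dg \<and> nvar st 2 = t \<and> nvar st 3 = s \<and> nvar st 6 = m \<and>
     farr st 0 = fa \<and> farr st 1 = arr a \<and> farr st 2 = zarr \<and> farr st 3 = ja \<and> farr st 4 = arr gen \<and>
     farr st 6 = arr (gen [^]\<^bsub>L\<^esub> (p ^ s)) \<and> farr st 7 = arr (a [^]\<^bsub>L\<^esub> e) \<and> farr st 16 = zarr"

definition setup_cost :: nat where
  "setup_cost = (Cn + 2 * dg + 2) + Cn + 2 * mm * bits (p ^ s) + 2 * mm * bits e + (2 * cc * bits m + 1) + 1"

lemma wp_setup:
  "wp K orc (setup_prog cM cC) (\<lambda>st. base st \<and> calls st = 0 \<and> ops st \<le> setup_cost \<and> farr st 10 = zarr \<and>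
      (nvar st 7 = 0 \<longleftrightarrow> is_pow)) (frame K [p, dg, t] [fa, arr a] 0 0)"
proof -
  have "length X\<^bsub>K\<^esub> \<le> Suc dg" using dg_pos by (simp add: var_def)
  note Xl = K.X_closed this
  have Xa: "K.coeff X\<^bsub>K\<^esub> = zarr(1 := \<one>\<^bsub>K\<^esub>)" using K.coeff_xp[of 1] by (auto simp: fun_eq_iff)
  \<comment> \<open>Composing X with X modulo f yields the reduced representative of the generator,
    which differs from X when n = 1.\<close>
  have c2: "computes K orc (comp_prog cC) [dg] [zarr, zarr(1 := \<one>\<^bsub>K\<^esub>), zarr(1 := \<one>\<^bsub>K\<^esub>), fa] (arr gen) Cn"
  proof -
    have "arr gen = K.coeff (modular_composition K X\<^bsub>K\<^esub> X\<^bsub>K\<^esub> f)"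
      using cls_composition[OF Xl(1) Xl(1)] arr_cls[of "modular_composition K X\<^bsub>K\<^esub> X\<^bsub>K\<^esub> f"] pmod_small ev_X[OF gen_closed] by (simp add: gen_def)
    then show ?thesis using PM.computes_comp[OF Xl(1) Xl(1) f Xl(2) Xl(2) length_f] by (simp add: Xa)
  qed
  let ?N = "twisted_norm (p ^ s) (a [^]\<^bsub>L\<^esub> e) m"
  have ae: "a [^]\<^bsub>L\<^esub> e \<in> carrier L" and N: "?N \<in> carrier L" using a by auto
  have c5: "computes K orc (double_prog cM cC) [dg, m, 1] [zarr, arr (gen [^]\<^bsub>L\<^esub> (p ^ s)), arr (a [^]\<^bsub>L\<^esub> e), zarr, fa, ja, arr gen] (arr ?N) (2 * cc * bits m + 1)"
    using computes_double[OF ae L.zero_closed, of m 1 s] by (simp add: arr_zero_fun)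
  have flag: "(\<exists>i<dg. ((arr ?N)(0 := arr ?N 0 \<ominus>\<^bsub>K\<^esub> \<one>\<^bsub>K\<^esub>)) i \<noteq> \<zero>\<^bsub>K\<^esub>) \<longleftrightarrow> \<not> is_pow"
  proof -
    have "(\<exists>i<dg. ((arr ?N)(0 := arr ?N 0 \<ominus>\<^bsub>K\<^esub> \<one>\<^bsub>K\<^esub>)) i \<noteq> \<zero>\<^bsub>K\<^esub>) \<longleftrightarrow> (\<exists>i<dg. arr ?N i \<noteq> arr \<one>\<^bsub>L\<^esub> i)"
      using N by (auto simp: arr_one)
    also have "\<dots> \<longleftrightarrow> ?N \<noteq> \<one>\<^bsub>L\<^esub>"
      using arr_inj[OF N L.one_closed] arr_high[OF N] arr_high[OF L.one_closed] by (metis not_le)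
    finally show ?thesis by (simp add: is_pow_iff)
  qed
  \<comment> \<open>Naming the updated array keeps the flag condition in the form in which
    \<open>fl\<close> can rewrite it.\<close>
  define B where "B = (arr ?N)(0 := arr ?N 0 \<ominus>\<^bsub>K\<^esub> \<one>\<^bsub>K\<^esub>)"
  have fl: "(\<exists>i<dg. B i \<noteq> \<zero>\<^bsub>K\<^esub>) \<longleftrightarrow> \<not> is_pow"
    unfolding B_def by (rule flag)
  have ee: "(p ^ s - Suc 0) div t = e" and me: "dg div s = m" by (simp_all add: e_def m_def)
  show ?thesis unfolding setup_prog_def
    apply (rule wp_Seq)
    apply (rule wp_order[OF t(1) cop _ _ p_pos], simp, simp)
    apply (unfold s[symmetric])
    apply (simp add: ee me)
    apply (rule wp_Seq_Call[OF barrett]; (simp add: set_cell_def)?)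
    apply (rule wp_Seq_Call[OF c2]; (simp add: set_cell_def)?)
    apply (rule wp_Seq_Call[OF computes_pow[OF gen_closed, of "p ^ s"]]; (simp add: set_cell_def)?)
    apply (rule wp_Seq_Call[OF computes_pow[OF a(1), of e]]; (simp add: set_cell_def ee)?)
    apply (rule wp_Seq_Call[OF c5]; (simp add: set_cell_def get_cell_def me ee B_def[symmetric])?)
    apply (rule wp_nonzero; (simp add: base_def setup_cost_def me ee fl)?)
    done
qed

end

context root_problem begin

lemma arr_nonzero_iff:
  assumes w: "w \<in> carrier L"
  shows "(\<exists>i<dg. arr w i \<noteq> \<zero>\<^bsub>K\<^esub>) \<longleftrightarrow> w \<noteq> \<zero>\<^bsub>L\<^esub>"
proof
  assume "\<exists>i<dg. arr w i \<noteq> \<zero>\<^bsub>K\<^esub>" then show "w \<noteq> \<zero>\<^bsub>L\<^esub>" by (auto simp: arr_zero)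
next
  assume "w \<noteq> \<zero>\<^bsub>L\<^esub>"
  then obtain i where i: "arr w i \<noteq> arr \<zero>\<^bsub>L\<^esub> i" using arr_inj[OF w L.zero_closed] by blast
  have "i < dg" using i arr_high[OF w, of i] by (cases "i < dg") (auto simp: arr_zero)
  then show "\<exists>i<dg. arr w i \<noteq> \<zero>\<^bsub>K\<^esub>" using i by (auto simp: arr_zero)
qed

definition tt :: "(nat \<Rightarrow> int) \<Rightarrow> int list set" where
  "tt c = twisted_trace (p ^ s) (a [^]\<^bsub>L\<^esub> e) (elt c) m"

lemma tt_closed: "(\<And>k. k < dg \<Longrightarrow> c k \<in> carrier K) \<Longrightarrow> tt c \<in> carrier L"
  unfolding tt_def using a elt_closed[of c] by simp

abbreviation attempt_cost :: nat where "attempt_cost \<equiv> 2 * cc * bits m + 1"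

lemma wp_attempt:
  assumes base: "base st" and c: "\<And>k. k < dg \<Longrightarrow> farr st 10 k \<in> carrier K" "\<And>k. k \<ge> dg \<Longrightarrow> farr st 10 k = \<zero>\<^bsub>K\<^esub>"
  shows "wp K orc (attempt_prog cM cC) (\<lambda>st'. base st' \<and> calls st' = calls st \<and> ops st' \<le> ops st + attempt_cost \<and>
      farr st' 10 = farr st 10 \<and> farr st' 11 = arr (tt (farr st 10)) \<and> (nvar st' 8 = 0 \<longleftrightarrow> tt (farr st 10) = \<zero>\<^bsub>L\<^esub>)) st"
proof -
  have ae: "a [^]\<^bsub>L\<^esub> e \<in> carrier L" using a by simp
  have "arr (elt (farr st 10)) = farr st 10" using c by (subst arr_elt) (auto simp: fun_eq_iff)
  then have c1: "computes K orc (double_prog cM cC) [dg, m, 0] [zarr, arr (gen [^]\<^bsub>L\<^esub> (p ^ s)), arr (a [^]\<^bsub>L\<^esub> e), farr st 10, fa, ja, arr gen] (arr (tt (farr st 10))) attempt_cost"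
    using computes_double[OF ae elt_closed[of "farr st 10", OF c(1)], of m 0 s] by (simp add: tt_def)
  define w where "w = tt (farr st 10)"
  have fl: "(\<exists>i<dg. arr w i \<noteq> \<zero>\<^bsub>K\<^esub>) \<longleftrightarrow> w \<noteq> \<zero>\<^bsub>L\<^esub>" unfolding w_def by (rule arr_nonzero_iff[OF tt_closed[of "farr st 10", OF c(1)]])
  show ?thesis unfolding attempt_prog_def w_def[symmetric]
    apply (rule wp_Seq_Call[OF c1[folded w_def]])
    subgoal using base by (simp add: base_def)
    subgoal using base by (simp add: base_def)
    apply (rule wp_nonzero)
    using base by (simp_all add: base_def fl)
qed

lemma tt_good:
  assumes al: "\<alpha> \<in> carrier L" "\<alpha> \<noteq> \<zero>\<^bsub>L\<^esub>" "\<alpha> [^]\<^bsub>L\<^esub> t = a" and c: "\<And>k. k < dg \<Longrightarrow> c k \<in> carrier K"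
  shows "tt c \<otimes>\<^bsub>L\<^esub> \<alpha> = trace (p ^ s) (\<alpha> \<otimes>\<^bsub>L\<^esub> elt c) m"
    and "tt c = \<zero>\<^bsub>L\<^esub> \<longleftrightarrow> trace (p ^ s) (\<alpha> \<otimes>\<^bsub>L\<^esub> elt c) m = \<zero>\<^bsub>L\<^esub>"
proof -
  show eq: "tt c \<otimes>\<^bsub>L\<^esub> \<alpha> = trace (p ^ s) (\<alpha> \<otimes>\<^bsub>L\<^esub> elt c) m"
    using twisted_trace_eq_trace[OF al(1) elt_closed[of c, OF c] te pk_ge_1, of m] by (simp add: tt_def al(3))
  show "tt c = \<zero>\<^bsub>L\<^esub> \<longleftrightarrow> trace (p ^ s) (\<alpha> \<otimes>\<^bsub>L\<^esub> elt c) m = \<zero>\<^bsub>L\<^esub>"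
    unfolding eq[symmetric] using L.integral_iff[OF tt_closed[of c, OF c] al(1)] al(2) by simp
qed

text \<open>T = w alpha is a trace, hence fixed by the Q-th power, and its t-th power a w^t is
  computable although alpha is not.\<close>

lemma trace_root:
  assumes al: "\<alpha> \<in> carrier L" "\<alpha> \<noteq> \<zero>\<^bsub>L\<^esub>" "\<alpha> [^]\<^bsub>L\<^esub> t = a" and c: "\<And>k. k < dg \<Longrightarrow> c k \<in> carrier K" and w: "tt c \<noteq> \<zero>\<^bsub>L\<^esub>"
  obtains T where "T \<in> carrier L" "T \<noteq> \<zero>\<^bsub>L\<^esub>" "T [^]\<^bsub>L\<^esub> t = a \<otimes>\<^bsub>L\<^esub> tt c [^]\<^bsub>L\<^esub> t" "T [^]\<^bsub>L\<^esub> (p ^ s) = T"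
proof (rule that[of "tt c \<otimes>\<^bsub>L\<^esub> \<alpha>"])
  note wc = tt_closed[of c, OF c]
  show "tt c \<otimes>\<^bsub>L\<^esub> \<alpha> \<in> carrier L" using wc al by simp
  show "tt c \<otimes>\<^bsub>L\<^esub> \<alpha> \<noteq> \<zero>\<^bsub>L\<^esub>" using L.integral_iff[OF wc al(1)] al(2) w by simp
  show "(tt c \<otimes>\<^bsub>L\<^esub> \<alpha>) [^]\<^bsub>L\<^esub> t = a \<otimes>\<^bsub>L\<^esub> tt c [^]\<^bsub>L\<^esub> t" using wc al a by (simp add: L.nat_pow_distrib L.m_comm)
  have "\<alpha> \<otimes>\<^bsub>L\<^esub> elt c \<in> carrier L" using al elt_closed[of c, OF c] by simp
  then have "trace (p ^ s) (\<alpha> \<otimes>\<^bsub>L\<^esub> elt c) m [^]\<^bsub>L\<^esub> (p ^ s) = trace (p ^ s) (\<alpha> \<otimes>\<^bsub>L\<^esub> elt c) m"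
    by (rule trace_fixed[OF _ Qm])
  moreover have "tt c \<otimes>\<^bsub>L\<^esub> \<alpha> = trace (p ^ s) (\<alpha> \<otimes>\<^bsub>L\<^esub> elt c) m" by (rule tt_good(1)[OF al]) (rule c)
  ultimately show "(tt c \<otimes>\<^bsub>L\<^esub> \<alpha>) [^]\<^bsub>L\<^esub> (p ^ s) = tt c \<otimes>\<^bsub>L\<^esub> \<alpha>" by (simp only:)
qed

text \<open>The degree condition of the box comes from \<open>minpoly_subfield\<close> and the
  existence of a root from \<open>minpoly_power\<close>. The answer is carried back to L by
  evaluation at y.\<close>

lemma box_root:
  assumes y: "y \<in> carrier L" and g: "minpoly y g"
    and T: "T \<in> carrier L" "T \<noteq> \<zero>\<^bsub>L\<^esub>" "T [^]\<^bsub>L\<^esub> t = y" "T [^]\<^bsub>L\<^esub> (p ^ s) = T"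
  defines "d \<equiv> length g - 1"
  defines "r \<equiv> orc (read_poly K (Suc d) (K.coeff g)) (read_poly K d (if d < 2 then zarr(0 := arr y 0) else zarr(1 := \<one>\<^bsub>K\<^esub>)))"
  shows "d \<le> s" "length g = Suc d" "r \<in> carrier K.PR" "length r \<le> Suc dg" "ev y r [^]\<^bsub>L\<^esub> t = y"
proof -
  interpret G: prime_ext p g by (rule minpoly_field[OF y g])
  interpret e: ring_hom_ring K.PR L "ev y" by (rule ev_hom[OF y])
  have gc: "g \<in> carrier K.PR" using g by (simp add: minpoly_def)
  have d: "d = G.dg" "d \<ge> 1" using G.dg_pos by (simp_all add: d_def G.dg_def)
  show lg: "length g = Suc d" using d G.length_f by simp
  have ys: "y [^]\<^bsub>L\<^esub> (p ^ s) = y"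
  proof -
    have "y [^]\<^bsub>L\<^esub> (p ^ s) = (T [^]\<^bsub>L\<^esub> (p ^ s)) [^]\<^bsub>L\<^esub> t" using T(1) by (simp add: T(3)[symmetric] L.nat_pow_pow mult.commute)
    then show ?thesis using T(3,4) by simp
  qed
  have dv: "d dvd s" using minpoly_subfield[OF y g ys] by (simp add: d_def)
  show "d \<le> s" using dv s_pos by (intro dvd_imp_le) auto
  have "s \<le> dg" using s_dvd dg_pos by (intro dvd_imp_le) auto
  let ?Y = "read_poly K d (if d < 2 then zarr(0 := arr y 0) else zarr(1 := \<one>\<^bsub>K\<^esub>))"
  have Y: "?Y \<in> carrier K.PR" "length ?Y \<le> d" using y by (auto intro!: K.read_poly_closed K.length_read_poly)
  have evY: "ev y ?Y = y"
  \<comment> \<open>In degree 1 the element y lies in F_p and equals its constant coordinate; the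
    polynomial Z would not have degree below d.\<close>
  proof (cases "d < 2")
    case True
    then have d1: "d = 1" using d by simp
    have "cls p g (K.xp p) = cls p g X\<^bsub>K\<^esub>"
      using G.frob_dg[OF G.gen_closed] unfolding d(1)[symmetric] d1 by (simp add: G.gen_def G.cls.hom_nat_pow)
    then have "ev y (K.xp p) = ev y X\<^bsub>K\<^esub>" using minpoly_cls_iff[OF y g] by simp
    then have "y [^]\<^bsub>L\<^esub> p = y" using y by (simp add: e.hom_nat_pow ev_X)
    then obtain k where k: "k \<in> carrier K" "y = emb k" using frob_fixed_emb[OF y] by blast
    have k0: "arr y 0 = k" using arr_scale[OF k(1) L.one_closed, of 0] k by (simp add: arr_one)
    have "?Y = K.poly_of_const k"
      by (rule K.poly_eqI[OF Y(1)]) (use k k0 d1 in \<open>auto simp: K.coeff_read_poly K.coeff_poly_of_const\<close>)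
    then show ?thesis using ev_const[OF y k(1)] k by simp
  next
    case False
    have "?Y = X\<^bsub>K\<^esub>"
      by (rule K.poly_eqI[OF Y(1)]) (use False K.coeff_xp[of 1] in \<open>auto simp: K.coeff_read_poly\<close>)
    then show ?thesis using ev_X[OF y] by simp
  qed
  have clsY: "cls p g ?Y = cls p g X\<^bsub>K\<^esub>" using minpoly_cls_iff[OF y g Y(1) K.X_closed] evY ev_X[OF y] by simp
  have "t dvd p ^ s - 1" using t_dvd_iff[of s] by simp
  then have ex: "\<exists>z\<in>carrier (ext p g). z [^]\<^bsub>ext p g\<^esub> t = cls p g ?Y"
    unfolding clsY using minpoly_power[OF y g t(1) _ s T] by simp
  have rg: "read_poly K (Suc d) (K.coeff g) = g" using K.read_poly_coeff[OF gc] lg by simp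
  have dY: "Polynomials.degree ?Y < Polynomials.degree g" using Y(2) lg d(2) by linarith
  have dg': "Polynomials.degree g dvd s" using dv unfolding d_def .
  have "r \<in> carrier K.PR \<and> Polynomials.degree r < Polynomials.degree g \<and> cls p g r [^]\<^bsub>ext p g\<^esub> t = cls p g ?Y"
    unfolding r_def rg
    by (rule box[unfolded root_box_def, THEN spec, THEN spec, THEN mp]) (intro conjI gc minpoly_irreducible[OF y g] dg' Y(1) dY ex)
  then have r: "r \<in> carrier K.PR" "Polynomials.degree r < Polynomials.degree g" "cls p g r [^]\<^bsub>ext p g\<^esub> t = cls p g ?Y" by auto
  show "r \<in> carrier K.PR" by fact
  show "length r \<le> Suc dg" using r(2) lg \<open>d \<le> s\<close> \<open>s \<le> dg\<close> by simp
  have "cls p g (r [^]\<^bsub>K.PR\<^esub> t) = cls p g ?Y" using r by (simp add: G.cls.hom_nat_pow)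
  then have "ev y (r [^]\<^bsub>K.PR\<^esub> t) = ev y ?Y" using minpoly_cls_iff[OF y g _ Y(1)] r(1) by simp
  then show "ev y r [^]\<^bsub>L\<^esub> t = y" using r(1) evY by (simp add: e.hom_nat_pow)
qed

text \<open>w u is the norm of w to F_p, because u has exponent p + ... + p^(dg-1), so one division
  in F_p suffices. The last conclusion is the array that \<open>axpy_prog\<close> returns when it
  scales u by the inverse norm.\<close>

lemma norm_inverse:
  assumes w: "w \<in> carrier L" "w \<noteq> \<zero>\<^bsub>L\<^esub>"
  defines "u \<equiv> twisted_norm p (w [^]\<^bsub>L\<^esub> p) (dg - 1)"
  obtains k where "k \<in> carrier K" "k \<noteq> \<zero>\<^bsub>K\<^esub>" "arr (w \<otimes>\<^bsub>L\<^esub> u) 0 = k" "w \<otimes>\<^bsub>L\<^esub> (emb (inv\<^bsub>K\<^esub> k) \<otimes>\<^bsub>L\<^esub> u) = \<one>\<^bsub>L\<^esub>" "u \<in> carrier L"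
    "(\<lambda>i. if i < dg then \<zero>\<^bsub>K\<^esub> \<ominus>\<^bsub>K\<^esub> (\<zero>\<^bsub>K\<^esub> \<ominus>\<^bsub>K\<^esub> inv\<^bsub>K\<^esub> k) \<otimes>\<^bsub>K\<^esub> arr u i else \<zero>\<^bsub>K\<^esub>) = arr (emb (inv\<^bsub>K\<^esub> k) \<otimes>\<^bsub>L\<^esub> u)"
proof -
  let ?N' = "p * geo p (dg - 1)"
  have u: "u = w [^]\<^bsub>L\<^esub> ?N'" "u \<in> carrier L" using w by (simp_all add: u_def twisted_norm_eq L.nat_pow_pow)
  have nu: "w \<otimes>\<^bsub>L\<^esub> u = w [^]\<^bsub>L\<^esub> (?N' + 1)" using w u by (simp add: L.m_comm)
  have p1: "p \<ge> 1" using p_pos by simp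
  have "(p - 1) * (p * geo p (dg - 1)) + p = p ^ dg"
  proof -
    have "p ^ dg = p * p ^ (dg - 1)" using dg_pos by (cases dg) auto
    also have "\<dots> = p * ((p - 1) * geo p (dg - 1) + 1)" using geo_mult[OF p1, of "dg - 1"] by simp
    also have "\<dots> = (p - 1) * (p * geo p (dg - 1)) + p" unfolding distrib_left mult_1_right by (subst mult.left_commute) (rule refl)
    finally show ?thesis by simp
  qed
  \<comment> \<open>Together with the previous identity, (N' + 1) p = N' + p^dg. Since w to the
    power p^dg is w, the p-th power leaves w u unchanged.\<close>
  moreover have "(?N' + 1) * p = ?N' + ((p - 1) * ?N' + p)"
  proof -
    have gen: "(Suc q * x + 1) * Suc q = Suc q * x + (q * (Suc q * x) + Suc q)" for q x :: nat by (simp add: algebra_simps)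
    show ?thesis using gen[of "p - 1" "geo p (dg - 1)"] p_pos by (simp only: Suc_diff_1)
  qed
  ultimately have "(?N' + 1) * p = ?N' + p ^ dg" by simp
  then have "(w \<otimes>\<^bsub>L\<^esub> u) [^]\<^bsub>L\<^esub> p = w [^]\<^bsub>L\<^esub> (?N' + p ^ dg)" unfolding nu using w by (simp only: L.nat_pow_pow)
  also have "\<dots> = w \<otimes>\<^bsub>L\<^esub> u" using w u by (simp add: L.nat_pow_mult[symmetric] frob_dg L.m_comm)
  finally obtain k where k: "k \<in> carrier K" "w \<otimes>\<^bsub>L\<^esub> u = emb k" using frob_fixed_emb[of "w \<otimes>\<^bsub>L\<^esub> u"] w u by auto
  have "w \<otimes>\<^bsub>L\<^esub> u \<noteq> \<zero>\<^bsub>L\<^esub>" unfolding nu by (rule L.nat_pow_nonzero[OF w])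
  then have k0: "k \<noteq> \<zero>\<^bsub>K\<^esub>" by (rule contrapos_nn) (simp only: k(2) emb.hom_zero)
  then have "k \<in> Units K" using k K.field_Units by simp
  then have ik: "inv\<^bsub>K\<^esub> k \<in> carrier K" "inv\<^bsub>K\<^esub> k \<otimes>\<^bsub>K\<^esub> k = \<one>\<^bsub>K\<^esub>" by simp_all
  show ?thesis
  proof (rule that[OF k(1) k0 _ _ u(2)])
    show "arr (w \<otimes>\<^bsub>L\<^esub> u) 0 = k" using arr_scale[OF k(1) L.one_closed, of 0] k by (simp add: arr_one)
    have "w \<otimes>\<^bsub>L\<^esub> (emb (inv\<^bsub>K\<^esub> k) \<otimes>\<^bsub>L\<^esub> u) = emb (inv\<^bsub>K\<^esub> k) \<otimes>\<^bsub>L\<^esub> (w \<otimes>\<^bsub>L\<^esub> u)" using w u ik by (simp add: L.m_lcomm)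
    also have "\<dots> = emb (inv\<^bsub>K\<^esub> k \<otimes>\<^bsub>K\<^esub> k)" unfolding k(2) using emb.hom_mult[OF ik(1) k(1)] by (simp only:)
    finally show "w \<otimes>\<^bsub>L\<^esub> (emb (inv\<^bsub>K\<^esub> k) \<otimes>\<^bsub>L\<^esub> u) = \<one>\<^bsub>L\<^esub>" unfolding ik(2) emb.hom_one .
    have cl: "emb (inv\<^bsub>K\<^esub> k) \<otimes>\<^bsub>L\<^esub> u \<in> carrier L" using u ik by simp
    have neg: "\<zero>\<^bsub>K\<^esub> \<ominus>\<^bsub>K\<^esub> (\<zero>\<^bsub>K\<^esub> \<ominus>\<^bsub>K\<^esub> x) \<otimes>\<^bsub>K\<^esub> z = x \<otimes>\<^bsub>K\<^esub> z" if "x \<in> carrier K" "z \<in> carrier K" for x z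
      using that by (simp add: a_minus_def K.l_minus)
    show "(\<lambda>i. if i < dg then \<zero>\<^bsub>K\<^esub> \<ominus>\<^bsub>K\<^esub> (\<zero>\<^bsub>K\<^esub> \<ominus>\<^bsub>K\<^esub> inv\<^bsub>K\<^esub> k) \<otimes>\<^bsub>K\<^esub> arr u i else \<zero>\<^bsub>K\<^esub>) = arr (emb (inv\<^bsub>K\<^esub> k) \<otimes>\<^bsub>L\<^esub> u)"
      using arr_high[OF cl] ik u by (auto simp: fun_eq_iff arr_scale neg not_less)
  qed
qed

definition root_cost :: nat where
  "root_cost = 2 * mm * bits t + mm + mm * (2 * s) + (8 * s + 5) * (4 * s + 1) + Cn + 4 * mm * bits p +
     (2 * cc * bits (dg - 1) + 1) + mm + 2 + 2 * dg + mm"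

lemma wp_root:
  assumes base: "base st" and c: "\<And>k. k < dg \<Longrightarrow> c k \<in> carrier K" and w11: "farr st 11 = arr (tt c)"
    and nz: "tt c \<noteq> \<zero>\<^bsub>L\<^esub>" and pow: is_pow
  shows "wp K orc (root_prog cM cC) (\<lambda>st'. nvar st' 0 = 1 \<and> calls st' = Suc (calls st) \<and> ops st' \<le> ops st + root_cost \<and>
      (\<exists>z\<in>carrier L. z [^]\<^bsub>L\<^esub> t = a \<and> farr st' 0 = arr z)) st"
proof -
  obtain \<alpha> where al: "\<alpha> \<in> carrier L" "\<alpha> \<noteq> \<zero>\<^bsub>L\<^esub>" "\<alpha> [^]\<^bsub>L\<^esub> t = a" using pow unfolding is_pow_def by blast
  define w where "w = tt c"
  have w: "w \<in> carrier L" "w \<noteq> \<zero>\<^bsub>L\<^esub>" using tt_closed[of c, OF c] nz by (simp_all add: w_def)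
  define y where "y = a \<otimes>\<^bsub>L\<^esub> w [^]\<^bsub>L\<^esub> t"
  have y: "y \<in> carrier L" using w a by (simp add: y_def)
  obtain T where T: "T \<in> carrier L" "T \<noteq> \<zero>\<^bsub>L\<^esub>" "T [^]\<^bsub>L\<^esub> t = y" "T [^]\<^bsub>L\<^esub> (p ^ s) = T"
    using trace_root[OF al, of c, OF c nz] unfolding y_def w_def by metis
  have y0: "y \<noteq> \<zero>\<^bsub>L\<^esub>" using L.nat_pow_nonzero[OF T(1,2), of t] T(3) by simp
  have ys: "y [^]\<^bsub>L\<^esub> (p ^ s) = y"
  proof -
    have "y [^]\<^bsub>L\<^esub> (p ^ s) = (T [^]\<^bsub>L\<^esub> (p ^ s)) [^]\<^bsub>L\<^esub> t" using T(1) by (simp add: T(3)[symmetric] L.nat_pow_pow mult.commute)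
    then show ?thesis using T(3,4) by simp
  qed
  define P where "P = (\<lambda>i. if i < 2 * s then arr (y [^]\<^bsub>L\<^esub> (2 * s - 1 - i)) 0 else \<zero>\<^bsub>K\<^esub>)"
  obtain g where g: "minpoly y g" and c4: "computes K orc euclid_prog [s] [zarr, P] (K.coeff g) ((8 * s + 5) * (4 * s + 1))"
    using computes_minpoly[OF y y0 ys s_pos] unfolding P_def by blast
  define d where "d = length g - 1"
  define Y where "Y = (if d < 2 then zarr(0 := arr y 0) else zarr(1 := \<one>\<^bsub>K\<^esub>))"
  define r where "r = orc (read_poly K (Suc d) (K.coeff g)) (read_poly K d Y)"
  note bx = box_root[OF y g T, folded d_def, folded Y_def, folded r_def]
  have gc: "g \<in> carrier K.PR" "g \<noteq> []" using g by (auto simp: minpoly_def)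
  have g_hi: "K.coeff g i = \<zero>\<^bsub>K\<^esub>" if "i > d" for i using that bx(2) by (intro K.coeff_length) simp
  have g_lc: "K.coeff g d \<noteq> \<zero>\<^bsub>K\<^esub>"
    using K.lead_coeff_simp[OF gc(2)] gc unfolding d_def by (simp add: univ_poly_carrier[symmetric] polynomial_def)
  define T' where "T' = ev y r"
  have T': "T' \<in> carrier L" "T' [^]\<^bsub>L\<^esub> t = y" using bx y by (simp_all add: T'_def)
  define u where "u = twisted_norm p (w [^]\<^bsub>L\<^esub> p) (dg - 1)"
  obtain k where k: "k \<in> carrier K" "k \<noteq> \<zero>\<^bsub>K\<^esub>" "arr (w \<otimes>\<^bsub>L\<^esub> u) 0 = k" "w \<otimes>\<^bsub>L\<^esub> (emb (inv\<^bsub>K\<^esub> k) \<otimes>\<^bsub>L\<^esub> u) = \<one>\<^bsub>L\<^esub>" "u \<in> carrier L"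
    "(\<lambda>i. if i < dg then \<zero>\<^bsub>K\<^esub> \<ominus>\<^bsub>K\<^esub> (\<zero>\<^bsub>K\<^esub> \<ominus>\<^bsub>K\<^esub> inv\<^bsub>K\<^esub> k) \<otimes>\<^bsub>K\<^esub> arr u i else \<zero>\<^bsub>K\<^esub>) = arr (emb (inv\<^bsub>K\<^esub> k) \<otimes>\<^bsub>L\<^esub> u)"
    by (rule norm_inverse[OF w, folded u_def])
  have "k \<in> Units K" using k K.field_Units by simp
  then have ik: "inv\<^bsub>K\<^esub> k \<in> carrier K" by simp
  define v where "v = emb (inv\<^bsub>K\<^esub> k) \<otimes>\<^bsub>L\<^esub> u"
  have v: "v \<in> carrier L" "w \<otimes>\<^bsub>L\<^esub> v = \<one>\<^bsub>L\<^esub>" using k(4,5) ik by (simp_all add: v_def)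
  define z where "z = T' \<otimes>\<^bsub>L\<^esub> v"
  have z: "z \<in> carrier L" using T' v by (simp add: z_def)
  have "z [^]\<^bsub>L\<^esub> t = y \<otimes>\<^bsub>L\<^esub> v [^]\<^bsub>L\<^esub> t" using T' v(1) by (simp add: z_def L.nat_pow_distrib)
  also have "\<dots> = a \<otimes>\<^bsub>L\<^esub> (w \<otimes>\<^bsub>L\<^esub> v) [^]\<^bsub>L\<^esub> t" using a(1) w(1) v(1) by (simp add: y_def L.nat_pow_distrib L.m_assoc)
  also have "\<dots> = a" unfolding v(2) using a(1) by simp
  finally have zt: "z [^]\<^bsub>L\<^esub> t = a" .
  have c1: "computes K orc (pow_prog cM) [dg, t] [zarr, arr w, fa, ja] (arr (w [^]\<^bsub>L\<^esub> t)) (2 * mm * bits t)"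
    by (rule computes_pow[OF w(1)])
  have c2: "computes K orc (mulmod_prog cM) [dg] [zarr, arr a, arr (w [^]\<^bsub>L\<^esub> t), fa, ja] (arr y) mm"
    unfolding y_def by (rule computes_mulmod_L) (use a w in auto)
  have c3: "computes K orc (powers_prog cM) [dg, 2 * s] [zarr, arr y, fa, ja] P (mm * (2 * s))"
    unfolding P_def by (rule computes_powers[OF y])
  have c5: "computes K orc (comp_prog cC) [dg] [zarr, K.coeff r, arr y, fa] (arr T') Cn"
    unfolding T'_def by (rule computes_comp_L[OF bx(3,4) y])
  have c6: "computes K orc (pow_prog cM) [dg, p] [zarr, arr gen, fa, ja] (arr (gen [^]\<^bsub>L\<^esub> p)) (2 * mm * bits p)"
    by (rule computes_pow[OF gen_closed])
  have c7: "computes K orc (pow_prog cM) [dg, p] [zarr, arr w, fa, ja] (arr (w [^]\<^bsub>L\<^esub> p)) (2 * mm * bits p)"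
    by (rule computes_pow[OF w(1)])
  have c8: "computes K orc (double_prog cM cC) [dg, dg - 1, 1] [zarr, arr (gen [^]\<^bsub>L\<^esub> p), arr (w [^]\<^bsub>L\<^esub> p), zarr, fa, ja, arr gen] (arr u) (2 * cc * bits (dg - 1) + 1)"
    using computes_double[OF L.nat_pow_closed[OF w(1), of p] L.zero_closed, of "dg - 1" 1 1] by (simp add: arr_zero_fun u_def)
  have c9: "computes K orc (mulmod_prog cM) [dg] [zarr, arr w, arr u, fa, ja] (arr (w \<otimes>\<^bsub>L\<^esub> u)) mm"
    by (rule computes_mulmod_L[OF w(1) k(5)])
  \<comment> \<open>Array 2 is zero, so \<open>axpy_prog\<close> returns 0 - q u; the scalar q = 0 -
    1/k makes this u/k.\<close>
  have c10: "computes K orc axpy_prog [0, dg] [zarr, zarr, arr u, q] (arr v) (2 * dg)" if "q 0 = \<zero>\<^bsub>K\<^esub> \<ominus>\<^bsub>K\<^esub> inv\<^bsub>K\<^esub> k" for q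
    using computes_axpy_array[of K orc 0 dg zarr "arr u" q] k(6) unfolding that v_def by (simp only: not_less0 if_False diff_zero)
  have c11: "computes K orc (mulmod_prog cM) [dg] [zarr, arr T', arr v, fa, ja] (arr z) mm"
    unfolding z_def by (rule computes_mulmod_L[OF T'(1) v(1)])
  have wpY: "wp K orc (IfThen (NLess (NVar 11) (NConst 2)) (Copy (16, NConst 0) (13, NConst 0)) (SetOne (16, NConst (Suc 0)))) Q st"
    if "farr st 16 = zarr" "nvar st 11 = d" "farr st 13 = arr y" "Q (st\<lparr>farr := (farr st)(16 := Y)\<rparr>)" for Q st
    using that by (cases "d < 2") (simp_all add: Y_def set_cell_def get_cell_def)
  note B = base[unfolded base_def, simplified] w11[folded w_def]
  define i where "i = arr (w \<otimes>\<^bsub>L\<^esub> u)"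
  have i: "i 0 = k" using k(3) by (simp add: i_def)
  show ?thesis unfolding root_prog_def
    apply (rule wp_Seq_Call[OF c1]; (simp add: B)?)
    apply (rule wp_Seq_Call[OF c2]; (simp add: B)?)
    apply (rule wp_Seq_Call[OF c3]; (simp add: B)?)
    apply (rule wp_Seq_Call[OF c4]; (simp add: B)?)
    apply (rule wp_Seq, rule wp_degree[where d = d]; (simp add: B g_hi g_lc bx(1))?)
    apply (rule wp_Seq, rule wpY; (simp add: B)?)
    apply (rule wp_Seq, simp add: r_def[symmetric])
    apply (rule wp_Seq_Call[OF c5]; (simp add: B)?)
    apply (rule wp_Seq_Call[OF c6]; (simp add: B)?)
    apply (rule wp_Seq_Call[OF c7]; (simp add: B)?)
    apply (rule wp_Seq_Call[OF c8]; (simp add: B)?)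
    apply (rule wp_Seq_Call[OF c9[folded i_def]]; (simp add: B)?)
    apply (rule wp_Seq, subst wp_FDiv; (simp add: B get_cell_def set_cell_def i k(2) ik)?)
    apply (rule wp_Seq_Call[OF c10]; (simp add: B)?)
    apply (rule wp_Seq_Call[OF c11]; (simp add: B)?)
    apply (intro conjI)
    apply (simp add: root_cost_def)
    apply (rule bexI[OF _ z], simp add: zt)
    done
qed

end

lemma nn_integral_return_spmf: "(\<integral>\<^sup>+ y. g y \<partial>measure_spmf (return_spmf x)) = g x"
  by (simp add: measure_spmf_return_spmf nn_integral_return)

lemma run_draw_prog: "run K orc draw_prog st = run K orc draw_loop (st\<lparr>nvar := (nvar st)(10 := 0)\<rparr>)"
  unfolding draw_prog_def For_def by simp

context root_problem begin

section \<open>The random loop and the complete run\<close>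

definition sampled :: "int store \<Rightarrow> bool" where
  "sampled st \<longleftrightarrow> base st \<and> calls st = 0 \<and> (\<forall>k<dg. farr st 10 k \<in> carrier K) \<and> (\<forall>k\<ge>dg. farr st 10 k = \<zero>\<^bsub>K\<^esub>)"

text \<open>Splits off \<open>sampled\<close>, which is all that a new round requires; the
  disjunction records that leaving the loop certifies a nonzero w for the current c. As
  \<open>calls\<close> is still 0, the root phase makes the only call.\<close>

definition loop_inv :: "int store \<Rightarrow> bool" where
  "loop_inv st \<longleftrightarrow> sampled st \<and>
     (nvar st 8 = 0 \<or> farr st 11 = arr (tt (farr st 10)) \<and> tt (farr st 10) \<noteq> \<zero>\<^bsub>L\<^esub>)"

abbreviation body :: com where "body \<equiv> Seq draw_prog (attempt_prog cM cC)"

lemma K_nonempty: "carrier K \<noteq> {}" using K.one_closed by blast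

lemma finite_K: "finite (carrier K)" and card_K: "card (carrier K) = p"
  using prime_field_facts(2,3)[OF p] by simp_all

lemma draw_outcome:
  assumes st: "sampled st"
  shows "lossless_spmf (run K orc draw_prog st)"
    and "st' \<in> set_spmf (run K orc draw_prog st) \<Longrightarrow> sampled st' \<and> ops st' = ops st"
proof -
  let ?st = "st\<lparr>nvar := (nvar st)(10 := 0)\<rparr>"
  have b: "nvar ?st 1 = dg" "nvar ?st 10 = 0" "0 \<le> dg" using st by (auto simp: sampled_def base_def)
  note run = run_draw_loop(1)[OF finite_K K_nonempty b, of orc]
  show "lossless_spmf (run K orc draw_prog st)" using run unfolding run_draw_prog by blast
  assume "st' \<in> set_spmf (run K orc draw_prog st)"
  then have "drawn K dg 0 ?st st'" using run unfolding run_draw_prog by blast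
  then obtain c where c: "st' = ?st\<lparr>nvar := (nvar ?st)(10 := dg), farr := (farr ?st)(10 := c)\<rparr>"
     "\<forall>k. (k < 0 \<or> k \<ge> dg) \<longrightarrow> c k = farr ?st 10 k" "\<forall>k. 0 \<le> k \<and> k < dg \<longrightarrow> c k \<in> carrier K"
    unfolding drawn_def by blast
  have "farr ?st 10 = farr st 10" by simp
  then show "sampled st' \<and> ops st' = ops st"
    using st c(2,3) unfolding c(1) sampled_def base_def by simp
qed

lemma attempt_outcome:
  assumes st: "sampled st"
  obtains st' where "run K orc (attempt_prog cM cC) st = return_spmf st'" "loop_inv st'" "ops st' \<le> ops st + attempt_cost"
    "nvar st' 8 = 0 \<longleftrightarrow> tt (farr st 10) = \<zero>\<^bsub>L\<^esub>"
proof -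
  have c: "base st" "\<And>k. k < dg \<Longrightarrow> farr st 10 k \<in> carrier K" "\<And>k. k \<ge> dg \<Longrightarrow> farr st 10 k = \<zero>\<^bsub>K\<^esub>"
    using st by (auto simp: sampled_def)
  obtain st' where st': "run K orc (attempt_prog cM cC) st = return_spmf st'" "base st'" "calls st' = calls st"
      "ops st' \<le> ops st + attempt_cost" "farr st' 10 = farr st 10" "farr st' 11 = arr (tt (farr st 10))"
      "nvar st' 8 = 0 \<longleftrightarrow> tt (farr st 10) = \<zero>\<^bsub>L\<^esub>"
    using wp_attempt[OF c, simplified simp_thms implies_True_equals triv_forall_equality, OF TrueI TrueI] unfolding wp_def by (elim exE conjE) (rule that)
  have "sampled st'" using st st' unfolding sampled_def by simp
  then have inv: "loop_inv st'" unfolding loop_inv_def st'(5,6,7) by (cases "tt (farr st 10) = \<zero>\<^bsub>L\<^esub>") simp_all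
  show ?thesis by (rule that[OF st'(1) inv st'(4) st'(7)])
qed

lemma body_outcome:
  assumes st: "sampled st"
  shows "lossless_spmf (run K orc body st)"
    and "st' \<in> set_spmf (run K orc body st) \<Longrightarrow> loop_inv st' \<and> ops st' \<le> ops st + attempt_cost"
proof -
  have r: "run K orc body st = bind_spmf (run K orc draw_prog st) (run K orc (attempt_prog cM cC))" by simp
  have "lossless_spmf (run K orc (attempt_prog cM cC) x)" if x: "x \<in> set_spmf (run K orc draw_prog st)" for x
  proof -
    obtain x' where "run K orc (attempt_prog cM cC) x = return_spmf x'"
      using attempt_outcome[of x] draw_outcome(2)[OF st x] by blast
    then show ?thesis by simp
  qed
  then show "lossless_spmf (run K orc body st)" unfolding r using draw_outcome(1)[OF st] by simp
  assume "st' \<in> set_spmf (run K orc body st)"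
  then obtain x where x: "x \<in> set_spmf (run K orc draw_prog st)" "st' \<in> set_spmf (run K orc (attempt_prog cM cC) x)"
    unfolding r by (auto simp: set_bind_spmf)
  have s: "sampled x" "ops x = ops st" using draw_outcome(2)[OF st x(1)] by auto
  obtain x' where x': "run K orc (attempt_prog cM cC) x = return_spmf x'" "loop_inv x'" "ops x' \<le> ops x + attempt_cost"
    by (rule attempt_outcome[OF s(1)]) (rule that)
  have "st' = x'" using x(2) unfolding x'(1) by simp
  then show "loop_inv st' \<and> ops st' \<le> ops st + attempt_cost" using x' s by simp
qed

text \<open>Failure of a round means Tr(alpha c) = 0 for some fixed root alpha, which exists only in
  the proof; \<open>trace_form\<close> supplies the hypotheses of \<open>draw_half\<close> for this
  event.\<close>

lemma body_half:
  assumes st: "sampled st" and pow: is_pow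
  shows "measure (measure_spmf (run K orc body st)) {st'. nvar st' 8 < 1} \<le> 1 / 2"
proof -
  obtain \<alpha> where al: "\<alpha> \<in> carrier L" "\<alpha> \<noteq> \<zero>\<^bsub>L\<^esub>" "\<alpha> [^]\<^bsub>L\<^esub> t = a" using pow unfolding is_pow_def by blast
  let ?good = "\<lambda>c. trace (p ^ s) (\<alpha> \<otimes>\<^bsub>L\<^esub> elt c) m \<noteq> \<zero>\<^bsub>L\<^esub>"
  let ?B = "{st'. nvar st' 8 < 1} :: int store set"
  let ?st = "st\<lparr>nvar := (nvar st)(10 := 0)\<rparr>"
  have r: "run K orc body st = bind_spmf (run K orc draw_prog st) (run K orc (attempt_prog cM cC))" by simp
  have "emeasure (measure_spmf (run K orc body st)) ?B = (\<integral>\<^sup>+ st'. indicator ?B st' \<partial>measure_spmf (run K orc body st))"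
    by simp
  also have "\<dots> = (\<integral>\<^sup>+ x. (\<integral>\<^sup>+ st'. indicator ?B st' \<partial>measure_spmf (run K orc (attempt_prog cM cC) x)) \<partial>measure_spmf (run K orc draw_prog st))"
    unfolding r by (rule nn_integral_bind_spmf)
  also have "\<dots> \<le> (\<integral>\<^sup>+ x. indicator {x. \<not> ?good (farr x 10)} x \<partial>measure_spmf (run K orc draw_prog st))"
  proof (intro nn_integral_mono_AE, simp only: AE_measure_spmf_iff, rule ballI)
    fix x assume "x \<in> set_spmf (run K orc draw_prog st)"
    then have s: "sampled x" using draw_outcome(2)[OF st] by blast
    then have c: "\<And>k. k < dg \<Longrightarrow> farr x 10 k \<in> carrier K" by (simp add: sampled_def)
    obtain x' where x': "run K orc (attempt_prog cM cC) x = return_spmf x'" "nvar x' 8 = 0 \<longleftrightarrow> tt (farr x 10) = \<zero>\<^bsub>L\<^esub>"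
      by (rule attempt_outcome[OF s]) (rule that)
    have "nvar x' 8 < 1 \<longleftrightarrow> \<not> ?good (farr x 10)" using tt_good(2)[OF al, of "farr x 10", OF c] x'(2) by simp
    then show "(\<integral>\<^sup>+ st'. indicator ?B st' \<partial>measure_spmf (run K orc (attempt_prog cM cC) x)) \<le> indicator {x. \<not> ?good (farr x 10)} x"
      unfolding x'(1) by (simp add: nn_integral_return_spmf indicator_def)
  qed
  also have "\<dots> \<le> ennreal (1 / 2)"
  proof -
    obtain j0 where j0: "j0 < dg"
      "\<And>c c'. (\<And>k. k \<le> j0 \<Longrightarrow> c k = c' k) \<Longrightarrow> (\<And>k. k < dg \<Longrightarrow> c k \<in> carrier K) \<Longrightarrow> (\<And>k. k < dg \<Longrightarrow> c' k \<in> carrier K) \<Longrightarrow> ?good c = ?good c'"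
      "\<And>c v v'. (\<And>k. k < dg \<Longrightarrow> c k \<in> carrier K) \<Longrightarrow> v \<in> carrier K \<Longrightarrow> v' \<in> carrier K \<Longrightarrow> \<not> ?good (c(j0 := v)) \<Longrightarrow> \<not> ?good (c(j0 := v')) \<Longrightarrow> v = v'"
      by (rule trace_form[OF al(1,2) m_pos Qm s_pos]) blast
    have card: "card (carrier K) \<ge> 2" unfolding card_K by (rule prime_ge_2_nat[OF p])
    show ?thesis unfolding run_draw_prog
    proof (rule draw_half[OF finite_K card j0(1), where good = ?good])
      show "?good c = ?good c'" if "\<And>k. k \<le> j0 \<Longrightarrow> c k = c' k" "\<And>k. k < dg \<Longrightarrow> c k \<in> carrier K" "\<And>k. k < dg \<Longrightarrow> c' k \<in> carrier K" for c c'
        using that by (rule j0(2))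
      show "v = v'" if "\<And>k. k < dg \<Longrightarrow> c k \<in> carrier K" "v \<in> carrier K" "v' \<in> carrier K" "\<not> ?good (c(j0 := v))" "\<not> ?good (c(j0 := v'))" for c v v'
        using that by (rule j0(3))
      show "nvar ?st 1 = dg" "nvar ?st 10 = 0" using st by (simp_all add: sampled_def base_def)
      show "farr ?st 10 k \<in> carrier K" if "k < dg" for k using st that by (simp add: sampled_def)
    qed simp
  qed
  finally have "ennreal (measure (measure_spmf (run K orc body st)) ?B) \<le> ennreal (1 / 2)"
    unfolding measure_spmf.emeasure_eq_measure .
  moreover have half: "(0 :: real) \<le> 1 / 2" by simp
  ultimately show ?thesis by (simp only: ennreal_le_iff[OF half])
qed

lemma loop_outcome:
  assumes st: "loop_inv st" and pow: is_pow
  defines "W \<equiv> run K orc (While (NLess (NVar 8) (NConst 1)) body) st"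
  shows "lossless_spmf W" and "st' \<in> set_spmf W \<Longrightarrow> loop_inv st' \<and> nvar st' 8 \<noteq> 0"
    and "(\<integral>\<^sup>+ st'. ennreal (real (ops st')) \<partial>measure_spmf W) \<le> ennreal (real (ops st + 2 * attempt_cost))"
proof -
  let ?b = "bval K (NLess (NVar 8) (NConst 1))" and ?c = "run K orc body"
  have W: "W = while_spmf ?b ?c st" unfolding W_def by (simp only: run.simps)
  have b: "{st'. ?b st'} = {st'. nvar st' 8 < 1}" by simp
  have inv: "loop_inv s' \<and> ops s' \<le> ops s + attempt_cost" if "loop_inv s" "?b s" "s' \<in> set_spmf (?c s)" for s s'
    using body_outcome(2)[of s s'] that(1,3) unfolding loop_inv_def[of s] by blast
  have half: "measure (measure_spmf (?c s)) {s'. ?b s'} \<le> 1 / 2" if "loop_inv s" "?b s" for s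
    unfolding b using body_half[OF _ pow, of s] that(1) unfolding loop_inv_def by blast
  show "lossless_spmf W" unfolding W
  proof (rule lossless_while_spmf[where I = loop_inv])
    show "loop_inv s'" if "loop_inv s" "?b s" "s' \<in> set_spmf (?c s)" for s s' using inv[OF that] by blast
    show "lossless_spmf (?c s)" if "loop_inv s" "?b s" for s using body_outcome(1)[of s] that(1) unfolding loop_inv_def by blast
  qed (fact half st)+
  show "loop_inv st' \<and> nvar st' 8 \<noteq> 0" if "st' \<in> set_spmf W"
  proof -
    have "loop_inv st' \<and> \<not> ?b st'"
      by (rule set_while_spmf[where I = loop_inv and s = st, OF _ st that[unfolded W]]) (use inv in blast)
    then show ?thesis by simp
  qed
  show "(\<integral>\<^sup>+ st'. ennreal (real (ops st')) \<partial>measure_spmf W) \<le> ennreal (real (ops st + 2 * attempt_cost))"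
    unfolding W by (rule expected_cost_while_spmf[where I = loop_inv, OF inv half st])
qed

definition outcome :: "int store \<Rightarrow> bool" where
  "outcome st \<longleftrightarrow> nvar st 0 = (if is_pow then 1 else 0) \<and>
     (is_pow \<longrightarrow> (\<exists>z\<in>carrier L. z [^]\<^bsub>L\<^esub> t = a \<and> farr st 0 = arr z)) \<and> calls st \<le> 1"

lemma root_outcome:
  assumes st: "loop_inv st" "nvar st 8 \<noteq> 0" and pow: is_pow
  obtains st' where "run K orc (root_prog cM cC) st = return_spmf st'" "outcome st'" "ops st' \<le> ops st + root_cost"
proof -
  have c: "base st" "\<And>k. k < dg \<Longrightarrow> farr st 10 k \<in> carrier K" "farr st 11 = arr (tt (farr st 10))" "tt (farr st 10) \<noteq> \<zero>\<^bsub>L\<^esub>" "calls st = 0"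
    using st by (auto simp: loop_inv_def sampled_def)
  obtain st' where "run K orc (root_prog cM cC) st = return_spmf st'" "nvar st' 0 = 1" "calls st' = Suc (calls st)"
     "ops st' \<le> ops st + root_cost" "\<exists>z\<in>carrier L. z [^]\<^bsub>L\<^esub> t = a \<and> farr st' 0 = arr z"
    using wp_root[OF c(1-4) pow, simplified simp_thms implies_True_equals triv_forall_equality, OF TrueI] unfolding wp_def by (elim exE conjE) (rule that)
  then show ?thesis using that pow c(5) unfolding outcome_def by simp
qed

lemma las_vegas_main:
  "las_vegas (run K orc (main_prog cM cC) (frame K [p, dg, t] [fa, arr a] 0 0)) outcome
     (real (setup_cost + 2 * attempt_cost + root_cost))"
proof -
  let ?W = "While (NLess (NVar 8) (NConst 1)) body"
  obtain s1 where s1: "run K orc (setup_prog cM cC) (frame K [p, dg, t] [fa, arr a] 0 0) = return_spmf s1"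
    "base s1" "calls s1 = 0" "ops s1 \<le> setup_cost" "farr s1 10 = zarr" "nvar s1 7 = 0 \<longleftrightarrow> is_pow"
    using wp_setup unfolding wp_def by (elim exE conjE) (rule that)
  have run1: "run K orc (main_prog cM cC) (frame K [p, dg, t] [fa, arr a] 0 0) =
      run K orc (IfThen (NLess (NConst 0) (NVar 7)) (NAssign 0 (NConst 0))
       (Seq (NAssign 8 (NConst 0)) (Seq ?W (root_prog cM cC)))) s1"
    unfolding main_prog_def run.simps(8) s1(1) by (rule return_bind_spmf)
  show ?thesis
  proof (cases is_pow)
    case False
    then have eq: "run K orc (main_prog cM cC) (frame K [p, dg, t] [fa, arr a] 0 0) = return_spmf (s1\<lparr>nvar := (nvar s1)(0 := 0)\<rparr>)"
      unfolding run1 using s1(6) by simp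
    have le: "ennreal (real (ops s1)) \<le> ennreal (real (setup_cost + 2 * attempt_cost + root_cost))"
      by (intro ennreal_leI, unfold of_nat_le_iff, intro trans_le_add1 s1(4))
    show ?thesis unfolding las_vegas_def eq
    proof (intro conjI ballI)
      show "(\<integral>\<^sup>+ s. ennreal (real (ops s)) \<partial>measure_spmf (return_spmf (s1\<lparr>nvar := (nvar s1)(0 := 0)\<rparr>))) \<le> ennreal (real (setup_cost + 2 * attempt_cost + root_cost))"
        unfolding nn_integral_return_spmf using le by simp
    qed (use False s1(3) in \<open>simp_all add: outcome_def\<close>)
  next
    case True
    let ?s2 = "s1\<lparr>nvar := (nvar s1)(8 := 0)\<rparr>"
    have s2: "loop_inv ?s2" using s1(2,3,5) unfolding loop_inv_def sampled_def base_def by simp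
    note W = loop_outcome[OF s2 True]
    have run2: "run K orc (main_prog cM cC) (frame K [p, dg, t] [fa, arr a] 0 0) = bind_spmf (run K orc ?W ?s2) (run K orc (root_prog cM cC))"
    proof -
      have "\<not> bval K (NLess (NConst 0) (NVar 7)) s1" using s1(6) True by simp
      then show ?thesis unfolding run1 by (simp only: run.simps(2,8,9) if_False return_bind_spmf nval.simps)
    qed
    have root: "\<exists>st'. run K orc (root_prog cM cC) x = return_spmf st' \<and> outcome st' \<and> ops st' \<le> ops x + root_cost"
      if "x \<in> set_spmf (run K orc ?W ?s2)" for x
    proof -
      have x: "loop_inv x" "nvar x 8 \<noteq> 0" using W(2)[OF that] by simp_all
      show ?thesis by (rule root_outcome[OF x True]) (intro exI conjI)
    qed
    have ll: "lossless_spmf (bind_spmf (run K orc ?W ?s2) (run K orc (root_prog cM cC)))"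
    proof -
      have "lossless_spmf (run K orc (root_prog cM cC) x)" if x: "x \<in> set_spmf (run K orc ?W ?s2)" for x
      proof -
        obtain st' where "run K orc (root_prog cM cC) x = return_spmf st'" using root[OF x] by blast
        then show ?thesis by (simp only: lossless_return_spmf)
      qed
      then show ?thesis using W(1) by (simp only: lossless_bind_spmf simp_thms) blast
    qed
    have out: "outcome st'" if in_set: "st' \<in> set_spmf (bind_spmf (run K orc ?W ?s2) (run K orc (root_prog cM cC)))" for st'
    proof -
      obtain x where x: "x \<in> set_spmf (run K orc ?W ?s2)" "st' \<in> set_spmf (run K orc (root_prog cM cC) x)"
        using in_set by (auto simp: set_bind_spmf simp del: run.simps)
      obtain st'' where st'': "run K orc (root_prog cM cC) x = return_spmf st''" "outcome st''" using root[OF x(1)] by blast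
      have "st' = st''" using x(2) unfolding st''(1) by simp
      then show ?thesis using st''(2) by (simp only:)
    qed
    have "(\<integral>\<^sup>+ st. ennreal (real (ops st)) \<partial>measure_spmf (bind_spmf (run K orc ?W ?s2) (run K orc (root_prog cM cC)))) =
        (\<integral>\<^sup>+ x. (\<integral>\<^sup>+ st. ennreal (real (ops st)) \<partial>measure_spmf (run K orc (root_prog cM cC) x)) \<partial>measure_spmf (run K orc ?W ?s2))"
      by (rule nn_integral_bind_spmf)
    also have "\<dots> \<le> (\<integral>\<^sup>+ x. ennreal (real (ops x)) + ennreal (real root_cost) \<partial>measure_spmf (run K orc ?W ?s2))"
    proof (intro nn_integral_mono_AE, simp only: AE_measure_spmf_iff, rule ballI)
      fix x assume "x \<in> set_spmf (run K orc ?W ?s2)"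
      from root[OF this] obtain st' where st': "run K orc (root_prog cM cC) x = return_spmf st'" "ops st' \<le> ops x + root_cost" by blast
      show "(\<integral>\<^sup>+ st. ennreal (real (ops st)) \<partial>measure_spmf (run K orc (root_prog cM cC) x)) \<le> ennreal (real (ops x)) + ennreal (real root_cost)"
        unfolding st'(1) using st'(2) by (simp add: nn_integral_return_spmf ennreal_plus[symmetric] del: ennreal_plus)
    qed
    also have "\<dots> = (\<integral>\<^sup>+ x. ennreal (real (ops x)) \<partial>measure_spmf (run K orc ?W ?s2)) + (\<integral>\<^sup>+ x. ennreal (real root_cost) \<partial>measure_spmf (run K orc ?W ?s2))"
      by (rule nn_integral_add) simp_all
    also have "\<dots> \<le> ennreal (real (ops ?s2 + 2 * attempt_cost)) + ennreal (real root_cost) * 1"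
      by (intro add_mono W(3)) (simp only: nn_integral_const, intro mult_left_mono measure_spmf.subprob_emeasure_le_1, simp)
    also have "\<dots> = ennreal (real (ops s1 + 2 * attempt_cost + root_cost))"
      by (simp add: ennreal_plus[symmetric] del: ennreal_plus)
    also have "\<dots> \<le> ennreal (real (setup_cost + 2 * attempt_cost + root_cost))"
      using s1(4) by (intro ennreal_leI) simp
    finally show ?thesis unfolding las_vegas_def run2 using ll out by blast
  qed
qed

end

section \<open>Cost\<close>

lemma bits_mono: "x \<le> y \<Longrightarrow> bits x \<le> bits y"
proof (induction y arbitrary: x rule: less_induct)
  case (less y)
  show ?case
  proof (cases "x = 0")
    case True
    then show ?thesis by (simp add: bits.simps[of 0])
  next
    case False
    then have "bits (x div 2) \<le> bits (y div 2)" using less.prems by (intro less.IH div_le_mono) auto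
    then show ?thesis using False less.prems bits.simps[of x] bits.simps[of y] by simp
  qed
qed

text \<open>Each halving lowers the logarithm by ln 2 >= 2/3, so twice the logarithm pays for one
  digit per halving.\<close>

lemma bits_le_ln: "x \<ge> 1 \<Longrightarrow> real (bits x) \<le> 1 + 2 * ln (real x)"
proof (induction x rule: less_induct)
  case (less x)
  show ?case
  proof (cases "x div 2 = 0")
    case True
    then have "bits x = 1" using less.prems bits.simps[of x] bits.simps[of 0] by simp
    then show ?thesis using less.prems by simp
  next
    case False
    have "real (bits (x div 2)) \<le> 1 + 2 * ln (real (x div 2))" using False less.prems by (intro less.IH) auto
    also have "ln (real (x div 2)) \<le> ln (real x / 2)"
    proof -
      have "2 * (x div 2) \<le> x" by simp
      then have "real (2 * (x div 2)) \<le> real x" by (rule of_nat_mono)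
      then show ?thesis using False by (intro ln_mono) auto
    qed
    also have "ln (real x / 2) = ln (real x) - ln 2" using less.prems by (simp add: ln_div)
    finally show ?thesis using ln2_ge_two_thirds less.prems bits.simps[of x] by simp
  qed
qed

text \<open>With U the target expression, each term is bounded by a multiple of U: n by a multiple
  of M n through superlinearity, s^2 by n s, and ln p from below by 1/2. The delicate terms are C n
  alone, since ln n = 0 at n = 1, and M n ln n, since M = O(C) holds only from some N on.\<close>

lemma cost_estimate:
  fixes M C :: "nat \<Rightarrow> real"
  assumes sup: "superlinear M" and pos: "M 1 > 0" and big: "M \<in> O(C)"
  obtains c where "c > 0" "\<And>n s p :: nat. n \<ge> 1 \<Longrightarrow> s \<ge> 1 \<Longrightarrow> s \<le> n \<Longrightarrow> p \<ge> 2 \<Longrightarrow> C n \<ge> 0 \<Longrightarrow>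
    3 * C n + 13 * real n + 10 * (3 * M n + 2 * real n) * (4 * real s * ln (real p)) +
    8 * (3 * C n + 2 * (3 * M n + 2 * real n) + 2 * real n) * (1 + 2 * ln (real n)) +
    5 * (3 * M n + 2 * real n) * real s + 65 * real s * real s
    \<le> c * (real s * M n * ln (real p) + C n * ln (real n))"
proof -
  obtain c0 where c0: "c0 > 0" "eventually (\<lambda>n. norm (M n) \<le> c0 * norm (C n)) at_top"
    using landau_o.bigE[OF big] by blast
  obtain N0 where N0: "\<And>n. n \<ge> N0 \<Longrightarrow> \<bar>M n\<bar> \<le> c0 * \<bar>C n\<bar>" using c0(2) unfolding eventually_at_top_linorder by auto
  define N where "N = max 1 N0"
  have N: "N \<ge> 1" "\<And>n. n \<ge> N \<Longrightarrow> \<bar>M n\<bar> \<le> c0 * \<bar>C n\<bar>" using N0 by (auto simp: N_def)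
  \<comment> \<open>The 4 serves n >= 2, where 1 + 2 ln n <= 4 ln n; the other summand pays for C 1
    by means of M n <= 2 U.\<close>
  define k1 where "k1 = 4 + 2 * (\<bar>C 1\<bar> / M 1)"
  \<comment> \<open>The 2 bounds M n itself, 2 c0 bounds 2 M n ln n from N on, and below N the
    logarithm is at most ln N.\<close>
  define k2 where "k2 = 2 + 2 * c0 + 4 * ln (real N)"
  have k: "k1 \<ge> 4" "k2 \<ge> 2" using pos c0(1) N(1) by (auto simp: k1_def k2_def)
  define i where "i = 1 / M 1"
  have i: "i > 0" using pos by (simp add: i_def)
  \<comment> \<open>The coefficients of the final sum, collected by k1, i, 1, k2 and k2 i.\<close>
  define c where "c = 27 * k1 + 256 * i + 150 + 48 * k2 + 48 * (k2 * i)"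
  have "c > 0" using k i by (simp add: c_def add_pos_nonneg)
  moreover have "3 * C n + 13 * real n + 10 * (3 * M n + 2 * real n) * (4 * real s * ln (real p)) +
    8 * (3 * C n + 2 * (3 * M n + 2 * real n) + 2 * real n) * (1 + 2 * ln (real n)) +
    5 * (3 * M n + 2 * real n) * real s + 65 * real s * real s
    \<le> c * (real s * M n * ln (real p) + C n * ln (real n))"
    if n: "n \<ge> 1" and s: "s \<ge> 1" "s \<le> n" and p: "p \<ge> 2" and C: "C n \<ge> 0" for n s p :: nat
  proof -
    define lp where "lp = ln (real p)"
    define ln' where "ln' = ln (real n)"
    define U where "U = real s * M n * lp + C n * ln'"
    define be where "be = 1 + 2 * ln'"
    have "ln 2 \<le> lp" unfolding lp_def using p by (intro ln_mono) auto
    then have lp: "1 / 2 \<le> lp" using ln2_ge_two_thirds by simp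
    have ln0: "ln' \<ge> 0" using n by (simp add: ln'_def)
    have "M 1 / real 1 \<le> M n / real n" using sup n unfolding superlinear_def by blast
    then have Mn: "M 1 * real n \<le> M n" using n by (simp add: field_simps)
    then have M0: "M n > 0" using mult_pos_pos[OF pos, of "real n"] n by linarith
    have D0: "C n * ln' \<ge> 0" using C ln0 by simp
    have sl: "1 / 2 \<le> real s * lp"
      using mult_mono[of 1 "real s" "1 / 2" lp] s lp by simp
    have A: "M n * (real s * lp) \<le> U" using D0 by (simp add: U_def algebra_simps)
    have U0: "U \<ge> 0" using A mult_nonneg_nonneg[of "M n" "real s * lp"] M0 sl by linarith
    have Ms: "M n * real s \<le> 2 * U"
    proof -
      have "M n * real s * (1 / 2) \<le> M n * real s * lp" using M0 lp by (intro mult_left_mono) auto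
      then show ?thesis using A by (simp add: algebra_simps)
    qed
    have M2: "M n \<le> 2 * U"
    proof -
      have "M n * 1 \<le> M n * real s" using M0 s by (intro mult_left_mono) auto
      then show ?thesis using Ms by simp
    qed
    have ni: "real n \<le> i * M n" using Mn pos by (simp add: i_def field_simps)
    have tr: "real n * x \<le> i * y" if "M n * x \<le> y" "x \<ge> 0" for x y
    proof -
      have "real n * x \<le> i * M n * x" using ni that(2) by (rule mult_right_mono)
      also have "\<dots> \<le> i * y" using that(1) i by (simp add: mult.assoc)
      finally show ?thesis .
    qed
    have Cb: "C n * be \<le> k1 * U"
    proof (cases "n = 1")
      case True
      have "C n * be = C 1" using True by (simp add: be_def ln'_def)
      also have "\<dots> \<le> \<bar>C 1\<bar> / M 1 * M n" using True pos by simp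
      also have "\<dots> \<le> \<bar>C 1\<bar> / M 1 * (2 * U)" using M2 pos by (intro mult_left_mono) auto
      also have "\<dots> \<le> k1 * U" using U0 by (simp add: k1_def algebra_simps)
      finally show ?thesis .
    next
      case False
      then have "ln 2 \<le> ln'" unfolding ln'_def using n by (intro ln_mono) auto
      then have "be \<le> 4 * ln'" using ln2_ge_two_thirds by (simp add: be_def)
      then have "C n * be \<le> C n * (4 * ln')" using C by (rule mult_left_mono)
      also have "\<dots> \<le> 4 * U"
      proof -
        have "0 \<le> real s * M n * lp" using M0 lp by simp
        then show ?thesis by (simp add: U_def)
      qed
      also have "\<dots> \<le> k1 * U" using k(1) U0 by (rule mult_right_mono)
      finally show ?thesis .
    qed
    have C1: "C n \<le> k1 * U"
    proof -
      have "C n * 1 \<le> C n * be" using C ln0 by (intro mult_left_mono) (auto simp: be_def)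
      then show ?thesis using Cb by simp
    qed
    have Mb: "M n * be \<le> k2 * U"
    proof -
      have "M n * ln' \<le> c0 * U + 2 * ln (real N) * U"
      proof (cases "n \<ge> N")
        case True
        then have "M n \<le> c0 * C n" using N(2)[OF True] M0 C by simp
        then have "M n * ln' \<le> c0 * C n * ln'" using ln0 by (rule mult_right_mono)
        also have "\<dots> \<le> c0 * U"
        proof -
          have "0 \<le> real s * M n * lp" using M0 lp by simp
          then have "C n * ln' \<le> U" by (simp add: U_def)
          then show ?thesis using c0(1) by (simp add: mult.assoc)
        qed
        also have "\<dots> \<le> c0 * U + 2 * ln (real N) * U" using N(1) U0 by simp
        finally show ?thesis .
      next
        case False
        then have "ln' \<le> ln (real N)" unfolding ln'_def using n by (intro ln_mono) auto
        then have "M n * ln' \<le> M n * ln (real N)" using M0 by (intro mult_left_mono) auto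
        also have "\<dots> \<le> 2 * U * ln (real N)" using M2 N(1) by (intro mult_right_mono) auto
        finally show ?thesis using c0(1) U0 by (simp add: mult_ac add_increasing)
      qed
      then show ?thesis using M2 by (simp add: be_def k2_def algebra_simps)
    qed
    have be0: "be \<ge> 0" using ln0 by (simp add: be_def)
    have nb: "real n * be \<le> i * (k2 * U)" by (rule tr[OF Mb be0])
    have n1: "real n \<le> i * (2 * U)" using tr[of 1 "2 * U"] M2 by simp
    have nsl: "real n * (real s * lp) \<le> i * U" by (rule tr[OF A]) (use sl in simp)
    have ns: "real n * real s \<le> i * (2 * U)" by (rule tr[OF Ms]) simp
    have ss: "real s * real s \<le> real n * real s" using s by (intro mult_right_mono) auto
    have "3 * C n + 13 * real n + 10 * (3 * M n + 2 * real n) * (4 * real s * lp) +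
      8 * (3 * C n + 2 * (3 * M n + 2 * real n) + 2 * real n) * be + 5 * (3 * M n + 2 * real n) * real s + 65 * real s * real s =
      3 * C n + 13 * real n + 120 * (M n * (real s * lp)) + 80 * (real n * (real s * lp)) +
      24 * (C n * be) + 48 * (M n * be) + 48 * (real n * be) + 15 * (M n * real s) + 10 * (real n * real s) + 65 * (real s * real s)"
      by (simp add: algebra_simps)
    also have "\<dots> \<le> 3 * (k1 * U) + 13 * (i * (2 * U)) + 120 * U + 80 * (i * U) + 24 * (k1 * U) + 48 * (k2 * U) + 48 * (i * (k2 * U)) +
       15 * (2 * U) + 10 * (i * (2 * U)) + 65 * (i * (2 * U))"
      using C1 n1 A nsl Cb Mb nb Ms ns ss by linarith
    also have "\<dots> = c * U" by (simp add: c_def algebra_simps)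
    finally show ?thesis unfolding U_def be_def lp_def ln'_def .
  qed
  ultimately show ?thesis by (rule that)
qed

text \<open>Every exponent given to \<open>pow_prog\<close> (p^s, e, t, p) is at most p^s, and every
  length given to \<open>double_prog\<close> is at most n. Two digit counts therefore bound all
  rounds. The attempts enter twice, the expected number of rounds being at most 2.\<close>

lemma (in root_problem) cost_le:
  assumes M: "real Mn \<le> Mr" and C: "real Cn \<le> Cr"
  shows "real (setup_cost + 2 * attempt_cost + root_cost) \<le>
    3 * Cr + 13 * real dg + 10 * (3 * Mr + 2 * real dg) * (4 * real s * ln (real p)) +
    8 * (3 * Cr + 2 * (3 * Mr + 2 * real dg) + 2 * real dg) * (1 + 2 * ln (real dg)) +
    5 * (3 * Mr + 2 * real dg) * real s + 65 * real s * real s"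
proof -
  define b where "b = bits (p ^ s)"
  define d where "d = bits dg"
  have "e \<le> p ^ s" unfolding e_def by (meson div_le_dividend diff_le_self le_trans)
  moreover have "t \<le> p ^ s"
  proof -
    have "e > 0"
    proof (rule ccontr)
      assume "\<not> e > 0"
      then have "p ^ s - 1 = 0" using te by simp
      moreover have "p ^ s > 1" using prime_gt_1_nat[OF p] s_pos by (intro one_less_power) auto
      ultimately show False by simp
    qed
    then have "t \<le> t * e" by simp
    then show ?thesis using te by simp
  qed
  moreover have "p \<le> p ^ s" using s_pos p_pos by (simp add: self_le_power)
  ultimately have B: "bits e \<le> b" "bits t \<le> b" "bits p \<le> b" unfolding b_def by (simp_all add: bits_mono)
  have D: "bits m \<le> d" "bits (dg - 1) \<le> d" unfolding d_def m_def by (simp_all add: bits_mono)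
  have mb: "mm * bits e \<le> mm * b" "mm * bits t \<le> mm * b" "mm * bits p \<le> mm * b" "cc * bits m \<le> cc * d" "cc * bits (dg - 1) \<le> cc * d"
    using B D by (simp_all add: mult_le_mono2)
  define quad where "quad = (8 * s + 5) * (4 * s + 1)"
  \<comment> \<open>For s >= 1 the factors satisfy 8s + 5 <= 13 s and 4s + 1 <= 5 s.\<close>
  have "quad \<le> (13 * s) * (5 * s)" unfolding quad_def using s_pos by (intro mult_le_mono) auto
  then have ss: "quad \<le> 65 * (s * s)" by simp
  have ms: "mm \<le> mm * s" using s_pos by simp
  have tot: "setup_cost + 2 * attempt_cost + root_cost \<le> 3 * Cn + 13 * dg + 10 * (mm * b) + 8 * (cc * d) + 5 * (mm * s) + 65 * (s * s)"
  proof -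
    have "setup_cost + 2 * attempt_cost + root_cost = 3 * Cn + 4 * dg + 9 + 2 * (mm * b) + 2 * (mm * bits e) + 2 * (mm * bits t) + 4 * (mm * bits p) +
       6 * (cc * bits m) + 2 * (cc * bits (dg - 1)) + 3 * mm + 2 * (mm * s) + quad"
      unfolding setup_cost_def root_cost_def b_def quad_def[symmetric] by simp
    also have "\<dots> \<le> 3 * Cn + 4 * dg + 9 * dg + 2 * (mm * b) + 2 * (mm * b) + 2 * (mm * b) + 4 * (mm * b) +
       6 * (cc * d) + 2 * (cc * d) + 3 * (mm * s) + 2 * (mm * s) + 65 * (s * s)"
      using mb ss ms dg_pos by linarith
    finally show ?thesis by linarith
  qed
  have mr: "real mm \<le> 3 * Mr + 2 * real dg" using M by (simp add: mm_def)
  have cr: "real cc \<le> 3 * Cr + 2 * (3 * Mr + 2 * real dg) + 2 * real dg" using C mr by (simp add: cc_def)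
  have lp: "1 / 2 \<le> ln (real p)"
  proof -
    have "ln 2 \<le> ln (real p)" using prime_ge_2_nat[OF p] by (intro ln_mono) auto
    then show ?thesis using ln2_ge_two_thirds by simp
  qed
  have br: "real b \<le> 4 * real s * ln (real p)"
  proof -
    have "real b \<le> 1 + 2 * ln (real (p ^ s))" unfolding b_def by (rule bits_le_ln[OF pk_ge_1])
    also have "ln (real (p ^ s)) = real s * ln (real p)" using p_pos by (simp add: ln_realpow)
    finally show ?thesis using mult_mono[of 1 "real s" "1 / 2" "ln (real p)"] s_pos lp by simp
  qed
  have dr: "real d \<le> 1 + 2 * ln (real dg)" unfolding d_def by (rule bits_le_ln[OF dg_pos])
  have "real (setup_cost + 2 * attempt_cost + root_cost) \<le> real (3 * Cn + 13 * dg + 10 * (mm * b) + 8 * (cc * d) + 5 * (mm * s) + 65 * (s * s))"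
    using tot by (rule of_nat_mono)
  also have "\<dots> = 3 * real Cn + 13 * real dg + 10 * (real mm * real b) + 8 * (real cc * real d) + 5 * (real mm * real s) + 65 * (real s * real s)"
    by simp
  also have "\<dots> \<le> 3 * Cr + 13 * real dg + 10 * ((3 * Mr + 2 * real dg) * (4 * real s * ln (real p))) +
      8 * ((3 * Cr + 2 * (3 * Mr + 2 * real dg) + 2 * real dg) * (1 + 2 * ln (real dg))) + 5 * ((3 * Mr + 2 * real dg) * real s) + 65 * (real s * real s)"
    using C mr cr br dr by (intro add_mono mult_left_mono mult_mono) (auto intro: order_trans[OF of_nat_0_le_iff])
  finally show ?thesis by (simp only: mult.assoc)
qed

text \<open>Operation counts are natural numbers, so the real bounds may be replaced by their
  floors.\<close>

lemma poly_machine_programs: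
  fixes K :: "int ring"
  assumes K: "field K" and n: "n \<ge> 1" and det: "deterministic cM" "deterministic cC"
    and M: "\<And>F G. F \<in> carrier (poly_ring K) \<Longrightarrow> Polynomials.degree F \<le> n \<Longrightarrow> G \<in> carrier (poly_ring K) \<Longrightarrow> Polynomials.degree G \<le> n \<Longrightarrow>
      \<exists>s. run K orc cM (initial K [n] [F, G]) = return_spmf s \<and>
             read_poly K (2 * n + 1) (farr s 0) = F \<otimes>\<^bsub>poly_ring K\<^esub> G \<and> real (ops s) \<le> Mr"
    and C: "\<And>F G H. F \<in> carrier (poly_ring K) \<Longrightarrow> Polynomials.degree F \<le> n \<Longrightarrow> G \<in> carrier (poly_ring K) \<Longrightarrow> Polynomials.degree G \<le> n \<Longrightarrow>
        H \<in> carrier (poly_ring K) \<Longrightarrow> Polynomials.degree H = n \<Longrightarrow>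
        \<exists>s. run K orc cC (initial K [n] [F, G, H]) = return_spmf s \<and>
             read_poly K n (farr s 0) = modular_composition K F G H \<and> real (ops s) \<le> Cr"
  shows "poly_machine K orc cM cC n (nat \<lfloor>Mr\<rfloor>) (nat \<lfloor>Cr\<rfloor>)"
proof -
  interpret K: base_field K by (rule base_field.intro[OF K])
  show ?thesis
  proof
    show "n \<ge> 1" by fact
  next
    fix F G assume FG: "F \<in> carrier K.PR" "G \<in> carrier K.PR" "length F \<le> Suc n" "length G \<le> Suc n"
    obtain s where s: "run K orc cM (initial K [n] [F, G]) = return_spmf s"
       "read_poly K (2 * n + 1) (farr s 0) = F \<otimes>\<^bsub>K.PR\<^esub> G" "real (ops s) \<le> Mr"
    proof -
      have "Polynomials.degree F \<le> n" "Polynomials.degree G \<le> n" using FG by simp_all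
      then show ?thesis using M[OF FG(1) _ FG(2)] that by blast
    qed
    have "computes K orc cM [n] (map K.coeff [F, G]) (farr s 0) (nat \<lfloor>Mr\<rfloor>)"
      by (rule computes_frame[OF det(1) s(1)[unfolded initial_def] le_nat_floor[OF s(3)]])
    then show "\<exists>A. computes K orc cM [n] [K.coeff F, K.coeff G] A (nat \<lfloor>Mr\<rfloor>) \<and> read_poly K (2 * n + 1) A = F \<otimes>\<^bsub>K.PR\<^esub> G"
      using s(2) by auto
  next
    fix F G H assume FG: "F \<in> carrier K.PR" "G \<in> carrier K.PR" "H \<in> carrier K.PR" "length F \<le> Suc n" "length G \<le> Suc n" "length H = Suc n"
    obtain s where s: "run K orc cC (initial K [n] [F, G, H]) = return_spmf s"
       "read_poly K n (farr s 0) = modular_composition K F G H" "real (ops s) \<le> Cr"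
    proof -
      have "Polynomials.degree F \<le> n" "Polynomials.degree G \<le> n" "Polynomials.degree H = n" using FG by simp_all
      then show ?thesis using C[OF FG(1) _ FG(2) _ FG(3)] that by blast
    qed
    have "computes K orc cC [n] (map K.coeff [F, G, H]) (farr s 0) (nat \<lfloor>Cr\<rfloor>)"
      by (rule computes_frame[OF det(2) s(1)[unfolded initial_def] le_nat_floor[OF s(3)]])
    then show "\<exists>A. computes K orc cC [n] [K.coeff F, K.coeff G, K.coeff H] A (nat \<lfloor>Cr\<rfloor>) \<and> read_poly K n A = modular_composition K F G H"
      using s(2) by auto
  qed
qed

lemma (in root_problem) outcome_correct:
  assumes x: "x \<in> carrier K.PR" "a = cls p f x" and st: "outcome st"
  shows "correct_answer p dg f t x st \<and> calls st \<le> 1"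
proof -
  have pow: "is_power p f t x \<longleftrightarrow> is_pow" unfolding is_power_def is_pow_def x(2)[symmetric] ..
  have "(\<forall>i<dg. farr st 0 i \<in> carrier K) \<and> cls p f (read_poly K dg (farr st 0)) [^]\<^bsub>L\<^esub> t = cls p f x" if is_pow
  proof -
    obtain z where z: "z \<in> carrier L" "z [^]\<^bsub>L\<^esub> t = a" "farr st 0 = arr z" using st \<open>is_pow\<close> unfolding outcome_def by blast
    have "read_poly K dg (farr st 0) = rep z" unfolding z(3) arr_def by (rule K.read_poly_coeff[OF rep_closed[OF z(1)] rep_length[OF z(1)]])
    then have "cls p f (read_poly K dg (farr st 0)) = z" using cls_rep[OF z(1)] by (simp only:)
    moreover have "\<forall>i<dg. farr st 0 i \<in> carrier K" unfolding z(3) using z(1) by simp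
    ultimately show ?thesis using z(2) x(2) by (simp only: simp_thms)
  qed
  then show ?thesis using st unfolding correct_answer_def pow outcome_def by blast
qed

theorem theorem1:
  fixes M C :: "nat \<Rightarrow> real"
  assumes "mult_bound M" and "superlinear M"
    and "composition_bound C" and "superlinear C"
    and "M \<in> O(C)"
  shows "\<exists>alg :: com. \<exists>c :: real. c > 0 \<and>
    (\<forall>(p::nat) (n::nat) (t::nat) (f :: int list) (s::nat) orc (a :: int list).
       Factorial_Ring.prime p \<and> n \<ge> 1 \<and>
       f \<in> carrier (poly_ring (prime_field p)) \<and>
       Polynomials.degree f = n \<and> Polynomials.lead_coeff f = \<one>\<^bsub>prime_field p\<^esub> \<and>
       pirreducible\<^bsub>prime_field p\<^esub> (carrier (prime_field p)) f \<and>
       Factorial_Ring.prime t \<and> t dvd p ^ n - 1 \<and>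
       s = ord t p \<and>
       root_box p s t orc \<and>
       a \<in> carrier (poly_ring (prime_field p)) \<and> a \<noteq> [] \<and> Polynomials.degree a < n \<longrightarrow>
       las_vegas (run (prime_field p) orc alg (initial (prime_field p) [p, n, t] [f, a]))
         (\<lambda>st. correct_answer p n f t a st \<and> calls st \<le> 1)
         (c * (real s * M n * ln (real p) + C n * ln (real n))))"
proof -
  obtain cM where cM: "deterministic cM" "\<And>(K :: int ring) orc n F G.
        field K \<and> n \<ge> 1 \<and>
        F \<in> carrier (poly_ring K) \<and> Polynomials.degree F \<le> n \<and>
        G \<in> carrier (poly_ring K) \<and> Polynomials.degree G \<le> n \<Longrightarrow>
        (\<exists>s. run K orc cM (initial K [n] [F, G]) = return_spmf s \<and>
             read_poly K (2 * n + 1) (farr s 0) = F \<otimes>\<^bsub>poly_ring K\<^esub> G \<and>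
             real (ops s) \<le> M n)"
    using assms(1) unfolding mult_bound_def by blast
  obtain cC where cC: "deterministic cC" "\<And>(K :: int ring) orc n F G H.
        field K \<and> n \<ge> 1 \<and>
        F \<in> carrier (poly_ring K) \<and> Polynomials.degree F \<le> n \<and>
        G \<in> carrier (poly_ring K) \<and> Polynomials.degree G \<le> n \<and>
        H \<in> carrier (poly_ring K) \<and> Polynomials.degree H = n \<Longrightarrow>
        (\<exists>s. run K orc cC (initial K [n] [F, G, H]) = return_spmf s \<and>
             read_poly K n (farr s 0) = modular_composition K F G H \<and>
             real (ops s) \<le> C n)"
    using assms(3) unfolding composition_bound_def by blast
  have M1: "M 1 > 0" by (rule mult_bound_pos[OF assms(1)])
  obtain c where c: "c > 0" "\<And>n s p :: nat. n \<ge> 1 \<Longrightarrow> s \<ge> 1 \<Longrightarrow> s \<le> n \<Longrightarrow> p \<ge> 2 \<Longrightarrow> C n \<ge> 0 \<Longrightarrow>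
    3 * C n + 13 * real n + 10 * (3 * M n + 2 * real n) * (4 * real s * ln (real p)) +
    8 * (3 * C n + 2 * (3 * M n + 2 * real n) + 2 * real n) * (1 + 2 * ln (real n)) +
    5 * (3 * M n + 2 * real n) * real s + 65 * real s * real s
    \<le> c * (real s * M n * ln (real p) + C n * ln (real n))"
    by (rule cost_estimate[OF assms(2) M1 assms(5)]) (rule that)
  show ?thesis
  \<comment> \<open>Program and constant are fixed before the prime, the degree and the polynomials,
    so one program serves all fields.\<close>
  proof (rule exI[of _ "main_prog cM cC"], rule exI[of _ c], intro conjI c(1) allI impI, elim conjE)
    fix p n t s :: nat and f a :: "int list" and orc
    assume p: "Factorial_Ring.prime p" and n: "n \<ge> 1" and f: "f \<in> carrier (poly_ring (prime_field p))"
      and df: "Polynomials.degree f = n" and lc: "Polynomials.lead_coeff f = \<one>\<^bsub>prime_field p\<^esub>"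
      and irr: "pirreducible\<^bsub>prime_field p\<^esub> (carrier (prime_field p)) f"
      and t: "Factorial_Ring.prime t" "t dvd p ^ n - 1" and s: "s = ord t p" and box: "root_box p s t orc"
      and a: "a \<in> carrier (poly_ring (prime_field p))" "a \<noteq> []" "Polynomials.degree a < n"
    interpret E: prime_ext p f by (rule prime_ext.intro[OF p f irr])
    have dg: "E.dg = n" using df by (simp add: E.dg_def)
    have lf: "length f = Suc n" using E.length_f dg by simp
    have la: "length a \<le> n" using a(2,3) by (cases a) auto
    have K: "field (prime_field p)" by (rule prime_field_facts(1)[OF p])
    have Mn: "0 \<le> M n"
    proof -
      have "M 1 / real 1 \<le> M n / real n" using assms(2) n unfolding superlinear_def by blast
      then have "0 < M n / real n" using M1 by simp
      then show ?thesis using n by (simp add: zero_less_divide_iff)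
    qed
    \<comment> \<open>C n bounds the operation count of an actual run, here of composing
      \<open>a\<close> with itself modulo \<open>f\<close>, and hence is nonnegative.\<close>
    have Cn: "0 \<le> C n"
    proof -
      obtain st :: "int store" where "real (ops st) \<le> C n"
        using cC(2)[of "prime_field p" n a a f orc] K n a f df by auto
      then show ?thesis using of_nat_0_le_iff[of "ops st"] by linarith
    qed
    have PM: "poly_machine (prime_field p) orc cM cC n (nat \<lfloor>M n\<rfloor>) (nat \<lfloor>C n\<rfloor>)"
      by (rule poly_machine_programs[OF K n cM(1) cC(1)]) (use cM(2) cC(2) K n in auto)
    obtain J where J: "J \<in> carrier E.K.PR" "length J \<le> n"
       "length (E.K.xp (2 * n - 1) \<ominus>\<^bsub>E.K.PR\<^esub> J \<otimes>\<^bsub>E.K.PR\<^esub> f) \<le> n"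
       "computes E.K orc (barrett_prog cC) [n] [\<lambda>_. \<zero>\<^bsub>E.K\<^esub>, E.K.coeff f] (E.K.coeff J) (nat \<lfloor>C n\<rfloor> + 2 * n + 2)"
      using poly_machine.computes_barrett[OF PM f lf lc] by blast
    have a': "cls p f a \<in> carrier E.L" "cls p f a \<noteq> \<zero>\<^bsub>E.L\<^esub>"
      using E.cls.hom_closed[OF a(1)] E.cls_zero_iff[OF a(1)] E.pmod_small[OF a(1)] la dg a(2) by simp_all
    interpret R: root_problem p f orc cM cC "nat \<lfloor>M n\<rfloor>" "nat \<lfloor>C n\<rfloor>" J t s "cls p f a"
      by (intro root_problem.intro field_machine.intro root_problem_axioms.intro field_machine_axioms.intro E.prime_ext_axioms; (unfold dg)?)
        (fact PM J t s box a')+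
    \<comment> \<open>Since \<open>a\<close> has degree below n it is its own reduced
      representative, so the input array is the coordinate array of its class.\<close>
    have init: "initial E.K [p, n, t] [f, a] = frame E.K [p, E.dg, t] [E.K.coeff f, E.arr (cls p f a)] 0 0"
      using E.arr_cls[OF a(1)] E.pmod_small[OF a(1)] la dg by (simp add: initial_def)
    have "s \<le> n" using dvd_imp_le[OF R.s_dvd] dg n by simp
    have "real (R.setup_cost + 2 * R.attempt_cost + R.root_cost) \<le> c * (real s * M n * ln (real p) + C n * ln (real n))"
      using R.cost_le[of "M n" "C n"] of_nat_floor[OF Mn] of_nat_floor[OF Cn]
        c(2)[OF n R.s_pos \<open>s \<le> n\<close> prime_ge_2_nat[OF p] Cn] unfolding dg by linarith
    then have B: "ennreal (real (R.setup_cost + 2 * R.attempt_cost + R.root_cost)) \<le> ennreal (c * (real s * M n * ln (real p) + C n * ln (real n)))"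
      by (rule ennreal_leI)
    note lv = R.las_vegas_main[folded init, unfolded las_vegas_def]
    show "las_vegas (run E.K orc (main_prog cM cC) (initial E.K [p, n, t] [f, a]))
         (\<lambda>st. correct_answer p n f t a st \<and> calls st \<le> 1)
         (c * (real s * M n * ln (real p) + C n * ln (real n)))"
      unfolding las_vegas_def
    proof (intro conjI ballI)
      fix st assume "st \<in> set_spmf (run E.K orc (main_prog cM cC) (initial E.K [p, n, t] [f, a]))"
      then have "R.outcome st" using lv by blast
      then show "correct_answer p n f t a st" "calls st \<le> 1"
        using R.outcome_correct[OF a(1) refl] unfolding dg by blast+
    next
      show "lossless_spmf (run E.K orc (main_prog cM cC) (initial E.K [p, n, t] [f, a]))" using lv by blast
      show "(\<integral>\<^sup>+ st. ennreal (real (ops st)) \<partial>measure_spmf (run E.K orc (main_prog cM cC) (initial E.K [p, n, t] [f, a])))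
          \<le> ennreal (c * (real s * M n * ln (real p) + C n * ln (real n)))"
        using lv B by (blast intro: order_trans)
    qed
  qed
qed

end
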